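(* Let $1\le p_0<q_0\le\infty$. Let $\mathcal{E}$ and $\mathcal{D}$ be vector spaces (of measurable functions on $\mathbb{R}^n$) with $\mathcal{D}\subset\mathcal{E}$. Let $T,S$ be operators such that $S$ acts from $\mathcal{D}$ into the set of measurable functions and $T$ is sublinear acting from $\mathcal{E}$ into $L^{p_0}$. Let $\{\mathcal{A}_r\}_{r>0}$ be a family of operators acting from $\mathcal{D}$ into $\mathcal{E}$. Assume that there is a constant $C$ such that $$\Big(\frac1{|B|}\int_B|T(I-\mathcal{A}_{r(B)})f|^{p_0}\Big)^{1/p_0}\le C\,M\big(|Sf|^{p_0}\big)^{1/p_0}(x)$$ and $$\Big(\frac1{|B|}\int_B|T\mathcal{A}_{r(B)}f|^{q_0}\Big)^{1/q_0}\le C\,M\big(|Tf|^{p_0}\big)^{1/p_0}(x)$$ for all $f\in\mathcal{D}$, all balls $B$ (with radius $r(B)$) and all $x\in B$. Let $p_0<p<q_0$ (or $p=q_0$ when $q_0<\infty$) and $w\in A_{p/p_0}\cap RH_{(q_0/p)'}$. Then there is a constant $C$ such that $$\|Tf\|_{L^p(w)}\le C\,\|Sf\|_{L^p(w)}\qquad\text{for all }f\in\mathcal{D}.$$ Furthermore, for all $p_0<r<q_0$ there is a constant $C$ such that $$\Big\|\Big(\sum_j|Tf_j|^r\Big)^{1/r}\Big\|_{L^p(w)}\le C\,\Big\|\Big(\sum_j|Sf_j|^r\Big)^{1/r}\Big\|_{L^p(w)}\qquad\text{for all }f_j\in\mathcal{D}.$$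
   Context: The setting is $\mathbb{R}^n$ with Lebesgue measure. "Acts from $A$ into $B$" means: is a map defined on $A$ with values in $B$. $T$ is sublinear if $|T(f+g)|\le|Tf|+|Tg|$ and $|T(\lambda f)|=|\lambda||Tf|$ for all $f,g$ in its domain and all scalars $\lambda$. $M$ is the uncentered Hardy--Littlewood maximal operator over balls (or cubes). If $q_0=\infty$, the $L^{q_0}$-average is the essential supremum over $B$. Weights: a weight $w$ is a non-negative locally integrable function, $L^p(w)=L^p(w\,dx)$. For $1<t<\infty$: $w\in A_t$ if $\big(\frac1{|B|}\int_Bw\big)\big(\frac1{|B|}\int_Bw^{1-t'}\big)^{t-1}\le C$ for all balls $B$; $w\in A_1$ if $\frac1{|B|}\int_Bw\le Cw(x)$ for a.e. $x\in B$, all $B$. For $1<t<\infty$: $w\in RH_t$ if $\big(\frac1{|B|}\int_Bw^t\big)^{1/t}\le C\frac1{|B|}\int_Bw$ for all balls; $w\in RH_\infty$ if $w(x)\le C\frac1{|B|}\int_Bw$ for a.e. $x\in B$, all $B$; $RH_1$ is the class of all weights. Primes denote conjugate exponents: $(q_0/p)'=\infty$ if $p=q_0$ and $(q_0/p)'=1$ if $q_0=\infty$ (so for $q_0=\infty$ the condition is just $w\in A_{p/p_0}$). *)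

theory Defs
  imports "HOL-Analysis.Analysis" "HOL-Probability.Essential_Supremum"
begin

text \<open>
  Averages, maximal functions and norms are taken in \<^typ>\<open>ennreal\<close>, so that they are defined without
  integrability side conditions. Functions are honest functions, not classes modulo null sets;
  relations between them are only required almost everywhere. ``Measurable'' is Lebesgue measurable.
  Functions take values in a type of class \<^class>\<open>real_normed_field\<close> and \<^class>\<open>euclidean_space\<close>,
  which covers both real and complex scalars.
\<close>

text \<open>
  Unlike \<^term>\<open>0 powr a = (0::real)\<close>, a negative power of \<open>0\<close> is \<open>\<infinity>\<close>; this matters in the
  \<open>A\<^sub>t\<close> condition, where \<open>w\<close> is raised to the negative exponent \<open>1 - t'\<close>.
\<close>

definition epowr :: "ennreal \<Rightarrow> real \<Rightarrow> ennreal" (infixr "epowr" 80) where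
  "x epowr a =
    (if a = 0 then 1
     else if x = 0 then (if a > 0 then 0 else \<infinity>)
     else if x = \<infinity> then (if a > 0 then \<infinity> else 0)
     else ennreal (enn2real x powr a))"

definition enorm :: "'k::real_normed_vector \<Rightarrow> ennreal" where
  "enorm z = ennreal (norm z)"

definition average :: "(real^'n) set \<Rightarrow> (real^'n \<Rightarrow> ennreal) \<Rightarrow> ennreal" where
  "average B g = (\<integral>\<^sup>+x\<in>B. g x \<partial>lebesgue) / emeasure lebesgue B"

definition Lp_average :: "ereal \<Rightarrow> (real^'n) set \<Rightarrow> (real^'n \<Rightarrow> ennreal) \<Rightarrow> ennreal" where
  "Lp_average q B g =
    (if q = \<infinity> then esssup (restrict_space lebesgue B) g
     else average B (\<lambda>x. g x epowr real_of_ereal q) epowr (1 / real_of_ereal q))"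

definition maximal :: "(real^'n \<Rightarrow> ennreal) \<Rightarrow> real^'n \<Rightarrow> ennreal" where
  "maximal g x = (SUP (c, \<rho>) \<in> {(c, \<rho>). \<rho> > 0 \<and> x \<in> ball c \<rho>}. average (ball c \<rho>) g)"

definition conjugate_exponent :: "ereal \<Rightarrow> ereal" where
  "conjugate_exponent t = (if t = \<infinity> then 1 else if t = 1 then \<infinity> else t / (t - 1))"

definition weight :: "(real^'n \<Rightarrow> real) \<Rightarrow> bool" where
  "weight w \<longleftrightarrow> (\<forall>x. 0 \<le> w x) \<and> w \<in> borel_measurable lebesgue \<and>
    (\<forall>K. compact K \<longrightarrow> set_integrable lebesgue K w)"

text \<open>
  The class \<open>A\<^sub>t\<close>, meaningful for \<open>1 \<le> t < \<infinity>\<close>; the exponent \<open>1 - t / (t - 1)\<close> is \<open>1 - t'\<close>.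
  Since \<open>0 * \<infinity> = 0\<close> in \<^typ>\<open>ennreal\<close>, a weight vanishing almost everywhere belongs to \<open>A\<^sub>t\<close>.
\<close>

definition muckenhoupt :: "real \<Rightarrow> (real^'n \<Rightarrow> real) set" where
  "muckenhoupt t = {w. weight w \<and>
    (\<exists>C::real. \<forall>c \<rho>. \<rho> > 0 \<longrightarrow>
      (if t = 1
       then (AE x in lebesgue. x \<in> ball c \<rho> \<longrightarrow>
               average (ball c \<rho>) (\<lambda>y. ennreal (w y)) \<le> ennreal C * ennreal (w x))
       else average (ball c \<rho>) (\<lambda>y. ennreal (w y)) *
              average (ball c \<rho>) (\<lambda>y. ennreal (w y) epowr (1 - t / (t - 1))) epowr (t - 1)
            \<le> ennreal C))}"

text \<open>The class \<open>RH\<^sub>t\<close>, meaningful for \<open>1 \<le> t \<le> \<infinity>\<close>.\<close>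

definition reverse_hoelder :: "ereal \<Rightarrow> (real^'n \<Rightarrow> real) set" where
  "reverse_hoelder t = {w. weight w \<and>
    (t \<noteq> 1 \<longrightarrow> (\<exists>C::real. \<forall>c \<rho>. \<rho> > 0 \<longrightarrow>
      (if t = \<infinity>
       then (AE x in lebesgue. x \<in> ball c \<rho> \<longrightarrow>
               ennreal (w x) \<le> ennreal C * average (ball c \<rho>) (\<lambda>y. ennreal (w y)))
       else Lp_average t (ball c \<rho>) (\<lambda>y. ennreal (w y))
            \<le> ennreal C * average (ball c \<rho>) (\<lambda>y. ennreal (w y)))))}"

definition Lp_space :: "real \<Rightarrow> (real^'n \<Rightarrow> 'k::real_normed_vector) set" where
  "Lp_space p = {f \<in> borel_measurable lebesgue. (\<integral>\<^sup>+x. enorm (f x) epowr p \<partial>lebesgue) < \<infinity>}"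

definition weighted_Lp_norm :: "real \<Rightarrow> (real^'n \<Rightarrow> real) \<Rightarrow> (real^'n \<Rightarrow> ennreal) \<Rightarrow> ennreal" where
  "weighted_Lp_norm p w g =
    (\<integral>\<^sup>+x. g x epowr p \<partial>density lebesgue (\<lambda>x. ennreal (w x))) epowr (1 / p)"

definition function_space :: "(real^'n \<Rightarrow> 'k::real_normed_field) set \<Rightarrow> bool" where
  "function_space V \<longleftrightarrow> V \<subseteq> borel_measurable lebesgue \<and> (\<lambda>x. 0) \<in> V \<and>
    (\<forall>f\<in>V. \<forall>g\<in>V. (\<lambda>x. f x + g x) \<in> V) \<and> (\<forall>a. \<forall>f\<in>V. (\<lambda>x. a * f x) \<in> V)"

definition sublinear_on ::
  "(real^'n \<Rightarrow> 'k::real_normed_field) set \<Rightarrow> ((real^'n \<Rightarrow> 'k) \<Rightarrow> real^'n \<Rightarrow> 'k) \<Rightarrow> bool" where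
  "sublinear_on V T \<longleftrightarrow>
    (\<forall>f\<in>V. \<forall>g\<in>V. AE x in lebesgue. norm (T (\<lambda>y. f y + g y) x) \<le> norm (T f x) + norm (T g x)) \<and>
    (\<forall>a. \<forall>f\<in>V. AE x in lebesgue. norm (T (\<lambda>y. a * f y) x) = norm a * norm (T f x))"

end

theory Submission
  imports Defs
begin

text \<open>
  Put \<open>F = |Tf|\<^sup>p\<^sub>0\<close> and \<open>g = |Sf|\<^sup>p\<^sub>0\<close>. By sublinearity, the two hypotheses split \<open>F\<close> on every ball into a part whose
  average is bounded by \<open>M g\<close> and a part whose average of order \<open>q\<^sub>0 / p\<^sub>0\<close> is bounded by \<open>M F\<close>. A good-\<open>\<lambda>\<close>
  inequality for such decompositions gives \<open>\<parallel>M F\<parallel> \<le> C \<parallel>M g\<parallel>\<close> in \<open>L\<^sup>P(v)\<close>, \<open>P = p / p\<^sub>0\<close>, for every doubling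
  \<open>v\<close> satisfying a quantitative \<open>A\<^sub>\<infinity>\<close> condition of exponent slightly below \<open>p / q\<^sub>0\<close>; the condition
  \<open>w \<in> A\<^sub>P \<inter> RH\<close> yields the exponent \<open>p / q\<^sub>0\<close>, and Muckenhoupt's theorem replaces \<open>M g\<close> by \<open>g\<close>.

  Summing this inequality over \<open>j\<close> proves the vector-valued one for \<open>p = r\<close>. The other values of \<open>p\<close> follow by
  extrapolation: for \<open>p > r\<close> by duality with the weight \<open>M\<^sub>w(h\<^sup>b)\<^sup>1\<^sup>/\<^sup>b w\<close>, which stays in the range of the good-\<open>\<lambda>\<close>
  inequality, and for \<open>p < r\<close> by Hoelder's inequality with a Rubio de Francia weight. A single function is
  the case of a one-element family.
\<close>

subsection \<open>Powers of extended nonnegative reals\<close>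

text \<open>The exponents are critical throughout. At the level \<open>2 ^ k * l\<close> the second
  hypothesis yields a set of relative measure about 2^(-kq) with q = q0/p0; an A_\<infinity>
  exponent P/q turns this into 2^(-kP), which exactly cancels the factor 2^(kP) of the L^P norm. A
  single level has nothing to spare, hence the sum over many levels. The room gained there is spent
  on the duality weight, whose construction costs a little of the A_\<infinity> exponent; this is
  also how p = q0 is reached, from exponents r < p. Two further points shape the proof. Since F is
  merely integrable, the L^P(v) norm of M F may be infinite and cannot be absorbed at once; the
  weight is therefore cut off at height m, with doubling and A_\<infinity> constants that do not
  depend on m. And the weights of the extrapolation depend on the functions to be estimated, so
  every constant has to be a function of the A_P, doubling and A_\<infinity> constants alone, which
  is why these are carried along explicitly.\<close>

lemma epowr_0 [simp]: "a > 0 \<Longrightarrow> 0 epowr a = 0"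
  and epowr_infinity [simp]: "a > 0 \<Longrightarrow> \<infinity> epowr a = \<infinity>"
  and epowr_zero_exponent [simp]: "x epowr 0 = 1"
  by (auto simp: epowr_def)

lemma epowr_top [simp]: "a > 0 \<Longrightarrow> top epowr a = top"
  using epowr_infinity[of a] by simp

lemma epowr_1 [simp]: "x epowr 1 = x"
  by (auto simp: epowr_def ennreal_enn2real_if)

lemma one_epowr [simp]: "1 epowr a = 1"
  by (auto simp: epowr_def)

lemma ennreal_epowr: "0 < r \<Longrightarrow> ennreal r epowr a = ennreal (r powr a)"
  by (auto simp: epowr_def)

lemma ennreal_epowr_nonneg: "0 \<le> r \<Longrightarrow> 0 < a \<Longrightarrow> ennreal r epowr a = ennreal (r powr a)"
  by (cases "r = 0") (auto simp: ennreal_epowr)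

lemma ennreal_cases_pos [case_names zero infinity pos]:
  obtains "x = (0::ennreal)" | "x = \<infinity>" | r where "0 < r" "x = ennreal r"
  by (cases x) (auto simp: le_less)

lemma ennreal_epowr_numeral: "numeral n epowr a = ennreal (numeral n powr a)"
  using ennreal_epowr[of "numeral n" a] by simp

lemma epowr_eq_0_iff [simp]: "0 < a \<Longrightarrow> x epowr a = 0 \<longleftrightarrow> x = 0"
  and epowr_eq_top_iff [simp]: "0 < a \<Longrightarrow> x epowr a = top \<longleftrightarrow> x = top"
  by (cases x rule: ennreal_cases_pos; simp add: ennreal_epowr)+

lemma epowr_pos: "0 < x \<Longrightarrow> x < top \<Longrightarrow> 0 < x epowr a"
  and epowr_finite: "0 < x \<Longrightarrow> x < top \<Longrightarrow> x epowr a < top"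
  by (cases x rule: ennreal_cases_pos; simp add: ennreal_epowr)+

lemma epowr_less_top: "0 < a \<Longrightarrow> x < top \<Longrightarrow> x epowr a < top"
  by (simp add: less_top[symmetric])

lemma epowr_mono: "0 \<le> a \<Longrightarrow> x \<le> y \<Longrightarrow> x epowr a \<le> y epowr a"
proof (cases "a = 0")
  case False
  assume "0 \<le> a" "x \<le> y"
  with False show ?thesis
    by (cases x rule: ennreal_cases_pos; cases y rule: ennreal_cases_pos)
      (auto simp: ennreal_epowr powr_mono2 top_unique)
qed auto

lemma epowr_antimono: "a \<le> 0 \<Longrightarrow> x \<le> y \<Longrightarrow> y epowr a \<le> x epowr a"
proof (cases "a = 0")
  case False
  assume "a \<le> 0" "x \<le> y"
  with False show ?thesis
    by (cases x rule: ennreal_cases_pos; cases y rule: ennreal_cases_pos)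
      (auto simp: ennreal_epowr powr_mono2' top_unique epowr_def)
qed auto

text \<open>Negative powers exchange 0 and \<infinity>, so exponents multiply at these two values as
  well.\<close>

lemma epowr_epowr: "(x epowr a) epowr b = x epowr (a * b)"
proof (cases x rule: ennreal_cases_pos)
  case (pos r)
  then show ?thesis by (simp add: ennreal_epowr powr_powr)
qed (auto simp: epowr_def mult_less_0_iff zero_less_mult_iff not_less)

text \<open>For negative exponents the law fails because 0 * \<infinity> = 0: the power of this
  product is \<infinity>, the product of the powers is 0. Hence the second version
  \<open>epowr_mult_finite\<close>.\<close>

lemma epowr_mult: "0 < a \<Longrightarrow> (x * y) epowr a = x epowr a * y epowr a"
  by (cases x rule: ennreal_cases_pos; cases y rule: ennreal_cases_pos)
    (auto simp: ennreal_epowr powr_mult ennreal_mult'[symmetric] ennreal_mult_top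
      ennreal_top_mult)

lemma epowr_mult_finite:
  "0 < x \<Longrightarrow> x < top \<Longrightarrow> 0 < y \<Longrightarrow> y < top \<Longrightarrow> (x * y) epowr a = x epowr a * y epowr a"
  by (cases x rule: ennreal_cases_pos; cases y rule: ennreal_cases_pos)
    (auto simp: ennreal_epowr powr_mult ennreal_mult'[symmetric])

lemma epowr_add: "0 < a \<Longrightarrow> 0 < b \<Longrightarrow> x epowr (a + b) = x epowr a * x epowr b"
  by (cases x rule: ennreal_cases_pos)
    (auto simp: ennreal_epowr powr_add ennreal_mult'[symmetric] ennreal_mult_top ennreal_top_mult)

lemma epowr_add_finite: "0 < x \<Longrightarrow> x < top \<Longrightarrow> x epowr (a + b) = x epowr a * x epowr b"
  by (cases x rule: ennreal_cases_pos)
    (auto simp: ennreal_epowr powr_add ennreal_mult'[symmetric])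

lemma epowr_minus: "x epowr (- a) = inverse (x epowr a)"
  by (cases x rule: ennreal_cases_pos)
    (auto simp: ennreal_epowr powr_minus inverse_ennreal epowr_def)

lemma inverse_epowr: "inverse x epowr a = inverse (x epowr a)"
  by (cases x rule: ennreal_cases_pos)
    (auto simp: ennreal_epowr powr_minus inverse_ennreal epowr_def inverse_powr)

lemma inverse_eq_epowr: "inverse x = x epowr (- 1)"
  by (simp add: epowr_minus)

lemma epowr_divide: "0 < a \<Longrightarrow> (x / y) epowr a = x epowr a / y epowr a"
  by (simp add: divide_ennreal_def epowr_mult inverse_epowr)

lemma measurable_epowr [measurable]: "(\<lambda>x. x epowr a) \<in> borel_measurable borel"
  unfolding epowr_def by measurable

lemma borel_measurable_epowr [measurable (raw)]:
  "f \<in> borel_measurable M \<Longrightarrow> (\<lambda>x. f x epowr a) \<in> borel_measurable M"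
  using measurable_compose[OF _ measurable_epowr] .

lemma epowr_le_iff: "0 < a \<Longrightarrow> x epowr a \<le> y epowr a \<longleftrightarrow> x \<le> y"
  using epowr_mono[of a x y] epowr_mono[of "1/a" "x epowr a" "y epowr a"]
  by (auto simp: epowr_epowr)

lemma epowr_less_iff: "0 < a \<Longrightarrow> x epowr a < y epowr a \<longleftrightarrow> x < y"
  using epowr_le_iff[of a y x] by (simp add: not_le[symmetric])

lemma epowr_le_swap: "0 < a \<Longrightarrow> x epowr a \<le> y \<longleftrightarrow> x \<le> y epowr (1 / a)"
  using epowr_le_iff[of a x "y epowr (1/a)"] by (simp add: epowr_epowr)

lemma epowr_SUP:
  assumes "0 < a"
  shows "(SUP i\<in>I. f i) epowr a = (SUP i\<in>I. f i epowr a)"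
proof (rule antisym)
  show "(SUP i\<in>I. f i) epowr a \<le> (SUP i\<in>I. f i epowr a)"
    unfolding epowr_le_swap[OF assms]
    by (intro SUP_least) (metis SUP_upper epowr_le_swap[OF assms])
  show "(SUP i\<in>I. f i epowr a) \<le> (SUP i\<in>I. f i) epowr a"
    using assms by (intro SUP_least epowr_mono SUP_upper) auto
qed

lemma epowr_max: "0 < a \<Longrightarrow> max x y epowr a = max (x epowr a) (y epowr a)"
  by (auto simp: max_def epowr_le_iff)

lemma epowr_sum_le:
  assumes "0 < a"
  shows "(x + y) epowr a \<le> 2 epowr a * (x epowr a + y epowr a)"
proof -
  have "x + y \<le> 2 * max x y"
    by (auto simp: max_def mult_2 intro: add_mono)
  then have "(x + y) epowr a \<le> (2 * max x y) epowr a"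
    using assms by (intro epowr_mono) auto
  also have "\<dots> = 2 epowr a * max (x epowr a) (y epowr a)"
    using assms by (simp add: epowr_mult epowr_max)
  also have "\<dots> \<le> 2 epowr a * (x epowr a + y epowr a)"
    by (intro mult_left_mono) auto
  finally show ?thesis .
qed

lemma epowr_decreasing: "x \<le> 1 \<Longrightarrow> a \<le> b \<Longrightarrow> x epowr b \<le> x epowr a"
proof (cases x rule: ennreal_cases_pos)
  case (pos r)
  assume "x \<le> 1" "a \<le> b"
  with pos have "r \<le> 1" by simp
  with pos \<open>a \<le> b\<close> show ?thesis
    using powr_mono'[of a b r] by (auto simp: ennreal_epowr)
qed (auto simp: epowr_def top_unique)

lemma epowr_increasing: "1 \<le> x \<Longrightarrow> a \<le> b \<Longrightarrow> x epowr a \<le> x epowr b"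
proof (cases x rule: ennreal_cases_pos)
  case (pos r)
  assume "1 \<le> x" "a \<le> b"
  with pos have "1 \<le> r" by simp
  with pos \<open>a \<le> b\<close> show ?thesis
    using powr_mono[of a b r] by (auto simp: ennreal_epowr)
qed (auto simp: epowr_def)

lemma epowr_arith_geo_mean:
  assumes "0 < s" "s < 1"
  shows "x epowr s * y epowr (1 - s) \<le> ennreal s * x + ennreal (1 - s) * y"
proof (cases x rule: ennreal_cases_pos)
  case x: (pos a)
  show ?thesis
  proof (cases y rule: ennreal_cases_pos)
    case y: (pos b)
    have "a powr s * b powr (1 - s) \<le> s * a + (1 - s) * b"
      using assms x y by (intro Youngs_inequality_0) auto
    with assms x y show ?thesis
      by (simp add: ennreal_epowr ennreal_mult'[symmetric] ennreal_plus[symmetric] del: ennreal_plus)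
  qed (use assms in \<open>auto simp: ennreal_mult_top\<close>)
qed (use assms in \<open>auto simp: ennreal_mult_top\<close>)

section \<open>Hoelder's inequality in \<open>ennreal\<close>\<close>

lemma ennreal_div_self: "0 < x \<Longrightarrow> x < top \<Longrightarrow> x / x = (1::ennreal)"
  by (simp add: ennreal_divide_self less_top[symmetric] order_less_imp_not_eq2)

lemma ennreal_mult_div_cancel: "0 < c \<Longrightarrow> c < top \<Longrightarrow> c * (x / c) = (x::ennreal)"
  by (metis ennreal_div_self mult.right_neutral ennreal_times_divide mult.commute)

lemma ennreal_le_divide_iff: "0 < c \<Longrightarrow> c < top \<Longrightarrow> x \<le> y / c \<longleftrightarrow> c * x \<le> (y::ennreal)"
  by (metis ennreal_mult_div_cancel ennreal_mult_le_mult_iff less_top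
      order_less_imp_not_eq2)

lemma ennreal_divide_le_iff: "0 < c \<Longrightarrow> c < top \<Longrightarrow> y / c \<le> x \<longleftrightarrow> y \<le> c * (x::ennreal)"
  by (metis ennreal_mult_div_cancel ennreal_mult_le_mult_iff less_top
      order_less_imp_not_eq2)

text \<open>Hoelder's inequality for the conjugate exponents 1/s and 1/(1 - s). After both integrals
  are normalised to 1 it is the weighted inequality of arithmetic and geometric means. By 0 *
  \<infinity> = 0 the right side vanishes as soon as one integral does; then one function, and with
  it the left integrand, is zero almost everywhere.\<close>

lemma nn_integral_Hoelder:
  assumes [measurable]: "f \<in> borel_measurable M" "g \<in> borel_measurable M"
    and s: "0 < s" "s < 1"
  shows "(\<integral>\<^sup>+x. f x epowr s * g x epowr (1 - s) \<partial>M)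
    \<le> (\<integral>\<^sup>+x. f x \<partial>M) epowr s * (\<integral>\<^sup>+x. g x \<partial>M) epowr (1 - s)" (is "?L \<le> ?A epowr s * ?B epowr (1 - s)")
proof -
  consider "?A = 0 \<or> ?B = 0" | "?A \<noteq> 0" "?B \<noteq> 0" "?A = top \<or> ?B = top"
    | "0 < ?A" "?A < top" "0 < ?B" "?B < top"
    using less_top zero_less_iff_neq_zero by metis
  then show ?thesis
  proof cases
    case 1
    then have "(AE x in M. f x = 0) \<or> (AE x in M. g x = 0)"
      by (auto simp: nn_integral_0_iff_AE)
    then have "AE x in M. f x epowr s * g x epowr (1 - s) = 0"
      using s by auto
    then have "?L = 0" by (subst nn_integral_0_iff_AE) auto
    then show ?thesis by simp
  next
    case 2
    then show ?thesis using s by (auto simp: ennreal_mult_top ennreal_top_mult)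
  next
    case 3
    let ?c = "?A epowr s * ?B epowr (1 - s)"
    have "?L = (\<integral>\<^sup>+x. ?c * ((f x / ?A) epowr s * (g x / ?B) epowr (1 - s)) \<partial>M)"
    proof (rule nn_integral_cong)
      fix x
      have "f x epowr s * g x epowr (1 - s)
        = (?A * (f x / ?A)) epowr s * (?B * (g x / ?B)) epowr (1 - s)"
        using 3 by (simp add: ennreal_mult_div_cancel)
      then show "f x epowr s * g x epowr (1 - s) = ?c * ((f x / ?A) epowr s * (g x / ?B) epowr (1 - s))"
        using s unfolding epowr_mult[OF s(1)] by (simp add: epowr_mult ac_simps)
    qed
    also have "\<dots> \<le> (\<integral>\<^sup>+x. ?c * (ennreal s * (f x / ?A) + ennreal (1 - s) * (g x / ?B)) \<partial>M)"
      by (intro nn_integral_mono mult_left_mono epowr_arith_geo_mean s) auto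
    also have "\<dots> = ?c * (ennreal s * (?A / ?A) + ennreal (1 - s) * (?B / ?B))"
      by (simp add: nn_integral_cmult nn_integral_add nn_integral_divide)
    also have "\<dots> = ?c"
      using 3 s by (simp add: ennreal_div_self ennreal_plus[symmetric] del: ennreal_plus)
    finally show ?thesis .
  qed
qed

lemma set_nn_integral_Hoelder:
  assumes [measurable]: "f \<in> borel_measurable M" "g \<in> borel_measurable M" "B \<in> sets M"
    and s: "0 < s" "s < 1"
  shows "(\<integral>\<^sup>+x\<in>B. f x epowr s * g x epowr (1 - s) \<partial>M)
    \<le> (\<integral>\<^sup>+x\<in>B. f x \<partial>M) epowr s * (\<integral>\<^sup>+x\<in>B. g x \<partial>M) epowr (1 - s)"
proof -
  have "(\<integral>\<^sup>+x\<in>B. f x epowr s * g x epowr (1 - s) \<partial>M)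
    = (\<integral>\<^sup>+x. (f x * indicator B x) epowr s * (g x * indicator B x) epowr (1 - s) \<partial>M)"
    using s by (intro nn_integral_cong) (auto split: split_indicator)
  also have "\<dots> \<le> (\<integral>\<^sup>+x\<in>B. f x \<partial>M) epowr s * (\<integral>\<^sup>+x\<in>B. g x \<partial>M) epowr (1 - s)"
    by (rule nn_integral_Hoelder) (use s in auto)
  finally show ?thesis .
qed

subsection \<open>Maximal functions of doubling measures\<close>

declare emeasure_completion [simp del]

text \<open>The uncentred maximal operator of the measure M, which enters both the integral and the
  normalisation. Besides Lebesgue measure it is applied to measures w dx, of which only the doubling
  property is used for its bounds.\<close>

definition maximal_fun :: "'a::euclidean_space measure \<Rightarrow> ('a \<Rightarrow> ennreal) \<Rightarrow> 'a \<Rightarrow> ennreal" where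
  "maximal_fun M g x = (SUP (c, \<rho>) \<in> {(c, \<rho>). \<rho> > 0 \<and> x \<in> ball c \<rho>}.
     (\<integral>\<^sup>+y\<in>ball c \<rho>. g y \<partial>M) / emeasure M (ball c \<rho>))"

lemma maximal_fun_upper:
  "0 < \<rho> \<Longrightarrow> x \<in> ball c \<rho> \<Longrightarrow> (\<integral>\<^sup>+y\<in>ball c \<rho>. g y \<partial>M) / emeasure M (ball c \<rho>) \<le> maximal_fun M g x"
  unfolding maximal_fun_def by (rule SUP_upper2[of "(c, \<rho>)"]) auto

lemma maximal_fun_least:
  "(\<And>c \<rho>. 0 < \<rho> \<Longrightarrow> x \<in> ball c \<rho> \<Longrightarrow> (\<integral>\<^sup>+y\<in>ball c \<rho>. g y \<partial>M) / emeasure M (ball c \<rho>) \<le> z)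
    \<Longrightarrow> maximal_fun M g x \<le> z"
  unfolding maximal_fun_def by (rule SUP_least) auto

lemma less_maximal_fun_iff:
  "t < maximal_fun M g x \<longleftrightarrow>
    (\<exists>c \<rho>. 0 < \<rho> \<and> x \<in> ball c \<rho> \<and> t < (\<integral>\<^sup>+y\<in>ball c \<rho>. g y \<partial>M) / emeasure M (ball c \<rho>))"
  unfolding maximal_fun_def less_SUP_iff by (auto simp: Bex_def)

lemma superlevel_maximal_fun:
  "{x. t < maximal_fun M g x}
    = (\<Union>(c, \<rho>) \<in> {(c, \<rho>). 0 < \<rho> \<and> t < (\<integral>\<^sup>+y\<in>ball c \<rho>. g y \<partial>M) / emeasure M (ball c \<rho>)}. ball c \<rho>)"
  unfolding less_maximal_fun_iff by (force simp: set_eq_iff)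

text \<open>Uncentred balls: a ball that shows the value at one point to exceed t shows it at all of
  its points. Measurability follows for every g.\<close>

lemma open_superlevel_maximal_fun: "open {x. t < maximal_fun M g x}"
  unfolding superlevel_maximal_fun by auto

lemma measurable_maximal_fun_borel: "maximal_fun M g \<in> borel_measurable borel"
  by (rule borel_measurableI_greater)
    (use open_superlevel_maximal_fun in \<open>auto intro: borel_open\<close>)

lemma measurable_maximal_fun [measurable]:
  "sets N = sets lebesgue \<Longrightarrow> maximal_fun M g \<in> borel_measurable N"
proof -
  assume "sets N = sets lebesgue"
  moreover have "maximal_fun M g \<in> borel_measurable lebesgue"
    using measurable_maximal_fun_borel by (intro measurable_completion) simp
  ultimately show ?thesis
    using measurable_cong_sets by blast
qed

lemma maximal_fun_mono_AE:
  assumes "AE x in M. f x \<le> g x"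
  shows "maximal_fun M f x \<le> maximal_fun M g x"
proof (rule maximal_fun_least)
  fix c \<rho> assume "0 < (\<rho>::real)" "x \<in> ball c \<rho>"
  have "(\<integral>\<^sup>+y\<in>ball c \<rho>. f y \<partial>M) \<le> (\<integral>\<^sup>+y\<in>ball c \<rho>. g y \<partial>M)"
    using assms by (intro nn_integral_mono_AE) (auto elim!: eventually_mono intro: mult_right_mono)
  then have "(\<integral>\<^sup>+y\<in>ball c \<rho>. f y \<partial>M) / emeasure M (ball c \<rho>) \<le> (\<integral>\<^sup>+y\<in>ball c \<rho>. g y \<partial>M) / emeasure M (ball c \<rho>)"
    by (rule divide_right_mono_ennreal)
  also have "\<dots> \<le> maximal_fun M g x"
    by (rule maximal_fun_upper) fact+
  finally show "(\<integral>\<^sup>+y\<in>ball c \<rho>. f y \<partial>M) / emeasure M (ball c \<rho>) \<le> maximal_fun M g x" .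
qed

lemma maximal_fun_mono: "(\<And>x. f x \<le> g x) \<Longrightarrow> maximal_fun M f x \<le> maximal_fun M g x"
  by (intro maximal_fun_mono_AE) auto

lemma maximal_fun_add:
  assumes M: "sets M = sets lebesgue" and [measurable]: "f \<in> borel_measurable M" "g \<in> borel_measurable M"
  shows "maximal_fun M (\<lambda>x. f x + g x) x \<le> maximal_fun M f x + maximal_fun M g x"
proof (rule maximal_fun_least)
  fix c \<rho> assume *: "0 < (\<rho>::real)" "x \<in> ball c \<rho>"
  have [measurable]: "ball c \<rho> \<in> sets M" using M by simp
  have "(\<integral>\<^sup>+y\<in>ball c \<rho>. (f y + g y) \<partial>M) = (\<integral>\<^sup>+y\<in>ball c \<rho>. f y \<partial>M) + (\<integral>\<^sup>+y\<in>ball c \<rho>. g y \<partial>M)"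
    by (simp add: distrib_right nn_integral_add)
  then show "(\<integral>\<^sup>+y\<in>ball c \<rho>. (f y + g y) \<partial>M) / emeasure M (ball c \<rho>) \<le> maximal_fun M f x + maximal_fun M g x"
    using * by (auto simp: add_divide_distrib_ennreal intro!: add_mono maximal_fun_upper)
qed

lemma maximal_fun_cmult:
  assumes M: "sets M = sets lebesgue" and [measurable]: "f \<in> borel_measurable M"
  shows "maximal_fun M (\<lambda>x. c * f x) x = c * maximal_fun M f x"
proof -
  have [measurable]: "ball a \<rho> \<in> sets M" for a \<rho> using M by simp
  show ?thesis
    unfolding maximal_fun_def SUP_mult_left_ennreal
    by (intro SUP_cong refl) (auto simp: mult.assoc nn_integral_cmult ennreal_times_divide)
qed

lemma maximal_fun_const_le:
  assumes M: "sets M = sets lebesgue" and fin: "\<And>c \<rho>. emeasure M (ball c \<rho>) < top"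
    and g: "AE x in M. g x \<le> z"
  shows "maximal_fun M g x \<le> z"
proof (rule maximal_fun_least)
  fix c \<rho>
  have [measurable]: "ball c \<rho> \<in> sets M" using M by simp
  have "(\<integral>\<^sup>+y\<in>ball c \<rho>. g y \<partial>M) \<le> (\<integral>\<^sup>+y\<in>ball c \<rho>. z \<partial>M)"
    using g by (intro nn_integral_mono_AE) (auto elim!: eventually_mono intro: mult_right_mono)
  also have "\<dots> = emeasure M (ball c \<rho>) * z"
    by (simp add: nn_integral_cmult_indicator mult.commute)
  finally show "(\<integral>\<^sup>+y\<in>ball c \<rho>. g y \<partial>M) / emeasure M (ball c \<rho>) \<le> z"
    using fin[of c \<rho>] by (cases "emeasure M (ball c \<rho>) = 0")
      (auto simp: ennreal_divide_le_iff zero_less_iff_neq_zero)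
qed

section \<open>Vitali coverings and dyadic layers\<close>

lemma emeasure_UN_le_count_space:
  assumes "countable I" and [measurable]: "\<And>i. i \<in> I \<Longrightarrow> X i \<in> sets M"
  shows "emeasure M (\<Union>i\<in>I. X i) \<le> (\<integral>\<^sup>+i. emeasure M (X i) \<partial>count_space I)"
proof -
  have "emeasure M (\<Union>i\<in>I. X i) = (\<integral>\<^sup>+x. indicator (\<Union>i\<in>I. X i) x \<partial>M)"
    using assms by (intro nn_integral_indicator[symmetric] sets.countable_UN'') auto
  also have "\<dots> \<le> (\<integral>\<^sup>+x. (\<integral>\<^sup>+i. indicator (X i) x \<partial>count_space I) \<partial>M)"
  proof (rule nn_integral_mono)
    fix x
    show "(indicator (\<Union>i\<in>I. X i) x :: ennreal) \<le> (\<integral>\<^sup>+i. indicator (X i) x \<partial>count_space I)"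
    proof (cases "x \<in> (\<Union>i\<in>I. X i)")
      case True
      then obtain i where i: "i \<in> I" "x \<in> X i" by auto
      have "(1::ennreal) = (\<integral>\<^sup>+j. indicator {i} j \<partial>count_space I)"
        using i by (simp add: emeasure_count_space)
      also have "\<dots> \<le> (\<integral>\<^sup>+j. indicator (X j) x \<partial>count_space I)"
        using i by (intro nn_integral_mono) (auto split: split_indicator)
      finally show ?thesis using True by simp
    qed auto
  qed
  also have "\<dots> = (\<integral>\<^sup>+i. (\<integral>\<^sup>+x. indicator (X i) x \<partial>M) \<partial>count_space I)"
    using assms by (intro nn_integral_count_space_nn_integral) auto
  also have "\<dots> = (\<integral>\<^sup>+i. emeasure M (X i) \<partial>count_space I)"
    by (intro nn_integral_cong) auto
  finally show ?thesis .
qed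

text \<open>The covering lemma with two measures: N is counted on the balls of fivefold radius,
  which cover the union, and M on the selected disjoint balls. The weak type bound, the half density
  enlargement and the good-\<lambda> inequality are all instances, with different densities in the
  place of M or N.\<close>

lemma vitali_comparison:
  fixes a :: "'i \<Rightarrow> 'a::euclidean_space"
  assumes M: "sets M = sets lebesgue" and N: "sets N = sets lebesgue"
    and r: "\<And>i. i \<in> I \<Longrightarrow> 0 < r i \<and> r i \<le> R"
    and le: "\<And>i. i \<in> I \<Longrightarrow> emeasure N (ball (a i) (5 * r i)) \<le> C * emeasure M (ball (a i) (r i))"
  shows "emeasure N (\<Union>i\<in>I. ball (a i) (r i)) \<le> C * emeasure M (\<Union>i\<in>I. ball (a i) (r i))"
proof -
  let ?U = "\<Union>i\<in>I. ball (a i) (r i)"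
  obtain J where J: "countable J" "J \<subseteq> I"
    "pairwise (\<lambda>i j. disjnt (ball (a i) (r i)) (ball (a j) (r j))) J"
    "?U \<subseteq> (\<Union>i\<in>J. ball (a i) (5 * r i))"
    using Vitali_covering_lemma_balls[OF order_refl, of I r R a] r by blast
  have disj: "disjoint_family_on (\<lambda>i. ball (a i) (r i)) J"
    using J(3) by (auto simp: disjoint_family_on_def pairwise_def disjnt_def)
  have op: "open T \<Longrightarrow> T \<in> sets M" "open T \<Longrightarrow> T \<in> sets N" for T
    using M N by auto
  have "emeasure N ?U \<le> emeasure N (\<Union>i\<in>J. ball (a i) (5 * r i))"
    by (intro emeasure_mono J op) auto
  also have "\<dots> \<le> (\<integral>\<^sup>+i. emeasure N (ball (a i) (5 * r i)) \<partial>count_space J)"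
    by (intro emeasure_UN_le_count_space J op) auto
  also have "\<dots> \<le> (\<integral>\<^sup>+i. C * emeasure M (ball (a i) (r i)) \<partial>count_space J)"
    using J le by (intro nn_integral_mono) auto
  also have "\<dots> = C * (\<integral>\<^sup>+i. emeasure M (ball (a i) (r i)) \<partial>count_space J)"
    by (intro nn_integral_cmult) auto
  also have "(\<integral>\<^sup>+i. emeasure M (ball (a i) (r i)) \<partial>count_space J) = emeasure M (\<Union>i\<in>J. ball (a i) (r i))"
    by (intro emeasure_UN_countable[symmetric] disj J op) auto
  also have "C * \<dots> \<le> C * emeasure M ?U"
    using J by (intro mult_left_mono emeasure_mono op) auto
  finally show ?thesis .
qed

text \<open>A dyadic layer-cake formula: it replaces the integral over the levels \<open>\<lambda> < \<Lambda>\<close>.\<close>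

definition dyadic_layers :: "real \<Rightarrow> real \<Rightarrow> ennreal \<Rightarrow> ennreal" where
  "dyadic_layers p \<Lambda> t = (\<Sum>i. ennreal ((\<Lambda> / 2 ^ i) powr p) * indicator {ennreal (\<Lambda> / 2 ^ i) <..} t)"

lemma ennreal_geometric:
  assumes "0 \<le> q" "q < 1"
  shows "(\<Sum>i. ennreal (q ^ i)) = ennreal (1 / (1 - q))"
  using assms by (subst suminf_ennreal_eq[OF _ geometric_sums]) auto

text \<open>The levels descend from \<open>\<Lambda>\<close>, so larger values of t are seen as
  \<open>\<Lambda>\<close>. For the first level below t, the preceding one is at least t, which
  costs the factor 2 to the power p.\<close>

lemma dyadic_layers_lower:
  assumes "0 < p" "0 < \<Lambda>"
  shows "min t (ennreal \<Lambda>) epowr p \<le> ennreal (2 powr p) * dyadic_layers p \<Lambda> t"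
proof -
  have *: "ennreal ((\<Lambda> / 2 ^ i) powr p) \<le> dyadic_layers p \<Lambda> t" if "ennreal (\<Lambda> / 2 ^ i) < t" for i
  proof -
    have "ennreal ((\<Lambda> / 2 ^ i) powr p) = (\<Sum>j\<in>{i}. ennreal ((\<Lambda> / 2 ^ j) powr p) * indicator {ennreal (\<Lambda> / 2 ^ j) <..} t)"
      using that by simp
    also have "\<dots> \<le> dyadic_layers p \<Lambda> t"
      unfolding dyadic_layers_def by (rule sum_le_suminf) auto
    finally show ?thesis .
  qed
  show ?thesis
  proof (cases "t = 0")
    case False
    define P where "P = (\<lambda>i::nat. ennreal (\<Lambda> / 2 ^ i) < t)"
    have "\<exists>i. P i"
    proof (cases t rule: ennreal_cases_pos)
      case (pos s)
      obtain i where "(1/2) ^ i < s / \<Lambda>"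
        using real_arch_pow_inv[of "s / \<Lambda>" "1/2"] pos(1) assms by auto
      then have "\<Lambda> / 2 ^ i < s"
        using assms by (simp add: field_simps power_divide)
      then show ?thesis unfolding P_def pos(2) using assms pos(1) by (auto intro!: exI[of _ i] ennreal_lessI)
    qed (use False in \<open>auto simp: P_def\<close>)
    define i where "i = (LEAST i. P i)"
    have Pi: "P i" unfolding i_def using \<open>\<exists>i. P i\<close> by (rule LeastI_ex)
    have "min t (ennreal \<Lambda>) \<le> ennreal (2 * (\<Lambda> / 2 ^ i))"
    proof (cases i)
      case 0
      then show ?thesis using assms by (auto intro!: min.coboundedI2 ennreal_leI)
    next
      case (Suc k)
      then have "\<not> P k" unfolding i_def by (metis lessI not_less_Least)
      then show ?thesis using Suc by (auto simp: P_def not_less intro!: min.coboundedI1)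
    qed
    then have "min t (ennreal \<Lambda>) epowr p \<le> ennreal (2 * (\<Lambda> / 2 ^ i)) epowr p"
      using assms by (intro epowr_mono) auto
    also have "\<dots> = ennreal (2 powr p) * ennreal ((\<Lambda> / 2 ^ i) powr p)"
      using assms by (simp add: ennreal_epowr ennreal_mult'[symmetric] powr_mult[symmetric])
    also have "\<dots> \<le> ennreal (2 powr p) * dyadic_layers p \<Lambda> t"
      by (intro mult_left_mono *) (use Pi in \<open>auto simp: P_def\<close>)
    finally show ?thesis .
  qed (use assms in auto)
qed

text \<open>The levels below t form a geometric series whose largest term belongs to the first of
  them.\<close>

lemma dyadic_layers_upper:
  assumes "0 < p" "0 < \<Lambda>"
  shows "dyadic_layers p \<Lambda> t \<le> ennreal (1 / (1 - 2 powr - p)) * t epowr p"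
proof (cases "\<exists>i. ennreal (\<Lambda> / 2 ^ i) < t")
  case False
  then have "dyadic_layers p \<Lambda> t = 0" by (simp add: dyadic_layers_def)
  then show ?thesis by simp
next
  case True
  define i where "i = (LEAST i. ennreal (\<Lambda> / 2 ^ i) < t)"
  have i: "ennreal (\<Lambda> / 2 ^ i) < t" unfolding i_def using True by (rule LeastI_ex)
  have before: "\<not> ennreal (\<Lambda> / 2 ^ j) < t" if "j < i" for j
    using that unfolding i_def by (rule not_less_Least)
  define f where "f j = ennreal ((\<Lambda> / 2 ^ j) powr p) * indicator {ennreal (\<Lambda> / 2 ^ j) <..} t" for j
  have q: "0 \<le> 2 powr - p" "2 powr - p < 1"
    using assms by (auto simp: powr_less_one)
  have "dyadic_layers p \<Lambda> t = (\<Sum>j. f (j + i)) + sum f {..<i}"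
    unfolding dyadic_layers_def f_def[symmetric]
    by (rule suminf_offset) auto
  also have "sum f {..<i} = 0"
    using before by (intro sum.neutral) (auto simp: f_def)
  also have "(\<Sum>j. f (j + i)) \<le> (\<Sum>j. ennreal ((\<Lambda> / 2 ^ i) powr p) * ennreal ((2 powr - p) ^ j))"
  proof (rule suminf_le)
    fix j
    have "(\<Lambda> / 2 ^ (j + i)) powr p = (\<Lambda> / 2 ^ i) powr p * (2 powr - p) ^ j"
    proof -
      have "(\<Lambda> / 2 ^ (j + i)) = (\<Lambda> / 2 ^ i) * 2 powr (- real j)"
        by (simp add: power_add powr_minus powr_realpow divide_simps)
      then have "(\<Lambda> / 2 ^ (j + i)) powr p = (\<Lambda> / 2 ^ i) powr p * (2 powr (- real j)) powr p"
        using assms powr_mult[of "\<Lambda> / 2 ^ i" "2 powr (- real j)" p] by simp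
      also have "(2 powr (- real j)) powr p = (2 powr - p) ^ j"
        by (simp add: powr_powr powr_realpow[symmetric] mult.commute)
      finally show ?thesis .
    qed
    then show "f (j + i) \<le> ennreal ((\<Lambda> / 2 ^ i) powr p) * ennreal ((2 powr - p) ^ j)"
      by (auto simp: f_def ennreal_mult'[symmetric] split: split_indicator)
  qed auto
  also have "\<dots> = ennreal ((\<Lambda> / 2 ^ i) powr p) * ennreal (1 / (1 - 2 powr - p))"
    by (simp add: ennreal_suminf_cmult ennreal_geometric[OF q])
  also have "\<dots> \<le> t epowr p * ennreal (1 / (1 - 2 powr - p))"
  proof (rule mult_right_mono)
    have "ennreal ((\<Lambda> / 2 ^ i) powr p) = ennreal (\<Lambda> / 2 ^ i) epowr p"
      using assms by (simp add: ennreal_epowr)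
    also have "\<dots> \<le> t epowr p" using assms i by (intro epowr_mono) auto
    finally show "ennreal ((\<Lambda> / 2 ^ i) powr p) \<le> t epowr p" .
  qed auto
  finally show ?thesis by (simp add: mult.commute)
qed

lemma nn_integral_dyadic_layers:
  assumes [measurable]: "X \<in> borel_measurable M" "f \<in> borel_measurable M"
  shows "(\<integral>\<^sup>+x. f x * dyadic_layers p \<Lambda> (X x) \<partial>M)
    = (\<Sum>i. ennreal ((\<Lambda> / 2 ^ i) powr p) * (\<integral>\<^sup>+x. f x * indicator {x. ennreal (\<Lambda> / 2 ^ i) < X x} x \<partial>M))"
proof -
  have "(\<integral>\<^sup>+x. f x * dyadic_layers p \<Lambda> (X x) \<partial>M)
    = (\<integral>\<^sup>+x. (\<Sum>i. ennreal ((\<Lambda> / 2 ^ i) powr p) * (f x * indicator {x. ennreal (\<Lambda> / 2 ^ i) < X x} x)) \<partial>M)"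
    unfolding dyadic_layers_def ennreal_suminf_cmult[symmetric]
    by (intro nn_integral_cong arg_cong[of _ _ suminf] ext) (simp add: indicator_def mult.commute)
  also have "\<dots> = (\<Sum>i. \<integral>\<^sup>+x. ennreal ((\<Lambda> / 2 ^ i) powr p) * (f x * indicator {x. ennreal (\<Lambda> / 2 ^ i) < X x} x) \<partial>M)"
    by (rule nn_integral_suminf) measurable
  also have "\<dots> = (\<Sum>i. ennreal ((\<Lambda> / 2 ^ i) powr p) * (\<integral>\<^sup>+x. f x * indicator {x. ennreal (\<Lambda> / 2 ^ i) < X x} x \<partial>M))"
    by (intro suminf_cong nn_integral_cmult) measurable
  finally show ?thesis .
qed

lemma measurable_dyadic_layers [measurable]:
  "X \<in> borel_measurable M \<Longrightarrow> (\<lambda>x. dyadic_layers p \<Lambda> (X x)) \<in> borel_measurable M"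
  unfolding dyadic_layers_def by measurable

lemma min_of_nat_SUP: "(SUP n. min x (ennreal (real (Suc n)))) = x"
proof (rule antisym)
  show "(SUP n. min x (ennreal (real (Suc n)))) \<le> x"
    by (rule SUP_least) auto
  show "x \<le> (SUP n. min x (ennreal (real (Suc n))))"
  proof (cases "x = top")
    case True
    have "(top::ennreal) = (SUP n::nat. ennreal (real n))"
      using ennreal_SUP_of_nat_eq_top by (simp only: ennreal_of_nat_eq_real_of_nat)
    also have "\<dots> \<le> (SUP n. min x (ennreal (real (Suc n))))"
    proof (rule SUP_mono)
      fix n :: nat
      show "\<exists>m\<in>UNIV. ennreal (real n) \<le> min x (ennreal (real (Suc m)))"
        by (intro bexI[of _ n]) (auto simp: True intro!: ennreal_leI simp del: of_nat_Suc)
    qed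
    finally show ?thesis by (rule order_trans[OF top_greatest])
  next
    case False
    then obtain n where "x < of_nat n"
      using ennreal_Ex_less_of_nat by (auto simp: less_top)
    then have "x \<le> ennreal (real (Suc n))"
      by (metis ennreal_leI ennreal_of_nat_eq_real_of_nat le_add2 less_imp_le of_nat_mono order_trans plus_1_eq_Suc)
    then have "x = min x (ennreal (real (Suc n)))" by (simp add: min_def)
    then show ?thesis by (metis SUP_upper UNIV_I)
  qed
qed

text \<open>Removes the upper end \<open>\<Lambda>\<close> of the layers by monotone convergence;
  starting at a largest level keeps all level sums one-sided.\<close>

lemma nn_integral_epowr_truncation:
  assumes [measurable]: "X \<in> borel_measurable M" and p: "0 < p"
    and le: "\<And>\<Lambda>. 0 < \<Lambda> \<Longrightarrow> (\<integral>\<^sup>+x. min (X x) (ennreal \<Lambda>) epowr p \<partial>M) \<le> c"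
  shows "(\<integral>\<^sup>+x. X x epowr p \<partial>M) \<le> c"
proof -
  have "(\<integral>\<^sup>+x. X x epowr p \<partial>M) = (\<integral>\<^sup>+x. (SUP n. min (X x) (ennreal (real (Suc n))) epowr p) \<partial>M)"
    by (simp add: epowr_SUP[OF p, symmetric] min_of_nat_SUP del: of_nat_Suc)
  also have "\<dots> = (SUP n. \<integral>\<^sup>+x. min (X x) (ennreal (real (Suc n))) epowr p \<partial>M)"
    by (rule nn_integral_monotone_convergence_SUP)
      (use p in \<open>auto simp: incseq_def le_fun_def intro!: epowr_mono min.mono ennreal_leI\<close>)
  also have "\<dots> \<le> c"
    by (intro SUP_least le) auto
  finally show ?thesis .
qed

text \<open>Doubling is stated with the factor 5 of the covering lemma, so that it can serve
  directly as the hypothesis of \<open>vitali_comparison\<close>.\<close>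

locale doubling_measure =
  fixes M :: "'a::euclidean_space measure" and K :: real
  assumes sets_M: "sets M = sets lebesgue"
    and ball_pos: "0 < \<rho> \<Longrightarrow> 0 < emeasure M (ball c \<rho>)"
    and ball_finite: "emeasure M (ball c \<rho>) < top"
    and doubling: "0 < \<rho> \<Longrightarrow> emeasure M (ball c (5 * \<rho>)) \<le> ennreal K * emeasure M (ball c \<rho>)"
begin

lemma open_sets: "open S \<Longrightarrow> S \<in> sets M"
  by (simp add: sets_M)

lemma ball_sets [measurable]: "ball c \<rho> \<in> sets M"
  by (simp add: open_sets)

lemma measurable_maximal [measurable]: "maximal_fun N g \<in> borel_measurable M"
  by (rule measurable_maximal_fun[OF sets_M])

lemma space_M: "space M = UNIV"
  using sets_eq_imp_space_eq[OF sets_M] by simp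

lemma K_ge_1: "1 \<le> K"
proof -
  have "emeasure M (ball 0 1) \<le> emeasure M (ball 0 (5 * 1))"
    by (intro emeasure_mono subset_ball) auto
  also have "\<dots> \<le> ennreal K * emeasure M (ball 0 1)"
    by (rule doubling) auto
  finally have "1 * emeasure M (ball 0 1) \<le> ennreal K * emeasure M (ball 0 1)"
    by simp
  then have "1 \<le> ennreal K"
    using ball_pos[of 1 0] ball_finite[of 0 1]
    by (subst (asm) (1 2) mult.commute, subst (asm) ennreal_mult_le_mult_iff) auto
  then show ?thesis by (simp add: ennreal_ge_1)
qed

lemma weak_type:
  assumes [measurable]: "g \<in> borel_measurable M" and t: "0 < t" "t < top"
  shows "t * emeasure M {x. t < maximal_fun M g x} \<le> ennreal K * (\<integral>\<^sup>+x. g x \<partial>M)"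
proof -
  \<comment> \<open>The covering lemma needs bounded radii; the bound R is removed at the end by
    continuity of the measure from below.\<close>
  define I where "I R = {(c, \<rho>). 0 < \<rho> \<and> \<rho> \<le> R \<and> t < (\<integral>\<^sup>+y\<in>ball c \<rho>. g y \<partial>M) / emeasure M (ball c \<rho>)}" for R :: real
  let ?U = "\<lambda>R. (\<Union>i\<in>I R. ball (fst i) (snd i))"
  have N: "sets (density M g) = sets lebesgue" by (simp add: sets_M)
  have U: "t * emeasure M (?U R) \<le> ennreal K * (\<integral>\<^sup>+x. g x \<partial>M)" for R
  proof -
    have "emeasure M (?U R) \<le> (ennreal K / t) * emeasure (density M g) (?U R)"
    proof (rule vitali_comparison[OF N sets_M, of "I R" snd R])
      fix i assume "i \<in> I R"
      then obtain c \<rho> where i: "i = (c, \<rho>)" "0 < \<rho>" "t < (\<integral>\<^sup>+y\<in>ball c \<rho>. g y \<partial>M) / emeasure M (ball c \<rho>)"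
        by (auto simp: I_def)
      then have "emeasure M (ball c \<rho>) * t \<le> (\<integral>\<^sup>+y\<in>ball c \<rho>. g y \<partial>M)"
        using ball_pos[of \<rho> c] ball_finite[of c \<rho>]
        by (subst ennreal_le_divide_iff[symmetric]) auto
      then have "t * emeasure M (ball c \<rho>) \<le> emeasure (density M g) (ball c \<rho>)"
        by (subst emeasure_density) (auto simp: mult.commute)
      then have "emeasure M (ball c \<rho>) \<le> emeasure (density M g) (ball c \<rho>) / t"
        using t by (subst ennreal_le_divide_iff) auto
      have "emeasure M (ball c (5 * \<rho>)) \<le> ennreal K * emeasure M (ball c \<rho>)"
        by (rule doubling) fact
      also have "\<dots> \<le> ennreal K * (emeasure (density M g) (ball c \<rho>) / t)"
        by (rule mult_left_mono) (fact, simp)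
      also have "\<dots> = ennreal K / t * emeasure (density M g) (ball c \<rho>)"
        by (simp add: divide_ennreal_def ac_simps)
      finally show "emeasure M (ball (fst i) (5 * snd i)) \<le> ennreal K / t * emeasure (density M g) (ball (fst i) (snd i))"
        using i by simp
    qed (auto simp: I_def)
    also have "emeasure (density M g) (?U R) \<le> emeasure (density M g) UNIV"
      by (intro emeasure_mono) (use sets.top[of M] in \<open>auto simp: space_M\<close>)
    also have "\<dots> = (\<integral>\<^sup>+x. g x \<partial>M)"
      by (subst emeasure_density) (use sets.top[of M] in \<open>auto simp: space_M\<close>)
    finally have "emeasure M (?U R) \<le> ennreal K / t * (\<integral>\<^sup>+x. g x \<partial>M)"
      by (meson mult_left_mono zero_le)
    also have "\<dots> = (ennreal K * (\<integral>\<^sup>+x. g x \<partial>M)) / t"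
      by (simp add: divide_ennreal_def ac_simps)
    finally have "emeasure M (?U R) \<le> (ennreal K * (\<integral>\<^sup>+x. g x \<partial>M)) / t" .
    then show ?thesis
      using t by (subst (asm) ennreal_le_divide_iff) auto
  qed
  have "{x. t < maximal_fun M g x} = (\<Union>n::nat. ?U (real n))"
  proof -
    have "x \<in> (\<Union>n::nat. ?U (real n))" if "x \<in> {x. t < maximal_fun M g x}" for x
    proof -
      obtain c \<rho> where c: "0 < \<rho>" "x \<in> ball c \<rho>" "t < (\<integral>\<^sup>+y\<in>ball c \<rho>. g y \<partial>M) / emeasure M (ball c \<rho>)"
        using \<open>x \<in> {x. t < maximal_fun M g x}\<close> unfolding less_maximal_fun_iff by auto
      obtain n :: nat where "\<rho> \<le> real n" using real_arch_simple by blast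
      with c have "(c, \<rho>) \<in> I (real n)" by (simp add: I_def)
      with c(2) show ?thesis by force
    qed
    moreover have "x \<in> {x. t < maximal_fun M g x}" if "x \<in> (\<Union>n::nat. ?U (real n))" for x
      using that unfolding less_maximal_fun_iff I_def by auto
    ultimately show ?thesis by blast
  qed
  then have "emeasure M {x. t < maximal_fun M g x} = (SUP n::nat. emeasure M (?U (real n)))"
  proof (simp only:, intro SUP_emeasure_incseq[symmetric])
    show "incseq (\<lambda>n::nat. ?U (real n))"
    proof (rule incseq_SucI, rule UN_mono)
      show "I (real n) \<subseteq> I (real (Suc n))" for n by (auto simp: I_def)
    qed auto
  qed (auto intro!: open_sets)
  then show ?thesis
    by (auto simp: SUP_mult_left_ennreal intro!: SUP_least U)
qed

text \<open>The part of g not exceeding l/2 adds at most l/2 to the maximal function. The weak type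
  bound at the level l/2 is therefore applied to the remaining part alone.\<close>

lemma superlevel_maximal_le:
  assumes [measurable]: "g \<in> borel_measurable M" and l: "0 < l"
  shows "ennreal l * emeasure M {x. ennreal l < maximal_fun M g x}
    \<le> ennreal (2 * K) * (\<integral>\<^sup>+x. g x * indicator {x. ennreal l < 2 * g x} x \<partial>M)"
proof -
  let ?h = "\<lambda>x. g x * indicator {x. ennreal l < 2 * g x} x"
  have "maximal_fun M g x \<le> maximal_fun M ?h x + ennreal (l / 2)" for x
  proof -
    have "maximal_fun M g x \<le> maximal_fun M (\<lambda>x. ?h x + ennreal (l / 2)) x"
    proof (rule maximal_fun_mono)
      fix x
      have "g x \<le> ennreal (l / 2)" if "\<not> ennreal l < 2 * g x"
      proof -
        have "2 * g x \<le> 2 * ennreal (l / 2)"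
          using that l by (simp add: ennreal_mult'[symmetric] flip: ennreal_numeral)
        then show ?thesis by (subst (asm) ennreal_mult_le_mult_iff) auto
      qed
      then show "g x \<le> ?h x + ennreal (l / 2)"
        by (auto split: split_indicator)
    qed
    also have "\<dots> \<le> maximal_fun M ?h x + maximal_fun M (\<lambda>x. ennreal (l / 2)) x"
      by (rule maximal_fun_add[OF sets_M]) measurable
    also have "maximal_fun M (\<lambda>x. ennreal (l / 2)) x \<le> ennreal (l / 2)"
      by (rule maximal_fun_const_le[OF sets_M ball_finite]) auto
    finally show ?thesis by (auto simp: add_left_mono)
  qed
  then have sub: "{x. ennreal l < maximal_fun M g x} \<subseteq> {x. ennreal (l / 2) < maximal_fun M ?h x}"
  proof safe
    fix x assume *: "ennreal l < maximal_fun M g x" and le: "\<And>x. maximal_fun M g x \<le> maximal_fun M ?h x + ennreal (l / 2)"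
    show "ennreal (l / 2) < maximal_fun M ?h x"
    proof (rule ccontr)
      assume "\<not> ?thesis"
      then have "maximal_fun M g x \<le> ennreal (l / 2) + ennreal (l / 2)"
        using le[of x] by (meson add_right_mono not_less order_trans)
      also have "\<dots> = ennreal l" using l by (simp add: ennreal_plus[symmetric] del: ennreal_plus)
      finally show False using * by simp
    qed
  qed
  have "ennreal l * emeasure M {x. ennreal l < maximal_fun M g x}
    \<le> 2 * (ennreal (l / 2) * emeasure M {x. ennreal (l / 2) < maximal_fun M ?h x})"
  proof -
    have "ennreal l * emeasure M {x. ennreal l < maximal_fun M g x}
      \<le> ennreal l * emeasure M {x. ennreal (l / 2) < maximal_fun M ?h x}"
      by (intro mult_left_mono emeasure_mono sub open_sets open_superlevel_maximal_fun) auto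
    also have "\<dots> = 2 * (ennreal (l / 2) * emeasure M {x. ennreal (l / 2) < maximal_fun M ?h x})"
      using l by (simp add: mult.assoc[symmetric] ennreal_mult'[symmetric] flip: ennreal_numeral)
    finally show ?thesis .
  qed
  also have "\<dots> \<le> 2 * (ennreal K * (\<integral>\<^sup>+x. ?h x \<partial>M))"
    using l by (intro mult_left_mono weak_type) auto
  also have "\<dots> = ennreal (2 * K) * (\<integral>\<^sup>+x. ?h x \<partial>M)"
    using K_ge_1 by (simp add: ennreal_mult' mult.assoc)
  finally show ?thesis .
qed

text \<open>A closed form in K and p, since later bounds must depend on the measure only through its
  doubling constant.\<close>

definition strong_const :: "real \<Rightarrow> real" where
  "strong_const p = 2 powr p * (2 * K * (2 powr (p - 1) / (1 - 2 powr - (p - 1))))"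

lemma strong_const_nonneg: "1 < p \<Longrightarrow> 0 \<le> strong_const p"
  using K_ge_1 powr_less_one[of 2 "- (p - 1)"] by (auto simp: strong_const_def intro!: mult_nonneg_nonneg divide_nonneg_nonneg)

text \<open>Marcinkiewicz interpolation in dyadic form. One factor of each level is spent on
  \<open>superlevel_maximal_le\<close>; the remaining power p - 1 > 0 of the levels below 2 g(x)
  sums to a multiple of g(x) to the power p - 1.\<close>

theorem strong_type:
  assumes [measurable]: "g \<in> borel_measurable M" and p: "1 < p"
  shows "(\<integral>\<^sup>+x. maximal_fun M g x epowr p \<partial>M) \<le> ennreal (strong_const p) * (\<integral>\<^sup>+x. g x epowr p \<partial>M)"
proof (rule nn_integral_epowr_truncation)
  fix \<Lambda> :: real assume \<Lambda>: "0 < \<Lambda>"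
  let ?X = "maximal_fun M g"
  have "(\<integral>\<^sup>+x. min (?X x) (ennreal \<Lambda>) epowr p \<partial>M) \<le> (\<integral>\<^sup>+x. ennreal (2 powr p) * dyadic_layers p \<Lambda> (?X x) \<partial>M)"
    using p \<Lambda> by (intro nn_integral_mono dyadic_layers_lower) auto
  also have "\<dots> = ennreal (2 powr p) * (\<integral>\<^sup>+x. 1 * dyadic_layers p \<Lambda> (?X x) \<partial>M)"
    by (simp add: nn_integral_cmult)
  also have "(\<integral>\<^sup>+x. 1 * dyadic_layers p \<Lambda> (?X x) \<partial>M)
    = (\<Sum>i. ennreal ((\<Lambda> / 2 ^ i) powr p) * (\<integral>\<^sup>+x. 1 * indicator {x. ennreal (\<Lambda> / 2 ^ i) < ?X x} x \<partial>M))"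
    by (rule nn_integral_dyadic_layers) auto
  also have "\<dots> \<le> (\<Sum>i. ennreal (2 * K) * (ennreal ((\<Lambda> / 2 ^ i) powr (p - 1)) *
       (\<integral>\<^sup>+x. g x * indicator {x. ennreal (\<Lambda> / 2 ^ i) < 2 * g x} x \<partial>M)))"
  proof (rule suminf_le)
    fix i
    let ?l = "\<Lambda> / 2 ^ i"
    have l: "0 < ?l" using \<Lambda> by simp
    have "(\<integral>\<^sup>+x. 1 * indicator {x. ennreal ?l < ?X x} x \<partial>M) = emeasure M {x. ennreal ?l < ?X x}"
      by (simp add: open_sets open_superlevel_maximal_fun)
    moreover have "?l powr p = ?l powr (p - 1) * ?l"
      using l \<Lambda> by (simp add: powr_diff)
    ultimately have "ennreal (?l powr p) * (\<integral>\<^sup>+x. 1 * indicator {x. ennreal ?l < ?X x} x \<partial>M)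
      = ennreal (?l powr (p - 1)) * (ennreal ?l * emeasure M {x. ennreal ?l < ?X x})"
      using l by (simp only: ennreal_mult' mult.assoc powr_ge_zero less_imp_le)
    also have "\<dots> \<le> ennreal (?l powr (p - 1)) * (ennreal (2 * K) * (\<integral>\<^sup>+x. g x * indicator {x. ennreal ?l < 2 * g x} x \<partial>M))"
      using l by (intro mult_left_mono superlevel_maximal_le) auto
    finally show "ennreal (?l powr p) * (\<integral>\<^sup>+x. 1 * indicator {x. ennreal ?l < ?X x} x \<partial>M)
      \<le> ennreal (2 * K) * (ennreal (?l powr (p - 1)) * (\<integral>\<^sup>+x. g x * indicator {x. ennreal ?l < 2 * g x} x \<partial>M))"
      by (simp add: ac_simps)
  qed auto
  also have "\<dots> = ennreal (2 * K) * (\<integral>\<^sup>+x. g x * dyadic_layers (p - 1) \<Lambda> (2 * g x) \<partial>M)"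
    by (subst nn_integral_dyadic_layers) (auto simp: ennreal_suminf_cmult)
  also have "(\<integral>\<^sup>+x. g x * dyadic_layers (p - 1) \<Lambda> (2 * g x) \<partial>M)
    \<le> (\<integral>\<^sup>+x. ennreal (2 powr (p - 1) / (1 - 2 powr - (p - 1))) * g x epowr p \<partial>M)"
  proof (rule nn_integral_mono)
    fix x
    have "g x * dyadic_layers (p - 1) \<Lambda> (2 * g x) \<le> g x * (ennreal (1 / (1 - 2 powr - (p - 1))) * (2 * g x) epowr (p - 1))"
      using p \<Lambda> by (intro mult_left_mono dyadic_layers_upper) auto
    also have "\<dots> = ennreal (1 / (1 - 2 powr - (p - 1))) * ennreal (2 powr (p - 1)) * (g x epowr 1 * g x epowr (p - 1))"
      using p by (simp add: epowr_mult ennreal_epowr_numeral ac_simps)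
    also have "g x epowr 1 * g x epowr (p - 1) = g x epowr p"
      using p by (subst epowr_add[symmetric]) auto
    also have "ennreal (1 / (1 - 2 powr - (p - 1))) * ennreal (2 powr (p - 1)) = ennreal (2 powr (p - 1) / (1 - 2 powr - (p - 1)))"
      using p by (subst ennreal_mult''[symmetric]) auto
    finally show "g x * dyadic_layers (p - 1) \<Lambda> (2 * g x)
      \<le> ennreal (2 powr (p - 1) / (1 - 2 powr - (p - 1))) * g x epowr p" .
  qed
  also have "\<dots> = ennreal (2 powr (p - 1) / (1 - 2 powr - (p - 1))) * (\<integral>\<^sup>+x. g x epowr p \<partial>M)"
    by (simp add: nn_integral_cmult)
  finally have "(\<integral>\<^sup>+x. min (?X x) (ennreal \<Lambda>) epowr p \<partial>M)
    \<le> ennreal (2 powr p) * (ennreal (2 * K) * (ennreal (2 powr (p - 1) / (1 - 2 powr - (p - 1))) * (\<integral>\<^sup>+x. g x epowr p \<partial>M)))"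
    by (auto simp: mult_left_mono)
  also have "\<dots> = ennreal (strong_const p) * (\<integral>\<^sup>+x. g x epowr p \<partial>M)"
  proof -
    have "2 powr - (p - 1) < 1" using p by (auto intro: powr_less_one)
    moreover have "strong_const p = 2 powr p * (2 * K * (2 powr (p - 1) / (1 - 2 powr - (p - 1))))"
      by (simp add: strong_const_def)
    ultimately show ?thesis
      using K_ge_1 by (simp only: ennreal_mult' mult.assoc powr_ge_zero)
  qed
  finally show "(\<integral>\<^sup>+x. min (?X x) (ennreal \<Lambda>) epowr p \<partial>M) \<le> ennreal (strong_const p) * (\<integral>\<^sup>+x. g x epowr p \<partial>M)" .
qed (use p in auto)


text \<open>Weak L^1 functions lie in L^\<eta> on sets of finite measure. At the level s = L / M(A)
  the trivial bound M(A) and the weak bound L / s for the superlevel set agree. Below s the function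
  is bounded by s; the dyadic levels above s give a geometric series of ratio 2^(\<eta> - 1) <
  1.\<close>

lemma kolmogorov:
  assumes [measurable]: "X \<in> borel_measurable M" "A \<in> sets M"
    and weak: "\<And>t. 0 < t \<Longrightarrow> t < top \<Longrightarrow> t * emeasure M {x. t < X x} \<le> L"
    and \<eta>: "0 < \<eta>" "\<eta> < 1" and A: "emeasure M A < top"
  shows "(\<integral>\<^sup>+x\<in>A. X x epowr \<eta> \<partial>M)
    \<le> ennreal (1 + 2 / (1 - 2 powr (\<eta> - 1))) * (emeasure M A epowr (1 - \<eta>) * L epowr \<eta>)"
proof -
  let ?a = "emeasure M A"
  have [simp]: "{x. t < X x} \<in> sets M" for t
    using measurable_sets[of X M borel "{t<..}"] by (simp add: vimage_def space_M)
  have q: "2 powr (\<eta> - 1) < 1" "0 < 2 powr (\<eta> - 1)" using \<eta> by (auto intro: powr_less_one)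
  consider "?a = 0" | "0 < ?a" "L = top" | "0 < ?a" "L = 0" | "0 < ?a" "0 < L" "L < top"
    using less_top zero_less_iff_neq_zero by metis
  then show ?thesis
  proof cases
    case 1
    then have "AE x in M. x \<notin> A" by (intro AE_not_in null_setsI) auto
    then have "(\<integral>\<^sup>+x\<in>A. X x epowr \<eta> \<partial>M) = 0"
      by (subst nn_integral_0_iff_AE) (auto elim!: eventually_mono)
    then show ?thesis by simp
  next
    case 2
    then show ?thesis using \<eta> q A
      by (simp add: ennreal_mult_top epowr_pos order_less_imp_not_eq2 ennreal_mult_eq_top_iff)
  next
    case 3
    have "emeasure M {x. ennreal (1 / real (Suc n)) < X x} = 0" for n
      using weak[of "ennreal (1 / real (Suc n))"] 3 by (simp add: ennreal_eq_0_iff)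
    then have "AE x in M. x \<notin> {x. ennreal (1 / real (Suc n)) < X x}" for n
      by (intro AE_not_in null_setsI) auto
    then have "AE x in M. \<forall>n. x \<notin> {x. ennreal (1 / real (Suc n)) < X x}"
      by (subst AE_all_countable) blast
    then have "AE x in M. X x = 0"
    proof eventually_elim
      case (elim x)
      show ?case
      proof (rule ccontr)
        assume "X x \<noteq> 0"
        then have "\<exists>n. ennreal (1 / real (Suc n)) < X x"
        proof (cases "X x" rule: ennreal_cases_pos)
          case (pos r)
          then obtain n where "1 / real (Suc n) < r"
            using nat_approx_posE by (metis)
          then show ?thesis using pos by (auto intro!: exI[of _ n] ennreal_lessI simp del: of_nat_Suc)
        qed auto
        with elim show False by blast
      qed
    qed
    then have "(\<integral>\<^sup>+x\<in>A. X x epowr \<eta> \<partial>M) = 0"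
      using \<eta> by (subst nn_integral_0_iff_AE) (auto elim!: eventually_mono)
    then show ?thesis by simp
  next
    case 4
    obtain a where a: "0 < a" "?a = ennreal a" using 4 A by (cases ?a rule: ennreal_cases_pos) auto
    obtain l where l: "0 < l" "L = ennreal l" using 4 by (cases L rule: ennreal_cases_pos) auto
    define s where "s = l / a"
    have s: "0 < s" using a l by (simp add: s_def)
    have *: "emeasure M {x. ennreal (2 ^ i * s) < X x} \<le> ennreal (a / 2 ^ i)" for i
    proof -
      have "ennreal (2 ^ i * s) * emeasure M {x. ennreal (2 ^ i * s) < X x} \<le> ennreal l"
        using weak[of "ennreal (2 ^ i * s)"] s l by simp
      then have "emeasure M {x. ennreal (2 ^ i * s) < X x} \<le> ennreal l / ennreal (2 ^ i * s)"
        using s by (subst ennreal_le_divide_iff) auto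
      also have "\<dots> = ennreal (a / 2 ^ i)"
        using s a l by (simp add: divide_ennreal s_def)
      finally show ?thesis .
    qed
    have "emeasure M {x. X x = top} \<le> ennreal (a / 2 ^ i)" for i
      by (rule order_trans[OF emeasure_mono *[of i]]) auto
    moreover have "(\<lambda>i. ennreal (a / 2 ^ i)) \<longlonglongrightarrow> ennreal 0"
      using tendsto_mult[OF tendsto_const[of a] LIMSEQ_power_zero[of "1/2::real"]]
      by (intro tendsto_ennrealI) (simp add: power_divide)
    ultimately have "emeasure M {x. X x = top} \<le> 0"
      by (metis LIMSEQ_le_const ennreal_0)
    moreover have "{x. X x = top} \<in> sets M"
      using measurable_sets[of X M borel "{top}"] by (simp add: vimage_def space_M)
    ultimately have fin: "AE x in M. X x \<noteq> top"
      by (intro AE_I[of _ _ "{x. X x = top}"]) auto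
    define g where "g i x = ennreal ((2 * (2 ^ i * s)) powr \<eta>) * indicator {x. ennreal (2 ^ i * s) < X x} x" for i x
    have [measurable]: "g i \<in> borel_measurable M" for i unfolding g_def by measurable
    have "(\<integral>\<^sup>+x\<in>A. X x epowr \<eta> \<partial>M) \<le> (\<integral>\<^sup>+x. ennreal (s powr \<eta>) * indicator A x + (\<Sum>i. g i x) \<partial>M)"
    proof (rule nn_integral_mono_AE, use fin in eventually_elim)
      fix x assume fin: "X x \<noteq> top"
      show "X x epowr \<eta> * indicator A x \<le> ennreal (s powr \<eta>) * indicator A x + (\<Sum>i. g i x)"
      proof (cases "X x \<le> ennreal s")
        case True
        then have "X x epowr \<eta> \<le> ennreal s epowr \<eta>" using \<eta> by (intro epowr_mono) auto
        then have "X x epowr \<eta> * indicator A x \<le> ennreal (s powr \<eta>) * indicator A x"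
          using s by (intro mult_right_mono) (auto simp: ennreal_epowr)
        then show ?thesis by (metis add.right_neutral add_mono zero_le)
      next
        case False
        then obtain y where y: "X x = ennreal y" "s < y"
          using fin s by (cases "X x") (auto simp: ennreal_le_iff2)
        define k where "k = (LEAST k. y \<le> 2 * (2 ^ k * s))"
        have "\<exists>k. y \<le> 2 * (2 ^ k * s)"
        proof -
          obtain k where "y / s < 2 ^ k" using real_arch_pow[of 2 "y / s"] by auto
          then have "y < 2 ^ k * s" using s by (simp add: field_simps)
          then show ?thesis using s y by (intro exI[of _ k]) simp
        qed
        then have k: "y \<le> 2 * (2 ^ k * s)" unfolding k_def by (rule LeastI_ex)
        have k': "2 ^ k * s < y"
        proof (cases k)
          case (Suc m)
          then have "\<not> y \<le> 2 * (2 ^ m * s)" unfolding k_def by (metis lessI not_less_Least)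
          then show ?thesis using Suc by simp
        qed (use y in auto)
        have "X x epowr \<eta> * indicator A x \<le> X x epowr \<eta>" by (simp split: split_indicator)
        also have "\<dots> \<le> ennreal (2 * (2 ^ k * s)) epowr \<eta>"
          using k \<eta> y by (intro epowr_mono) (auto intro: ennreal_leI)
        also have "\<dots> = g k x"
          using s k' y by (simp add: g_def ennreal_epowr ennreal_lessI)
        also have "\<dots> = (\<Sum>i\<in>{k}. g i x)" by simp
        also have "\<dots> \<le> (\<Sum>i. g i x)" by (rule sum_le_suminf) auto
        finally show ?thesis by (metis add_increasing zero_le)
      qed
    qed
    also have "\<dots> = ennreal (s powr \<eta>) * ?a + (\<Sum>i. \<integral>\<^sup>+x. g i x \<partial>M)"
      by (simp add: nn_integral_add nn_integral_cmult_indicator nn_integral_suminf)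
    also have "(\<Sum>i. \<integral>\<^sup>+x. g i x \<partial>M) \<le> (\<Sum>i. ennreal ((2 * s) powr \<eta> * a) * ennreal ((2 powr (\<eta> - 1)) ^ i))"
    proof (rule suminf_le)
      fix i
      have "(\<integral>\<^sup>+x. g i x \<partial>M) = ennreal ((2 * (2 ^ i * s)) powr \<eta>) * emeasure M {x. ennreal (2 ^ i * s) < X x}"
        unfolding g_def by (subst nn_integral_cmult_indicator) auto
      also have "\<dots> \<le> ennreal ((2 * (2 ^ i * s)) powr \<eta>) * ennreal (a / 2 ^ i)"
        by (intro mult_left_mono *) auto
      also have "\<dots> = ennreal ((2 * (2 ^ i * s)) powr \<eta> * (a / 2 ^ i))"
        using a by (simp only: ennreal_mult' powr_ge_zero)
      also have "(2 * (2 ^ i * s)) powr \<eta> * (a / 2 ^ i) = (2 * s) powr \<eta> * a * (2 powr (\<eta> - 1)) ^ i"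
      proof -
        have "(2 * (2 ^ i * s)) powr \<eta> = ((2 * s) * 2 powr real i) powr \<eta>"
          by (simp add: powr_realpow ac_simps)
        also have "\<dots> = (2 * s) powr \<eta> * (2 powr real i) powr \<eta>"
          using s powr_mult[of "2 * s" "2 powr real i" \<eta>] by simp
        also have "(2 powr real i) powr \<eta> = (2 powr (\<eta> - 1)) ^ i * 2 ^ i"
          by (simp add: powr_powr powr_realpow[symmetric] powr_add[symmetric] algebra_simps)
        finally show ?thesis by simp
      qed
      finally show "(\<integral>\<^sup>+x. g i x \<partial>M) \<le> ennreal ((2 * s) powr \<eta> * a) * ennreal ((2 powr (\<eta> - 1)) ^ i)"
        using a by (simp add: ennreal_mult')
    qed auto
    also have "\<dots> = ennreal ((2 * s) powr \<eta> * a) * ennreal (1 / (1 - 2 powr (\<eta> - 1)))"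
      by (subst ennreal_suminf_cmult, subst ennreal_geometric) (use q in auto)
    also have "ennreal (s powr \<eta>) * ?a + \<dots> = ennreal (s powr \<eta> * a + (2 * s) powr \<eta> * a * (1 / (1 - 2 powr (\<eta> - 1))))"
      using a q s by (simp add: ennreal_mult'[symmetric] ennreal_plus[symmetric] del: ennreal_plus)
    also have "\<dots> \<le> ennreal ((1 + 2 / (1 - 2 powr (\<eta> - 1))) * (a powr (1 - \<eta>) * l powr \<eta>))"
    proof (rule ennreal_leI)
      have "s powr \<eta> * a = a powr (1 - \<eta>) * l powr \<eta>"
        using a l by (simp add: s_def powr_divide powr_diff)
      moreover have "(2 * s) powr \<eta> * a = 2 powr \<eta> * (s powr \<eta> * a)"
        using s by (simp add: powr_mult)
      moreover have "2 powr \<eta> \<le> 2 powr 1" using \<eta> by (intro powr_mono) auto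
      then have "2 powr \<eta> * (1 / (1 - 2 powr (\<eta> - 1))) \<le> 2 * (1 / (1 - 2 powr (\<eta> - 1)))"
        using q by (intro mult_right_mono) auto
      then have "s powr \<eta> * a * (1 + 2 powr \<eta> * (1 / (1 - 2 powr (\<eta> - 1)))) \<le> s powr \<eta> * a * (1 + 2 / (1 - 2 powr (\<eta> - 1)))"
        using a s by (intro mult_left_mono) auto
      ultimately show "s powr \<eta> * a + (2 * s) powr \<eta> * a * (1 / (1 - 2 powr (\<eta> - 1)))
          \<le> (1 + 2 / (1 - 2 powr (\<eta> - 1))) * (a powr (1 - \<eta>) * l powr \<eta>)"
        by (simp add: algebra_simps)
    qed
    also have "\<dots> = ennreal (1 + 2 / (1 - 2 powr (\<eta> - 1))) * (?a epowr (1 - \<eta>) * L epowr \<eta>)"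
      using a l q by (simp add: ennreal_epowr ennreal_mult')
    finally show ?thesis by (auto simp: add_left_mono)
  qed
qed

end

lemma lebesgue_ball_scale:
  "0 \<le> k \<Longrightarrow> 0 \<le> \<rho> \<Longrightarrow> emeasure lebesgue (ball (c::'a::euclidean_space) (k * \<rho>))
    = ennreal (k ^ DIM('a)) * emeasure lebesgue (ball c \<rho>)"
  by (subst (1 2) emeasure_lebesgue_ball_conv_unit_ball)
    (simp_all add: power_mult_distrib ennreal_mult' mult.assoc)

lemma lebesgue_ball_pos: "0 < \<rho> \<Longrightarrow> 0 < emeasure lebesgue (ball (c::'a::euclidean_space) \<rho>)"
  using content_ball_pos[of \<rho> c] by (auto simp: measure_def zero_less_iff_neq_zero emeasure_completion)

lemma lebesgue_ball_finite: "emeasure lebesgue (ball (c::'a::euclidean_space) \<rho>) < top"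
  using emeasure_lborel_ball_finite[of c \<rho>] by (simp add: infinity_ennreal_def emeasure_completion)

interpretation lebesgue: doubling_measure "lebesgue :: 'a::euclidean_space measure" "5 ^ DIM('a)"
proof unfold_locales
  fix c :: 'a and \<rho> :: real assume "0 < \<rho>"
  then show "emeasure lebesgue (ball c (5 * \<rho>)) \<le> ennreal (5 ^ DIM('a)) * emeasure lebesgue (ball c \<rho>)"
    by (subst lebesgue_ball_scale) auto
qed (rule refl lebesgue_ball_pos lebesgue_ball_finite, assumption?)+

subsection \<open>Muckenhoupt weights\<close>

text \<open>The constant is part of the predicate, because weights will be built from functions and
  must satisfy the condition uniformly. Averages are replaced by integrals, which moves all powers
  of the measure of the ball to the right side. Values in \<open>ennreal\<close> allow duals, powers
  and products with maximal functions to be weights again.\<close>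

definition Ap_weight :: "real \<Rightarrow> real \<Rightarrow> ('a::euclidean_space \<Rightarrow> ennreal) \<Rightarrow> bool" where
  "Ap_weight t C W \<longleftrightarrow> W \<in> borel_measurable lebesgue \<and> (AE x in lebesgue. 0 < W x \<and> W x < top) \<and>
    (\<forall>c \<rho>. 0 < \<rho> \<longrightarrow> (\<integral>\<^sup>+x\<in>ball c \<rho>. W x \<partial>lebesgue) < top \<and>
      (\<integral>\<^sup>+x\<in>ball c \<rho>. W x \<partial>lebesgue) * (\<integral>\<^sup>+x\<in>ball c \<rho>. W x epowr (- 1 / (t - 1)) \<partial>lebesgue) epowr (t - 1)
        \<le> ennreal C * emeasure lebesgue (ball c \<rho>) epowr t)"

text \<open>The A_\<infinity> condition with its exponent kept visible. A reverse Hoelder inequality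
  of order \<kappa> provides \<theta> = 1 - 1/\<kappa>, and RH_\<infinity> provides \<theta> =
  1.\<close>

definition Ainf_measure :: "real \<Rightarrow> real \<Rightarrow> 'a::euclidean_space measure \<Rightarrow> bool" where
  "Ainf_measure C \<theta> M \<longleftrightarrow> (\<forall>c \<rho> A. 0 < \<rho> \<longrightarrow> A \<in> sets lebesgue \<longrightarrow> A \<subseteq> ball c \<rho> \<longrightarrow>
     emeasure M A \<le> ennreal C * (emeasure lebesgue A / emeasure lebesgue (ball c \<rho>)) epowr \<theta> * emeasure M (ball c \<rho>))"

lemma Ainf_measureD:
  "Ainf_measure C \<theta> M \<Longrightarrow> 0 < \<rho> \<Longrightarrow> A \<in> sets lebesgue \<Longrightarrow> A \<subseteq> ball c \<rho> \<Longrightarrow>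
     emeasure M A \<le> ennreal C * (emeasure lebesgue A / emeasure lebesgue (ball c \<rho>)) epowr \<theta> * emeasure M (ball c \<rho>)"
  by (auto simp: Ainf_measure_def)

lemma Ap_weight_measurable: "Ap_weight t C W \<Longrightarrow> W \<in> borel_measurable lebesgue"
  and Ap_weight_AE: "Ap_weight t C W \<Longrightarrow> AE x in lebesgue. 0 < W x \<and> W x < top"
  and Ap_weight_finite: "Ap_weight t C W \<Longrightarrow> 0 < \<rho> \<Longrightarrow> (\<integral>\<^sup>+x\<in>ball c \<rho>. W x \<partial>lebesgue) < top"
  and Ap_weight_le: "Ap_weight t C W \<Longrightarrow> 0 < \<rho> \<Longrightarrow>
    (\<integral>\<^sup>+x\<in>ball c \<rho>. W x \<partial>lebesgue) * (\<integral>\<^sup>+x\<in>ball c \<rho>. W x epowr (- 1 / (t - 1)) \<partial>lebesgue) epowr (t - 1)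
        \<le> ennreal C * emeasure lebesgue (ball c \<rho>) epowr t"
  by (auto simp: Ap_weight_def)

lemma set_nn_integral_pos:
  assumes [measurable]: "f \<in> borel_measurable M" "A \<in> sets M" and "AE x in M. 0 < f x" "0 < emeasure M A"
  shows "0 < (\<integral>\<^sup>+x\<in>A. f x \<partial>M)"
proof (rule ccontr)
  assume "\<not> ?thesis"
  then have "AE x in M. f x * indicator A x = 0"
    by (subst nn_integral_0_iff_AE[symmetric]) auto
  with assms(3) have "AE x in M. x \<notin> A"
    by eventually_elim (auto split: split_indicator_asm)
  then have "emeasure M A = 0"
    using AE_iff_measurable[of A M "\<lambda>x. x \<notin> A"] sets.sets_into_space[OF assms(2)] by auto
  with assms show False by simp
qed

lemma ennreal_mult_right_cancel_le:
  assumes "0 < z" "z < top" "x * z \<le> c * y * z" shows "x \<le> c * (y::ennreal)"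
  using assms ennreal_mult_le_mult_iff[of z x "c * y"] by (simp add: ac_simps less_top zero_less_iff_neq_zero)

text \<open>Hoelder's inequality for the product of W to the powers 1/t and -1/t. It bounds from
  below the expression that the A_t condition bounds from above, and does so on every measurable
  set.\<close>

lemma measure_le_Ap:
  assumes W [measurable]: "W \<in> borel_measurable (lebesgue :: 'a::euclidean_space measure)"
    and pos: "AE x in lebesgue. 0 < W x \<and> W x < top"
    and t: "1 < t" and [measurable]: "A \<in> sets lebesgue"
  shows "emeasure lebesgue A epowr t
    \<le> (\<integral>\<^sup>+x\<in>A. W x \<partial>lebesgue) * (\<integral>\<^sup>+x\<in>A. W x epowr (- 1 / (t - 1)) \<partial>lebesgue) epowr (t - 1)"
proof -
  have "emeasure lebesgue A = (\<integral>\<^sup>+x. indicator A x \<partial>lebesgue)" by simp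
  also have "\<dots> = (\<integral>\<^sup>+x\<in>A. W x epowr (1/t) * (W x epowr (- 1 / (t - 1))) epowr (1 - 1/t) \<partial>lebesgue)"
  proof (rule nn_integral_cong_AE, use pos in eventually_elim)
    fix x assume x: "0 < W x \<and> W x < top"
    have "- 1 / (t - 1) * (1 - 1/t) = - (1/t)" using t by (simp add: field_simps)
    then have "W x epowr (1/t) * (W x epowr (- 1 / (t - 1))) epowr (1 - 1/t) = W x epowr (1/t + - (1/t))"
      unfolding epowr_epowr using x by (subst epowr_add_finite) auto
    then show "indicator A x = W x epowr (1/t) * (W x epowr (- 1 / (t - 1))) epowr (1 - 1/t) * indicator A x"
      by simp
  qed
  also have "\<dots> \<le> (\<integral>\<^sup>+x\<in>A. W x \<partial>lebesgue) epowr (1/t) * (\<integral>\<^sup>+x\<in>A. W x epowr (- 1 / (t - 1)) \<partial>lebesgue) epowr (1 - 1/t)"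
    by (rule set_nn_integral_Hoelder) (use t in auto)
  finally have "emeasure lebesgue A epowr t \<le> \<dots> epowr t"
    using t by (intro epowr_mono) auto
  also have "\<dots> = (\<integral>\<^sup>+x\<in>A. W x \<partial>lebesgue) * (\<integral>\<^sup>+x\<in>A. W x epowr (- 1 / (t - 1)) \<partial>lebesgue) epowr (t - 1)"
    using t by (subst epowr_mult) (auto simp: epowr_epowr left_diff_distrib)
  finally show ?thesis .
qed

lemma Ap_weight_dual_finite:
  assumes W: "Ap_weight t C W" and t: "1 < t" and \<rho>: "0 < \<rho>"
  shows "(\<integral>\<^sup>+x\<in>ball c \<rho>. W x epowr (- 1 / (t - 1)) \<partial>lebesgue) < top"
proof -
  note [measurable] = Ap_weight_measurable[OF W]
  have "0 < (\<integral>\<^sup>+x\<in>ball c \<rho>. W x \<partial>lebesgue)"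
    by (rule set_nn_integral_pos) (use Ap_weight_AE[OF W] lebesgue_ball_pos[OF \<rho>, of c] in auto)
  moreover have "ennreal C * emeasure lebesgue (ball c \<rho>) epowr t < top"
    using lebesgue_ball_finite[of c \<rho>] t by (intro ennreal_mult_less_top[THEN iffD2]) (auto intro: epowr_less_top)
  then have "(\<integral>\<^sup>+x\<in>ball c \<rho>. W x \<partial>lebesgue) * (\<integral>\<^sup>+x\<in>ball c \<rho>. W x epowr (- 1 / (t - 1)) \<partial>lebesgue) epowr (t - 1) < top"
    using Ap_weight_le[OF W \<rho>] by (rule le_less_trans[rotated])
  ultimately show ?thesis
    using t by (auto simp: ennreal_mult_less_top less_top[symmetric])
qed

text \<open>Raising the A_t condition to the power 1/(t - 1) exchanges the two integrals; this is
  the origin of the new constant.\<close>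

lemma Ap_weight_dual:
  assumes W: "Ap_weight t C (W :: 'a::euclidean_space \<Rightarrow> ennreal)" and t: "1 < t"
  shows "Ap_weight (t / (t - 1)) (C powr (1 / (t - 1))) (\<lambda>x. W x epowr (- 1 / (t - 1)))"
  unfolding Ap_weight_def
proof (intro conjI allI impI)
  note [measurable] = Ap_weight_measurable[OF W]
  show "(\<lambda>x. W x epowr (- 1 / (t - 1))) \<in> borel_measurable lebesgue" by measurable
  show "AE x in lebesgue. 0 < W x epowr (- 1 / (t - 1)) \<and> W x epowr (- 1 / (t - 1)) < top"
    using Ap_weight_AE[OF W] by eventually_elim (auto intro: epowr_pos epowr_finite)
  fix c :: 'a and \<rho> :: real assume \<rho>: "0 < \<rho>"
  show "(\<integral>\<^sup>+x\<in>ball c \<rho>. W x epowr (- 1 / (t - 1)) \<partial>lebesgue) < top"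
    by (rule Ap_weight_dual_finite[OF W t \<rho>])
  let ?w = "(\<integral>\<^sup>+x\<in>ball c \<rho>. W x \<partial>lebesgue)" and ?s = "(\<integral>\<^sup>+x\<in>ball c \<rho>. W x epowr (- 1 / (t - 1)) \<partial>lebesgue)"
  have e: "t / (t - 1) - 1 = 1 / (t - 1)" using t by (simp add: field_simps)
  have "- 1 / (t - 1) * (- 1 / (t / (t - 1) - 1)) = 1" unfolding e using t by (simp add: field_simps)
  then have "?s * (\<integral>\<^sup>+x\<in>ball c \<rho>. (W x epowr (- 1 / (t - 1))) epowr (- 1 / (t / (t - 1) - 1)) \<partial>lebesgue) epowr (t / (t - 1) - 1)
     = (?w * ?s epowr (t - 1)) epowr (1 / (t - 1))"
    unfolding epowr_epowr using t by (simp add: e epowr_mult epowr_epowr mult.commute)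
  also have "\<dots> \<le> (ennreal C * emeasure lebesgue (ball c \<rho>) epowr t) epowr (1 / (t - 1))"
    using Ap_weight_le[OF W \<rho>] t by (intro epowr_mono) auto
  also have "\<dots> = ennreal C epowr (1 / (t - 1)) * emeasure lebesgue (ball c \<rho>) epowr (t / (t - 1))"
    using t by (simp add: epowr_mult epowr_epowr)
  also have "ennreal C epowr (1 / (t - 1)) \<le> ennreal (C powr (1 / (t - 1)))"
    using t by (cases "0 < C") (auto simp: ennreal_epowr ennreal_neg)
  finally show "?s * (\<integral>\<^sup>+x\<in>ball c \<rho>. (W x epowr (- 1 / (t - 1))) epowr (- 1 / (t / (t - 1) - 1)) \<partial>lebesgue) epowr (t / (t - 1) - 1)
     \<le> ennreal (C powr (1 / (t - 1))) * emeasure lebesgue (ball c \<rho>) epowr (t / (t - 1))"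
    by (auto simp: mult_right_mono)
qed

text \<open>\<open>measure_le_Ap\<close> on A is played against the A_t condition on the ball: a set
  filling a fixed portion of a ball carries a fixed portion of its weight. Applied to concentric
  balls this is the doubling property.\<close>

lemma Ap_weight_compare:
  assumes W: "Ap_weight t C W" and t: "1 < t" and \<rho>: "0 < \<rho>"
    and [measurable]: "A \<in> sets lebesgue" and A: "A \<subseteq> ball c \<rho>"
  shows "emeasure lebesgue A epowr t * (\<integral>\<^sup>+x\<in>ball c \<rho>. W x \<partial>lebesgue)
    \<le> ennreal C * emeasure lebesgue (ball c \<rho>) epowr t * (\<integral>\<^sup>+x\<in>A. W x \<partial>lebesgue)"
proof -
  note [measurable] = Ap_weight_measurable[OF W]
  let ?s = "\<lambda>A. (\<integral>\<^sup>+x\<in>A. W x epowr (- 1 / (t - 1)) \<partial>lebesgue)"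
  have "emeasure lebesgue A epowr t \<le> (\<integral>\<^sup>+x\<in>A. W x \<partial>lebesgue) * ?s A epowr (t - 1)"
    by (rule measure_le_Ap) (use Ap_weight_AE[OF W] t in auto)
  also have "\<dots> \<le> (\<integral>\<^sup>+x\<in>A. W x \<partial>lebesgue) * ?s (ball c \<rho>) epowr (t - 1)"
    using A t by (intro mult_left_mono epowr_mono nn_integral_mono) (auto split: split_indicator)
  finally have *: "emeasure lebesgue A epowr t \<le> (\<integral>\<^sup>+x\<in>A. W x \<partial>lebesgue) * ?s (ball c \<rho>) epowr (t - 1)" .
  have "emeasure lebesgue A epowr t * (\<integral>\<^sup>+x\<in>ball c \<rho>. W x \<partial>lebesgue)
    \<le> (\<integral>\<^sup>+x\<in>A. W x \<partial>lebesgue) * ((\<integral>\<^sup>+x\<in>ball c \<rho>. W x \<partial>lebesgue) * ?s (ball c \<rho>) epowr (t - 1))"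
    using mult_right_mono[OF *, of "\<integral>\<^sup>+x\<in>ball c \<rho>. W x \<partial>lebesgue"] by (simp add: ac_simps)
  also have "\<dots> \<le> (\<integral>\<^sup>+x\<in>A. W x \<partial>lebesgue) * (ennreal C * emeasure lebesgue (ball c \<rho>) epowr t)"
    by (intro mult_left_mono Ap_weight_le[OF W \<rho>]) auto
  finally show ?thesis by (simp add: ac_simps)
qed

lemma Ap_weight_const_ge_1:
  assumes W: "Ap_weight t C (W :: 'a::euclidean_space \<Rightarrow> ennreal)" and t: "1 < t"
  shows "1 \<le> C"
proof -
  note [measurable] = Ap_weight_measurable[OF W]
  let ?B = "ball (0::'a) 1"
  have "emeasure lebesgue ?B epowr t \<le> (\<integral>\<^sup>+x\<in>?B. W x \<partial>lebesgue) * (\<integral>\<^sup>+x\<in>?B. W x epowr (- 1 / (t - 1)) \<partial>lebesgue) epowr (t - 1)"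
    by (rule measure_le_Ap) (use Ap_weight_AE[OF W] t in auto)
  also have "\<dots> \<le> ennreal C * emeasure lebesgue ?B epowr t"
    by (rule Ap_weight_le[OF W]) simp
  finally have "1 * emeasure lebesgue ?B epowr t \<le> ennreal C * 1 * emeasure lebesgue ?B epowr t"
    by simp
  then have "1 \<le> ennreal C * 1"
    by (rule ennreal_mult_right_cancel_le[rotated 2]) (auto intro!: epowr_pos epowr_finite lebesgue_ball_pos lebesgue_ball_finite)
  then show ?thesis by (simp add: ennreal_ge_1)
qed

text \<open>The type argument only transports the dimension.\<close>

definition Ap_doubling :: "'a::euclidean_space itself \<Rightarrow> real \<Rightarrow> real \<Rightarrow> real" where
  "Ap_doubling _ t C = C * (5 ^ DIM('a)) powr t"

lemma Ap_weight_doubling: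
  assumes W: "Ap_weight t C (W :: 'a::euclidean_space \<Rightarrow> ennreal)" and t: "1 < t"
  shows "doubling_measure (density lebesgue W) (Ap_doubling TYPE('a) t C)"
proof
  note [measurable] = Ap_weight_measurable[OF W]
  have W_eq: "emeasure (density lebesgue W) (ball c \<rho>) = (\<integral>\<^sup>+x\<in>ball c \<rho>. W x \<partial>lebesgue)" for c \<rho>
    by (subst emeasure_density) auto
  show "sets (density lebesgue W) = sets lebesgue" by simp
  show "0 < emeasure (density lebesgue W) (ball c \<rho>)" if "0 < \<rho>" for c \<rho>
    unfolding W_eq
    by (rule set_nn_integral_pos) (use that Ap_weight_AE[OF W] lebesgue_ball_pos[of \<rho> c] in auto)
  show "emeasure (density lebesgue W) (ball c \<rho>) < top" for c \<rho>
    using Ap_weight_finite[OF W, of \<rho> c] by (cases "0 < \<rho>") (simp_all add: W_eq ball_empty)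
  fix c :: 'a and \<rho> :: real assume \<rho>: "0 < \<rho>"
  let ?b = "emeasure lebesgue (ball c \<rho>) epowr t"
  have "?b * (\<integral>\<^sup>+x\<in>ball c (5 * \<rho>). W x \<partial>lebesgue)
    \<le> ennreal C * emeasure lebesgue (ball c (5 * \<rho>)) epowr t * (\<integral>\<^sup>+x\<in>ball c \<rho>. W x \<partial>lebesgue)"
    by (rule Ap_weight_compare[OF W t]) (use \<rho> in \<open>auto intro!: subset_ball\<close>)
  also have "emeasure lebesgue (ball c (5 * \<rho>)) epowr t = ennreal ((5 ^ DIM('a)) powr t) * ?b"
    using \<rho> t by (subst lebesgue_ball_scale) (auto simp: epowr_mult ennreal_epowr)
  also have "ennreal C * (ennreal ((5 ^ DIM('a)) powr t) * ?b) = ennreal (Ap_doubling TYPE('a) t C) * ?b"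
    using Ap_weight_const_ge_1[OF W t] by (simp add: Ap_doubling_def ennreal_mult' mult.assoc)
  finally have "(\<integral>\<^sup>+x\<in>ball c (5 * \<rho>). W x \<partial>lebesgue) * ?b
    \<le> ennreal (Ap_doubling TYPE('a) t C) * (\<integral>\<^sup>+x\<in>ball c \<rho>. W x \<partial>lebesgue) * ?b"
    by (simp add: ac_simps)
  then have "(\<integral>\<^sup>+x\<in>ball c (5 * \<rho>). W x \<partial>lebesgue) \<le> ennreal (Ap_doubling TYPE('a) t C) * (\<integral>\<^sup>+x\<in>ball c \<rho>. W x \<partial>lebesgue)"
    by (rule ennreal_mult_right_cancel_le[rotated 2])
      (use \<rho> in \<open>auto intro!: epowr_pos epowr_finite lebesgue_ball_pos lebesgue_ball_finite\<close>)
  then show "emeasure (density lebesgue W) (ball c (5 * \<rho>)) \<le> ennreal (Ap_doubling TYPE('a) t C) * emeasure (density lebesgue W) (ball c \<rho>)"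
    unfolding W_eq .
qed

text \<open>The exponent \<kappa>(t - 1) + 1 is the one for which the dual power of W^\<kappa> is
  again W^(-1/(t - 1)). Only the integral of W itself has to be compared with that of W^\<kappa>,
  which is Jensen's inequality.\<close>

lemma Ap_weight_epowr_imp:
  assumes W: "Ap_weight (\<kappa> * (t - 1) + 1) C (\<lambda>x. W x epowr \<kappa>)" and [measurable]: "W \<in> borel_measurable (lebesgue :: 'a::euclidean_space measure)"
    and t: "1 < t" and \<kappa>: "1 < \<kappa>"
  shows "Ap_weight t (C powr (1 / \<kappa>)) W"
  unfolding Ap_weight_def
proof (intro conjI allI impI)
  show "W \<in> borel_measurable lebesgue" by fact
  show "AE x in lebesgue. 0 < W x \<and> W x < top"
    using Ap_weight_AE[OF W] by eventually_elim (use \<kappa> in \<open>auto simp: less_top[symmetric] zero_less_iff_neq_zero\<close>)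
  fix c :: 'a and \<rho> :: real assume \<rho>: "0 < \<rho>"
  let ?B = "ball c \<rho>"
  let ?b = "emeasure lebesgue ?B" and ?k = "\<integral>\<^sup>+x\<in>?B. W x epowr \<kappa> \<partial>lebesgue" and ?w = "\<integral>\<^sup>+x\<in>?B. W x \<partial>lebesgue"
    and ?s = "\<integral>\<^sup>+x\<in>?B. W x epowr (- 1 / (t - 1)) \<partial>lebesgue"
  have b: "0 < ?b" "?b < top" using \<rho> by (auto intro: lebesgue_ball_pos lebesgue_ball_finite)
  have "?w = (\<integral>\<^sup>+x\<in>?B. (W x epowr \<kappa>) epowr (1 / \<kappa>) * 1 epowr (1 - 1 / \<kappa>) \<partial>lebesgue)"
    using \<kappa> by (simp add: epowr_epowr)
  also have "\<dots> \<le> ?k epowr (1 / \<kappa>) * (\<integral>\<^sup>+x\<in>?B. 1 \<partial>lebesgue) epowr (1 - 1 / \<kappa>)"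
    by (rule set_nn_integral_Hoelder) (use \<kappa> in auto)
  finally have w: "?w \<le> ?k epowr (1 / \<kappa>) * ?b epowr (1 - 1 / \<kappa>)" by (simp del: emeasure_completion)
  also have "\<dots> < top"
    using Ap_weight_finite[OF W \<rho>, of c] \<kappa> b by (auto simp: ennreal_mult_less_top intro!: epowr_less_top)
  finally show "?w < top" .
  have e: "\<kappa> * (- 1 / (\<kappa> * (t - 1) + 1 - 1)) = - 1 / (t - 1)" using \<kappa> t by (simp add: field_simps)
  have "?w * ?s epowr (t - 1) \<le> ?k epowr (1 / \<kappa>) * ?b epowr (1 - 1 / \<kappa>) * ?s epowr (t - 1)"
    by (intro mult_right_mono w) auto
  also have "\<dots> = (?k * ?s epowr (\<kappa> * (t - 1))) epowr (1 / \<kappa>) * ?b epowr (1 - 1 / \<kappa>)"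
    using \<kappa> t by (simp add: epowr_mult epowr_epowr ac_simps)
  also have "\<dots> \<le> (ennreal C * ?b epowr (\<kappa> * (t - 1) + 1)) epowr (1 / \<kappa>) * ?b epowr (1 - 1 / \<kappa>)"
    using Ap_weight_le[OF W \<rho>, of c] \<kappa> unfolding epowr_epowr e
    by (intro mult_right_mono epowr_mono) auto
  also have "\<dots> = ennreal C epowr (1 / \<kappa>) * ?b epowr ((\<kappa> * (t - 1) + 1) / \<kappa> + (1 - 1 / \<kappa>))"
    using \<kappa> by (subst epowr_add_finite[OF b]) (simp add: epowr_mult epowr_epowr mult.assoc)
  also have "(\<kappa> * (t - 1) + 1) / \<kappa> + (1 - 1 / \<kappa>) = t" using \<kappa> by (simp add: field_simps)
  also have "ennreal C epowr (1 / \<kappa>) \<le> ennreal (C powr (1 / \<kappa>))"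
    using \<kappa> by (cases "0 < C") (auto simp: ennreal_epowr ennreal_neg)
  finally show "?w * ?s epowr (t - 1) \<le> ennreal (C powr (1 / \<kappa>)) * ?b epowr t"
    by (auto simp: mult_right_mono)
qed

text \<open>Hoelder's inequality on A passes to the integral of W^\<kappa> and gains the power 1 -
  1/\<kappa> of the measure of A. To return to W on the ball, the condition for W^\<kappa> and the
  lower bound \<open>measure_le_Ap\<close> for W are combined; both contain the same dual integral
  \<open>?s\<close>, which cancels.\<close>

lemma Ap_weight_epowr_Ainf:
  assumes W: "Ap_weight (\<kappa> * (t - 1) + 1) C (\<lambda>x. W x epowr \<kappa>)" and [measurable]: "W \<in> borel_measurable (lebesgue :: 'a::euclidean_space measure)"
    and t: "1 < t" and \<kappa>: "1 < \<kappa>"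
  shows "Ainf_measure (C powr (1 / \<kappa>)) (1 - 1 / \<kappa>) (density lebesgue W)"
  unfolding Ainf_measure_def
proof (intro allI impI)
  fix c :: 'a and \<rho> :: real and A :: "'a set"
  assume \<rho>: "0 < \<rho>" and [measurable]: "A \<in> sets lebesgue" and A: "A \<subseteq> ball c \<rho>"
  let ?B = "ball c \<rho>"
  let ?b = "emeasure lebesgue ?B" and ?k = "\<integral>\<^sup>+x\<in>?B. W x epowr \<kappa> \<partial>lebesgue" and ?w = "\<integral>\<^sup>+x\<in>?B. W x \<partial>lebesgue"
    and ?s = "\<integral>\<^sup>+x\<in>?B. W x epowr (- 1 / (t - 1)) \<partial>lebesgue"
  have b: "0 < ?b" "?b < top" using \<rho> by (auto intro: lebesgue_ball_pos lebesgue_ball_finite)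
  have AW: "Ap_weight t (C powr (1 / \<kappa>)) W" by (rule Ap_weight_epowr_imp) fact+
  have e: "\<kappa> * (- 1 / (\<kappa> * (t - 1) + 1 - 1)) = - 1 / (t - 1)" using \<kappa> t by (simp add: field_simps)
  have s: "?s < top" by (rule Ap_weight_dual_finite[OF AW t \<rho>])
  have s0: "0 < ?s"
    by (rule set_nn_integral_pos)
      (use b in \<open>auto intro: eventually_mono[OF Ap_weight_AE[OF AW]] epowr_pos\<close>)
  have "(\<integral>\<^sup>+x\<in>A. W x \<partial>lebesgue) = (\<integral>\<^sup>+x\<in>A. (W x epowr \<kappa>) epowr (1 / \<kappa>) * 1 epowr (1 - 1 / \<kappa>) \<partial>lebesgue)"
    using \<kappa> by (simp add: epowr_epowr)
  also have "\<dots> \<le> (\<integral>\<^sup>+x\<in>A. W x epowr \<kappa> \<partial>lebesgue) epowr (1 / \<kappa>) * (\<integral>\<^sup>+x\<in>A. 1 \<partial>lebesgue) epowr (1 - 1 / \<kappa>)"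
    by (rule set_nn_integral_Hoelder) (use \<kappa> in auto)
  also have "\<dots> \<le> ?k epowr (1 / \<kappa>) * emeasure lebesgue A epowr (1 - 1 / \<kappa>)"
    using A \<kappa> by (intro mult_mono epowr_mono nn_integral_mono) (auto split: split_indicator)
  finally have 1: "(\<integral>\<^sup>+x\<in>A. W x \<partial>lebesgue) \<le> ?k epowr (1 / \<kappa>) * emeasure lebesgue A epowr (1 - 1 / \<kappa>)" .
  have "?k epowr (1 / \<kappa>) * ?s epowr (t - 1) = (?k * ?s epowr (\<kappa> * (t - 1))) epowr (1 / \<kappa>)"
    using \<kappa> t by (simp add: epowr_mult epowr_epowr ac_simps)
  also have "\<dots> \<le> (ennreal C * ?b epowr (\<kappa> * (t - 1) + 1)) epowr (1 / \<kappa>)"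
    using Ap_weight_le[OF W \<rho>, of c] \<kappa> unfolding epowr_epowr e
    by (intro epowr_mono) auto
  also have "\<dots> = ennreal C epowr (1 / \<kappa>) * ?b epowr (t + (1 / \<kappa> - 1))"
    using \<kappa> by (simp add: epowr_mult epowr_epowr field_simps)
  also have "\<dots> = ennreal C epowr (1 / \<kappa>) * ?b epowr (1 / \<kappa> - 1) * ?b epowr t"
    unfolding epowr_add_finite[OF b] by (simp add: ac_simps)
  also have "\<dots> \<le> ennreal C epowr (1 / \<kappa>) * ?b epowr (1 / \<kappa> - 1) * (?w * ?s epowr (t - 1))"
    by (intro mult_left_mono measure_le_Ap) (use Ap_weight_AE[OF AW] t in auto)
  finally have "?k epowr (1 / \<kappa>) * ?s epowr (t - 1) \<le> (ennreal C epowr (1 / \<kappa>) * ?b epowr (1 / \<kappa> - 1)) * ?w * ?s epowr (t - 1)"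
    by (simp add: ac_simps)
  then have 2: "?k epowr (1 / \<kappa>) \<le> (ennreal C epowr (1 / \<kappa>) * ?b epowr (1 / \<kappa> - 1)) * ?w"
    by (rule ennreal_mult_right_cancel_le[rotated 2]) (use s s0 in \<open>auto intro: epowr_pos epowr_finite\<close>)
  have 3: "?b epowr (1 / \<kappa> - 1) = inverse (?b epowr (1 - 1 / \<kappa>))"
    using epowr_minus[of ?b "1 - 1/\<kappa>"] by simp
  have "(\<integral>\<^sup>+x\<in>A. W x \<partial>lebesgue)
    \<le> (ennreal C epowr (1 / \<kappa>) * ?b epowr (1 / \<kappa> - 1)) * ?w * emeasure lebesgue A epowr (1 - 1 / \<kappa>)"
    by (rule order_trans[OF 1 mult_right_mono[OF 2]]) simp
  also have "\<dots> = ennreal C epowr (1 / \<kappa>) * (emeasure lebesgue A / ?b) epowr (1 - 1 / \<kappa>) * ?w"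
    unfolding 3 using \<kappa> by (simp add: divide_ennreal_def epowr_mult inverse_epowr ac_simps)
  also have "\<dots> \<le> ennreal (C powr (1 / \<kappa>)) * (emeasure lebesgue A / ?b) epowr (1 - 1 / \<kappa>) * ?w"
    using \<kappa> by (intro mult_right_mono) (cases "0 < C"; auto simp: ennreal_epowr ennreal_neg)+
  finally show "emeasure (density lebesgue W) A
      \<le> ennreal (C powr (1 / \<kappa>)) * (emeasure lebesgue A / ?b) epowr (1 - 1 / \<kappa>) * emeasure (density lebesgue W) ?B"
    by (simp add: emeasure_density)
qed

text \<open>The converse passage: the dual integral is common to the conditions for W and for
  W^\<kappa>, and the reverse Hoelder inequality replaces the integral of W^\<kappa> by a power of
  that of W.\<close>

lemma Ap_weight_epowr_intro:
  assumes W: "Ap_weight t C (W :: 'a::euclidean_space \<Rightarrow> ennreal)" and t: "1 < t" and \<kappa>: "1 < \<kappa>"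
    and RH: "\<And>c \<rho>. 0 < \<rho> \<Longrightarrow> (\<integral>\<^sup>+x\<in>ball c \<rho>. W x epowr \<kappa> \<partial>lebesgue)
      \<le> ennreal C' * emeasure lebesgue (ball c \<rho>) epowr (1 - \<kappa>) * (\<integral>\<^sup>+x\<in>ball c \<rho>. W x \<partial>lebesgue) epowr \<kappa>"
  shows "Ap_weight (\<kappa> * (t - 1) + 1) (C' * C powr \<kappa>) (\<lambda>x. W x epowr \<kappa>)"
  unfolding Ap_weight_def
proof (intro conjI allI impI)
  note [measurable] = Ap_weight_measurable[OF W]
  show "(\<lambda>x. W x epowr \<kappa>) \<in> borel_measurable lebesgue" by measurable
  show "AE x in lebesgue. 0 < W x epowr \<kappa> \<and> W x epowr \<kappa> < top"
    using Ap_weight_AE[OF W] by eventually_elim (auto intro: epowr_pos epowr_finite)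
  fix c :: 'a and \<rho> :: real assume \<rho>: "0 < \<rho>"
  let ?B = "ball c \<rho>"
  let ?b = "emeasure lebesgue ?B" and ?k = "\<integral>\<^sup>+x\<in>?B. W x epowr \<kappa> \<partial>lebesgue" and ?w = "\<integral>\<^sup>+x\<in>?B. W x \<partial>lebesgue"
    and ?s = "\<integral>\<^sup>+x\<in>?B. W x epowr (- 1 / (t - 1)) \<partial>lebesgue"
  have b: "0 < ?b" "?b < top" using \<rho> by (auto intro: lebesgue_ball_pos lebesgue_ball_finite)
  have C: "1 \<le> C" by (rule Ap_weight_const_ge_1[OF W t])
  show "?k < top"
    by (rule le_less_trans[OF RH[OF \<rho>]])
      (use Ap_weight_finite[OF W \<rho>, of c] epowr_finite[OF b] epowr_less_top[of \<kappa> ?w] \<kappa> in \<open>simp add: ennreal_mult_less_top\<close>)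
  have e: "\<kappa> * (- 1 / (\<kappa> * (t - 1) + 1 - 1)) = - 1 / (t - 1)" using \<kappa> t by (simp add: field_simps)
  have "?k * ?s epowr (\<kappa> * (t - 1)) \<le> ennreal C' * ?b epowr (1 - \<kappa>) * ?w epowr \<kappa> * ?s epowr (\<kappa> * (t - 1))"
    by (intro mult_right_mono RH \<rho>) auto
  also have "\<dots> = ennreal C' * ?b epowr (1 - \<kappa>) * (?w * ?s epowr (t - 1)) epowr \<kappa>"
    using \<kappa> by (simp add: epowr_mult epowr_epowr ac_simps)
  also have "\<dots> \<le> ennreal C' * ?b epowr (1 - \<kappa>) * (ennreal C * ?b epowr t) epowr \<kappa>"
    using \<kappa> by (intro mult_left_mono epowr_mono Ap_weight_le[OF W \<rho>]) auto
  also have "\<dots> = ennreal C' * ennreal (C powr \<kappa>) * (?b epowr (1 - \<kappa>) * ?b epowr (t * \<kappa>))"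
    using \<kappa> C by (simp add: epowr_mult epowr_epowr ennreal_epowr ac_simps)
  also have "?b epowr (1 - \<kappa>) * ?b epowr (t * \<kappa>) = ?b epowr (\<kappa> * (t - 1) + 1)"
    unfolding epowr_add_finite[OF b, symmetric] by (simp add: algebra_simps)
  also have "ennreal C' * ennreal (C powr \<kappa>) = ennreal (C' * C powr \<kappa>)"
    by (simp add: ennreal_mult'')
  finally show "?k * (\<integral>\<^sup>+x\<in>?B. (W x epowr \<kappa>) epowr (- 1 / (\<kappa> * (t - 1) + 1 - 1)) \<partial>lebesgue) epowr (\<kappa> * (t - 1) + 1 - 1)
      \<le> ennreal (C' * C powr \<kappa>) * ?b epowr (\<kappa> * (t - 1) + 1)"
    unfolding epowr_epowr e by simp
qed


section \<open>From A_t to A_\<infinity> and to the reverse Hoelder inequality\<close>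

lemma lebesgue_unit_ball:
  obtains u where "0 < u" "emeasure lebesgue (ball (0::'a::euclidean_space) 1) = ennreal u"
  using lebesgue_ball_pos[of 1 "0::'a"] lebesgue_ball_finite[of "0::'a" 1]
  by (cases "emeasure lebesgue (ball (0::'a) 1)" rule: ennreal_cases_pos) auto

lemma sets_lebesgue_superlevel:
  "f \<in> borel_measurable lebesgue \<Longrightarrow> {x. t < f x} \<in> sets lebesgue" for f :: "_ \<Rightarrow> ennreal"
  using measurable_sets[of f lebesgue borel "{t<..}"] by (simp add: vimage_def)

lemma emeasure_density_indicator:
  "A \<in> sets M \<Longrightarrow> X \<in> sets M \<Longrightarrow> emeasure (density M (indicator A)) X = emeasure M (A \<inter> X)"
  by (simp add: emeasure_density indicator_inter_arith[symmetric])

context doubling_measure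
begin

text \<open>
  For open \<open>A\<close> the balls in which \<open>A\<close> has density about \<open>1/2\<close> form a set whose Lebesgue measure is comparable
  to that of \<open>A\<close>, but of which \<open>A\<close> is only a proper fraction with respect to \<open>M\<close>. Iterating gives
  a power of \<open>|A| / |B|\<close>.
\<close>

lemma half_density_enlargement:
  assumes compare: "\<forall>c \<rho> A. 0 < \<rho> \<longrightarrow> A \<in> sets lebesgue \<longrightarrow> A \<subseteq> ball c \<rho> \<longrightarrow>
      emeasure lebesgue A epowr t * emeasure M (ball c \<rho>) \<le> ennreal C * emeasure lebesgue (ball c \<rho>) epowr t * emeasure M A"
    and t: "1 < t" and C: "1 \<le> C"
    and A: "open A" "A \<noteq> {}" "emeasure lebesgue A < top"
  obtains \<Omega> and r :: "'a \<Rightarrow> real" where "\<Omega> = (\<Union>x\<in>A. ball x (r x))" "\<forall>x\<in>A. 0 < r x"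
    "\<forall>x\<in>A. emeasure lebesgue (ball x (r x)) \<le> ennreal (2 * 2 ^ DIM('a)) * emeasure lebesgue A"
    "emeasure lebesgue \<Omega> \<le> ennreal (2 * 10 ^ DIM('a)) * emeasure lebesgue A"
    "emeasure M \<Omega> \<le> ennreal (K * C * 2 powr t) * emeasure M (\<Omega> - A)"
proof -
  let ?n = "DIM('a)"
  define dense where "dense x \<rho> \<longleftrightarrow> 0 < \<rho> \<and> emeasure lebesgue (ball x \<rho>) \<le> 2 * emeasure lebesgue (A \<inter> ball x \<rho>)" for x \<rho>
  have [measurable]: "A \<in> sets lebesgue" using A by (intro lebesgue.open_sets)
  obtain a where a: "0 < a" "emeasure lebesgue A = ennreal a"
  proof -
    obtain x \<rho> where "0 < \<rho>" "ball x \<rho> \<subseteq> A" using A openE by blast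
    then have "0 < emeasure lebesgue A"
      using lebesgue_ball_pos[of \<rho> x] emeasure_mono[of "ball x \<rho>" A lebesgue] by (auto intro: less_le_trans)
    then show ?thesis using that A(3) by (cases "emeasure lebesgue A" rule: ennreal_cases_pos) auto
  qed
  have bound: "emeasure lebesgue (ball x \<rho>) \<le> 2 * emeasure lebesgue A" if "dense x \<rho>" for x \<rho>
  proof -
    have "emeasure lebesgue (ball x \<rho>) \<le> 2 * emeasure lebesgue (A \<inter> ball x \<rho>)" using that by (simp add: dense_def)
    also have "\<dots> \<le> 2 * emeasure lebesgue A" by (intro mult_left_mono emeasure_mono) auto
    finally show ?thesis .
  qed
  obtain u where u: "0 < u" "emeasure lebesgue (ball (0::'a) 1) = ennreal u"
    by (rule lebesgue_unit_ball)
  have radius: "\<rho> ^ ?n \<le> d" if "0 < \<rho>" "emeasure lebesgue (ball (x::'a) \<rho>) \<le> ennreal (d * u)" "0 < d" for x \<rho> d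
  proof -
    have "ennreal (\<rho> ^ ?n * u) \<le> ennreal (d * u)"
      using that u by (subst (asm) emeasure_lebesgue_ball_conv_unit_ball) (auto simp: ennreal_mult')
    then show ?thesis using u that by (subst (asm) ennreal_le_iff) auto
  qed
  define R where "R = max 1 (2 * a / u)"
  have dense_le: "\<rho> \<le> R" if "dense x \<rho>" for x \<rho>
  proof (rule ccontr)
    assume "\<not> \<rho> \<le> R"
    then have \<rho>: "R < \<rho>" "1 \<le> \<rho>" by (auto simp: R_def)
    have "\<rho> ^ ?n \<le> 2 * a / u"
      using bound[OF that] that a u by (intro radius[of _ x]) (auto simp: dense_def ennreal_mult')
    moreover have "\<rho> ^ 1 \<le> \<rho> ^ ?n" using \<rho> by (intro power_increasing) auto
    ultimately show False using \<rho> by (auto simp: R_def)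
  qed
  have "\<exists>\<rho>. dense x \<rho> \<and> \<not> dense x (2 * \<rho>)" if "x \<in> A" for x
  proof -
    obtain \<rho> where \<rho>: "0 < \<rho>" "ball x \<rho> \<subseteq> A" using A \<open>x \<in> A\<close> openE by blast
    have "dense x \<rho>" using \<rho> by (auto simp: dense_def Int_absorb1 mult_2)
    \<comment> \<open>A dense radius larger than half the supremum has a double that exceeds the
      supremum and is therefore not dense.\<close>
    define s where "s = Sup {\<rho>. dense x \<rho>}"
    have bdd: "bdd_above {\<rho>. dense x \<rho>}" using dense_le by (auto intro!: bdd_aboveI)
    have "0 < s" using cSup_upper[OF _ bdd, of \<rho>] \<open>dense x \<rho>\<close> \<rho> by (auto simp: s_def)
    then have "s / 2 < s" by simp
    then obtain \<rho>' where "dense x \<rho>'" "s / 2 < \<rho>'"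
      unfolding s_def using less_cSup_iff[OF _ bdd] \<open>dense x \<rho>\<close> by (metis (no_types, lifting) empty_iff mem_Collect_eq)
    moreover have "\<not> dense x (2 * \<rho>')"
      using cSup_upper[OF _ bdd, of "2 * \<rho>'"] \<open>s / 2 < \<rho>'\<close> by (auto simp: s_def)
    ultimately show ?thesis by blast
  qed
  then obtain q where q: "\<And>x. x \<in> A \<Longrightarrow> dense x (q x) \<and> \<not> dense x (2 * q x)" by metis
  \<comment> \<open>In the doubled ball A fills less than half. The ball of half this radius is
    dense, so the measure of the doubled ball is still controlled by that of A.\<close>
  define r where "r x = 2 * q x" for x
  define \<Omega> where "\<Omega> = (\<Union>x\<in>A. ball x (r x))"
  have r: "0 < r x" if "x \<in> A" for x using q[OF that] by (simp add: r_def dense_def)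
  have rR: "r x \<le> 2 * R" if "x \<in> A" for x using q[OF that] dense_le by (auto simp: r_def)
  have [measurable]: "\<Omega> \<in> sets lebesgue" "\<Omega> \<in> sets M" unfolding \<Omega>_def by (auto intro!: lebesgue.open_sets open_sets)
  have [measurable]: "A \<in> sets M" using A by (intro open_sets)
  have AO: "A \<subseteq> \<Omega>" using r by (force simp: \<Omega>_def)
  have ball_r: "emeasure lebesgue (ball x (r x)) = ennreal (2 ^ ?n) * emeasure lebesgue (ball x (q x))" if "x \<in> A" for x
    unfolding r_def using q[OF that] by (intro lebesgue_ball_scale) (auto simp: dense_def)
  show thesis
  proof
    show "\<Omega> = (\<Union>x\<in>A. ball x (r x))" by (rule \<Omega>_def)
    show "\<forall>x\<in>A. 0 < r x" using r by blast
    show "\<forall>x\<in>A. emeasure lebesgue (ball x (r x)) \<le> ennreal (2 * 2 ^ ?n) * emeasure lebesgue A"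
    proof
      fix x assume that: "x \<in> A"
      have "emeasure lebesgue (ball x (r x)) \<le> ennreal (2 ^ ?n) * (2 * emeasure lebesgue A)"
        unfolding ball_r[OF that] using q[OF that] by (intro mult_left_mono bound) auto
      also have "\<dots> = ennreal (2 * 2 ^ ?n) * emeasure lebesgue A" by (simp add: ennreal_mult' ac_simps)
      finally show "emeasure lebesgue (ball x (r x)) \<le> ennreal (2 * 2 ^ ?n) * emeasure lebesgue A" .
    qed
    \<comment> \<open>The constant is 5^n * 2^n * 2 in dimension n: covering factor, doubled radius,
      density 1/2.\<close>
    have "emeasure lebesgue \<Omega> \<le> ennreal (2 * 10 ^ ?n) * emeasure (density lebesgue (indicator A)) \<Omega>"
      unfolding \<Omega>_def
    proof (rule vitali_comparison[of _ _ _ _ "2 * R"])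
      fix x assume x: "x \<in> A"
      have "emeasure lebesgue (ball x (5 * r x)) = ennreal (5 ^ ?n) * (ennreal (2 ^ ?n) * emeasure lebesgue (ball x (q x)))"
        using r[OF x] by (subst lebesgue_ball_scale) (auto simp: ball_r[OF x])
      also have "\<dots> \<le> ennreal (5 ^ ?n) * (ennreal (2 ^ ?n) * (2 * emeasure lebesgue (A \<inter> ball x (q x))))"
        using q[OF x] by (intro mult_left_mono) (auto simp: dense_def)
      also have "\<dots> = ennreal (2 * 10 ^ ?n) * emeasure lebesgue (A \<inter> ball x (q x))"
      proof -
        have "(10::real) ^ ?n = 5 ^ ?n * 2 ^ ?n" by (simp add: power_mult_distrib[symmetric])
        then show ?thesis by (simp add: ennreal_mult' ac_simps)
      qed
      also have "\<dots> \<le> ennreal (2 * 10 ^ ?n) * emeasure lebesgue (A \<inter> ball x (r x))"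
        using q[OF x] by (intro mult_left_mono emeasure_mono Int_mono subset_ball) (auto simp: r_def dense_def)
      finally show "emeasure lebesgue (ball x (5 * r x)) \<le> ennreal (2 * 10 ^ ?n) * emeasure (density lebesgue (indicator A)) (ball x (r x))"
        by (subst emeasure_density_indicator) auto
    qed (use r rR in auto)
    also have "emeasure (density lebesgue (indicator A)) \<Omega> = emeasure lebesgue (A \<inter> \<Omega>)"
      by (subst emeasure_density_indicator) auto
    also have "A \<inter> \<Omega> = A" using AO by auto
    finally show "emeasure lebesgue \<Omega> \<le> ennreal (2 * 10 ^ ?n) * emeasure lebesgue A" .
    have [measurable]: "- A \<in> sets M"
      using sets.compl_sets[of A M] by (simp add: space_M Compl_eq_Diff_UNIV)
    have "emeasure M \<Omega> \<le> ennreal (K * C * 2 powr t) * emeasure (density M (indicator (- A))) \<Omega>"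
      unfolding \<Omega>_def
    proof (rule vitali_comparison[of _ _ _ _ "2 * R"])
      fix x assume x: "x \<in> A"
      let ?B = "ball x (r x)"
      let ?b = "emeasure lebesgue ?B"
      have b: "0 < ?b" "?b < top" using r[OF x] by (auto intro: lebesgue_ball_pos lebesgue_ball_finite)
      have "2 * emeasure lebesgue (A \<inter> ?B) \<le> ?b"
        using q[OF x] r[OF x] by (auto simp: dense_def r_def)
      moreover have "?b = emeasure lebesgue (A \<inter> ?B) + emeasure lebesgue (?B - A)"
        by (subst plus_emeasure) (auto intro!: arg_cong[of _ _ "emeasure lebesgue"])
      moreover obtain \<alpha> where \<alpha>: "0 \<le> \<alpha>" "emeasure lebesgue (A \<inter> ?B) = ennreal \<alpha>"
        using b emeasure_mono[of "A \<inter> ?B" ?B lebesgue] by (cases "emeasure lebesgue (A \<inter> ?B)") auto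
      moreover obtain \<beta> where \<beta>: "0 \<le> \<beta>" "emeasure lebesgue (?B - A) = ennreal \<beta>"
        using b emeasure_mono[of "?B - A" ?B lebesgue] by (cases "emeasure lebesgue (?B - A)") auto
      ultimately have "ennreal (2 * \<alpha>) \<le> ennreal (\<alpha> + \<beta>)" "?b = ennreal (\<alpha> + \<beta>)" by (simp_all add: ennreal_mult')
      then have "?b \<le> ennreal (2 * \<beta>)" using \<alpha>(1) \<beta>(1) by (simp del: ennreal_plus)
      then have "?b \<le> 2 * emeasure lebesgue (?B - A)" using \<beta> by (simp add: ennreal_mult')
      then have half: "?b epowr t \<le> 2 epowr t * emeasure lebesgue (?B - A) epowr t"
        using t epowr_mono[of t ?b "2 * emeasure lebesgue (?B - A)"] by (simp add: epowr_mult)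
      have "?b epowr t * emeasure M ?B \<le> 2 epowr t * (emeasure lebesgue (?B - A) epowr t * emeasure M ?B)"
        using mult_right_mono[OF half, of "emeasure M ?B"] by (simp add: mult.assoc)
      also have "\<dots> \<le> 2 epowr t * (ennreal C * ?b epowr t * emeasure M (?B - A))"
        using r[OF x] by (intro mult_left_mono compare[rule_format]) auto
      finally have "emeasure M ?B * ?b epowr t \<le> ennreal (C * 2 powr t) * emeasure M (?B - A) * ?b epowr t"
        using C by (simp add: ennreal_mult' ennreal_epowr_numeral ac_simps)
      then have MB: "emeasure M ?B \<le> ennreal (C * 2 powr t) * emeasure M (?B - A)"
        by (rule ennreal_mult_right_cancel_le[rotated 2]) (use b in \<open>auto intro: epowr_pos epowr_finite\<close>)
      have "emeasure M (ball x (5 * r x)) \<le> ennreal K * emeasure M ?B" by (rule doubling[OF r[OF x]])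
      also have "\<dots> \<le> ennreal K * (ennreal (C * 2 powr t) * emeasure M (?B - A))"
        by (intro mult_left_mono MB) auto
      also have "\<dots> = ennreal (K * C * 2 powr t) * emeasure M (?B - A)"
        using C K_ge_1 by (simp add: ennreal_mult' ac_simps)
      also have "emeasure M (?B - A) = emeasure (density M (indicator (- A))) ?B"
        by (subst emeasure_density_indicator) (auto simp: space_M Int_commute Diff_eq)
      finally show "emeasure M (ball x (5 * r x)) \<le> ennreal (K * C * 2 powr t) * emeasure (density M (indicator (- A))) ?B" .
    qed (use r rR sets_M in auto)
    also have "emeasure (density M (indicator (- A))) \<Omega> = emeasure M (\<Omega> - A)"
      by (subst emeasure_density_indicator) (auto simp: Int_commute Diff_eq)
    finally show "emeasure M \<Omega> \<le> ennreal (K * C * 2 powr t) * emeasure M (\<Omega> - A)" .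
  qed
qed

text \<open>Each step passes from A to the enlargement \<open>\<Omega>\<close> of
  \<open>half_density_enlargement\<close>. Its Lebesgue measure grows at most by the factor 2 *
  10^n, which uses up one power in the hypothesis. With H = K C 2^t, the bound
  M(\<open>\<Omega>\<close>) \<le> H M(\<open>\<Omega> - A\<close>) rearranges to M(A) \<le> (1 -
  1/H) M(\<open>\<Omega>\<close>). The radii of the enlargements are bounded by a geometric
  sequence, so everything stays in a ball of radius less than R + 2\<rho>.\<close>

lemma power_decay:
  assumes compare: "\<forall>c \<rho> A. 0 < \<rho> \<longrightarrow> A \<in> sets lebesgue \<longrightarrow> A \<subseteq> ball c \<rho> \<longrightarrow>
      emeasure lebesgue A epowr t * emeasure M (ball c \<rho>) \<le> ennreal C * emeasure lebesgue (ball c \<rho>) epowr t * emeasure M A"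
    and t: "1 < t" and C: "1 \<le> C"
    and \<rho>: "0 < \<rho>" and "open A" "A \<subseteq> ball c R"
    and "ennreal ((2 * 10 ^ DIM('a)) ^ m) * emeasure lebesgue A \<le> emeasure lebesgue (ball c \<rho>)"
  shows "emeasure M A \<le> ennreal ((1 - 1 / (K * C * 2 powr t)) ^ m) * emeasure M (ball c (R + 2 * \<rho> * (1 - 1 / 2 ^ m)))"
  using assms(5-)
proof (induction m arbitrary: A R)
  case 0
  then show ?case by (auto intro!: emeasure_mono)
next
  case (Suc m)
  let ?n = "DIM('a)" and ?L = "2 * 10 ^ DIM('a) :: real"
  let ?H = "K * C * 2 powr t"
  have H: "1 < ?H"
  proof -
    have "1 * 1 \<le> K * C" using K_ge_1 C by (intro mult_mono) auto
    moreover have "2 powr 1 < 2 powr t" using t by (intro powr_less_mono) auto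
    ultimately have "1 * 1 < (K * C) * 2 powr t" by (intro mult_le_less_imp_less) auto
    then show ?thesis by simp
  qed
  show ?case
  proof (cases "A = {}")
    case False
    have A_fin: "emeasure lebesgue A < top"
      using emeasure_mono[OF Suc.prems(2), of lebesgue] lebesgue_ball_finite[of c R] by (auto intro: le_less_trans)
    obtain \<Omega> r where \<Omega>: "\<Omega> = (\<Union>x\<in>A. ball x (r x))" "\<forall>x\<in>A. 0 < r x"
      "\<forall>x\<in>A. emeasure lebesgue (ball x (r x)) \<le> ennreal (2 * 2 ^ ?n) * emeasure lebesgue A"
      "emeasure lebesgue \<Omega> \<le> ennreal ?L * emeasure lebesgue A"
      "emeasure M \<Omega> \<le> ennreal ?H * emeasure M (\<Omega> - A)"
      by (rule half_density_enlargement[OF compare t C Suc.prems(1) False A_fin]) (rule that)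
    \<comment> \<open>In dimension n the ball of radius r x has measure at most 2 * 2^n |A|, and (2
      * 10^n)^(m+1) |A| is at most the measure of \<open>ball c \<rho>\<close>. Since (2 * 2^n)
      (2^m)^n \<le> (2 * 10^n)^(m+1), the radius is at most \<rho> / 2^m.\<close>
    have rx: "r x \<le> \<rho> / 2 ^ m" if x: "x \<in> A" for x
    proof -
      obtain a where a: "0 \<le> a" "emeasure lebesgue A = ennreal a" using A_fin by (cases "emeasure lebesgue A") auto
      obtain u where u: "0 < u" "emeasure lebesgue (ball (0::'a) 1) = ennreal u"
        by (rule lebesgue_unit_ball)
      have "ennreal (r x ^ ?n * u) \<le> ennreal (2 * 2 ^ ?n * a)"
        using bspec[OF \<Omega>(3) x] bspec[OF \<Omega>(2) x] u a
        by (subst (asm) emeasure_lebesgue_ball_conv_unit_ball) (auto simp: ennreal_mult')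
      then have 1: "r x ^ ?n * u \<le> 2 * 2 ^ ?n * a" using a by (subst (asm) ennreal_le_iff) auto
      have "ennreal (?L ^ Suc m * a) \<le> ennreal (\<rho> ^ ?n * u)"
        using Suc.prems(3) \<rho> u a
        by (subst (asm) emeasure_lebesgue_ball_conv_unit_ball) (auto simp: ennreal_mult'')
      then have 2: "?L ^ Suc m * a \<le> \<rho> ^ ?n * u" using u \<rho> by (subst (asm) ennreal_le_iff) auto
      have "2 * 2 ^ ?n * (2 ^ m) ^ ?n \<le> ?L ^ Suc m"
      proof -
        have "(2::real) ^ ?n \<le> 10 ^ ?n" by (intro power_mono) auto
        then have "(2::real) ^ ?n \<le> ?L" "2 * 2 ^ ?n \<le> ?L" using zero_le_power[of "10::real" ?n] by linarith+
        then have "(2 * 2 ^ ?n) * (2 ^ ?n) ^ m \<le> ?L * ?L ^ m" by (intro mult_mono power_mono) auto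
        then show ?thesis by (simp add: power_mult[symmetric] mult.commute)
      qed
      then have "(r x * 2 ^ m) ^ ?n * u * (2 * 2 ^ ?n) \<le> (r x ^ ?n * u) * ?L ^ Suc m"
        using mult_left_mono[of "2 * 2 ^ ?n * (2 ^ m) ^ ?n" "?L ^ Suc m" "r x ^ ?n * u"] u bspec[OF \<Omega>(2) x]
        by (simp add: power_mult_distrib ac_simps)
      also have "\<dots> \<le> (2 * 2 ^ ?n * a) * ?L ^ Suc m" by (intro mult_right_mono 1) auto
      also have "\<dots> = (2 * 2 ^ ?n) * (?L ^ Suc m * a)" by simp
      also have "\<dots> \<le> (2 * 2 ^ ?n) * (\<rho> ^ ?n * u)" by (intro mult_left_mono 2) auto
      finally have "(r x * 2 ^ m) ^ ?n * (u * (2 * 2 ^ ?n)) \<le> \<rho> ^ ?n * (u * (2 * 2 ^ ?n))" by (simp add: ac_simps)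
      then have "(r x * 2 ^ m) ^ ?n \<le> \<rho> ^ ?n" using u by (subst (asm) mult_le_cancel_right) auto
      then have "r x * 2 ^ m \<le> \<rho>"
        using power_mono_iff[of "r x * 2 ^ m" \<rho> ?n] \<rho> bspec[OF \<Omega>(2) x] by simp
      then show ?thesis by (simp add: field_simps)
    qed
    have op: "open \<Omega>" unfolding \<Omega>(1) by auto
    have AO: "A \<subseteq> \<Omega>" using \<Omega>(2) by (force simp: \<Omega>(1))
    have sub: "\<Omega> \<subseteq> ball c (R + \<rho> / 2 ^ m)"
    proof
      fix y assume "y \<in> \<Omega>"
      then obtain x where x: "x \<in> A" "dist x y < r x" by (auto simp: \<Omega>(1))
      have "dist c y \<le> dist c x + dist x y" by (rule dist_triangle)
      also have "\<dots> < R + \<rho> / 2 ^ m" using x rx[OF x(1)] Suc.prems(2) by (intro add_strict_mono) auto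
      finally show "y \<in> ball c (R + \<rho> / 2 ^ m)" by simp
    qed
    have "ennreal (?L ^ m) * emeasure lebesgue \<Omega> \<le> ennreal (?L ^ m) * (ennreal ?L * emeasure lebesgue A)"
      by (intro mult_left_mono \<Omega>) auto
    also have "\<dots> = ennreal (?L ^ Suc m) * emeasure lebesgue A"
      unfolding mult.assoc[symmetric] by (subst ennreal_mult'[symmetric]) (simp_all add: mult.commute)
    also note Suc.prems(3)
    finally have IH: "emeasure M \<Omega> \<le> ennreal ((1 - 1 / ?H) ^ m) * emeasure M (ball c (R + \<rho> / 2 ^ m + 2 * \<rho> * (1 - 1 / 2 ^ m)))"
      by (intro Suc.IH op sub)
    have [measurable]: "A \<in> sets M" "\<Omega> \<in> sets M" using Suc.prems(1) op by (auto intro: open_sets)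
    have MO: "emeasure M \<Omega> < top"
      using emeasure_mono[OF sub, of M] ball_finite[of c] by (auto intro: le_less_trans)
    have "emeasure M A \<le> ennreal (1 - 1 / ?H) * emeasure M \<Omega>"
    proof -
      obtain a where a: "0 \<le> a" "emeasure M A = ennreal a"
        using MO emeasure_mono[OF AO, of M] by (cases "emeasure M A") auto
      obtain b where b: "0 \<le> b" "emeasure M \<Omega> = ennreal b"
        using MO by (cases "emeasure M \<Omega>") auto
      have "emeasure M (\<Omega> - A) = ennreal b - ennreal a"
        using AO MO a b by (subst emeasure_Diff) auto
      also have "\<dots> = ennreal (b - a)" using a by (simp add: ennreal_minus)
      finally have "ennreal b \<le> ennreal (?H * (b - a))" using \<Omega>(5) b H by (simp add: ennreal_mult')
      moreover have "a \<le> b" using emeasure_mono[OF AO, of M] a b by simp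
      ultimately have "b \<le> ?H * (b - a)" using H by (subst (asm) ennreal_le_iff) auto
      then have "b / ?H \<le> b - a" using H by (simp only: pos_divide_le_eq mult.commute)
      then have "a \<le> (1 - 1 / ?H) * b" unfolding left_diff_distrib by simp
      then show ?thesis using a b H by (simp add: ennreal_mult'[symmetric])
    qed
    also have "\<dots> \<le> ennreal (1 - 1 / ?H) * (ennreal ((1 - 1 / ?H) ^ m) * emeasure M (ball c (R + \<rho> / 2 ^ m + 2 * \<rho> * (1 - 1 / 2 ^ m))))"
      by (intro mult_left_mono IH) auto
    also have "\<dots> = ennreal ((1 - 1 / ?H) ^ Suc m) * emeasure M (ball c (R + \<rho> / 2 ^ m + 2 * \<rho> * (1 - 1 / 2 ^ m)))"
      unfolding mult.assoc[symmetric] using H by (subst ennreal_mult'[symmetric]) simp_all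
    also have "R + \<rho> / 2 ^ m + 2 * \<rho> * (1 - 1 / 2 ^ m) = R + 2 * \<rho> * (1 - 1 / 2 ^ Suc m)"
      by (simp add: field_simps)
    finally show ?thesis .
  qed auto
qed

end

text \<open>If m is the number of enlargements by the factor L that fit into the ball, the decay q^m
  of \<open>power_decay\<close> is a power of the ratio of Lebesgue measures, with the exponent
  determined by L^(-\<theta>) = q.\<close>

lemma Ap_weight_Ainf:
  assumes W: "Ap_weight t C (W :: 'a::euclidean_space \<Rightarrow> ennreal)" and t: "1 < t"
  obtains \<theta> C' where "0 < \<theta>" "\<theta> < 1" "0 < C'" "Ainf_measure C' \<theta> (density lebesgue W)"
proof -
  let ?M = "density lebesgue W"
  define K where "K = Ap_doubling TYPE('a) t C"
  interpret doubling_measure ?M K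
    unfolding K_def by (rule Ap_weight_doubling[OF W t])
  note [measurable] = Ap_weight_measurable[OF W]
  note C = Ap_weight_const_ge_1[OF W t]
  have compare: "\<forall>c \<rho> A. 0 < \<rho> \<longrightarrow> A \<in> sets lebesgue \<longrightarrow> A \<subseteq> ball c \<rho> \<longrightarrow>
      emeasure lebesgue A epowr t * emeasure ?M (ball c \<rho>) \<le> ennreal C * emeasure lebesgue (ball c \<rho>) epowr t * emeasure ?M A"
    using Ap_weight_compare[OF W t] by (auto simp: emeasure_density)
  define H where "H = K * C * 2 powr t"
  have H: "1 < H"
  proof -
    have "1 * 1 \<le> K * C" using K_ge_1 C by (intro mult_mono) auto
    moreover have "2 powr 1 < 2 powr t" using t by (intro powr_less_mono) auto
    ultimately have "1 * 1 < (K * C) * 2 powr t" by (intro mult_le_less_imp_less) auto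
    then show ?thesis by (simp add: H_def)
  qed
  define q where "q = 1 - 1 / H"
  define L :: real where "L = 2 * 10 ^ DIM('a)"
  have q: "0 < q" "q < 1" using H by (auto simp: q_def)
  have L: "1 < L" using one_le_power[of "10::real" "DIM('a)"] unfolding L_def by linarith
  define \<theta>\<^sub>1 where "\<theta>\<^sub>1 = - ln q / ln L"
  have \<theta>\<^sub>1: "0 < \<theta>\<^sub>1" using q L by (auto simp: \<theta>\<^sub>1_def divide_neg_pos)
  have Lq: "L powr - \<theta>\<^sub>1 = q" using L q by (simp add: \<theta>\<^sub>1_def powr_def)
  \<comment> \<open>Kept below 1, since the reverse Hoelder exponent derived from it is bounded by
    1/(1 - \<theta>).\<close>
  define \<theta> where "\<theta> = min \<theta>\<^sub>1 (1/2)"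
  have \<theta>: "0 < \<theta>" "\<theta> < 1" "\<theta> \<le> \<theta>\<^sub>1" using \<theta>\<^sub>1 by (auto simp: \<theta>_def)
  have decay: "emeasure ?M A \<le> ennreal (q ^ m * K) * emeasure ?M (ball c \<rho>)"
    if \<rho>: "0 < \<rho>" and A: "A \<in> sets lebesgue" "A \<subseteq> ball c \<rho>"
      and ab: "0 \<le> a" "emeasure lebesgue A = ennreal a" "emeasure lebesgue (ball c \<rho>) = ennreal b" "L ^ m * a < b"
    for c :: 'a and \<rho> A m a b
  proof -
    \<comment> \<open>\<open>power_decay\<close> concerns open sets. The strict inequality
      \<open>L ^ m * a < b\<close> leaves the margin e for an open set containing A.\<close>
    define e where "e = b / L ^ m - a"
    have e: "0 < e" using ab L by (simp add: e_def field_simps)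
    obtain T where T: "open T" "A \<subseteq> T" "T - A \<in> lmeasurable" "emeasure lebesgue (T - A) < ennreal e"
      using sets_lebesgue_outer_open[OF A(1) e] .
    let ?T = "T \<inter> ball c \<rho>"
    have "emeasure lebesgue ?T \<le> emeasure lebesgue (A \<union> (T - A))"
      using T A by (intro emeasure_mono) auto
    also have "\<dots> \<le> emeasure lebesgue A + emeasure lebesgue (T - A)"
      using T A by (intro emeasure_subadditive) auto
    also have "\<dots> \<le> ennreal a + ennreal e" using T ab by (intro add_mono) auto
    also have "\<dots> = ennreal (b / L ^ m)" using ab e by (simp add: e_def ennreal_plus[symmetric] del: ennreal_plus)
    finally have "ennreal (L ^ m) * emeasure lebesgue ?T \<le> ennreal (L ^ m) * ennreal (b / L ^ m)"
      by (rule mult_left_mono) simp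
    also have "\<dots> = emeasure lebesgue (ball c \<rho>)" using L ab by (simp add: ennreal_mult'[symmetric])
    finally have *: "ennreal (L ^ m) * emeasure lebesgue ?T \<le> emeasure lebesgue (ball c \<rho>)" .
    have "emeasure ?M A \<le> emeasure ?M ?T"
      using T A by (intro emeasure_mono open_sets) auto
    also have "\<dots> \<le> ennreal ((1 - 1 / (K * C * 2 powr t)) ^ m) * emeasure ?M (ball c (\<rho> + 2 * \<rho> * (1 - 1 / 2 ^ m)))"
      using T by (intro power_decay[OF compare t C \<rho>]) (use T *[unfolded L_def] in blast)+
    \<comment> \<open>The enlargements reach radius less than 3\<rho>; one use of doubling returns
      to the original ball.\<close>
    also have "\<dots> \<le> ennreal (q ^ m) * emeasure ?M (ball c (5 * \<rho>))"
      unfolding q_def H_def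
    proof (intro mult_left_mono emeasure_mono subset_ball)
      have "2 * \<rho> * (1 - 1 / 2 ^ m) \<le> 2 * \<rho> * 1" using \<rho> by (intro mult_left_mono) auto
      then show "\<rho> + 2 * \<rho> * (1 - 1 / 2 ^ m) \<le> 5 * \<rho>" using \<rho> by linarith
    qed auto
    also have "\<dots> \<le> ennreal (q ^ m) * (ennreal K * emeasure ?M (ball c \<rho>))"
      by (intro mult_left_mono doubling \<rho>) auto
    also have "\<dots> = ennreal (q ^ m * K) * emeasure ?M (ball c \<rho>)"
      using q by (simp add: ennreal_mult' mult.assoc)
    finally show ?thesis .
  qed
  have Kq: "1 \<le> K / q" using K_ge_1 q by simp
  \<comment> \<open>The division by q pays for the choice of m: |B| \<le> L^(m+1) |A| bounds
    q^(m+1), whereas the decay provides only q^m.\<close>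
  have "Ainf_measure (K / q) \<theta> ?M"
    unfolding Ainf_measure_def
  proof (intro allI impI)
    fix c :: 'a and \<rho> :: real and A :: "'a set"
    assume \<rho>: "0 < \<rho>" and A: "A \<in> sets lebesgue" "A \<subseteq> ball c \<rho>"
    obtain b where b: "0 < b" "emeasure lebesgue (ball c \<rho>) = ennreal b"
      using lebesgue_ball_pos[OF \<rho>, of c] lebesgue_ball_finite[of c \<rho>]
      by (cases "emeasure lebesgue (ball c \<rho>)" rule: ennreal_cases_pos) auto
    have "emeasure lebesgue A \<le> ennreal b" using emeasure_mono[OF A(2), of lebesgue] b by simp
    then obtain a where a: "0 \<le> a" "emeasure lebesgue A = ennreal a" "a \<le> b"
      using b by (cases "emeasure lebesgue A") (auto simp: top_unique)
    have MA: "emeasure ?M A \<le> emeasure ?M (ball c \<rho>)" using A by (intro emeasure_mono) auto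
    show "emeasure ?M A \<le> ennreal (K / q) * (emeasure lebesgue A / emeasure lebesgue (ball c \<rho>)) epowr \<theta> * emeasure ?M (ball c \<rho>)"
    proof -
      consider "a = 0" | "a = b" | "0 < a" "a < b" using a b by fastforce
      then show ?thesis
      proof cases
        case 1
        then have "A \<in> null_sets lebesgue" using A a by auto
        then have "AE x in lebesgue. x \<notin> A" by (rule AE_not_in)
        then have "A \<in> null_sets ?M" using A by (subst null_sets_density_iff) (auto elim!: eventually_mono)
        then show ?thesis by auto
      next
        case 2
        then have "emeasure lebesgue A / emeasure lebesgue (ball c \<rho>) = 1"
          using a b by (simp add: ennreal_div_self)
        moreover have "1 * emeasure ?M (ball c \<rho>) \<le> ennreal (K / q) * emeasure ?M (ball c \<rho>)"
          using Kq by (intro mult_right_mono) (auto simp: ennreal_ge_1)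
        ultimately show ?thesis using MA by (auto intro: order_trans)
      next
        case 3
        obtain k where k: "b / a < L ^ k" using real_arch_pow[OF L] by blast
        define m where "m = (LEAST m. b \<le> L ^ Suc m * a)"
        have "\<exists>m. b \<le> L ^ Suc m * a"
        proof
          have "L ^ k \<le> L ^ Suc k" using L by (intro power_increasing) auto
          then have "L ^ k * a \<le> L ^ Suc k * a" using 3 by (intro mult_right_mono) auto
          moreover have "b < L ^ k * a" using k 3 by (simp add: field_simps)
          ultimately show "b \<le> L ^ Suc k * a" by linarith
        qed
        then have m1: "b \<le> L ^ Suc m * a" unfolding m_def by (rule LeastI_ex)
        have m2: "L ^ m * a < b"
        proof (cases m)
          case (Suc l)
          then have "\<not> b \<le> L ^ Suc l * a" unfolding m_def by (metis lessI not_less_Least)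
          then show ?thesis using Suc by simp
        qed (use 3 in auto)
        have "q ^ Suc m \<le> (a / b) powr \<theta>\<^sub>1"
        proof -
          have "q ^ Suc m = q powr real (Suc m)" using q by (simp only: powr_realpow)
          also have "\<dots> = (L powr - real (Suc m)) powr \<theta>\<^sub>1"
            unfolding Lq[symmetric] powr_powr by (simp add: mult.commute del: of_nat_Suc)
          also have "L powr - real (Suc m) = 1 / L ^ Suc m"
            using L by (simp add: powr_minus powr_realpow divide_inverse del: of_nat_Suc power_Suc)
          also have "(1 / L ^ Suc m) powr \<theta>\<^sub>1 \<le> (a / b) powr \<theta>\<^sub>1"
            using m1 3 b L \<theta>\<^sub>1 by (intro powr_mono2) (auto simp: field_simps)
          finally show ?thesis .
        qed
        also have "\<dots> \<le> (a / b) powr \<theta>"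
          using 3 \<theta> by (intro powr_mono') auto
        finally have "q ^ m \<le> (a / b) powr \<theta> / q"
          using q by (simp add: pos_le_divide_eq mult.commute)
        then have "q ^ m * K \<le> (a / b) powr \<theta> / q * K"
          using K_ge_1 by (intro mult_right_mono) auto
        then have "q ^ m * K \<le> K / q * (a / b) powr \<theta>"
          by (simp add: mult.commute)
        then have "ennreal (q ^ m * K) \<le> ennreal (K / q) * (emeasure lebesgue A / emeasure lebesgue (ball c \<rho>)) epowr \<theta>"
          using a b 3 K_ge_1 q by (simp add: divide_ennreal ennreal_epowr ennreal_mult'[symmetric] ennreal_leI)
        then have "ennreal (q ^ m * K) * emeasure ?M (ball c \<rho>) \<le> ennreal (K / q) * (emeasure lebesgue A / emeasure lebesgue (ball c \<rho>)) epowr \<theta> * emeasure ?M (ball c \<rho>)"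
          by (rule mult_right_mono) simp
        with decay[OF \<rho> A a(1,2) b(2) m2] show ?thesis by (rule order_trans)
      qed
    qed
  qed
  with that[of \<theta> "K / q"] \<theta> Kq show thesis by linarith
qed

text \<open>The A_\<infinity> condition on the superlevel sets of W in a ball places W in weak
  L^(1/(1 - \<theta>)) there, with the correct normalisation; every smaller exponent s then has a
  strong bound by Kolmogorov's inequality.\<close>

lemma Ap_weight_reverse_Hoelder:
  assumes W: "Ap_weight t C (W :: 'a::euclidean_space \<Rightarrow> ennreal)" and t: "1 < t"
  obtains s\<^sub>0 where "1 < s\<^sub>0" "\<And>s. 1 < s \<Longrightarrow> s < s\<^sub>0 \<Longrightarrow>
    \<exists>C'. \<forall>c \<rho>. 0 < \<rho> \<longrightarrow> (\<integral>\<^sup>+x\<in>ball c \<rho>. W x epowr s \<partial>lebesgue)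
      \<le> ennreal C' * emeasure lebesgue (ball c \<rho>) epowr (1 - s) * (\<integral>\<^sup>+x\<in>ball c \<rho>. W x \<partial>lebesgue) epowr s"
proof -
  note [measurable] = Ap_weight_measurable[OF W]
  obtain \<theta> C' where \<theta>: "0 < \<theta>" "\<theta> < 1" and C': "0 < C'" and ainf: "Ainf_measure C' \<theta> (density lebesgue W)"
    by (rule Ap_weight_Ainf[OF W t])
  show thesis
  proof (rule that[of "1 / (1 - \<theta>)"])
    show "1 < 1 / (1 - \<theta>)" using \<theta> by simp
    fix s assume s: "1 < s" "s < 1 / (1 - \<theta>)"
    define \<eta> where "\<eta> = s * (1 - \<theta>)"
    have \<eta>: "0 < \<eta>" "\<eta> < 1" using s \<theta> by (auto simp: \<eta>_def field_simps)
    define c\<^sub>\<eta> where "c\<^sub>\<eta> = 1 + 2 / (1 - 2 powr (\<eta> - 1))"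
    show "\<exists>C'. \<forall>c \<rho>. 0 < \<rho> \<longrightarrow> (\<integral>\<^sup>+x\<in>ball c \<rho>. W x epowr s \<partial>lebesgue)
      \<le> ennreal C' * emeasure lebesgue (ball c \<rho>) epowr (1 - s) * (\<integral>\<^sup>+x\<in>ball c \<rho>. W x \<partial>lebesgue) epowr s"
    proof (intro exI allI impI)
      fix c :: 'a and \<rho> :: real assume \<rho>: "0 < \<rho>"
      let ?B = "ball c \<rho>"
      let ?b = "emeasure lebesgue ?B" and ?w = "\<integral>\<^sup>+x\<in>?B. W x \<partial>lebesgue"
      have b: "0 < ?b" "?b < top" using \<rho> by (auto intro: lebesgue_ball_pos lebesgue_ball_finite)
      \<comment> \<open>The power turns the weak bound of order 1/(1 - \<theta>) for W into a weak
        L^1 bound for X; W^s is X^\<eta>.\<close>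
      define X where "X x = (W x * indicator ?B x) epowr (1 / (1 - \<theta>))" for x
      have [measurable]: "X \<in> borel_measurable lebesgue" unfolding X_def by measurable
      define G where "G = ennreal C' * ?b epowr - \<theta> * ?w"
      have "(\<integral>\<^sup>+x\<in>?B. W x epowr s \<partial>lebesgue) = (\<integral>\<^sup>+x\<in>?B. X x epowr \<eta> \<partial>lebesgue)"
        using \<theta> by (intro nn_integral_cong) (auto simp: X_def epowr_epowr \<eta>_def split: split_indicator)
      also have "\<dots> \<le> ennreal c\<^sub>\<eta> * (?b epowr (1 - \<eta>) * (G epowr (1 / (1 - \<theta>))) epowr \<eta>)"
        unfolding c\<^sub>\<eta>_def
      proof (rule lebesgue.kolmogorov)
        fix u :: ennreal assume u: "0 < u" "u < top"
        let ?E = "{x. u < X x}"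
        have E: "?E = {x\<in>?B. u epowr (1 - \<theta>) < W x}"
        proof -
          have "u < X x \<longleftrightarrow> u epowr (1 - \<theta>) < W x * indicator ?B x" for x
            using epowr_less_iff[of "1 - \<theta>" u "X x"] \<theta> by (simp add: X_def epowr_epowr)
          then show ?thesis by (auto split: split_indicator split_indicator_asm)
        qed
        have [measurable]: "?E \<in> sets lebesgue" by (rule sets_lebesgue_superlevel) measurable
        have Eb: "emeasure lebesgue ?E < top"
          by (rule le_less_trans[OF emeasure_mono b(2)]) (auto simp: E)
        show "u * emeasure lebesgue ?E \<le> G epowr (1 / (1 - \<theta>))"
        proof (cases "emeasure lebesgue ?E = 0")
          case False
          then have E0: "0 < emeasure lebesgue ?E" by (simp add: zero_less_iff_neq_zero)
          \<comment> \<open>Chebyshev's inequality from below and the A_\<infinity> condition from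
            above: the W-mass of E lies between u^(1-\<theta>) |E| and G |E|^\<theta>. Dividing by
            |E|^\<theta> gives the weak bound.\<close>
          have "u epowr (1 - \<theta>) * emeasure lebesgue ?E = (\<integral>\<^sup>+x. u epowr (1 - \<theta>) * indicator ?E x \<partial>lebesgue)"
            by (simp add: nn_integral_cmult_indicator)
          also have "\<dots> \<le> (\<integral>\<^sup>+x\<in>?E. W x \<partial>lebesgue)"
            unfolding E by (intro nn_integral_mono) (auto split: split_indicator)
          also have "\<dots> = emeasure (density lebesgue W) ?E" by (simp add: emeasure_density)
          also have "\<dots> \<le> ennreal C' * (emeasure lebesgue ?E / ?b) epowr \<theta> * emeasure (density lebesgue W) ?B"
            by (rule Ainf_measureD[OF ainf \<rho> \<open>?E \<in> sets lebesgue\<close>]) (auto simp: E)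
          also have "\<dots> = G * emeasure lebesgue ?E epowr \<theta>"
            using \<theta> by (simp add: G_def epowr_minus emeasure_density divide_ennreal_def epowr_mult inverse_epowr ac_simps)
          also have "u epowr (1 - \<theta>) * emeasure lebesgue ?E
            = u epowr (1 - \<theta>) * emeasure lebesgue ?E epowr (1 - \<theta>) * emeasure lebesgue ?E epowr \<theta>"
            using epowr_add[of "1 - \<theta>" \<theta> "emeasure lebesgue ?E"] \<theta> by (simp add: mult.assoc)
          finally have "u epowr (1 - \<theta>) * emeasure lebesgue ?E epowr (1 - \<theta>) * emeasure lebesgue ?E epowr \<theta>
            \<le> G * 1 * emeasure lebesgue ?E epowr \<theta>" by simp
          then have "u epowr (1 - \<theta>) * emeasure lebesgue ?E epowr (1 - \<theta>) \<le> G * 1"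
            by (rule ennreal_mult_right_cancel_le[rotated 2]) (use E0 Eb in \<open>auto intro: epowr_pos epowr_finite\<close>)
          then have "(u * emeasure lebesgue ?E) epowr (1 - \<theta>) \<le> G"
            using \<theta> by (simp add: epowr_mult)
          then show ?thesis using \<theta> by (subst (asm) epowr_le_swap) auto
        qed auto
      qed (use \<eta> b in auto)
      also have "(G epowr (1 / (1 - \<theta>))) epowr \<eta> = ennreal (C' powr s) * ?b epowr (- \<theta> * s) * ?w epowr s"
        using s \<theta> C' by (simp add: epowr_epowr \<eta>_def G_def epowr_mult ennreal_epowr powr_powr)
      also have "ennreal c\<^sub>\<eta> * (?b epowr (1 - \<eta>) * (ennreal (C' powr s) * ?b epowr (- \<theta> * s) * ?w epowr s))
        = ennreal c\<^sub>\<eta> * ennreal (C' powr s) * (?b epowr (1 - \<eta>) * ?b epowr (- \<theta> * s)) * ?w epowr s"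
        by (simp add: ac_simps)
      also have "?b epowr (1 - \<eta>) * ?b epowr (- \<theta> * s) = ?b epowr (1 - s)"
        unfolding epowr_add_finite[OF b, symmetric] by (simp add: \<eta>_def algebra_simps)
      also have "ennreal c\<^sub>\<eta> * ennreal (C' powr s) = ennreal (c\<^sub>\<eta> * C' powr s)"
        by (simp add: ennreal_mult'')
      finally show "(\<integral>\<^sup>+x\<in>?B. W x epowr s \<partial>lebesgue) \<le> ennreal (c\<^sub>\<eta> * C' powr s) * ?b epowr (1 - s) * ?w epowr s" .
    qed
  qed
qed

subsection \<open>Muckenhoupt's theorem and the Rubio de Francia algorithm\<close>

text \<open>
  With \<open>\<sigma> = W powr (-1/(t-1))\<close>, \<open>h = M\<^sub>\<sigma> (f/\<sigma>) powr (t-1) / W\<close>: the \<open>A\<^sub>t\<close> condition bounds \<open>(M f) powr (t-1)\<close> by a multiple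
  of \<open>M\<^sub>W h\<close>, so that only the maximal operators of the doubling measures \<open>W dx\<close> and \<open>\<sigma> dx\<close> occur.
\<close>

lemma maximal_fun_le_weighted_maximal_fun:
  assumes W: "Ap_weight t C (W :: 'a::euclidean_space \<Rightarrow> ennreal)" and t: "1 < t"
    and [measurable]: "f \<in> borel_measurable lebesgue"
  defines "\<sigma> \<equiv> \<lambda>x. W x epowr (- 1 / (t - 1))"
  defines "g \<equiv> \<lambda>x. f x * inverse (\<sigma> x)"
  defines "h \<equiv> \<lambda>x. maximal_fun (density lebesgue \<sigma>) g x epowr (t - 1) * inverse (W x)"
  shows "maximal_fun lebesgue f x \<le> (ennreal C * maximal_fun (density lebesgue W) h x) epowr (1 / (t - 1))"
proof (rule maximal_fun_least)
  note [measurable] = Ap_weight_measurable[OF W]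
  let ?\<mu> = "density lebesgue W" and ?\<nu> = "density lebesgue \<sigma>"
  have [measurable]: "\<sigma> \<in> borel_measurable lebesgue" unfolding \<sigma>_def by measurable
  have [measurable]: "g \<in> borel_measurable lebesgue" unfolding g_def by measurable
  have [measurable]: "maximal_fun ?\<nu> g \<in> borel_measurable lebesgue" by (rule measurable_maximal_fun) simp
  have [measurable]: "h \<in> borel_measurable lebesgue" unfolding h_def by measurable
  interpret \<mu>: doubling_measure ?\<mu> "Ap_doubling TYPE('a) t C" by (rule Ap_weight_doubling[OF W t])
  interpret \<nu>: doubling_measure ?\<nu> "Ap_doubling TYPE('a) (t / (t - 1)) (C powr (1 / (t - 1)))"
    unfolding \<sigma>_def using t by (intro Ap_weight_doubling Ap_weight_dual[OF W t]) (simp add: less_divide_eq)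
  fix c :: 'a and \<rho> :: real assume \<rho>: "0 < \<rho>" and x: "x \<in> ball c \<rho>"
  let ?B = "ball c \<rho>"
  let ?b = "emeasure lebesgue ?B" and ?I = "\<integral>\<^sup>+y\<in>?B. f y \<partial>lebesgue"
  have b: "0 < ?b" "?b < top" using \<rho> by (auto intro: lebesgue_ball_pos lebesgue_ball_finite)
  have \<nu>B: "emeasure ?\<nu> ?B = (\<integral>\<^sup>+y\<in>?B. \<sigma> y \<partial>lebesgue)" and \<mu>B: "emeasure ?\<mu> ?B = (\<integral>\<^sup>+y\<in>?B. W y \<partial>lebesgue)"
    by (auto simp: emeasure_density)
  have I: "?I = (\<integral>\<^sup>+y\<in>?B. g y \<partial>?\<nu>)"
  proof -
    have "(\<integral>\<^sup>+y\<in>?B. g y \<partial>?\<nu>) = (\<integral>\<^sup>+y. \<sigma> y * (g y * indicator ?B y) \<partial>lebesgue)"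
      by (rule nn_integral_density) auto
    also have "\<dots> = ?I"
    proof (rule nn_integral_cong_AE, use Ap_weight_AE[OF W] in eventually_elim)
      fix y assume "0 < W y \<and> W y < top"
      then have "0 < \<sigma> y" "\<sigma> y < top" by (auto simp: \<sigma>_def intro: epowr_pos epowr_finite)
      then have "\<sigma> y * (f y * inverse (\<sigma> y)) = f y"
        using ennreal_mult_div_cancel[of "\<sigma> y" "f y"] by (simp add: divide_ennreal_def)
      then show "\<sigma> y * (g y * indicator ?B y) = f y * indicator ?B y"
        unfolding g_def by (simp add: mult.assoc[symmetric])
    qed
    finally show ?thesis ..
  qed
  have 1: "?I epowr (t - 1) \<le> emeasure ?\<nu> ?B epowr (t - 1) * maximal_fun ?\<nu> g y epowr (t - 1)" if "y \<in> ?B" for y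
  proof -
    have "?I / emeasure ?\<nu> ?B \<le> maximal_fun ?\<nu> g y"
      unfolding I by (rule maximal_fun_upper[OF \<rho> that])
    then have "?I \<le> emeasure ?\<nu> ?B * maximal_fun ?\<nu> g y"
      by (subst (asm) ennreal_divide_le_iff) (use \<nu>.ball_pos[OF \<rho>] \<nu>.ball_finite in auto)
    then have "?I epowr (t - 1) \<le> (emeasure ?\<nu> ?B * maximal_fun ?\<nu> g y) epowr (t - 1)"
      using t by (intro epowr_mono) auto
    then show ?thesis using t by (simp add: epowr_mult)
  qed
  have "?I epowr (t - 1) * ?b = (\<integral>\<^sup>+y\<in>?B. ?I epowr (t - 1) \<partial>lebesgue)"
    by (simp add: nn_integral_cmult_indicator)
  also have "\<dots> \<le> (\<integral>\<^sup>+y\<in>?B. emeasure ?\<nu> ?B epowr (t - 1) * maximal_fun ?\<nu> g y epowr (t - 1) \<partial>lebesgue)"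
    by (intro nn_integral_mono) (auto split: split_indicator intro: 1)
  also have "\<dots> = emeasure ?\<nu> ?B epowr (t - 1) * (\<integral>\<^sup>+y\<in>?B. maximal_fun ?\<nu> g y epowr (t - 1) \<partial>lebesgue)"
    by (simp add: mult.assoc nn_integral_cmult)
  also have "(\<integral>\<^sup>+y\<in>?B. maximal_fun ?\<nu> g y epowr (t - 1) \<partial>lebesgue) = (\<integral>\<^sup>+y\<in>?B. h y \<partial>?\<mu>)"
  proof -
    have "(\<integral>\<^sup>+y\<in>?B. h y \<partial>?\<mu>) = (\<integral>\<^sup>+y. W y * (h y * indicator ?B y) \<partial>lebesgue)"
      by (rule nn_integral_density) auto
    also have "\<dots> = (\<integral>\<^sup>+y\<in>?B. maximal_fun ?\<nu> g y epowr (t - 1) \<partial>lebesgue)"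
    proof (rule nn_integral_cong_AE, use Ap_weight_AE[OF W] in eventually_elim)
      fix y assume "0 < W y \<and> W y < top"
      then have "W y * (z * inverse (W y)) = z" for z
        using ennreal_mult_div_cancel[of "W y" z] by (simp add: divide_ennreal_def)
      then show "W y * (h y * indicator ?B y) = maximal_fun ?\<nu> g y epowr (t - 1) * indicator ?B y"
        unfolding h_def by (simp add: mult.assoc[symmetric])
    qed
    finally show ?thesis ..
  qed
  also have "(\<integral>\<^sup>+y\<in>?B. h y \<partial>?\<mu>) \<le> emeasure ?\<mu> ?B * maximal_fun ?\<mu> h x"
    using maximal_fun_upper[OF \<rho> x, of ?\<mu> h]
    by (subst (asm) ennreal_divide_le_iff) (use \<mu>.ball_pos[OF \<rho>] \<mu>.ball_finite in auto)
  finally have "?I epowr (t - 1) * ?b \<le> emeasure ?\<nu> ?B epowr (t - 1) * (emeasure ?\<mu> ?B * maximal_fun ?\<mu> h x)"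
    by (auto simp: mult_left_mono)
  also have "\<dots> = (emeasure ?\<mu> ?B * emeasure ?\<nu> ?B epowr (t - 1)) * maximal_fun ?\<mu> h x"
    by (simp add: ac_simps)
  also have "\<dots> \<le> (ennreal C * ?b epowr t) * maximal_fun ?\<mu> h x"
    unfolding \<mu>B \<nu>B by (intro mult_right_mono) (use Ap_weight_le[OF W \<rho>, of c] in \<open>simp_all add: \<sigma>_def\<close>)
  also have "?b epowr t = ?b epowr (t - 1) * ?b"
    using epowr_add[of "t - 1" 1 ?b] t by simp
  finally have "?I epowr (t - 1) * ?b \<le> ennreal C * maximal_fun ?\<mu> h x * ?b epowr (t - 1) * ?b"
    by (simp add: ac_simps)
  then have "?I epowr (t - 1) * ?b \<le> (ennreal C * maximal_fun ?\<mu> h x) * ?b epowr (t - 1) * ?b"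
    by (simp add: ac_simps)
  then have "?I epowr (t - 1) \<le> (ennreal C * maximal_fun ?\<mu> h x) * ?b epowr (t - 1)"
    by (rule ennreal_mult_right_cancel_le[OF b])
  then have "?I epowr (t - 1) / ?b epowr (t - 1) \<le> ennreal C * maximal_fun ?\<mu> h x"
    by (subst ennreal_divide_le_iff) (use b in \<open>auto simp: mult.commute intro: epowr_pos epowr_finite\<close>)
  then have "(?I / ?b) epowr (t - 1) \<le> ennreal C * maximal_fun ?\<mu> h x"
    using t by (simp add: epowr_divide)
  then show "?I / ?b \<le> (ennreal C * maximal_fun ?\<mu> h x) epowr (1 / (t - 1))"
    using t by (subst (asm) epowr_le_swap) auto
qed

text \<open>Depends on the dimension, t and C only, so one bound serves all weights with the same
  A_t constant.\<close>

definition muckenhoupt_const :: "'a::euclidean_space itself \<Rightarrow> real \<Rightarrow> real \<Rightarrow> real" where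
  "muckenhoupt_const T t C = C powr (t / (t - 1)) * (doubling_measure.strong_const (Ap_doubling T t C) (t / (t - 1))
     * doubling_measure.strong_const (Ap_doubling T (t / (t - 1)) (C powr (1 / (t - 1)))) t)"

text \<open>With t' = t/(t - 1), the pointwise bound raised to the power t contains the maximal
  function of h for W dx to the power t'. The strong type bound for W dx removes it; h is defined so
  that W h^t' is \<sigma> times the t-th power of the maximal function of f/\<sigma> for \<sigma>
  dx. The strong type bound for \<sigma> dx and the identity \<sigma> (f/\<sigma>)^t = W f^t
  finish.\<close>

theorem muckenhoupt_maximal_theorem:
  assumes W: "Ap_weight t C (W :: 'a::euclidean_space \<Rightarrow> ennreal)" and t: "1 < t"
    and [measurable]: "f \<in> borel_measurable lebesgue"
  shows "(\<integral>\<^sup>+x. W x * maximal_fun lebesgue f x epowr t \<partial>lebesgue)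
    \<le> ennreal (muckenhoupt_const TYPE('a) t C) * (\<integral>\<^sup>+x. W x * f x epowr t \<partial>lebesgue)"
proof -
  note [measurable] = Ap_weight_measurable[OF W]
  define \<sigma> where "\<sigma> = (\<lambda>x. W x epowr (- 1 / (t - 1)))"
  define g where "g = (\<lambda>x. f x * inverse (\<sigma> x))"
  define h where "h = (\<lambda>x. maximal_fun (density lebesgue \<sigma>) g x epowr (t - 1) * inverse (W x))"
  let ?\<mu> = "density lebesgue W" and ?\<nu> = "density lebesgue \<sigma>"
  have [measurable]: "\<sigma> \<in> borel_measurable lebesgue" unfolding \<sigma>_def by measurable
  have [measurable]: "g \<in> borel_measurable lebesgue" unfolding g_def by measurable
  have [measurable]: "maximal_fun ?\<nu> g \<in> borel_measurable lebesgue" "maximal_fun lebesgue f \<in> borel_measurable lebesgue"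
    "\<And>h. maximal_fun ?\<mu> h \<in> borel_measurable lebesgue"
    by (auto intro!: measurable_maximal_fun)
  have [measurable]: "h \<in> borel_measurable lebesgue" unfolding h_def by measurable
  define t' where "t' = t / (t - 1)"
  have t': "1 < t'" using t by (simp add: t'_def less_divide_eq)
  define K\<^sub>1 where "K\<^sub>1 = Ap_doubling TYPE('a) t C"
  define K\<^sub>2 where "K\<^sub>2 = Ap_doubling TYPE('a) t' (C powr (1 / (t - 1)))"
  interpret \<mu>: doubling_measure ?\<mu> K\<^sub>1 unfolding K\<^sub>1_def by (rule Ap_weight_doubling[OF W t])
  interpret \<nu>: doubling_measure ?\<nu> K\<^sub>2
    unfolding \<sigma>_def K\<^sub>2_def using t' unfolding t'_def by (intro Ap_weight_doubling Ap_weight_dual[OF W t])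
  have C: "1 \<le> C" by (rule Ap_weight_const_ge_1[OF W t])
  have "(\<integral>\<^sup>+x. W x * maximal_fun lebesgue f x epowr t \<partial>lebesgue)
    \<le> (\<integral>\<^sup>+x. W x * (ennreal (C powr t') * maximal_fun ?\<mu> h x epowr t') \<partial>lebesgue)"
  proof (intro nn_integral_mono mult_left_mono)
    fix x
    have "maximal_fun lebesgue f x epowr t \<le> ((ennreal C * maximal_fun ?\<mu> h x) epowr (1 / (t - 1))) epowr t"
      using maximal_fun_le_weighted_maximal_fun[OF W t, of f x] t unfolding h_def g_def \<sigma>_def
      by (intro epowr_mono) auto
    also have "\<dots> = ennreal (C powr t') * maximal_fun ?\<mu> h x epowr t'"
      using t t' C by (simp add: epowr_epowr epowr_mult ennreal_epowr powr_powr t'_def)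
    finally show "maximal_fun lebesgue f x epowr t \<le> ennreal (C powr t') * maximal_fun ?\<mu> h x epowr t'" .
  qed auto
  also have "\<dots> = ennreal (C powr t') * (\<integral>\<^sup>+x. maximal_fun ?\<mu> h x epowr t' \<partial>?\<mu>)"
    by (simp add: nn_integral_density mult.left_commute[of _ "ennreal (C powr t')"] nn_integral_cmult)
  also have "(\<integral>\<^sup>+x. maximal_fun ?\<mu> h x epowr t' \<partial>?\<mu>) \<le> ennreal (\<mu>.strong_const t') * (\<integral>\<^sup>+x. h x epowr t' \<partial>?\<mu>)"
    by (rule \<mu>.strong_type[OF _ t']) simp
  also have "(\<integral>\<^sup>+x. h x epowr t' \<partial>?\<mu>) = (\<integral>\<^sup>+x. maximal_fun ?\<nu> g x epowr t \<partial>?\<nu>)"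
  proof -
    have "(\<integral>\<^sup>+x. W x * h x epowr t' \<partial>lebesgue) = (\<integral>\<^sup>+x. \<sigma> x * maximal_fun ?\<nu> g x epowr t \<partial>lebesgue)"
    proof (rule nn_integral_cong_AE, use Ap_weight_AE[OF W] in eventually_elim)
      fix x assume x: "0 < W x \<and> W x < top"
      have "h x epowr t' = maximal_fun ?\<nu> g x epowr t * W x epowr (- t')"
        using t t' by (simp add: h_def epowr_mult epowr_epowr inverse_eq_epowr) (simp add: t'_def)
      moreover have "W x * W x epowr (- t') = \<sigma> x"
      proof -
        have "1 + - t' = - 1 / (t - 1)" using t by (simp add: t'_def field_simps)
        then show ?thesis unfolding \<sigma>_def using epowr_add_finite[of "W x" 1 "- t'"] x by simp
      qed
      ultimately show "W x * h x epowr t' = \<sigma> x * maximal_fun ?\<nu> g x epowr t"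
        by (metis mult.assoc mult.commute)
    qed
    then show ?thesis by (simp add: nn_integral_density)
  qed
  also have "(\<integral>\<^sup>+x. maximal_fun ?\<nu> g x epowr t \<partial>?\<nu>) \<le> ennreal (\<nu>.strong_const t) * (\<integral>\<^sup>+x. g x epowr t \<partial>?\<nu>)"
    by (rule \<nu>.strong_type[OF _ t]) simp
  also have "(\<integral>\<^sup>+x. g x epowr t \<partial>?\<nu>) = (\<integral>\<^sup>+x. W x * f x epowr t \<partial>lebesgue)"
  proof -
    have "(\<integral>\<^sup>+x. \<sigma> x * g x epowr t \<partial>lebesgue) = (\<integral>\<^sup>+x. W x * f x epowr t \<partial>lebesgue)"
    proof (rule nn_integral_cong_AE, use Ap_weight_AE[OF W] in eventually_elim)
      fix x assume x: "0 < W x \<and> W x < top"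
      have "\<sigma> x * \<sigma> x epowr (- t) = W x"
      proof -
        have "t / (t - 1) - 1 / (t - 1) = 1" using t by (simp add: diff_divide_distrib[symmetric])
        then have "- 1 / (t - 1) + - 1 / (t - 1) * - t = 1" by simp
        then show ?thesis unfolding \<sigma>_def epowr_epowr using epowr_add_finite[of "W x"] x
          by (metis epowr_1)
      qed
      then show "\<sigma> x * g x epowr t = W x * f x epowr t"
        using t by (simp add: g_def epowr_mult inverse_eq_epowr epowr_epowr) (metis mult.assoc mult.commute)
    qed
    then show ?thesis by (simp add: nn_integral_density)
  qed
  finally have "(\<integral>\<^sup>+x. W x * maximal_fun lebesgue f x epowr t \<partial>lebesgue)
    \<le> ennreal (C powr t') * (ennreal (\<mu>.strong_const t') * (ennreal (\<nu>.strong_const t) * (\<integral>\<^sup>+x. W x * f x epowr t \<partial>lebesgue)))"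
    by (auto simp: mult_left_mono)
  also have "\<dots> = ennreal (muckenhoupt_const TYPE('a) t C) * (\<integral>\<^sup>+x. W x * f x epowr t \<partial>lebesgue)"
    using \<mu>.strong_const_nonneg[OF t'] \<nu>.strong_const_nonneg[OF t]
    unfolding muckenhoupt_const_def K\<^sub>1_def K\<^sub>2_def t'_def mult.assoc[symmetric]
    by (simp add: ennreal_mult'')
  finally show ?thesis .
qed

section \<open>The Rubio de Francia algorithm\<close>

lemma suminf_epowr_le:
  assumes a: "(\<Sum>k. a k) = (1::ennreal)" and t: "1 < t"
  shows "(\<Sum>k. a k * x k) epowr t \<le> (\<Sum>k. a k * x k epowr t)"
proof -
  have "(\<Sum>k. a k * x k) = (\<integral>\<^sup>+k. (a k * x k epowr t) epowr (1 / t) * a k epowr (1 - 1 / t) \<partial>count_space UNIV)"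
    unfolding nn_integral_count_space_nat
  proof (intro arg_cong[of _ _ suminf] ext)
    fix k
    have "a k = a k epowr (1 / t) * a k epowr (1 - 1 / t)"
      using t epowr_add[of "1 / t" "1 - 1 / t" "a k"] by simp
    then show "a k * x k = (a k * x k epowr t) epowr (1 / t) * a k epowr (1 - 1 / t)"
      using t by (simp add: epowr_mult epowr_epowr) (metis mult.assoc mult.commute)
  qed
  also have "\<dots> \<le> (\<integral>\<^sup>+k. a k * x k epowr t \<partial>count_space UNIV) epowr (1 / t) * (\<integral>\<^sup>+k. a k \<partial>count_space UNIV) epowr (1 - 1 / t)"
    by (rule nn_integral_Hoelder) (use t in auto)
  also have "\<dots> = (\<Sum>k. a k * x k epowr t) epowr (1 / t)"
    by (simp add: nn_integral_count_space_nat a)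
  finally show ?thesis using t by (simp add: epowr_le_swap)
qed

lemma maximal_fun_suminf:
  assumes M: "sets M = sets lebesgue" and [measurable]: "\<And>k. f k \<in> borel_measurable M"
  shows "maximal_fun M (\<lambda>x. \<Sum>k. f k x) x \<le> (\<Sum>k. maximal_fun M (f k) x)"
proof (rule maximal_fun_least)
  fix c \<rho> assume *: "0 < (\<rho>::real)" "x \<in> ball c \<rho>"
  have [measurable]: "ball c \<rho> \<in> sets M" using M by simp
  have "(\<integral>\<^sup>+y\<in>ball c \<rho>. (\<Sum>k. f k y) \<partial>M) / emeasure M (ball c \<rho>)
    = (\<Sum>k. (\<integral>\<^sup>+y\<in>ball c \<rho>. f k y \<partial>M) / emeasure M (ball c \<rho>))"
    by (simp add: nn_integral_suminf divide_ennreal_def flip: ennreal_suminf_multc)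
  also have "\<dots> \<le> (\<Sum>k. maximal_fun M (f k) x)"
    using * by (intro suminf_le maximal_fun_upper) auto
  finally show "(\<integral>\<^sup>+y\<in>ball c \<rho>. (\<Sum>k. f k y) \<partial>M) / emeasure M (ball c \<rho>) \<le> (\<Sum>k. maximal_fun M (f k) x)" .
qed

text \<open>A sufficiently large ball around x meets the mass of u. The point of the lemma is
  positivity everywhere, which the iterated maximal function U inherits.\<close>

lemma (in doubling_measure) maximal_fun_pos:
  assumes [measurable]: "u \<in> borel_measurable M" and "\<not> (AE x in M. u x = 0)"
  shows "0 < maximal_fun M u x"
proof (rule ccontr)
  assume "\<not> ?thesis"
  then have 0: "maximal_fun M u x \<le> 0" by simp
  have "AE y in M. y \<notin> ball x (real (Suc n)) \<or> u y = 0" for n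
  proof -
    let ?B = "ball x (real (Suc n))"
    have "(\<integral>\<^sup>+y\<in>?B. u y \<partial>M) / emeasure M ?B \<le> 0"
      by (rule order_trans[OF maximal_fun_upper 0]) auto
    then have "(\<integral>\<^sup>+y\<in>?B. u y \<partial>M) \<le> emeasure M ?B * 0"
      by (subst (asm) ennreal_divide_le_iff) (auto intro!: ball_pos ball_finite simp del: of_nat_Suc)
    then have "AE y in M. u y * indicator ?B y = 0"
      by (subst nn_integral_0_iff_AE[symmetric]) (auto simp del: of_nat_Suc)
    then show ?thesis by eventually_elim (auto split: split_indicator_asm)
  qed
  then have "AE y in M. \<forall>n. y \<notin> ball x (real (Suc n)) \<or> u y = 0"
    by (subst AE_all_countable) blast
  then have "AE y in M. u y = 0"
  proof eventually_elim
    case (elim y)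
    obtain n :: nat where "dist x y < real n" using reals_Archimedean2 by blast
    then have "y \<in> ball x (real (Suc n))" by simp
    then show ?case using elim by blast
  qed
  with assms show False by simp
qed

text \<open>U is the sum of 2^(-k-1) l^(-k) M^k u, where l = N^(1/t) bounds M on L^t(W). The numbers
  2^(-k-1) add up to 1, so Jensen's inequality \<open>suminf_epowr_le\<close> keeps the norm of U
  below that of u, with constant one. The term k = 0 gives u \<le> 2 U, shifting the index gives the
  A_1 bound with constant 2 l, and the term k = 1 gives positivity.\<close>

lemma rubio_de_francia:
  fixes W :: "'a::euclidean_space \<Rightarrow> ennreal"
  assumes [measurable]: "W \<in> borel_measurable lebesgue" and t: "1 < t" and N: "1 \<le> N"
    and bound: "\<And>f. f \<in> borel_measurable lebesgue \<Longrightarrow> (\<integral>\<^sup>+x. W x * maximal_fun lebesgue f x epowr t \<partial>lebesgue)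
      \<le> ennreal N * (\<integral>\<^sup>+x. W x * f x epowr t \<partial>lebesgue)"
    and [measurable]: "u \<in> borel_measurable lebesgue"
  obtains U where "U \<in> borel_measurable lebesgue" "\<And>x. u x \<le> 2 * U x"
    "(\<integral>\<^sup>+x. W x * U x epowr t \<partial>lebesgue) \<le> (\<integral>\<^sup>+x. W x * u x epowr t \<partial>lebesgue)"
    "\<And>x. maximal_fun lebesgue U x \<le> ennreal (2 * N powr (1 / t)) * U x"
    "\<not> (AE x in lebesgue. u x = 0) \<Longrightarrow> (\<forall>x. 0 < U x)"
proof -
  let ?M = "maximal_fun lebesgue :: ('a \<Rightarrow> ennreal) \<Rightarrow> 'a \<Rightarrow> ennreal"
  define l where "l = N powr (1 / t)"
  have l: "1 \<le> l" unfolding l_def using N t by (intro ge_one_powr_ge_zero) auto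
  define a where "a k = ennreal (1 / 2 * (1/2) ^ k)" for k :: nat
  define v where "v k x = ennreal ((1 / l) ^ k) * (?M ^^ k) u x" for k x
  define U where "U x = (\<Sum>k. a k * v k x)" for x
  have meas [measurable]: "(?M ^^ k) u \<in> borel_measurable lebesgue" for k
    by (cases k) (auto intro: measurable_maximal_fun)
  have [measurable]: "v k \<in> borel_measurable lebesgue" for k unfolding v_def by measurable
  have "(\<Sum>k. a k) = (\<Sum>k. ennreal (1/2) * ennreal ((1/2) ^ k))"
    by (simp only: a_def ennreal_mult'[of "1/2"])
  also have "\<dots> = 1"
    unfolding ennreal_suminf_cmult
    by (subst ennreal_geometric, simp, simp, subst ennreal_mult'[symmetric]) simp_all
  finally have a1: "(\<Sum>k. a k) = 1" .
  have term_le: "a k * v k x \<le> U x" for k x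
    unfolding U_def using sum_le_suminf[of "\<lambda>k. a k * v k x" "{k}"] by simp
  show thesis
  proof
    show "U \<in> borel_measurable lebesgue" unfolding U_def by measurable
    show "u x \<le> 2 * U x" for x
    proof -
      have "(2::ennreal) * ennreal (1 / 2) = 1"
        by (subst ennreal_numeral[symmetric], subst ennreal_mult'[symmetric]) simp_all
      then have "u x = 2 * (a 0 * v 0 x)" by (simp add: a_def v_def mult.assoc[symmetric])
      also have "\<dots> \<le> 2 * U x" by (intro mult_left_mono term_le) auto
      finally show ?thesis .
    qed
    have vk: "(\<integral>\<^sup>+x. W x * v k x epowr t \<partial>lebesgue) \<le> (\<integral>\<^sup>+x. W x * u x epowr t \<partial>lebesgue)" for k
    proof -
      have "(\<integral>\<^sup>+x. W x * (?M ^^ k) u x epowr t \<partial>lebesgue) \<le> ennreal (N ^ k) * (\<integral>\<^sup>+x. W x * u x epowr t \<partial>lebesgue)"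
      proof (induction k)
        case (Suc k)
        have "(\<integral>\<^sup>+x. W x * (?M ^^ Suc k) u x epowr t \<partial>lebesgue) \<le> ennreal N * (\<integral>\<^sup>+x. W x * (?M ^^ k) u x epowr t \<partial>lebesgue)"
          using bound[of "(?M ^^ k) u"] by simp
        also have "\<dots> \<le> ennreal N * (ennreal (N ^ k) * (\<integral>\<^sup>+x. W x * u x epowr t \<partial>lebesgue))"
          by (intro mult_left_mono Suc) auto
        finally show ?case using N by (simp add: ennreal_mult' mult.assoc)
      qed simp
      moreover have "v k x epowr t = ennreal ((1 / N) ^ k) * (?M ^^ k) u x epowr t" for x
      proof -
        have "((1 / l) ^ k) powr t = (1 / N) ^ k"
        proof -
          have "((1 / l) ^ k) powr t = ((1 / l) powr t) ^ k"
            using l by (simp add: powr_powr powr_realpow[symmetric] mult.commute)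
          also have "(1 / l) powr t = 1 / N"
            using N t by (simp add: l_def powr_divide powr_powr)
          finally show ?thesis .
        qed
        then show ?thesis using t l by (simp add: v_def epowr_mult ennreal_epowr)
      qed
      then have "(\<integral>\<^sup>+x. W x * v k x epowr t \<partial>lebesgue) = ennreal ((1 / N) ^ k) * (\<integral>\<^sup>+x. W x * (?M ^^ k) u x epowr t \<partial>lebesgue)"
        by (simp add: mult.left_commute[of _ "ennreal ((1 / N) ^ k)"] nn_integral_cmult)
      ultimately have "(\<integral>\<^sup>+x. W x * v k x epowr t \<partial>lebesgue)
          \<le> ennreal ((1 / N) ^ k) * (ennreal (N ^ k) * (\<integral>\<^sup>+x. W x * u x epowr t \<partial>lebesgue))"
        by (auto intro: mult_left_mono)
      also have "\<dots> = ennreal ((1 / N) ^ k * N ^ k) * (\<integral>\<^sup>+x. W x * u x epowr t \<partial>lebesgue)"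
        using N by (simp add: ennreal_mult' mult.assoc)
      also have "(1 / N) ^ k * N ^ k = 1" using N by (simp add: power_mult_distrib[symmetric])
      finally show ?thesis by simp
    qed
    have "(\<integral>\<^sup>+x. W x * U x epowr t \<partial>lebesgue) \<le> (\<integral>\<^sup>+x. W x * (\<Sum>k. a k * v k x epowr t) \<partial>lebesgue)"
      unfolding U_def by (intro nn_integral_mono mult_left_mono suminf_epowr_le a1 t) auto
    also have "\<dots> = (\<integral>\<^sup>+x. (\<Sum>k. a k * (W x * v k x epowr t)) \<partial>lebesgue)"
      unfolding ennreal_suminf_cmult[symmetric] by (simp only: mult.left_commute)
    also have "\<dots> = (\<Sum>k. a k * (\<integral>\<^sup>+x. W x * v k x epowr t \<partial>lebesgue))"
      by (simp add: nn_integral_suminf nn_integral_cmult)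
    also have "\<dots> \<le> (\<Sum>k. a k * (\<integral>\<^sup>+x. W x * u x epowr t \<partial>lebesgue))"
      by (intro suminf_le mult_left_mono vk) auto
    also have "\<dots> = (\<integral>\<^sup>+x. W x * u x epowr t \<partial>lebesgue)"
      by (simp add: ennreal_suminf_multc a1)
    finally show "(\<integral>\<^sup>+x. W x * U x epowr t \<partial>lebesgue) \<le> (\<integral>\<^sup>+x. W x * u x epowr t \<partial>lebesgue)" .
    show "?M U x \<le> ennreal (2 * N powr (1 / t)) * U x" for x
    proof -
      have "?M U x \<le> (\<Sum>k. ?M (\<lambda>x. a k * v k x) x)"
        unfolding U_def by (rule maximal_fun_suminf) auto
      also have "\<dots> \<le> (\<Sum>k. ennreal (2 * l) * (a (Suc k) * v (Suc k) x))"
      proof (intro suminf_le)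
        fix k
        have "?M (\<lambda>x. a k * v k x) x = a k * (ennreal ((1 / l) ^ k) * ?M ((?M ^^ k) u) x)"
          unfolding v_def by (simp add: maximal_fun_cmult)
        also have "\<dots> = ennreal (2 * l) * (a (Suc k) * v (Suc k) x)"
        proof -
          have "a k = 2 * a (Suc k)" unfolding a_def by (simp add: ennreal_mult'[symmetric] flip: ennreal_numeral)
          moreover have "ennreal ((1 / l) ^ k) = ennreal l * ennreal ((1 / l) ^ Suc k)"
            using l by (simp add: ennreal_mult'[symmetric])
          ultimately show ?thesis using l by (simp add: v_def ennreal_mult' ac_simps)
        qed
        finally show "?M (\<lambda>x. a k * v k x) x \<le> ennreal (2 * l) * (a (Suc k) * v (Suc k) x)" by simp
      qed auto
      also have "\<dots> = ennreal (2 * l) * (\<Sum>k. a (Suc k) * v (Suc k) x)"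
        by (rule ennreal_suminf_cmult)
      also have "\<dots> \<le> ennreal (2 * l) * U x"
      proof (rule mult_left_mono)
        have "U x = (\<Sum>k. a (k + 1) * v (k + 1) x) + (\<Sum>k<1. a k * v k x)"
          unfolding U_def by (rule suminf_offset) auto
        then show "(\<Sum>k. a (Suc k) * v (Suc k) x) \<le> U x" by simp
      qed auto
      finally show ?thesis unfolding l_def .
    qed
    assume "\<not> (AE x in lebesgue. u x = 0)"
    show "\<forall>x. 0 < U x"
    proof
      fix x
      have "0 < ?M u x" by (rule lebesgue.maximal_fun_pos) fact+
      then have "0 < a 1 * v 1 x" using l by (simp add: a_def v_def ennreal_zero_less_mult_iff)
      then show "0 < U x" using term_le[of 1 x] by (rule less_le_trans)
    qed
  qed
qed


section \<open>Weights built from A_1 weights\<close>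

lemma A1_weight_average:
  assumes [measurable]: "U \<in> borel_measurable (lebesgue :: 'a::euclidean_space measure)"
    and pos: "AE x in lebesgue. 0 < U x \<and> U x < top"
    and A1: "\<And>x. maximal_fun lebesgue U x \<le> ennreal k * U x" and k: "0 < k" and \<rho>: "0 < \<rho>"
  obtains m where "0 < m" "(\<integral>\<^sup>+x\<in>ball c \<rho>. U x \<partial>lebesgue) = ennreal m * emeasure lebesgue (ball c \<rho>)"
    "\<And>x. x \<in> ball c \<rho> \<Longrightarrow> ennreal (m / k) \<le> U x"
proof -
  let ?B = "ball c \<rho>"
  let ?b = "emeasure lebesgue ?B" and ?I = "\<integral>\<^sup>+x\<in>?B. U x \<partial>lebesgue"
  have b: "0 < ?b" "?b < top" using \<rho> by (auto intro: lebesgue_ball_pos lebesgue_ball_finite)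
  have le: "?I / ?b \<le> ennreal k * U x" if "x \<in> ?B" for x
    using maximal_fun_upper[OF \<rho> that, of lebesgue U] A1[of x] by (rule order_trans)
  \<comment> \<open>The A_1 bound holds at every point, so a single point with finite value bounds
    the average.\<close>
  have "\<exists>x\<in>?B. U x < top"
  proof (rule ccontr)
    assume "\<not> ?thesis"
    then have "AE x in lebesgue. x \<notin> ?B" by (intro eventually_mono[OF pos]) blast
    then have "?B \<in> null_sets lebesgue" by (subst AE_iff_null_sets) auto
    then have "?b = 0" by (rule null_setsD1)
    with b show False by simp
  qed
  then obtain x where "x \<in> ?B" "U x < top" by blast
  then have fin: "?I / ?b < top" using le[of x] by (auto simp: ennreal_mult_less_top intro: le_less_trans)
  have "0 < ?I" by (rule set_nn_integral_pos) (use b in \<open>auto intro: eventually_mono[OF pos]\<close>)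
  then have "0 < ?I / ?b" using b by (simp add: ennreal_zero_less_divide less_top)
  with fin obtain m where m: "0 < m" "?I / ?b = ennreal m" by (cases "?I / ?b" rule: ennreal_cases_pos) auto
  show thesis
  proof
    show "0 < m" by (rule m)
    show "?I = ennreal m * ?b"
      using ennreal_mult_div_cancel[OF b, of ?I] unfolding m(2) by (simp add: mult.commute)
    show "ennreal (m / k) \<le> U x" if "x \<in> ?B" for x
    proof -
      have "ennreal k * ennreal (m / k) \<le> ennreal k * U x"
        using le[OF that] m k by (simp add: ennreal_mult'[symmetric])
      then show ?thesis using k by (subst (asm) ennreal_mult_le_mult_iff) auto
    qed
  qed
qed

text \<open>The easy direction of the factorisation of weights. On a ball with average m of U, the
  lower bound U \<ge> m/k takes the negative power out of the first integral. In the dual integral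
  Hoelder's inequality with exponent (t - 1)/(s - 1) separates W from U. The powers of m
  cancel.\<close>

lemma Ap_weight_mult_A1_negative_power:
  assumes W: "Ap_weight t C (W :: 'a::euclidean_space \<Rightarrow> ennreal)" and t: "1 < t" "t < s"
    and [measurable]: "U \<in> borel_measurable lebesgue" and pos: "AE x in lebesgue. 0 < U x \<and> U x < top"
    and A1: "\<And>x. maximal_fun lebesgue U x \<le> ennreal k * U x" and k: "0 < k"
  shows "Ap_weight s (C * k powr (s - t)) (\<lambda>x. W x * U x epowr (t - s))"
  unfolding Ap_weight_def
proof (intro conjI allI impI)
  note [measurable] = Ap_weight_measurable[OF W]
  have C: "1 \<le> C" by (rule Ap_weight_const_ge_1[OF W t(1)])
  show "(\<lambda>x. W x * U x epowr (t - s)) \<in> borel_measurable lebesgue" by measurable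
  show "AE x in lebesgue. 0 < W x * U x epowr (t - s) \<and> W x * U x epowr (t - s) < top"
    using Ap_weight_AE[OF W] pos
    by eventually_elim (auto simp: ennreal_zero_less_mult_iff ennreal_mult_less_top intro: epowr_pos epowr_finite)
  fix c :: 'a and \<rho> :: real assume \<rho>: "0 < \<rho>"
  let ?B = "ball c \<rho>"
  let ?b = "emeasure lebesgue ?B" and ?I = "\<integral>\<^sup>+x\<in>?B. U x \<partial>lebesgue"
  have b: "0 < ?b" "?b < top" using \<rho> by (auto intro: lebesgue_ball_pos lebesgue_ball_finite)
  obtain m where m: "0 < m" "?I = ennreal m * ?b" "\<And>x. x \<in> ?B \<Longrightarrow> ennreal (m / k) \<le> U x"
    by (rule A1_weight_average[of U k \<rho> c]) (use pos A1 k \<rho> in auto)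
  let ?w = "\<integral>\<^sup>+x\<in>?B. W x \<partial>lebesgue" and ?s = "\<integral>\<^sup>+x\<in>?B. W x epowr (- 1 / (t - 1)) \<partial>lebesgue"
  have "(\<integral>\<^sup>+x\<in>?B. W x * U x epowr (t - s) \<partial>lebesgue) \<le> (\<integral>\<^sup>+x\<in>?B. ennreal (m / k) epowr (t - s) * W x \<partial>lebesgue)"
    using t m by (intro nn_integral_mono) (auto simp: mult.commute intro!: mult_left_mono epowr_antimono split: split_indicator)
  also have "\<dots> = ennreal ((m / k) powr (t - s)) * ?w"
    using m k by (simp add: mult.assoc nn_integral_cmult ennreal_epowr)
  finally have 1: "(\<integral>\<^sup>+x\<in>?B. W x * U x epowr (t - s) \<partial>lebesgue) \<le> ennreal ((m / k) powr (t - s)) * ?w" .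
  also have "\<dots> < top" using Ap_weight_finite[OF W \<rho>, of c] by (auto simp: ennreal_mult_less_top)
  finally show "(\<integral>\<^sup>+x\<in>?B. W x * U x epowr (t - s) \<partial>lebesgue) < top" .
  define \<tau> where "\<tau> = (t - 1) / (s - 1)"
  have \<tau>: "0 < \<tau>" "\<tau> < 1" "1 - \<tau> = (s - t) / (s - 1)" using t by (auto simp: \<tau>_def field_simps)
  have "(\<integral>\<^sup>+x\<in>?B. (W x * U x epowr (t - s)) epowr (- 1 / (s - 1)) \<partial>lebesgue)
    = (\<integral>\<^sup>+x\<in>?B. (W x epowr (- 1 / (t - 1))) epowr \<tau> * U x epowr (1 - \<tau>) \<partial>lebesgue)"
  proof (rule nn_integral_cong_AE, use Ap_weight_AE[OF W] pos in eventually_elim)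
    fix x assume x: "0 < W x \<and> W x < top" "0 < U x \<and> U x < top"
    have "(W x * U x epowr (t - s)) epowr (- 1 / (s - 1)) = W x epowr (- 1 / (s - 1)) * (U x epowr (t - s)) epowr (- 1 / (s - 1))"
      using x by (intro epowr_mult_finite epowr_pos epowr_finite) auto
    also have "\<dots> = (W x epowr (- 1 / (t - 1))) epowr \<tau> * U x epowr (1 - \<tau>)"
    proof -
      have "- 1 / (t - 1) * \<tau> = - 1 / (s - 1)" "(t - s) * (- 1 / (s - 1)) = 1 - \<tau>"
        using t by (auto simp: \<tau>_def field_simps)
      then show ?thesis unfolding epowr_epowr by simp
    qed
    finally show "(W x * U x epowr (t - s)) epowr (- 1 / (s - 1)) * indicator ?B x
      = (W x epowr (- 1 / (t - 1))) epowr \<tau> * U x epowr (1 - \<tau>) * indicator ?B x" by simp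
  qed
  also have "\<dots> \<le> ?s epowr \<tau> * ?I epowr (1 - \<tau>)"
    by (rule set_nn_integral_Hoelder) (use \<tau> in auto)
  finally have "(\<integral>\<^sup>+x\<in>?B. (W x * U x epowr (t - s)) epowr (- 1 / (s - 1)) \<partial>lebesgue) epowr (s - 1)
    \<le> (?s epowr \<tau> * ?I epowr (1 - \<tau>)) epowr (s - 1)"
    using t by (intro epowr_mono) auto
  also have "\<dots> = ?s epowr (t - 1) * ?I epowr (s - t)"
    using t \<tau> by (simp add: epowr_mult epowr_epowr) (simp add: \<tau>_def)
  also have "?I epowr (s - t) = ennreal (m powr (s - t)) * ?b epowr (s - t)"
    unfolding m(2) using t m by (simp add: epowr_mult ennreal_epowr)
  finally have "(\<integral>\<^sup>+x\<in>?B. W x * U x epowr (t - s) \<partial>lebesgue) * (\<integral>\<^sup>+x\<in>?B. (W x * U x epowr (t - s)) epowr (- 1 / (s - 1)) \<partial>lebesgue) epowr (s - 1)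
    \<le> (ennreal ((m / k) powr (t - s)) * ?w) * (?s epowr (t - 1) * (ennreal (m powr (s - t)) * ?b epowr (s - t)))"
    by (intro mult_mono 1) auto
  also have "\<dots> = ennreal ((m / k) powr (t - s)) * ennreal (m powr (s - t)) * (?w * ?s epowr (t - 1)) * ?b epowr (s - t)"
    by (simp add: ac_simps)
  also have "\<dots> \<le> ennreal ((m / k) powr (t - s)) * ennreal (m powr (s - t)) * (ennreal C * ?b epowr t) * ?b epowr (s - t)"
    by (intro mult_right_mono mult_left_mono Ap_weight_le[OF W \<rho>]) auto
  also have "\<dots> = ennreal ((m / k) powr (t - s)) * ennreal (m powr (s - t)) * ennreal C * (?b epowr t * ?b epowr (s - t))"
    by (simp add: ac_simps)
  also have "?b epowr t * ?b epowr (s - t) = ?b epowr s"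
    unfolding epowr_add_finite[OF b, symmetric] by simp
  also have "ennreal ((m / k) powr (t - s)) * ennreal (m powr (s - t)) * ennreal C = ennreal (C * k powr (s - t))"
  proof -
    have "(m / k) powr (t - s) * m powr (s - t) = k powr (s - t)"
      using m k by (simp add: powr_divide powr_add[symmetric] powr_minus_divide[of k "s - t", simplified] field_simps)
    then show ?thesis using C by (simp add: ennreal_mult'[symmetric] mult.commute)
  qed
  finally show "(\<integral>\<^sup>+x\<in>?B. W x * U x epowr (t - s) \<partial>lebesgue) * (\<integral>\<^sup>+x\<in>?B. (W x * U x epowr (t - s)) epowr (- 1 / (s - 1)) \<partial>lebesgue) epowr (s - 1)
    \<le> ennreal (C * k powr (s - t)) * ?b epowr s" .
qed

text \<open>Interpolation between A_1 and A_t: the number a is determined by s = a + (1 - a) t.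
  Hoelder's inequality splits the first integral; in the dual one U appears with a negative power
  and is removed by its lower bound m/k.\<close>

lemma Ap_weight_A1_geometric_mean:
  assumes W: "Ap_weight t C (W :: 'a::euclidean_space \<Rightarrow> ennreal)" and s: "1 < s" "s < t"
    and [measurable]: "U \<in> borel_measurable lebesgue" and pos: "AE x in lebesgue. 0 < U x \<and> U x < top"
    and A1: "\<And>x. maximal_fun lebesgue U x \<le> ennreal k * U x" and k: "0 < k"
  defines "a \<equiv> (t - s) / (t - 1)"
  shows "Ap_weight s (k powr a * C powr (1 - a)) (\<lambda>x. U x epowr a * W x epowr (1 - a))"
  unfolding Ap_weight_def
proof (intro conjI allI impI)
  note [measurable] = Ap_weight_measurable[OF W]
  have a: "0 < a" "a < 1" "1 - a = (s - 1) / (t - 1)" using s by (auto simp: a_def field_simps)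
  have C: "1 \<le> C" using Ap_weight_const_ge_1[OF W] s by simp
  show "(\<lambda>x. U x epowr a * W x epowr (1 - a)) \<in> borel_measurable lebesgue" by measurable
  show "AE x in lebesgue. 0 < U x epowr a * W x epowr (1 - a) \<and> U x epowr a * W x epowr (1 - a) < top"
    using Ap_weight_AE[OF W] pos
    by eventually_elim (auto simp: ennreal_zero_less_mult_iff ennreal_mult_less_top intro: epowr_pos epowr_finite)
  fix c :: 'a and \<rho> :: real assume \<rho>: "0 < \<rho>"
  let ?B = "ball c \<rho>"
  let ?b = "emeasure lebesgue ?B" and ?I = "\<integral>\<^sup>+x\<in>?B. U x \<partial>lebesgue"
  have b: "0 < ?b" "?b < top" using \<rho> by (auto intro: lebesgue_ball_pos lebesgue_ball_finite)
  obtain m where m: "0 < m" "?I = ennreal m * ?b" "\<And>x. x \<in> ?B \<Longrightarrow> ennreal (m / k) \<le> U x"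
    by (rule A1_weight_average[of U k \<rho> c]) (use pos A1 k \<rho> in auto)
  let ?w = "\<integral>\<^sup>+x\<in>?B. W x \<partial>lebesgue" and ?s = "\<integral>\<^sup>+x\<in>?B. W x epowr (- 1 / (t - 1)) \<partial>lebesgue"
  have 1: "(\<integral>\<^sup>+x\<in>?B. U x epowr a * W x epowr (1 - a) \<partial>lebesgue) \<le> ?I epowr a * ?w epowr (1 - a)"
    by (rule set_nn_integral_Hoelder) (use a in auto)
  also have "\<dots> < top" using Ap_weight_finite[OF W \<rho>, of c] a b
    unfolding m(2) by (auto simp: ennreal_mult_less_top intro!: epowr_less_top)
  finally show "(\<integral>\<^sup>+x\<in>?B. U x epowr a * W x epowr (1 - a) \<partial>lebesgue) < top" .
  have "(\<integral>\<^sup>+x\<in>?B. (U x epowr a * W x epowr (1 - a)) epowr (- 1 / (s - 1)) \<partial>lebesgue)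
    \<le> (\<integral>\<^sup>+x\<in>?B. ennreal (m / k) epowr (- (a / (s - 1))) * W x epowr (- 1 / (t - 1)) \<partial>lebesgue)"
  proof (rule nn_integral_mono_AE, use Ap_weight_AE[OF W] pos in eventually_elim)
    fix x assume x: "0 < W x \<and> W x < top" "0 < U x \<and> U x < top"
    have "(U x epowr a * W x epowr (1 - a)) epowr (- 1 / (s - 1))
      = (U x epowr a) epowr (- 1 / (s - 1)) * (W x epowr (1 - a)) epowr (- 1 / (s - 1))"
      using x by (intro epowr_mult_finite epowr_pos epowr_finite) auto
    also have "\<dots> = U x epowr (- (a / (s - 1))) * W x epowr (- 1 / (t - 1))"
    proof -
      have "(1 - a) * (- 1 / (s - 1)) = - 1 / (t - 1)" using s unfolding a(3) by (simp add: field_simps)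
      then show ?thesis unfolding epowr_epowr by simp
    qed
    finally show "(U x epowr a * W x epowr (1 - a)) epowr (- 1 / (s - 1)) * indicator ?B x
      \<le> ennreal (m / k) epowr (- (a / (s - 1))) * W x epowr (- 1 / (t - 1)) * indicator ?B x"
      using m(3)[of x] a s by (auto split: split_indicator intro!: mult_right_mono epowr_antimono)
  qed
  also have "\<dots> = ennreal (m / k) epowr (- (a / (s - 1))) * ?s"
    by (simp add: mult.assoc nn_integral_cmult)
  finally have "(\<integral>\<^sup>+x\<in>?B. (U x epowr a * W x epowr (1 - a)) epowr (- 1 / (s - 1)) \<partial>lebesgue) epowr (s - 1)
    \<le> (ennreal (m / k) epowr (- (a / (s - 1))) * ?s) epowr (s - 1)"
    using s by (intro epowr_mono) auto
  also have "\<dots> = ennreal ((m / k) powr - a) * ?s epowr (s - 1)"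
    using s m k by (simp add: epowr_mult epowr_epowr) (simp add: ennreal_epowr)
  finally have "(\<integral>\<^sup>+x\<in>?B. U x epowr a * W x epowr (1 - a) \<partial>lebesgue)
      * (\<integral>\<^sup>+x\<in>?B. (U x epowr a * W x epowr (1 - a)) epowr (- 1 / (s - 1)) \<partial>lebesgue) epowr (s - 1)
    \<le> (?I epowr a * ?w epowr (1 - a)) * (ennreal ((m / k) powr - a) * ?s epowr (s - 1))"
    by (intro mult_mono 1) auto
  also have "?I epowr a = ennreal (m powr a) * ?b epowr a"
    unfolding m(2) using a m by (simp add: epowr_mult ennreal_epowr)
  also have "ennreal (m powr a) * ?b epowr a * ?w epowr (1 - a) * (ennreal ((m / k) powr - a) * ?s epowr (s - 1))
    = ennreal (m powr a) * ennreal ((m / k) powr - a) * ?b epowr a * (?w epowr (1 - a) * ?s epowr (s - 1))"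
    by (simp add: ac_simps)
  also have "?w epowr (1 - a) * ?s epowr (s - 1) = (?w * ?s epowr (t - 1)) epowr (1 - a)"
  proof -
    have "(t - 1) * (1 - a) = s - 1" using s unfolding a(3) by simp
    then show ?thesis using a by (simp add: epowr_mult epowr_epowr)
  qed
  also have "ennreal (m powr a) * ennreal ((m / k) powr - a) * ?b epowr a * \<dots>
    \<le> ennreal (m powr a) * ennreal ((m / k) powr - a) * ?b epowr a * (ennreal C * ?b epowr t) epowr (1 - a)"
    using a by (intro mult_left_mono epowr_mono Ap_weight_le[OF W \<rho>]) auto
  also have "(ennreal C * ?b epowr t) epowr (1 - a) = ennreal (C powr (1 - a)) * ?b epowr (t * (1 - a))"
    using a C by (simp add: epowr_mult epowr_epowr ennreal_epowr)
  also have "ennreal (m powr a) * ennreal ((m / k) powr - a) * ?b epowr a * (ennreal (C powr (1 - a)) * ?b epowr (t * (1 - a)))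
    = ennreal (m powr a) * ennreal ((m / k) powr - a) * ennreal (C powr (1 - a)) * (?b epowr a * ?b epowr (t * (1 - a)))"
    by (simp add: ac_simps)
  also have "?b epowr a * ?b epowr (t * (1 - a)) = ?b epowr s"
  proof -
    have "a * (t - 1) = t - s" using s by (simp add: a_def)
    then have "a + t * (1 - a) = s" by (simp add: algebra_simps)
    then show ?thesis unfolding epowr_add_finite[OF b, symmetric] by simp
  qed
  also have "ennreal (m powr a) * ennreal ((m / k) powr - a) * ennreal (C powr (1 - a)) = ennreal (k powr a * C powr (1 - a))"
  proof -
    have "m powr a * (m / k) powr - a = k powr a"
      using m k by (simp add: powr_divide powr_minus field_simps)
    then show ?thesis by (simp add: ennreal_mult'[symmetric])
  qed
  finally show "(\<integral>\<^sup>+x\<in>?B. U x epowr a * W x epowr (1 - a) \<partial>lebesgue)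
      * (\<integral>\<^sup>+x\<in>?B. (U x epowr a * W x epowr (1 - a)) epowr (- 1 / (s - 1)) \<partial>lebesgue) epowr (s - 1)
    \<le> ennreal (k powr a * C powr (1 - a)) * ?b epowr s" .
qed

subsection \<open>A good-\<open>\<lambda>\<close> inequality\<close>

text \<open>The hypotheses with the operators removed: F stands for |Tf|^p0, G for the maximal
  function of |Sf|^p0, and q for the ratio of the exponents. The functions g and h may change with
  the ball. Integrability of F gives the superlevel sets of its maximal function finite measure, and
  with it bounded radii for the coverings.\<close>

definition good_decomposition ::
  "real \<Rightarrow> real \<Rightarrow> ('a::euclidean_space \<Rightarrow> ennreal) \<Rightarrow> ('a \<Rightarrow> ennreal) \<Rightarrow> bool" where
  "good_decomposition a q F G \<longleftrightarrow> F \<in> borel_measurable lebesgue \<and> G \<in> borel_measurable lebesgue \<and>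
    (\<integral>\<^sup>+x. F x \<partial>lebesgue) < top \<and>
    (\<forall>c \<rho>. 0 < \<rho> \<longrightarrow> (\<exists>g\<in>borel_measurable lebesgue. \<exists>h\<in>borel_measurable lebesgue.
      (AE x in lebesgue. x \<in> ball c \<rho> \<longrightarrow> F x \<le> g x + h x) \<and>
      (\<forall>x\<in>ball c \<rho>. (\<integral>\<^sup>+y\<in>ball c \<rho>. g y \<partial>lebesgue) \<le> ennreal a * emeasure lebesgue (ball c \<rho>) * G x) \<and>
      (\<forall>x\<in>ball c \<rho>. (\<integral>\<^sup>+y\<in>ball c \<rho>. h y epowr q \<partial>lebesgue)
        \<le> ennreal a * emeasure lebesgue (ball c \<rho>) * maximal_fun lebesgue F x epowr q)))"

lemma good_decompositionE:
  assumes "good_decomposition a q F G" "0 < \<rho>"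
  obtains g h where "g \<in> borel_measurable lebesgue" "h \<in> borel_measurable lebesgue"
    "AE x in lebesgue. x \<in> ball c \<rho> \<longrightarrow> F x \<le> g x + h x"
    "\<forall>x\<in>ball c \<rho>. (\<integral>\<^sup>+y\<in>ball c \<rho>. g y \<partial>lebesgue) \<le> ennreal a * emeasure lebesgue (ball c \<rho>) * G x"
    "\<forall>x\<in>ball c \<rho>. (\<integral>\<^sup>+y\<in>ball c \<rho>. h y epowr q \<partial>lebesgue)
        \<le> ennreal a * emeasure lebesgue (ball c \<rho>) * maximal_fun lebesgue F x epowr q"
  using assms unfolding good_decomposition_def by blast

text \<open>A ball through y of radius at least d has z in its sevenfold enlargement, so its average
  of F is at most 7^n l in dimension n, and 7^n \<le> 2^(3n). Balls that witness a level from k = 3n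
  on are therefore smaller than d and stay near x. This is where the first level 3 DIM comes
  from.\<close>

lemma maximal_fun_localize:
  fixes F :: "'a::euclidean_space \<Rightarrow> ennreal"
  assumes d: "0 < d" "dist x z = d" and z: "maximal_fun lebesgue F z \<le> ennreal l" and l: "0 < l"
    and y: "y \<in> ball x (5 * d)" and k: "3 * DIM('a) \<le> k" and big: "ennreal (2 ^ k * l) < maximal_fun lebesgue F y"
  shows "ennreal (2 ^ k * l) < maximal_fun lebesgue (\<lambda>x'. F x' * indicator (ball x (25 * d)) x') y"
proof -
  obtain c \<rho> where c: "0 < \<rho>" "y \<in> ball c \<rho>"
    "ennreal (2 ^ k * l) < (\<integral>\<^sup>+y\<in>ball c \<rho>. F y \<partial>lebesgue) / emeasure lebesgue (ball c \<rho>)"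
    using big unfolding less_maximal_fun_iff by auto
  have "\<rho> < d"
  proof (rule ccontr)
    assume "\<not> \<rho> < d"
    then have \<rho>: "d \<le> \<rho>" by simp
    have "dist c z \<le> dist c y + dist y x + dist x z" by (metis add_mono_thms_linordered_semiring(2) dist_triangle order_trans dist_triangle_le add.commute add_right_mono)
    also have "\<dots> < \<rho> + 5 * d + d" using c y d by (auto simp: dist_commute)
    also have "\<dots> \<le> 7 * \<rho>" using \<rho> by simp
    finally have zc: "z \<in> ball c (7 * \<rho>)" by simp
    let ?b = "emeasure lebesgue (ball c \<rho>)"
    have b: "0 < ?b" "?b < top" using c by (auto intro: lebesgue_ball_pos lebesgue_ball_finite)
    have b7: "emeasure lebesgue (ball c (7 * \<rho>)) = ennreal (7 ^ DIM('a)) * ?b"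
      using c by (subst lebesgue_ball_scale) auto
    have "(\<integral>\<^sup>+y\<in>ball c \<rho>. F y \<partial>lebesgue) \<le> (\<integral>\<^sup>+y\<in>ball c (7 * \<rho>). F y \<partial>lebesgue)"
      using c by (intro nn_integral_mono) (auto split: split_indicator)
    also have "\<dots> \<le> emeasure lebesgue (ball c (7 * \<rho>)) * ennreal l"
    proof -
      have "(\<integral>\<^sup>+y\<in>ball c (7 * \<rho>). F y \<partial>lebesgue) / emeasure lebesgue (ball c (7 * \<rho>)) \<le> ennreal l"
        by (rule order_trans[OF maximal_fun_upper z]) (use c zc in auto)
      then show ?thesis
        by (subst (asm) ennreal_divide_le_iff) (use c in \<open>auto intro!: lebesgue_ball_pos lebesgue_ball_finite\<close>)
    qed
    finally have "(\<integral>\<^sup>+y\<in>ball c \<rho>. F y \<partial>lebesgue) / ?b \<le> ennreal (7 ^ DIM('a)) * ennreal l"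
      unfolding b7 using b by (subst ennreal_divide_le_iff) (auto simp: ac_simps)
    also have "\<dots> = ennreal (7 ^ DIM('a) * l)" using l by (simp add: ennreal_mult')
    also have "\<dots> \<le> ennreal (2 ^ k * l)"
    proof (intro ennreal_leI mult_right_mono)
      have "(7::real) ^ DIM('a) \<le> 8 ^ DIM('a)" by (intro power_mono) auto
      also have "\<dots> = 2 ^ (3 * DIM('a))" by (simp add: power_mult)
      also have "\<dots> \<le> 2 ^ k" using k by (intro power_increasing) auto
      finally show "(7::real) ^ DIM('a) \<le> 2 ^ k" .
    qed (use l in auto)
    finally show False using c(3) by simp
  qed
  have sub: "ball c \<rho> \<subseteq> ball x (25 * d)"
  proof
    fix w assume w: "w \<in> ball c \<rho>"
    have "dist x w \<le> dist x y + dist y c + dist c w" using dist_triangle[of x w c] dist_triangle[of x c y] by linarith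
    also have "\<dots> < 5 * d + \<rho> + \<rho>" using y c w by (intro add_strict_mono) (auto simp: dist_commute)
    finally show "w \<in> ball x (25 * d)" using \<open>\<rho> < d\<close> d by simp
  qed
  have "(\<integral>\<^sup>+y\<in>ball c \<rho>. F y \<partial>lebesgue) = (\<integral>\<^sup>+y\<in>ball c \<rho>. F y * indicator (ball x (25 * d)) y \<partial>lebesgue)"
    using sub by (intro nn_integral_cong) (auto split: split_indicator)
  with c show ?thesis unfolding less_maximal_fun_iff by auto
qed

text \<open>On the ball of radius 25 d the decomposition bounds F by g + h, so at each level the
  maximal function of g or that of h exceeds half the level. The sets \<open>E'\<close> belong to g
  and are small at each level by the weak type bound and the choice of \<open>y\<^sub>0\<close>. The
  sets \<open>E\<close> belong to h: they are controlled jointly over all levels, by the strong type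
  (q, q) bound and the value at z.\<close>

lemma local_level_sets:
  fixes F :: "'a::euclidean_space \<Rightarrow> ennreal"
  assumes gd: "good_decomposition a q F G" and q: "1 < q" and a: "1 \<le> a"
    and d: "0 < d" "dist x z = d" and z: "maximal_fun lebesgue F z \<le> ennreal l" and l: "0 < l"
    and y\<^sub>0: "y\<^sub>0 \<in> ball x (5 * d)" "G y\<^sub>0 \<le> ennreal (\<gamma> * l)" and \<gamma>: "0 < \<gamma>"
  obtains E E' :: "nat \<Rightarrow> 'a set" where
    "\<And>k. E k \<in> sets lebesgue" "\<And>k. E' k \<in> sets lebesgue" "\<And>k. E k \<subseteq> ball x (25 * d)" "\<And>k. E' k \<subseteq> ball x (25 * d)"
    "\<And>k. 3 * DIM('a) \<le> k \<Longrightarrow> {y\<in>ball x (5 * d). ennreal (2 ^ k * l) < maximal_fun lebesgue F y} \<subseteq> E k \<union> E' k"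
    "\<And>k. emeasure lebesgue (E' k) \<le> ennreal (2 * 5 ^ DIM('a) * a * \<gamma> / 2 ^ k) * emeasure lebesgue (ball x (25 * d))"
    "\<And>m. (\<Sum>k<m. ennreal ((2 ^ k) powr q) * emeasure lebesgue (E k))
       \<le> ennreal (2 powr q / (1 - 2 powr - q) * (lebesgue.strong_const TYPE('a) q * a)) * emeasure lebesgue (ball x (25 * d))"
proof -
  let ?B = "ball x (25 * d)"
  let ?b = "emeasure lebesgue ?B"
  have b: "0 < ?b" "?b < top" using d by (auto intro: lebesgue_ball_pos lebesgue_ball_finite)
  obtain g h where [measurable]: "g \<in> borel_measurable lebesgue" "h \<in> borel_measurable lebesgue"
    and F: "AE x in lebesgue. x \<in> ?B \<longrightarrow> F x \<le> g x + h x"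
    and g: "\<forall>x\<in>?B. (\<integral>\<^sup>+y\<in>?B. g y \<partial>lebesgue) \<le> ennreal a * ?b * G x"
    and h: "\<forall>x\<in>?B. (\<integral>\<^sup>+y\<in>?B. h y epowr q \<partial>lebesgue) \<le> ennreal a * ?b * maximal_fun lebesgue F x epowr q"
    by (rule good_decompositionE[OF gd, of "25 * d" x]) (use d in auto)
  let ?Mg = "maximal_fun lebesgue (\<lambda>x'. g x' * indicator ?B x')" and ?Mh = "maximal_fun lebesgue (\<lambda>x'. h x' * indicator ?B x')"
  define E where "E k = {y. ennreal (2 ^ k * l / 2) < ?Mh y} \<inter> ?B" for k :: nat
  define E' where "E' k = {y. ennreal (2 ^ k * l / 2) < ?Mg y} \<inter> ?B" for k :: nat
  have [measurable]: "{y. ennreal (2 ^ k * l / 2) < ?Mh y} \<in> sets lebesgue" "{y. ennreal (2 ^ k * l / 2) < ?Mg y} \<in> sets lebesgue" for k :: nat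
    by (intro lebesgue.open_sets open_superlevel_maximal_fun)+
  have mE [measurable]: "E k \<in> sets lebesgue" "E' k \<in> sets lebesgue" for k
    unfolding E_def E'_def by measurable
  show thesis
  proof
    show "E k \<in> sets lebesgue" "E' k \<in> sets lebesgue" "E k \<subseteq> ?B" "E' k \<subseteq> ?B" for k
      by (fact mE)+ (auto simp: E_def E'_def)
    show "{y\<in>ball x (5 * d). ennreal (2 ^ k * l) < maximal_fun lebesgue F y} \<subseteq> E k \<union> E' k" if k: "3 * DIM('a) \<le> k" for k
    proof
      fix y assume "y \<in> {y\<in>ball x (5 * d). ennreal (2 ^ k * l) < maximal_fun lebesgue F y}"
      then have y: "y \<in> ball x (5 * d)" "ennreal (2 ^ k * l) < maximal_fun lebesgue F y" by auto
      have "ennreal (2 ^ k * l) < maximal_fun lebesgue (\<lambda>x'. F x' * indicator ?B x') y"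
        by (rule maximal_fun_localize[OF d z l y(1) k y(2)])
      also have "\<dots> \<le> maximal_fun lebesgue (\<lambda>x'. g x' * indicator ?B x' + h x' * indicator ?B x') y"
        by (rule maximal_fun_mono_AE, use F in eventually_elim) (auto split: split_indicator)
      also have "\<dots> \<le> ?Mg y + ?Mh y" by (rule maximal_fun_add) auto
      finally have *: "ennreal (2 ^ k * l) < ?Mg y + ?Mh y" .
      have "ennreal (2 ^ k * l / 2) < ?Mg y \<or> ennreal (2 ^ k * l / 2) < ?Mh y"
      proof (rule ccontr)
        assume "\<not> ?thesis"
        then have "?Mg y + ?Mh y \<le> ennreal (2 ^ k * l / 2) + ennreal (2 ^ k * l / 2)"
          by (intro add_mono) auto
        also have "\<dots> = ennreal (2 ^ k * l)" using l by (subst ennreal_plus[symmetric]) auto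
        finally show False using * by simp
      qed
      moreover have "y \<in> ?B" using y(1) d by auto
      ultimately show "y \<in> E k \<union> E' k" by (auto simp: E_def E'_def)
    qed
    show "emeasure lebesgue (E' k) \<le> ennreal (2 * 5 ^ DIM('a) * a * \<gamma> / 2 ^ k) * ?b" for k
    proof -
      let ?t = "2 ^ k * l / 2"
      have t: "0 < ?t" using l by simp
      have "ennreal ?t * emeasure lebesgue (E' k) \<le> ennreal ?t * emeasure lebesgue {y. ennreal ?t < ?Mg y}"
        by (intro mult_left_mono emeasure_mono) (auto simp: E'_def)
      also have "\<dots> \<le> ennreal (5 ^ DIM('a)) * (\<integral>\<^sup>+y\<in>?B. g y \<partial>lebesgue)"
        using t by (intro lebesgue.weak_type) auto
      also have "\<dots> \<le> ennreal (5 ^ DIM('a)) * (ennreal a * ?b * ennreal (\<gamma> * l))"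
      proof (rule mult_left_mono)
        have "y\<^sub>0 \<in> ?B" using y\<^sub>0 d by auto
        then have "(\<integral>\<^sup>+y\<in>?B. g y \<partial>lebesgue) \<le> ennreal a * ?b * G y\<^sub>0" using g by blast
        also have "\<dots> \<le> ennreal a * ?b * ennreal (\<gamma> * l)" by (intro mult_left_mono y\<^sub>0) auto
        finally show "(\<integral>\<^sup>+y\<in>?B. g y \<partial>lebesgue) \<le> ennreal a * ?b * ennreal (\<gamma> * l)" .
      qed auto
      also have "\<dots> = ennreal (5 ^ DIM('a)) * ennreal a * ennreal (\<gamma> * l) * ?b" by (simp only: ac_simps)
      also have "ennreal (5 ^ DIM('a)) * ennreal a * ennreal (\<gamma> * l) = ennreal (5 ^ DIM('a) * a * (\<gamma> * l))"
        using a \<gamma> l by (simp add: ennreal_mult')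
      also have "5 ^ DIM('a) * a * (\<gamma> * l) = ?t * (2 * 5 ^ DIM('a) * a * \<gamma> / 2 ^ k)"
        by simp
      also have "ennreal (?t * (2 * 5 ^ DIM('a) * a * \<gamma> / 2 ^ k)) = ennreal ?t * ennreal (2 * 5 ^ DIM('a) * a * \<gamma> / 2 ^ k)"
        using t by (intro ennreal_mult') simp
      finally have "emeasure lebesgue (E' k) * ennreal ?t \<le> ennreal (2 * 5 ^ DIM('a) * a * \<gamma> / 2 ^ k) * ?b * ennreal ?t"
        by (simp only: ac_simps)
      then show ?thesis by (rule ennreal_mult_right_cancel_le[rotated 2]) (use t in auto)
    qed
    show "(\<Sum>k<m. ennreal ((2 ^ k) powr q) * emeasure lebesgue (E k))
       \<le> ennreal (2 powr q / (1 - 2 powr - q) * (lebesgue.strong_const TYPE('a) q * a)) * ?b" for m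
    proof -
      \<comment> \<open>The levels 2^k l / 2 with k < m are L / 2^i with i = m - k, as in
        \<open>dyadic_layers\<close>.\<close>
      define L where "L = 2 ^ m * l / 2"
      have L: "0 < L" using l by (simp add: L_def)
      have S: "0 \<le> lebesgue.strong_const TYPE('a) q" by (rule lebesgue.strong_const_nonneg[OF q])
      have "2 powr - q < 1" using q by (auto intro: powr_less_one)
      then have cq: "0 < 1 / (1 - 2 powr - q)" by simp
      have "ennreal (l powr q / 2 powr q) * (\<Sum>k<m. ennreal ((2 ^ k) powr q) * emeasure lebesgue (E k))
        = (\<Sum>k<m. ennreal ((2 ^ k * l / 2) powr q) * emeasure lebesgue (E k))"
        unfolding sum_distrib_left
      proof (intro sum.cong refl)
        fix k
        have "(2 ^ k * l / 2) powr q = l powr q / 2 powr q * (2 ^ k) powr q"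
          using l by (simp add: powr_mult powr_divide)
        also have "ennreal (l powr q / 2 powr q * (2 ^ k) powr q) = ennreal (l powr q / 2 powr q) * ennreal ((2 ^ k) powr q)"
          by (rule ennreal_mult') simp
        finally show "ennreal (l powr q / 2 powr q) * (ennreal ((2 ^ k) powr q) * emeasure lebesgue (E k))
          = ennreal ((2 ^ k * l / 2) powr q) * emeasure lebesgue (E k)"
          by (simp only: mult.assoc)
      qed
      also have "\<dots> \<le> (\<Sum>k<m. ennreal ((2 ^ k * l / 2) powr q) * emeasure lebesgue {y. ennreal (2 ^ k * l / 2) < ?Mh y})"
        by (intro sum_mono mult_left_mono emeasure_mono) (auto simp: E_def)
      also have "\<dots> = (\<Sum>i\<in>{1..m}. ennreal ((L / 2 ^ i) powr q) * (\<integral>\<^sup>+y. 1 * indicator {y. ennreal (L / 2 ^ i) < ?Mh y} y \<partial>lebesgue))"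
      proof (rule sum.reindex_bij_witness[of _ "\<lambda>i. m - i" "\<lambda>k. m - k"])
        fix k assume "k \<in> {..<m}"
        then have "L / 2 ^ (m - k) = 2 ^ k * l / 2" by (simp add: L_def power_diff field_simps)
        then show "ennreal ((L / 2 ^ (m - k)) powr q) * (\<integral>\<^sup>+y. 1 * indicator {y. ennreal (L / 2 ^ (m - k)) < ?Mh y} y \<partial>lebesgue)
          = ennreal ((2 ^ k * l / 2) powr q) * emeasure lebesgue {y. ennreal (2 ^ k * l / 2) < ?Mh y}"
          by (simp only: mult_1 nn_integral_indicator)
            (simp add: nn_integral_indicator)
      qed auto
      also have "\<dots> \<le> (\<Sum>i. ennreal ((L / 2 ^ i) powr q) * (\<integral>\<^sup>+y. 1 * indicator {y. ennreal (L / 2 ^ i) < ?Mh y} y \<partial>lebesgue))"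
        by (rule sum_le_suminf) auto
      also have "\<dots> = (\<integral>\<^sup>+y. 1 * dyadic_layers q L (?Mh y) \<partial>lebesgue)"
        by (rule nn_integral_dyadic_layers[symmetric]) auto
      also have "\<dots> \<le> (\<integral>\<^sup>+y. ennreal (1 / (1 - 2 powr - q)) * ?Mh y epowr q \<partial>lebesgue)"
        using q L by (intro nn_integral_mono) (simp add: dyadic_layers_upper)
      also have "\<dots> = ennreal (1 / (1 - 2 powr - q)) * (\<integral>\<^sup>+y. ?Mh y epowr q \<partial>lebesgue)"
        by (rule nn_integral_cmult) measurable
      also have "\<dots> \<le> ennreal (1 / (1 - 2 powr - q)) * (ennreal (lebesgue.strong_const TYPE('a) q) *
          (ennreal a * ?b * ennreal (l powr q)))"
      proof (intro mult_left_mono)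
        have "(\<integral>\<^sup>+y. ?Mh y epowr q \<partial>lebesgue) \<le> ennreal (lebesgue.strong_const TYPE('a) q) * (\<integral>\<^sup>+y. (h y * indicator ?B y) epowr q \<partial>lebesgue)"
          by (rule lebesgue.strong_type[OF _ q]) measurable
        also have "(\<integral>\<^sup>+y. (h y * indicator ?B y) epowr q \<partial>lebesgue) = (\<integral>\<^sup>+y\<in>?B. h y epowr q \<partial>lebesgue)"
          using q by (intro nn_integral_cong) (auto split: split_indicator)
        \<comment> \<open>The second hypothesis holds at every point of the ball; it is used at z,
          where the maximal function is at most l.\<close>
        also have "\<dots> \<le> ennreal a * ?b * maximal_fun lebesgue F z epowr q"
          using h d by auto
        also have "\<dots> \<le> ennreal a * ?b * ennreal l epowr q"
          using q by (intro mult_left_mono epowr_mono z) auto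
        finally show "(\<integral>\<^sup>+y. ?Mh y epowr q \<partial>lebesgue) \<le> ennreal (lebesgue.strong_const TYPE('a) q) * (ennreal a * ?b * ennreal (l powr q))"
          using l by (simp add: ennreal_epowr mult_left_mono)
      qed auto
      also have "\<dots> = (ennreal (1 / (1 - 2 powr - q)) * (ennreal (lebesgue.strong_const TYPE('a) q) * ennreal a) * ennreal (l powr q)) * ?b"
        by (simp only: ac_simps)
      also have "ennreal (1 / (1 - 2 powr - q)) * (ennreal (lebesgue.strong_const TYPE('a) q) * ennreal a) * ennreal (l powr q)
        = ennreal (1 / (1 - 2 powr - q) * (lebesgue.strong_const TYPE('a) q * a) * l powr q)"
        using S a cq by (simp only: ennreal_mult' less_imp_le mult_nonneg_nonneg zero_le_one order_trans[OF zero_le_one a])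
      also have "1 / (1 - 2 powr - q) * (lebesgue.strong_const TYPE('a) q * a) * l powr q
        = l powr q / 2 powr q * (2 powr q / (1 - 2 powr - q) * (lebesgue.strong_const TYPE('a) q * a))"
        by (simp add: field_simps)
      also have "ennreal \<dots> = ennreal (l powr q / 2 powr q) * ennreal (2 powr q / (1 - 2 powr - q) * (lebesgue.strong_const TYPE('a) q * a))"
        by (rule ennreal_mult') simp
      finally have "(\<Sum>k<m. ennreal ((2 ^ k) powr q) * emeasure lebesgue (E k)) * ennreal (l powr q / 2 powr q)
        \<le> ennreal (2 powr q / (1 - 2 powr - q) * (lebesgue.strong_const TYPE('a) q * a)) * ?b * ennreal (l powr q / 2 powr q)"
        by (simp only: ac_simps)
      then show ?thesis by (rule ennreal_mult_right_cancel_le[rotated 2]) (use l in auto)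
    qed
  qed
qed

text \<open>Replaces the concave power by a linear function with a small constant term, so that a
  bound for a sum over levels can be used after the A_\<infinity> condition has introduced the power
  \<theta>. For y < 1 the power is at most that with exponent \<open>\<theta>\<^sub>0\<close>; where
  this exceeds \<eta>, y is bounded below, which yields the coefficient. It does not depend on
  \<theta>.\<close>

lemma epowr_le_affine:
  assumes "0 < \<eta>" "\<eta> \<le> 1" "0 < \<theta>\<^sub>0" "\<theta>\<^sub>0 \<le> \<theta>" "\<theta> \<le> 1"
  shows "y epowr \<theta> \<le> ennreal \<eta> + ennreal (\<eta> powr ((\<theta>\<^sub>0 - 1) / \<theta>\<^sub>0) + 1) * y"
proof (cases "1 \<le> y")
  case True
  then have "y epowr \<theta> \<le> y epowr 1" using assms by (intro epowr_increasing) auto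
  also have "\<dots> = 1 * y" by simp
  also have "\<dots> \<le> ennreal (\<eta> powr ((\<theta>\<^sub>0 - 1) / \<theta>\<^sub>0) + 1) * y"
    by (intro mult_right_mono) (auto simp: ennreal_ge_1 simp del: ennreal_plus)
  finally show ?thesis by (metis add_increasing zero_le)
next
  case False
  show ?thesis
  proof (cases y rule: ennreal_cases_pos)
    case (pos s)
    with False have s1: "s < 1" by simp
    have "s powr \<theta> \<le> s powr \<theta>\<^sub>0" using pos s1 assms by (intro powr_mono') auto
    also have "\<dots> \<le> \<eta> + (\<eta> powr ((\<theta>\<^sub>0 - 1) / \<theta>\<^sub>0) + 1) * s"
    proof (cases "s powr \<theta>\<^sub>0 \<le> \<eta>")
      case True
      then show ?thesis using pos assms by (auto intro!: add_increasing2 mult_nonneg_nonneg)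
    next
      case False
      then have "\<eta> powr (1 / \<theta>\<^sub>0) \<le> (s powr \<theta>\<^sub>0) powr (1 / \<theta>\<^sub>0)" using assms by (intro powr_mono2) auto
      then have "\<eta> powr (1 / \<theta>\<^sub>0) \<le> s" using assms pos by (simp add: powr_powr)
      then have "s powr (\<theta>\<^sub>0 - 1) \<le> (\<eta> powr (1 / \<theta>\<^sub>0)) powr (\<theta>\<^sub>0 - 1)"
        using assms by (intro powr_mono2') auto
      also have "\<dots> = \<eta> powr ((\<theta>\<^sub>0 - 1) / \<theta>\<^sub>0)" by (simp add: powr_powr)
      finally have "s powr (\<theta>\<^sub>0 - 1) * s \<le> (\<eta> powr ((\<theta>\<^sub>0 - 1) / \<theta>\<^sub>0) + 1) * s"
        using pos by (intro mult_right_mono) auto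
      moreover have "s powr (\<theta>\<^sub>0 - 1) * s = s powr \<theta>\<^sub>0" using pos by (simp add: powr_diff)
      ultimately show ?thesis using assms by linarith
    qed
    finally have "ennreal (s powr \<theta>) \<le> ennreal (\<eta> + (\<eta> powr ((\<theta>\<^sub>0 - 1) / \<theta>\<^sub>0) + 1) * s)" by (rule ennreal_leI)
    then show ?thesis using pos assms
      by (simp add: ennreal_epowr ennreal_mult' ennreal_plus[of \<eta>] del: ennreal_plus)
  qed (use assms False in auto)
qed

lemma Ainf_measure_mono:
  assumes A: "Ainf_measure C \<theta> M" and le: "\<theta>' \<le> \<theta>"
  shows "Ainf_measure C \<theta>' M"
  unfolding Ainf_measure_def
proof (intro allI impI)
  fix c :: 'a and \<rho> :: real and A assume *: "0 < \<rho>" "A \<in> sets lebesgue" "A \<subseteq> ball c \<rho>"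
  have "emeasure lebesgue A / emeasure lebesgue (ball c \<rho>) \<le> 1"
    using emeasure_mono[OF *(3), of lebesgue] lebesgue_ball_pos[OF *(1), of c] lebesgue_ball_finite[of c \<rho>]
    by (subst ennreal_divide_le_iff) auto
  then have "ennreal C * (emeasure lebesgue A / emeasure lebesgue (ball c \<rho>)) epowr \<theta> * emeasure M (ball c \<rho>)
    \<le> ennreal C * (emeasure lebesgue A / emeasure lebesgue (ball c \<rho>)) epowr \<theta>' * emeasure M (ball c \<rho>)"
    by (intro mult_right_mono mult_left_mono epowr_decreasing le) auto
  with Ainf_measureD[OF A *] show "emeasure M A \<le> ennreal C * (emeasure lebesgue A / emeasure lebesgue (ball c \<rho>)) epowr \<theta>' * emeasure M (ball c \<rho>)"
    by (rule order_trans)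
qed

text \<open>
  The good-\<open>\<lambda>\<close> inequality is summed over \<open>N\<close> consecutive dyadic levels \<open>2\<^sup>k \<lambda>\<close>. The strong type \<open>(q, q)\<close> of the
  maximal operator controls the whole sum, which therefore grows more slowly than \<open>N\<close>. This gains over
  the critical exponent and makes Gehring's lemma unnecessary.
\<close>

lemma good_lambda:
  fixes q P a C K :: real
  assumes q: "1 < q" and P: "0 < P" "P < q" and a: "1 \<le> a" and C: "1 \<le> C" and K: "1 \<le> K"
  obtains \<epsilon> N \<gamma> where "0 < \<epsilon>" "\<epsilon> \<le> P / q / 2" "0 < (N::nat)" "0 < \<gamma>"
    "\<forall>(F :: 'a::euclidean_space \<Rightarrow> ennreal) G v l.
      good_decomposition a q F G \<longrightarrow> doubling_measure v K \<longrightarrow> Ainf_measure C (P / q - \<epsilon>) v \<longrightarrow> 0 < l \<longrightarrow>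
      (\<Sum>k\<in>{3 * DIM('a)..<3 * DIM('a) + N}. ennreal ((2 ^ k) powr P) *
          emeasure v {x. ennreal (2 ^ k * l) < maximal_fun lebesgue F x \<and> G x \<le> ennreal (\<gamma> * l)})
      \<le> ennreal (real N / 2) * emeasure v {x. ennreal l < maximal_fun lebesgue F x}"
proof -
  let ?k\<^sub>0 = "3 * DIM('a)"
  define \<theta>\<^sub>0 where "\<theta>\<^sub>0 = P / q / 2"
  have \<theta>\<^sub>0: "0 < \<theta>\<^sub>0" "\<theta>\<^sub>0 < 1" using P q by (auto simp: \<theta>\<^sub>0_def field_simps)
  \<comment> \<open>C comes from the A_\<infinity> condition on the ball of radius 25 d, the square
    of K from returning to radius d.\<close>
  define H where "H = C * K\<^sup>2"
  have H: "1 \<le> H" using mult_mono[of 1 C 1 "K\<^sup>2"] C K by (simp add: H_def)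
  define \<eta> where "\<eta> = 1 / (16 * H)"
  have \<eta>: "0 < \<eta>" "\<eta> \<le> 1" using H by (auto simp: \<eta>_def)
  \<comment> \<open>Uniform for all exponents between \<open>\<theta>\<^sub>0\<close> and 1. It must
    precede \<epsilon>, which depends on N, which in turn depends on D.\<close>
  define D where "D = \<eta> powr ((\<theta>\<^sub>0 - 1) / \<theta>\<^sub>0) + 1"
  have D: "0 < D" by (simp add: D_def add_nonneg_pos)
  define c\<^sub>1 where "c\<^sub>1 = 2 powr q / (1 - 2 powr - q) * (lebesgue.strong_const TYPE('a) q * a)"
  have c\<^sub>1: "0 \<le> c\<^sub>1"
    using lebesgue.strong_const_nonneg[OF q, where 'a='a] a q powr_less_one[of 2 "- q"]
    by (auto simp: c\<^sub>1_def intro!: mult_nonneg_nonneg divide_nonneg_nonneg)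
  define c\<^sub>2 where "c\<^sub>2 = 2 * 5 ^ DIM('a) * a"
  have c\<^sub>2: "0 < c\<^sub>2" using a by (simp add: c\<^sub>2_def)
  \<comment> \<open>The budget N/2 is split as follows: N/8 for the constant term \<eta> of the
    affine bound, N/4 for the sets \<open>E'\<close>, and N/8 for the linear term. The last one is a
    fixed bound on a sum over all levels, so it is met by taking N large.\<close>
  obtain N :: nat where N: "1 \<le> N" "16 * H * D * c\<^sub>1 \<le> real N"
  proof -
    obtain m :: nat where "16 * H * D * c\<^sub>1 \<le> real m" using real_arch_simple by blast
    then show thesis by (intro that[of "Suc m"]) auto
  qed
  let ?I = "{?k\<^sub>0..<?k\<^sub>0 + N}"
  define M where "M = real (?k\<^sub>0 + N)"
  have M: "0 < M" using N by (simp add: M_def)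
  \<comment> \<open>The missing \<epsilon> of the A_\<infinity> exponent produces the factor 2^(k q
    \<epsilon>). Since k \<le> M, it stays below 2.\<close>
  define \<epsilon> where "\<epsilon> = min \<theta>\<^sub>0 (1 / (M * q))"
  have \<epsilon>: "0 < \<epsilon>" "\<epsilon> \<le> \<theta>\<^sub>0" "M * q * \<epsilon> \<le> 1"
    using \<theta>\<^sub>0 M q by (auto simp: \<epsilon>_def min_def field_simps)
  \<comment> \<open>With \<gamma> as below, \<open>E'\<close> has relative measure at most \<delta>
    to the power 1/\<open>\<theta>\<^sub>0\<close>. Its power \<theta> is at most \<delta>, which
    outweighs the largest factor 2^(M P).\<close>
  define \<delta> where "\<delta> = 1 / (4 * H * 2 powr (M * P))"
  have \<delta>: "0 < \<delta>" "\<delta> \<le> 1"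
  proof -
    have "1 \<le> 2 powr (M * P)" using M P by (intro ge_one_powr_ge_zero) auto
    then have "1 * 1 \<le> 4 * H * 2 powr (M * P)" using H by (intro mult_mono) auto
    then show "0 < \<delta>" "\<delta> \<le> 1" using H by (auto simp: \<delta>_def)
  qed
  define \<gamma> where "\<gamma> = \<delta> powr (1 / \<theta>\<^sub>0) / c\<^sub>2"
  have \<gamma>: "0 < \<gamma>" using \<delta> c\<^sub>2 by (simp add: \<gamma>_def)
  define \<theta> where "\<theta> = P / q - \<epsilon>"
  have \<theta>: "\<theta>\<^sub>0 \<le> \<theta>" "\<theta> \<le> 1" "0 < \<theta>"
    using \<epsilon> \<theta>\<^sub>0 P q by (auto simp: \<theta>_def \<theta>\<^sub>0_def) (smt (verit) divide_le_eq_1_pos)+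
  show thesis
  proof (rule that[of \<epsilon> N \<gamma>]; (intro allI impI)?)
    show "0 < \<epsilon>" "\<epsilon> \<le> P / q / 2" "0 < N" "0 < \<gamma>" using \<epsilon> N \<gamma> by (auto simp: \<theta>\<^sub>0_def)
    fix F :: "'a \<Rightarrow> ennreal" and G :: "'a \<Rightarrow> ennreal" and v :: "'a measure" and l :: real
    assume gd: "good_decomposition a q F G" and "doubling_measure v K" and ainf: "Ainf_measure C (P / q - \<epsilon>) v" and l: "0 < l"
    interpret doubling_measure v K by fact
    have [measurable]: "F \<in> borel_measurable lebesgue" "G \<in> borel_measurable lebesgue" and F: "(\<integral>\<^sup>+x. F x \<partial>lebesgue) < top"
      using gd by (auto simp: good_decomposition_def)
    let ?MF = "maximal_fun lebesgue F"
    define \<Omega> where "\<Omega> = {x. ennreal l < ?MF x}"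
    have op: "open \<Omega>" unfolding \<Omega>_def by (rule open_superlevel_maximal_fun)
    define A where "A k = {x. ennreal (2 ^ k * l) < ?MF x \<and> G x \<le> ennreal (\<gamma> * l)}" for k :: nat
    have [measurable]: "A k \<in> sets v" for k
    proof -
      have "{x \<in> space lebesgue. ennreal (2 ^ k * l) < ?MF x \<and> G x \<le> ennreal (\<gamma> * l)} \<in> sets lebesgue"
        by measurable
      then show ?thesis by (simp add: A_def sets_M)
    qed
    have A\<Omega>: "A k \<subseteq> \<Omega>" for k
    proof -
      have "1 * l \<le> 2 ^ k * l" using l by (intro mult_right_mono) auto
      then show ?thesis unfolding A_def \<Omega>_def by (auto intro: le_less_trans[OF ennreal_leI])
    qed
    obtain u where u: "0 < u" "emeasure lebesgue (ball (0::'a) 1) = ennreal u" by (rule lebesgue_unit_ball)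
    obtain \<omega> where \<omega>: "0 \<le> \<omega>" "emeasure lebesgue \<Omega> = ennreal \<omega>"
    proof -
      have "ennreal l * emeasure lebesgue \<Omega> \<le> ennreal (5 ^ DIM('a)) * (\<integral>\<^sup>+x. F x \<partial>lebesgue)"
        unfolding \<Omega>_def using l by (intro lebesgue.weak_type) auto
      also have "\<dots> < top" using F by (simp add: ennreal_mult_less_top)
      finally have "emeasure lebesgue \<Omega> < top" using l by (auto simp: ennreal_mult_less_top)
      then show thesis using that by (cases "emeasure lebesgue \<Omega>") auto
    qed
    \<comment> \<open>A ball inside \<open>\<Omega>\<close> has measure at most \<omega>; this
      bounds the radii for the covering lemma and shows that \<open>\<Omega>\<close> is not the
      whole space.\<close>
    define R where "R = max 1 (\<omega> / u)"
    have radius: "\<rho> \<le> R" if "0 < \<rho>" "ball x \<rho> \<subseteq> \<Omega>" for x \<rho>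
    proof (rule ccontr)
      assume "\<not> \<rho> \<le> R"
      then have \<rho>: "R < \<rho>" "1 \<le> \<rho>" by (auto simp: R_def)
      have "ennreal (\<rho> ^ DIM('a) * u) = emeasure lebesgue (ball x \<rho>)"
        using that u by (subst emeasure_lebesgue_ball_conv_unit_ball) (auto simp: ennreal_mult')
      also have "\<dots> \<le> ennreal \<omega>" using emeasure_mono[OF that(2), of lebesgue] op \<omega> by (simp add: lebesgue.open_sets)
      finally have "\<rho> ^ DIM('a) * u \<le> \<omega>" using \<omega> by (simp add: ennreal_le_iff)
      then have "\<rho> ^ DIM('a) \<le> \<omega> / u" using u by (simp add: field_simps)
      moreover have "\<rho> ^ 1 \<le> \<rho> ^ DIM('a)" using \<rho> by (intro power_increasing) auto
      ultimately show False using \<rho> by (auto simp: R_def)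
    qed
    have nonempty: "- \<Omega> \<noteq> {}"
    proof
      assume "- \<Omega> = {}"
      then have "ball 0 (R + 1) \<subseteq> \<Omega>" by blast
      moreover have "1 \<le> R" by (simp add: R_def)
      ultimately show False using radius[of "R + 1" 0] by simp
    qed
    \<comment> \<open>The ball of this radius lies in \<open>\<Omega>\<close>, while a point at
      exactly this distance has maximal function at most l, as \<open>local_level_sets\<close>
      requires.\<close>
    define r where "r x = infdist x (- \<Omega>)" for x
    have cl: "closed (- \<Omega>)" using op by (rule closed_Compl)
    have r_pos: "0 < r x" if "x \<in> \<Omega>" for x
      using in_closed_iff_infdist_zero[OF cl nonempty, of x] that infdist_nonneg[of x "- \<Omega>"] by (auto simp: r_def)
    have r_sub: "ball x (r x) \<subseteq> \<Omega>" for x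
    proof
      fix y assume "y \<in> ball x (r x)"
      then show "y \<in> \<Omega>" using infdist_le[of y "- \<Omega>" x] by (force simp: r_def)
    qed
    have \<Omega>_eq: "\<Omega> = (\<Union>x\<in>\<Omega>. ball x (r x))" using r_sub r_pos by force
    \<comment> \<open>As the density of one measure, \<phi> collects all N levels, so that a single
      covering treats them simultaneously.\<close>
    define \<phi> where "\<phi> x = (\<Sum>k\<in>?I. ennreal ((2 ^ k) powr P) * indicator (A k) x)" for x
    have [measurable]: "\<phi> \<in> borel_measurable v" unfolding \<phi>_def by measurable
    have \<phi>: "emeasure (density v \<phi>) X = (\<Sum>k\<in>?I. ennreal ((2 ^ k) powr P) * emeasure v (A k \<inter> X))" if [measurable]: "X \<in> sets v" for X
    proof -
      have "emeasure (density v \<phi>) X = (\<integral>\<^sup>+x. (\<Sum>k\<in>?I. ennreal ((2 ^ k) powr P) * indicator (A k \<inter> X) x) \<partial>v)"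
      proof (subst emeasure_density; (intro nn_integral_cong)?)
        show "\<phi> x * indicator X x = (\<Sum>k\<in>?I. ennreal ((2 ^ k) powr P) * indicator (A k \<inter> X) x)" for x
          unfolding \<phi>_def sum_distrib_right by (intro sum.cong refl) (simp only: indicator_inter_arith mult.assoc)
      qed auto
      also have "\<dots> = (\<Sum>k\<in>?I. \<integral>\<^sup>+x. ennreal ((2 ^ k) powr P) * indicator (A k \<inter> X) x \<partial>v)"
        by (rule nn_integral_sum) measurable
      also have "\<dots> = (\<Sum>k\<in>?I. ennreal ((2 ^ k) powr P) * emeasure v (A k \<inter> X))"
        by (intro sum.cong refl nn_integral_cmult_indicator) measurable
      finally show ?thesis .
    qed
    have local: "emeasure (density v \<phi>) (ball x (5 * r x)) \<le> ennreal (real N / 2) * emeasure v (ball x (r x))"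
      if x: "x \<in> \<Omega>" for x
    proof (cases "\<exists>y\<^sub>0\<in>ball x (5 * r x). G y\<^sub>0 \<le> ennreal (\<gamma> * l)")
      case False
      then have "A k \<inter> ball x (5 * r x) = {}" for k by (auto simp: A_def)
      then show ?thesis by (subst \<phi>) auto
    next
      case True
      then obtain y\<^sub>0 where y\<^sub>0: "y\<^sub>0 \<in> ball x (5 * r x)" "G y\<^sub>0 \<le> ennreal (\<gamma> * l)" by blast
      obtain z where z: "z \<in> - \<Omega>" "infdist x (- \<Omega>) = dist x z"
        using infdist_attains_inf[OF cl nonempty] by blast
      define d where "d = r x"
      have d: "0 < d" "dist x z = d" using r_pos[OF x] z by (auto simp: d_def r_def)
      let ?Y = "ball x (5 * d)" and ?B = "ball x (25 * d)"
      let ?b = "emeasure lebesgue ?B"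
      have b: "0 < ?b" "?b < top" using d by (auto intro: lebesgue_ball_pos lebesgue_ball_finite)
      obtain E E' :: "nat \<Rightarrow> 'a set" where E: "\<And>k. E k \<in> sets lebesgue" "\<And>k. E' k \<in> sets lebesgue"
        "\<And>k. E k \<subseteq> ?B" "\<And>k. E' k \<subseteq> ?B"
        "\<And>k. ?k\<^sub>0 \<le> k \<Longrightarrow> {y\<in>?Y. ennreal (2 ^ k * l) < ?MF y} \<subseteq> E k \<union> E' k"
        and E': "\<And>k. emeasure lebesgue (E' k) \<le> ennreal (2 * 5 ^ DIM('a) * a * \<gamma> / 2 ^ k) * ?b"
        and sumE: "\<And>m. (\<Sum>k<m. ennreal ((2 ^ k) powr q) * emeasure lebesgue (E k))
         \<le> ennreal (2 powr q / (1 - 2 powr - q) * (lebesgue.strong_const TYPE('a) q * a)) * ?b"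
        by (rule local_level_sets[OF gd q a d _ l y\<^sub>0[folded d_def] \<gamma>]) (use z in \<open>auto simp: \<Omega>_def not_less\<close>)
      define y where "y k = ennreal ((2 ^ k) powr q) * emeasure lebesgue (E k) / ?b" for k
      have sum_y: "(\<Sum>k\<in>?I. y k) \<le> ennreal c\<^sub>1"
      proof -
        have "(\<Sum>k\<in>?I. y k) \<le> (\<Sum>k<?k\<^sub>0 + N. y k)" by (intro sum_mono2) auto
        also have "\<dots> = (\<Sum>k<?k\<^sub>0 + N. ennreal ((2 ^ k) powr q) * emeasure lebesgue (E k)) / ?b"
          by (simp add: y_def divide_ennreal_def sum_distrib_right)
        also have "\<dots> \<le> ennreal c\<^sub>1"
          using sumE[of "?k\<^sub>0 + N"] unfolding c\<^sub>1_def[symmetric]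
          by (subst ennreal_divide_le_iff[OF b]) (simp add: mult.commute)
        finally show ?thesis .
      qed
      have vB: "emeasure v ?B \<le> ennreal (K\<^sup>2) * emeasure v (ball x d)"
      proof -
        have "emeasure v (ball x (5 * (5 * d))) \<le> ennreal K * emeasure v (ball x (5 * d))"
          using d by (intro doubling) auto
        also have "\<dots> \<le> ennreal K * (ennreal K * emeasure v (ball x d))"
          using d by (intro mult_left_mono doubling) auto
        finally show ?thesis using K by (simp add: power2_eq_square ennreal_mult' mult.assoc)
      qed
      have term_le: "ennreal ((2 ^ k) powr P) * emeasure v (A k \<inter> ?Y)
        \<le> ennreal C * emeasure v ?B * (ennreal (2 * \<eta> + 1 / (4 * H)) + ennreal (2 * D) * y k)"
        if k: "k \<in> ?I" for k
      proof -
        have kM: "real k \<le> M" using k by (simp add: M_def)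
        have p2: "(2 ^ k) powr P = 2 powr (k * P)" for P :: real by (simp add: powr_powr powr_realpow[symmetric])
        have "A k \<inter> ?Y \<subseteq> E k \<union> E' k" using E(5)[of k] k by (auto simp: A_def)
        then have "emeasure v (A k \<inter> ?Y) \<le> emeasure v (E k \<union> E' k)"
          using E by (intro emeasure_mono) (auto simp: sets_M)
        also have "\<dots> \<le> emeasure v (E k) + emeasure v (E' k)"
          using E by (intro emeasure_subadditive) (auto simp: sets_M)
        finally have *: "emeasure v (A k \<inter> ?Y) \<le> emeasure v (E k) + emeasure v (E' k)" .
        have vE: "emeasure v X \<le> ennreal C * (emeasure lebesgue X / ?b) epowr \<theta> * emeasure v ?B"
          if "X \<in> sets lebesgue" "X \<subseteq> ?B" for X
          unfolding \<theta>_def using that d by (intro Ainf_measureD[OF ainf]) auto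
        \<comment> \<open>The relative measure of \<open>E k\<close> is 2^(-kq) y k. After the power
          \<theta> = P/q - \<epsilon> the exponents kP and -kq\<theta> leave only k q
          \<epsilon>.\<close>
        have 1: "ennreal ((2 ^ k) powr P) * (emeasure lebesgue (E k) / ?b) epowr \<theta> \<le> ennreal (2 * \<eta>) + ennreal (2 * D) * y k"
        proof -
          have "emeasure lebesgue (E k) / ?b = ennreal (2 powr (- (k * q))) * y k"
            unfolding y_def p2 ennreal_times_divide[symmetric] mult.assoc[symmetric]
            by (subst ennreal_mult'[symmetric]) (auto simp: p2 powr_add[symmetric])
          then have "(emeasure lebesgue (E k) / ?b) epowr \<theta> = ennreal (2 powr (- (k * q) * \<theta>)) * y k epowr \<theta>"
            using \<theta> by (simp add: epowr_mult ennreal_epowr powr_powr)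
          then have "ennreal ((2 ^ k) powr P) * (emeasure lebesgue (E k) / ?b) epowr \<theta>
            = ennreal (2 powr (k * P)) * ennreal (2 powr (- (k * q) * \<theta>)) * y k epowr \<theta>"
            by (simp only: p2 mult.assoc)
          also have "ennreal (2 powr (k * P)) * ennreal (2 powr (- (k * q) * \<theta>)) = ennreal (2 powr (k * q * \<epsilon>))"
          proof -
            have "k * P + (- (k * q) * \<theta>) = k * q * \<epsilon>" using q by (simp add: \<theta>_def field_simps)
            then show ?thesis by (simp add: ennreal_mult'[symmetric] powr_add[symmetric])
          qed
          also have "ennreal (2 powr (k * q * \<epsilon>)) * y k epowr \<theta> \<le> ennreal 2 * (ennreal \<eta> + ennreal D * y k)"
          proof (rule mult_mono)
            have "k * q * \<epsilon> \<le> M * q * \<epsilon>" using kM q \<epsilon> by (intro mult_right_mono) auto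
            then have "2 powr (k * q * \<epsilon>) \<le> 2 powr 1" using \<epsilon> by (intro powr_mono) auto
            then show "ennreal (2 powr (k * q * \<epsilon>)) \<le> ennreal 2" by (intro ennreal_leI) simp
            show "y k epowr \<theta> \<le> ennreal \<eta> + ennreal D * y k"
              unfolding D_def by (rule epowr_le_affine) (use \<eta> \<theta>\<^sub>0 \<theta> in auto)
          qed auto
          also have "\<dots> = ennreal 2 * ennreal \<eta> + ennreal 2 * ennreal D * y k" by (simp only: distrib_left mult.assoc)
          also have "\<dots> = ennreal (2 * \<eta>) + ennreal (2 * D) * y k"
            using \<eta> D by (simp only: ennreal_mult' less_imp_le zero_le_numeral)
          finally show ?thesis .
        qed
        have 2: "ennreal ((2 ^ k) powr P) * (emeasure lebesgue (E' k) / ?b) epowr \<theta> \<le> ennreal (1 / (4 * H))"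
        proof -
          have "emeasure lebesgue (E' k) / ?b \<le> ennreal (c\<^sub>2 * \<gamma> / 2 ^ k)"
            using E'[of k] by (subst ennreal_divide_le_iff[OF b]) (simp add: c\<^sub>2_def mult.commute)
          also have "\<dots> \<le> ennreal (\<delta> powr (1 / \<theta>\<^sub>0))"
          proof (rule ennreal_leI)
            have "c\<^sub>2 * \<gamma> / 2 ^ k \<le> c\<^sub>2 * \<gamma> / 1" using c\<^sub>2 \<gamma> by (intro divide_left_mono) auto
            then show "c\<^sub>2 * \<gamma> / 2 ^ k \<le> \<delta> powr (1 / \<theta>\<^sub>0)" using c\<^sub>2 by (simp add: \<gamma>_def)
          qed
          finally have "(emeasure lebesgue (E' k) / ?b) epowr \<theta> \<le> ennreal (\<delta> powr (1 / \<theta>\<^sub>0)) epowr \<theta>"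
            using \<theta> by (intro epowr_mono) auto
          also have "\<dots> = ennreal (\<delta> powr (\<theta> / \<theta>\<^sub>0))" using \<delta> by (simp add: ennreal_epowr powr_powr)
          also have "\<dots> \<le> ennreal (\<delta> powr 1)"
            using \<delta> \<theta> \<theta>\<^sub>0 by (intro ennreal_leI powr_mono') auto
          finally have "ennreal ((2 ^ k) powr P) * (emeasure lebesgue (E' k) / ?b) epowr \<theta> \<le> ennreal (2 powr (M * P)) * ennreal \<delta>"
            unfolding p2 using kM P \<delta> by (intro mult_mono ennreal_leI powr_mono) auto
          also have "\<dots> = ennreal (1 / (4 * H))" by (subst ennreal_mult'[symmetric]) (auto simp: \<delta>_def)
          finally show ?thesis .
        qed
        have "ennreal ((2 ^ k) powr P) * emeasure v (A k \<inter> ?Y) \<le> ennreal ((2 ^ k) powr P) *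
            (ennreal C * (emeasure lebesgue (E k) / ?b) epowr \<theta> * emeasure v ?B + ennreal C * (emeasure lebesgue (E' k) / ?b) epowr \<theta> * emeasure v ?B)"
          using E by (intro mult_left_mono order_trans[OF *] add_mono vE) auto
        also have "\<dots> = ennreal C * emeasure v ?B *
            (ennreal ((2 ^ k) powr P) * (emeasure lebesgue (E k) / ?b) epowr \<theta> + ennreal ((2 ^ k) powr P) * (emeasure lebesgue (E' k) / ?b) epowr \<theta>)"
          by (simp only: distrib_left ac_simps)
        also have "\<dots> \<le> ennreal C * emeasure v ?B * ((ennreal (2 * \<eta>) + ennreal (2 * D) * y k) + ennreal (1 / (4 * H)))"
          by (intro mult_left_mono add_mono 1 2) auto
        also have "(ennreal (2 * \<eta>) + ennreal (2 * D) * y k) + ennreal (1 / (4 * H)) = ennreal (2 * \<eta> + 1 / (4 * H)) + ennreal (2 * D) * y k"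
          using \<eta> H by (subst ennreal_plus) (auto simp: ac_simps)
        finally show ?thesis .
      qed
      have "emeasure (density v \<phi>) ?Y = (\<Sum>k\<in>?I. ennreal ((2 ^ k) powr P) * emeasure v (A k \<inter> ?Y))"
        by (rule \<phi>) (rule ball_sets)
      also have "\<dots> \<le> (\<Sum>k\<in>?I. ennreal C * emeasure v ?B * (ennreal (2 * \<eta> + 1 / (4 * H)) + ennreal (2 * D) * y k))"
        by (intro sum_mono term_le)
      also have "\<dots> = ennreal C * emeasure v ?B * (of_nat N * ennreal (2 * \<eta> + 1 / (4 * H)) + ennreal (2 * D) * (\<Sum>k\<in>?I. y k))"
        by (simp add: sum_distrib_left[symmetric] sum.distrib)
      also have "\<dots> \<le> ennreal C * (ennreal (K\<^sup>2) * emeasure v (ball x d)) * (of_nat N * ennreal (2 * \<eta> + 1 / (4 * H)) + ennreal (2 * D) * ennreal c\<^sub>1)"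
        by (intro mult_mono add_mono sum_y vB mult_left_mono) auto
      also have "\<dots> = ennreal (H * (real N * (2 * \<eta> + 1 / (4 * H)) + 2 * D * c\<^sub>1)) * emeasure v (ball x d)"
      proof -
        have "of_nat N * ennreal (2 * \<eta> + 1 / (4 * H)) + ennreal (2 * D) * ennreal c\<^sub>1 = ennreal (real N * (2 * \<eta> + 1 / (4 * H)) + 2 * D * c\<^sub>1)"
          using \<eta> H D c\<^sub>1 by (subst ennreal_plus) (auto simp: ennreal_of_nat_eq_real_of_nat ennreal_mult' simp del: ennreal_plus)
        moreover have "ennreal C * ennreal (K\<^sup>2) = ennreal H" using C by (simp add: H_def ennreal_mult')
        moreover have "ennreal H * ennreal w = ennreal (H * w)" for w using H by (simp add: ennreal_mult')
        moreover have "ennreal C * (ennreal (K\<^sup>2) * w) * w' = ennreal C * ennreal (K\<^sup>2) * w' * w" for w w'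
          by (simp only: ac_simps)
        ultimately show ?thesis by simp
      qed
      also have "\<dots> \<le> ennreal (real N / 2) * emeasure v (ball x d)"
      proof (intro mult_right_mono ennreal_leI)
        have "H * (real N * (2 * \<eta> + 1 / (4 * H)) + 2 * D * c\<^sub>1) = real N * (H * (2 * \<eta>) + H * (1 / (4 * H))) + 2 * H * D * c\<^sub>1"
          by (simp add: algebra_simps)
        also have "H * (2 * \<eta>) = 1 / 8" using H by (simp add: \<eta>_def)
        also have "H * (1 / (4 * H)) = 1 / 4" using H by simp
        finally show "H * (real N * (2 * \<eta> + 1 / (4 * H)) + 2 * D * c\<^sub>1) \<le> real N / 2" using N(2) by simp
      qed auto
      finally show ?thesis unfolding d_def .
    qed
    have "(\<Sum>k\<in>?I. ennreal ((2 ^ k) powr P) * emeasure v (A k)) = emeasure (density v \<phi>) \<Omega>"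
      using A\<Omega> op by (subst \<phi>) (auto intro: open_sets simp: Int_absorb2)
    also have "\<dots> \<le> ennreal (real N / 2) * emeasure v \<Omega>"
      by (subst (1 2) \<Omega>_eq, rule vitali_comparison[of _ _ _ _ R])
        (use sets_M r_pos radius[OF r_pos r_sub] local in auto)
    finally show "(\<Sum>k\<in>?I. ennreal ((2 ^ k) powr P) * emeasure v {x. ennreal (2 ^ k * l) < ?MF x \<and> G x \<le> ennreal (\<gamma> * l)})
      \<le> ennreal (real N / 2) * emeasure v {x. ennreal l < ?MF x}"
      unfolding A_def \<Omega>_def .
  qed
qed

section \<open>Truncated weights and absorption\<close>

lemma min_mult_distrib_left_ennreal: "min (c * x) (c * y) = c * min x (y::ennreal)"
  by (cases "x \<le> y") (auto simp: min_def not_le mult_left_mono intro!: antisym mult_left_mono)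

text \<open>The truncated weight gives a ball B a mass comparable to the smaller of its V-mass and n
  |B| (the claim \<open>key\<close>). Both of these satisfy the doubling and A_\<infinity> bounds,
  hence so does their minimum, with constants that do not depend on n. For \<open>key\<close>, the
  A_\<infinity> condition shows that V exceeds half its mean on a fixed portion of the ball.\<close>

lemma truncated_weight:
  fixes V :: "'a::euclidean_space \<Rightarrow> ennreal"
  assumes [measurable]: "V \<in> borel_measurable lebesgue" and "doubling_measure (density lebesgue V) K"
    and ainf: "Ainf_measure C \<theta> (density lebesgue V)" and \<theta>: "0 < \<theta>\<^sub>0" "\<theta>\<^sub>0 \<le> \<theta>" "\<theta> \<le> 1" and C: "1 \<le> C" and n: "0 < n"
  defines "e \<equiv> (1 / (2 * C)) powr (1 / \<theta>\<^sub>0) / 2"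
  shows "doubling_measure (density lebesgue (\<lambda>x. min (V x) (ennreal n))) (max K (5 ^ DIM('a)) / e)" (is "doubling_measure ?vn _")
    and "Ainf_measure (C / e) \<theta> (density lebesgue (\<lambda>x. min (V x) (ennreal n)))"
proof -
  let ?v = "density lebesgue V"
  interpret doubling_measure ?v K by fact
  have e: "0 < e" using C by (simp add: e_def)
  have vn_le: "emeasure ?vn A \<le> emeasure ?v A" "emeasure ?vn A \<le> ennreal n * emeasure lebesgue A"
    if [measurable]: "A \<in> sets lebesgue" for A
  proof -
    show "emeasure ?vn A \<le> emeasure ?v A"
      by (auto simp: emeasure_density intro!: nn_integral_mono mult_right_mono)
    have "emeasure ?vn A \<le> (\<integral>\<^sup>+x. ennreal n * indicator A x \<partial>lebesgue)"
      by (auto simp: emeasure_density intro!: nn_integral_mono mult_right_mono)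
    then show "emeasure ?vn A \<le> ennreal n * emeasure lebesgue A"
      by (simp add: nn_integral_cmult_indicator)
  qed
  have key: "ennreal e * min (emeasure ?v (ball c \<rho>)) (ennreal n * emeasure lebesgue (ball c \<rho>)) \<le> emeasure ?vn (ball c \<rho>)"
    if \<rho>: "0 < \<rho>" for c \<rho>
  proof -
    let ?B = "ball c \<rho>"
    obtain b where b: "0 < b" "emeasure lebesgue ?B = ennreal b"
      using lebesgue_ball_pos[OF \<rho>, of c] lebesgue_ball_finite[of c \<rho>] by (cases "emeasure lebesgue ?B" rule: ennreal_cases_pos) auto
    obtain \<nu> where \<nu>: "0 < \<nu>" "emeasure ?v ?B = ennreal \<nu>"
      using ball_pos[OF \<rho>, of c] ball_finite[of c \<rho>] by (cases "emeasure ?v ?B" rule: ennreal_cases_pos) auto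
    \<comment> \<open>Half the mean of V. The part of the ball where V \<le> s carries at most half
      of the mass, so the set E carries the other half.\<close>
    define s where "s = \<nu> / (2 * b)"
    have s: "0 < s" using b \<nu> by (simp add: s_def)
    define E where "E = {x. ennreal s < V x} \<inter> ?B"
    have [measurable]: "{x. ennreal s < V x} \<in> sets lebesgue" by (rule sets_lebesgue_superlevel) measurable
    have [measurable]: "E \<in> sets lebesgue" unfolding E_def by measurable
    have "emeasure lebesgue E \<le> ennreal b" using emeasure_mono[of E ?B lebesgue] b by (simp add: E_def)
    then obtain \<beta> where \<beta>: "0 \<le> \<beta>" "emeasure lebesgue E = ennreal \<beta>" using b by (cases "emeasure lebesgue E") (auto simp: top_unique)
    have "emeasure ?v ?B \<le> emeasure ?v (E \<union> (?B - E))" by (intro emeasure_mono) (auto simp: E_def)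
    also have "\<dots> \<le> emeasure ?v E + emeasure ?v (?B - E)" by (intro emeasure_subadditive) auto
    also have "emeasure ?v (?B - E) \<le> ennreal (\<nu> / 2)"
    proof -
      have "emeasure ?v (?B - E) \<le> (\<integral>\<^sup>+x. ennreal s * indicator ?B x \<partial>lebesgue)"
        by (auto simp: emeasure_density E_def not_less split: split_indicator intro!: nn_integral_mono)
      also have "\<dots> = ennreal (\<nu> / 2)" using b s by (simp add: nn_integral_cmult_indicator ennreal_mult'[symmetric] s_def)
      finally show ?thesis .
    qed
    also have "emeasure ?v E \<le> ennreal C * (emeasure lebesgue E / emeasure lebesgue ?B) epowr \<theta> * emeasure ?v ?B"
      by (rule Ainf_measureD[OF ainf \<rho>]) (auto simp: E_def)
    also have "\<dots> = ennreal (C * (\<beta> / b) powr \<theta> * \<nu>)"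
      using \<beta> b \<nu> C \<theta> by (simp add: divide_ennreal ennreal_epowr_nonneg ennreal_mult')
    finally have "ennreal \<nu> \<le> ennreal (C * (\<beta> / b) powr \<theta> * \<nu>) + ennreal (\<nu> / 2)" using \<nu> by (simp add: add_right_mono)
    also have "\<dots> = ennreal (C * (\<beta> / b) powr \<theta> * \<nu> + \<nu> / 2)" using \<nu> C by (subst ennreal_plus) auto
    finally have "\<nu> \<le> C * (\<beta> / b) powr \<theta> * \<nu> + \<nu> / 2" using \<nu> C by (subst (asm) ennreal_le_iff) auto
    then have "\<nu> * (1 / 2) \<le> \<nu> * (C * (\<beta> / b) powr \<theta>)" by (simp add: algebra_simps)
    then have "1 / 2 \<le> C * (\<beta> / b) powr \<theta>" using \<nu> by (subst (asm) mult_le_cancel_left_pos) auto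
    then have half: "1 / (2 * C) \<le> (\<beta> / b) powr \<theta>" using C by (simp add: field_simps)
    \<comment> \<open>Passing to \<open>\<theta>\<^sub>0\<close> makes e the same for all admissible
      exponents \<theta>.\<close>
    have "(1 / (2 * C)) powr (1 / \<theta>\<^sub>0) \<le> (1 / (2 * C)) powr (1 / \<theta>)"
      using C \<theta> by (intro powr_mono') (auto simp: frac_le)
    also have "\<dots> \<le> ((\<beta> / b) powr \<theta>) powr (1 / \<theta>)" using half C \<theta> by (intro powr_mono2) auto
    also have "\<dots> = \<beta> / b" using \<theta> \<beta> b by (simp add: powr_powr)
    finally have "2 * e \<le> \<beta> / b" by (simp add: e_def)
    then have eb: "2 * e * b \<le> \<beta>" using b by (simp add: field_simps)
    have "ennreal e * min (emeasure ?v ?B) (ennreal n * emeasure lebesgue ?B) = ennreal (e * min \<nu> (n * b))"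
      unfolding b(2) \<nu>(2) using e n b \<nu> by (simp add: min_def ennreal_mult'[symmetric])
    also have "\<dots> \<le> ennreal (min s n * \<beta>)"
    proof (rule ennreal_leI)
      have "2 * b * s = \<nu>" "0 < n * b" using b n by (simp_all add: s_def)
      then have "min \<nu> (n * b) \<le> 2 * b * min s n" by (auto simp: min_def mult_ac)
      then have "e * min \<nu> (n * b) \<le> e * (2 * b * min s n)" using e by (intro mult_left_mono) auto
      also have "\<dots> = min s n * (2 * e * b)" by simp
      also have "\<dots> \<le> min s n * \<beta>" using s n eb by (intro mult_left_mono) auto
      finally show "e * min \<nu> (n * b) \<le> min s n * \<beta>" .
    qed
    also have "\<dots> = (\<integral>\<^sup>+x. ennreal (min s n) * indicator E x \<partial>lebesgue)"
      using s n \<beta> by (simp add: nn_integral_cmult_indicator ennreal_mult')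
    also have "\<dots> \<le> emeasure ?vn ?B"
    proof (subst emeasure_density; (intro nn_integral_mono)?)
      fix x
      show "ennreal (min s n) * indicator E x \<le> min (V x) (ennreal n) * indicator ?B x"
      proof (cases "x \<in> E")
        case True
        then have "ennreal s \<le> V x" "x \<in> ?B" by (auto simp: E_def)
        moreover have "ennreal (min s n) \<le> ennreal s" "ennreal (min s n) \<le> ennreal n" by (auto intro: ennreal_leI)
        ultimately show ?thesis using True by (auto intro: order_trans)
      qed auto
    qed auto
    finally show ?thesis .
  qed
  show "doubling_measure ?vn (max K (5 ^ DIM('a)) / e)"
  proof
    show "sets ?vn = sets lebesgue" by simp
    fix c :: 'a and \<rho> :: real
    show "emeasure ?vn (ball c \<rho>) < top"
      using vn_le(1)[of "ball c \<rho>"] ball_finite[of c \<rho>] by (auto intro: le_less_trans)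
    assume \<rho>: "0 < \<rho>"
    have "0 < ennreal e * min (emeasure ?v (ball c \<rho>)) (ennreal n * emeasure lebesgue (ball c \<rho>))"
      using e n ball_pos[OF \<rho>, of c] lebesgue_ball_pos[OF \<rho>, of c] by (auto simp: ennreal_zero_less_mult_iff)
    then show "0 < emeasure ?vn (ball c \<rho>)" using key[OF \<rho>, of c] by (rule less_le_trans)
    have "emeasure ?vn (ball c (5 * \<rho>)) \<le> min (emeasure ?v (ball c (5 * \<rho>))) (ennreal n * emeasure lebesgue (ball c (5 * \<rho>)))"
      by (intro min.boundedI vn_le) auto
    also have "\<dots> \<le> min (ennreal (max K (5 ^ DIM('a))) * emeasure ?v (ball c \<rho>)) (ennreal (max K (5 ^ DIM('a))) * (ennreal n * emeasure lebesgue (ball c \<rho>)))"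
    proof (rule min.mono)
      have "emeasure ?v (ball c (5 * \<rho>)) \<le> ennreal K * emeasure ?v (ball c \<rho>)" by (rule doubling[OF \<rho>])
      also have "\<dots> \<le> ennreal (max K (5 ^ DIM('a))) * emeasure ?v (ball c \<rho>)" by (intro mult_right_mono ennreal_leI) auto
      finally show "emeasure ?v (ball c (5 * \<rho>)) \<le> ennreal (max K (5 ^ DIM('a))) * emeasure ?v (ball c \<rho>)" .
      have "ennreal n * emeasure lebesgue (ball c (5 * \<rho>)) = ennreal (5 ^ DIM('a)) * (ennreal n * emeasure lebesgue (ball c \<rho>))"
        using \<rho> by (subst lebesgue_ball_scale) (auto simp: ac_simps)
      also have "\<dots> \<le> ennreal (max K (5 ^ DIM('a))) * (ennreal n * emeasure lebesgue (ball c \<rho>))"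
        by (intro mult_right_mono ennreal_leI) auto
      finally show "ennreal n * emeasure lebesgue (ball c (5 * \<rho>)) \<le> ennreal (max K (5 ^ DIM('a))) * (ennreal n * emeasure lebesgue (ball c \<rho>))" .
    qed
    also have "\<dots> = ennreal (max K (5 ^ DIM('a))) * min (emeasure ?v (ball c \<rho>)) (ennreal n * emeasure lebesgue (ball c \<rho>))"
      by (rule min_mult_distrib_left_ennreal)
    also have "\<dots> = ennreal (max K (5 ^ DIM('a)) / e) * (ennreal e * min (emeasure ?v (ball c \<rho>)) (ennreal n * emeasure lebesgue (ball c \<rho>)))"
      unfolding mult.assoc[symmetric] using e by (subst ennreal_mult''[symmetric]) auto
    also have "\<dots> \<le> ennreal (max K (5 ^ DIM('a)) / e) * emeasure ?vn (ball c \<rho>)"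
      by (intro mult_left_mono key \<rho>) auto
    finally show "emeasure ?vn (ball c (5 * \<rho>)) \<le> ennreal (max K (5 ^ DIM('a)) / e) * emeasure ?vn (ball c \<rho>)" .
  qed
  show "Ainf_measure (C / e) \<theta> ?vn"
    unfolding Ainf_measure_def
  proof (intro allI impI)
    fix c :: 'a and \<rho> :: real and A assume \<rho>: "0 < \<rho>" and A [measurable]: "A \<in> sets lebesgue" and AB: "A \<subseteq> ball c \<rho>"
    let ?B = "ball c \<rho>"
    let ?b = "emeasure lebesgue ?B"
    have b: "0 < ?b" "?b < top" using \<rho> by (auto intro: lebesgue_ball_pos lebesgue_ball_finite)
    let ?x = "(emeasure lebesgue A / ?b) epowr \<theta>"
    have "emeasure ?vn A \<le> min (emeasure ?v A) (ennreal n * emeasure lebesgue A)"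
      by (intro min.boundedI vn_le) auto
    also have "\<dots> \<le> min ((ennreal C * ?x) * emeasure ?v ?B) ((ennreal C * ?x) * (ennreal n * ?b))"
    proof (rule min.mono)
      show "emeasure ?v A \<le> (ennreal C * ?x) * emeasure ?v ?B" by (rule Ainf_measureD[OF ainf \<rho> A AB])
      have le1: "emeasure lebesgue A / ?b \<le> 1"
        using emeasure_mono[OF AB, of lebesgue] by (subst ennreal_divide_le_iff[OF b]) auto
      have "emeasure lebesgue A = ?b * (emeasure lebesgue A / ?b)" by (simp add: ennreal_mult_div_cancel[OF b])
      also have "\<dots> \<le> ?b * (ennreal C * ?x)"
      proof (rule mult_left_mono)
        have "emeasure lebesgue A / ?b = (emeasure lebesgue A / ?b) epowr 1" by simp
        also have "\<dots> \<le> 1 * ?x" using epowr_decreasing[OF le1 \<theta>(3)] by simp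
        also have "\<dots> \<le> ennreal C * ?x" using C by (intro mult_right_mono) (auto simp: ennreal_ge_1)
        finally show "emeasure lebesgue A / ?b \<le> ennreal C * ?x" .
      qed auto
      finally have "ennreal n * emeasure lebesgue A \<le> ennreal n * (?b * (ennreal C * ?x))" by (rule mult_left_mono) simp
      then show "ennreal n * emeasure lebesgue A \<le> (ennreal C * ?x) * (ennreal n * ?b)" by (simp only: ac_simps)
    qed
    also have "\<dots> = (ennreal C * ?x) * min (emeasure ?v ?B) (ennreal n * ?b)"
      by (rule min_mult_distrib_left_ennreal)
    also have "ennreal C = ennreal (C / e) * ennreal e" using e C by (subst ennreal_mult'[symmetric]) auto
    also have "ennreal (C / e) * ennreal e * ?x * min (emeasure ?v ?B) (ennreal n * ?b)
      = ennreal (C / e) * ?x * (ennreal e * min (emeasure ?v ?B) (ennreal n * ?b))" by (simp only: ac_simps)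
    also have "\<dots> \<le> ennreal (C / e) * ?x * emeasure ?vn ?B" by (intro mult_left_mono key \<rho>) auto
    finally show "emeasure ?vn A \<le> ennreal (C / e) * ?x * emeasure ?vn ?B" .
  qed
qed


text \<open>Let J be the sum over the levels \<open>\<Lambda> / 2 ^ i\<close> of their P-th powers
  times the measures of the superlevel sets of X. Adding the good-\<lambda> inequalities gives N J
  \<le> (N/2) J + S Y, where Y is the corresponding sum for G/\<gamma>. The weak bound is there to
  make J finite before it is absorbed; its constant c does not enter the result.\<close>

lemma integral_of_good_lambda:
  fixes v :: "'a measure" and X G :: "'a \<Rightarrow> ennreal" and P \<gamma> n c :: real and N k\<^sub>0 :: nat
  assumes [measurable]: "X \<in> borel_measurable v" "G \<in> borel_measurable v" and sp: "space v = UNIV"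
    and P: "1 < P" and N: "0 < N" and \<gamma>: "0 < \<gamma>"
    and gl: "\<And>l. 0 < l \<Longrightarrow> (\<Sum>k\<in>{k\<^sub>0..<k\<^sub>0 + N}. ennreal ((2 ^ k) powr P) * emeasure v {x. ennreal (2 ^ k * l) < X x \<and> G x \<le> ennreal (\<gamma> * l)})
      \<le> ennreal (real N / 2) * emeasure v {x. ennreal l < X x}"
    and weak: "\<And>l. 0 < l \<Longrightarrow> ennreal l * emeasure v {x. ennreal l < X x} \<le> ennreal c"
  shows "(\<integral>\<^sup>+x. X x epowr P \<partial>v) \<le> ennreal (2 powr P * (2 / real N * ((\<Sum>k\<in>{k\<^sub>0..<k\<^sub>0 + N}. (2 ^ k) powr P) * (1 / (1 - 2 powr - P) / \<gamma> powr P))))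
     * (\<integral>\<^sup>+x. G x epowr P \<partial>v)"
proof (rule nn_integral_epowr_truncation)
  let ?I = "{k\<^sub>0..<k\<^sub>0 + N}"
  have [measurable]: "{x. t < X x} \<in> sets v" "{x. t < G x} \<in> sets v" "{x. t < X x \<and> G x \<le> s} \<in> sets v"
    "{x. t < s * G x} \<in> sets v" for s t
  proof -
    have "{x \<in> space v. t < X x} \<in> sets v" "{x \<in> space v. t < G x} \<in> sets v" "{x \<in> space v. t < X x \<and> G x \<le> s} \<in> sets v"
      "{x \<in> space v. t < s * G x} \<in> sets v"
      by measurable
    then show "{x. t < X x} \<in> sets v" "{x. t < G x} \<in> sets v" "{x. t < X x \<and> G x \<le> s} \<in> sets v"
      "{x. t < s * G x} \<in> sets v" by (simp_all add: sp)
  qed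
  fix \<Lambda> :: real assume \<Lambda>: "0 < \<Lambda>"
  define level where "level i = \<Lambda> / 2 ^ i" for i :: nat
  have level: "0 < level i" for i using \<Lambda> by (simp add: level_def)
  define J where "J = (\<Sum>i. ennreal (level i powr P) * emeasure v {x. ennreal (level i) < X x})"
  define Y where "Y = (\<Sum>i. ennreal (level i powr P) * emeasure v {x. ennreal (\<gamma> * level i) < G x})"
  have cP: "2 powr - P < 1" using P by (auto intro: powr_less_one)
  have J_eq: "J = (\<integral>\<^sup>+x. 1 * dyadic_layers P \<Lambda> (X x) \<partial>v)"
    unfolding J_def level_def by (subst nn_integral_dyadic_layers) auto
  have Y_le: "Y \<le> ennreal (1 / (1 - 2 powr - P) / \<gamma> powr P) * (\<integral>\<^sup>+x. G x epowr P \<partial>v)"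
  proof -
    have "ennreal (\<gamma> * level i) < G x \<longleftrightarrow> ennreal (level i) < ennreal (1 / \<gamma>) * G x" for i x
      using \<gamma> level[of i] by (cases "G x") (auto simp: ennreal_mult'[symmetric] ennreal_less_iff field_simps ennreal_mult_top)
    then have "Y = (\<integral>\<^sup>+x. 1 * dyadic_layers P \<Lambda> (ennreal (1 / \<gamma>) * G x) \<partial>v)"
      unfolding Y_def level_def by (subst nn_integral_dyadic_layers) auto
    also have "\<dots> \<le> (\<integral>\<^sup>+x. ennreal (1 / (1 - 2 powr - P)) * (ennreal (1 / \<gamma>) * G x) epowr P \<partial>v)"
      using P \<Lambda> by (intro nn_integral_mono) (simp add: dyadic_layers_upper)
    also have "\<dots> = (\<integral>\<^sup>+x. ennreal (1 / (1 - 2 powr - P) / \<gamma> powr P) * G x epowr P \<partial>v)"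
    proof (rule nn_integral_cong)
      fix x
      have "(ennreal (1 / \<gamma>) * G x) epowr P = ennreal (1 / \<gamma> powr P) * G x epowr P"
        using P \<gamma> by (simp add: epowr_mult ennreal_epowr powr_divide)
      moreover have "ennreal (1 / (1 - 2 powr - P)) * ennreal (1 / \<gamma> powr P) = ennreal (1 / (1 - 2 powr - P) / \<gamma> powr P)"
        using cP by (subst ennreal_mult'[symmetric]) auto
      ultimately show "ennreal (1 / (1 - 2 powr - P)) * (ennreal (1 / \<gamma>) * G x) epowr P = ennreal (1 / (1 - 2 powr - P) / \<gamma> powr P) * G x epowr P"
        by (simp only: mult.assoc[symmetric])
    qed
    also have "\<dots> = ennreal (1 / (1 - 2 powr - P) / \<gamma> powr P) * (\<integral>\<^sup>+x. G x epowr P \<partial>v)"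
      by (rule nn_integral_cmult) measurable
    finally show ?thesis .
  qed
  \<comment> \<open>One factor of each level goes into the weak bound; the remaining powers of order
    P - 1 > 0 are summable.\<close>
  have J_fin: "J < top"
  proof -
    have q: "0 \<le> 2 powr (1 - P)" "2 powr (1 - P) < 1" using P by (auto intro: powr_less_one)
    have "J \<le> (\<Sum>i. ennreal (\<Lambda> powr (P - 1) * c) * ennreal ((2 powr (1 - P)) ^ i))"
      unfolding J_def
    proof (intro suminf_le)
      fix i
      have "level i powr P = level i powr (P - 1) * level i" using level[of i] by (simp add: powr_diff)
      then have "ennreal (level i powr P) * emeasure v {x. ennreal (level i) < X x}
        = ennreal (level i powr (P - 1)) * (ennreal (level i) * emeasure v {x. ennreal (level i) < X x})"
        by (simp only: ennreal_mult' powr_ge_zero mult.assoc)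
      also have "\<dots> \<le> ennreal (level i powr (P - 1)) * ennreal c" by (intro mult_left_mono weak level) auto
      also have "level i powr (P - 1) = \<Lambda> powr (P - 1) * (2 powr (1 - P)) ^ i"
      proof -
        have "(2 powr (1 - P)) ^ i = 2 powr ((1 - P) * real i)" by (simp add: powr_powr powr_realpow[symmetric])
        also have "\<dots> = inverse (2 powr (real i * (P - 1)))" by (simp add: powr_minus[symmetric] algebra_simps)
        also have "2 powr (real i * (P - 1)) = (2 ^ i) powr (P - 1)" by (simp add: powr_powr powr_realpow[symmetric])
        finally show ?thesis unfolding level_def by (subst powr_divide) (use \<Lambda> in \<open>auto simp: divide_inverse\<close>)
      qed
      also have "ennreal (\<Lambda> powr (P - 1) * (2 powr (1 - P)) ^ i) * ennreal c = ennreal (\<Lambda> powr (P - 1) * c) * ennreal ((2 powr (1 - P)) ^ i)"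
        by (simp add: ennreal_mult' ennreal_mult'' mult_ac)
      finally show "ennreal (level i powr P) * emeasure v {x. ennreal (level i) < X x} \<le> ennreal (\<Lambda> powr (P - 1) * c) * ennreal ((2 powr (1 - P)) ^ i)" .
    qed auto
    also have "\<dots> = ennreal (\<Lambda> powr (P - 1) * c) * ennreal (1 / (1 - 2 powr (1 - P)))"
      by (subst ennreal_suminf_cmult, subst ennreal_geometric[OF q]) simp
    also have "\<dots> < top" by (simp add: ennreal_mult_less_top)
    finally show ?thesis .
  qed
  define S where "S = (\<Sum>k\<in>?I. (2 ^ k) powr P)"
  have S: "0 \<le> S" unfolding S_def by (intro sum_nonneg) auto
  \<comment> \<open>For every k the level sum with 2^k times the level and the factor 2^(kP)
    contains J, shifted by k places: \<open>level i\<close> equals 2^k times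
    \<open>level (i + k)\<close>.\<close>
  have "ennreal (real N) * J = (\<Sum>k\<in>?I. J)" by (simp add: ennreal_of_nat_eq_real_of_nat)
  also have "\<dots> \<le> (\<Sum>k\<in>?I. \<Sum>i. ennreal (level i powr P) * (ennreal ((2 ^ k) powr P) * emeasure v {x. ennreal (2 ^ k * level i) < X x}))"
  proof (rule sum_mono)
    fix k
    let ?f = "\<lambda>i. ennreal (level i powr P) * (ennreal ((2 ^ k) powr P) * emeasure v {x. ennreal (2 ^ k * level i) < X x})"
    have "J = (\<Sum>i. ?f (i + k))"
      unfolding J_def
    proof (intro arg_cong[of _ _ suminf] ext)
      fix i
      have l: "2 ^ k * level (i + k) = level i" by (simp add: level_def power_add)
      have "level i powr P = level (i + k) powr P * (2 ^ k) powr P"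
        unfolding l[symmetric] using level[of "i + k"] by (simp add: powr_mult)
      then show "ennreal (level i powr P) * emeasure v {x. ennreal (level i) < X x} = ?f (i + k)"
        unfolding l by (simp only: ennreal_mult' powr_ge_zero mult.assoc)
    qed
    also have "\<dots> \<le> (\<Sum>i. ?f (i + k)) + (\<Sum>i<k. ?f i)" by simp
    also have "\<dots> = (\<Sum>i. ?f i)" by (rule suminf_offset[symmetric]) auto
    finally show "J \<le> (\<Sum>i. ?f i)" .
  qed
  also have "\<dots> = (\<Sum>i. \<Sum>k\<in>?I. ennreal (level i powr P) * (ennreal ((2 ^ k) powr P) * emeasure v {x. ennreal (2 ^ k * level i) < X x}))"
    by (rule suminf_sum[symmetric]) auto
  also have "\<dots> \<le> (\<Sum>i. ennreal (real N / 2) * (ennreal (level i powr P) * emeasure v {x. ennreal (level i) < X x})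
      + ennreal S * (ennreal (level i powr P) * emeasure v {x. ennreal (\<gamma> * level i) < G x}))"
  proof (intro suminf_le)
    fix i
    let ?g = "emeasure v {x. ennreal (\<gamma> * level i) < G x}"
    have "(\<Sum>k\<in>?I. ennreal ((2 ^ k) powr P) * emeasure v {x. ennreal (2 ^ k * level i) < X x})
      \<le> (\<Sum>k\<in>?I. ennreal ((2 ^ k) powr P) * emeasure v {x. ennreal (2 ^ k * level i) < X x \<and> G x \<le> ennreal (\<gamma> * level i)} + ennreal ((2 ^ k) powr P) * ?g)"
    proof (rule sum_mono)
      fix k :: nat
      have "emeasure v {x. ennreal (2 ^ k * level i) < X x}
        \<le> emeasure v ({x. ennreal (2 ^ k * level i) < X x \<and> G x \<le> ennreal (\<gamma> * level i)} \<union> {x. ennreal (\<gamma> * level i) < G x})"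
        by (intro emeasure_mono) (auto simp: not_less)
      also have "\<dots> \<le> emeasure v {x. ennreal (2 ^ k * level i) < X x \<and> G x \<le> ennreal (\<gamma> * level i)} + ?g"
        by (intro emeasure_subadditive) auto
      finally have le: "emeasure v {x. ennreal (2 ^ k * level i) < X x}
        \<le> emeasure v {x. ennreal (2 ^ k * level i) < X x \<and> G x \<le> ennreal (\<gamma> * level i)} + ?g" .
      show "ennreal ((2 ^ k) powr P) * emeasure v {x. ennreal (2 ^ k * level i) < X x}
        \<le> ennreal ((2 ^ k) powr P) * emeasure v {x. ennreal (2 ^ k * level i) < X x \<and> G x \<le> ennreal (\<gamma> * level i)} + ennreal ((2 ^ k) powr P) * ?g"
        unfolding distrib_left[symmetric] by (intro mult_left_mono le) simp
    qed
    also have "\<dots> \<le> ennreal (real N / 2) * emeasure v {x. ennreal (level i) < X x} + ennreal S * ?g"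
      unfolding sum.distrib sum_distrib_right[symmetric] S_def
      by (subst sum_ennreal) (auto intro!: add_mono gl level)
    finally have "ennreal (level i powr P) * (\<Sum>k\<in>?I. ennreal ((2 ^ k) powr P) * emeasure v {x. ennreal (2 ^ k * level i) < X x})
      \<le> ennreal (level i powr P) * (ennreal (real N / 2) * emeasure v {x. ennreal (level i) < X x} + ennreal S * ?g)"
      by (rule mult_left_mono) simp
    then show "(\<Sum>k\<in>?I. ennreal (level i powr P) * (ennreal ((2 ^ k) powr P) * emeasure v {x. ennreal (2 ^ k * level i) < X x}))
      \<le> ennreal (real N / 2) * (ennreal (level i powr P) * emeasure v {x. ennreal (level i) < X x}) + ennreal S * (ennreal (level i powr P) * ?g)"
      by (simp only: sum_distrib_left distrib_left mult.left_commute)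
  qed auto
  also have "\<dots> = ennreal (real N / 2) * J + ennreal S * Y"
    unfolding J_def Y_def by (subst suminf_add[symmetric]) (auto simp: ennreal_suminf_cmult)
  finally have main: "ennreal (real N) * J \<le> ennreal (real N / 2) * J + ennreal S * Y" .
  have J_le: "J \<le> ennreal (2 / real N) * (ennreal S * Y)"
  proof -
    obtain j where j: "0 \<le> j" "J = ennreal j" using J_fin by (cases J) auto
    show ?thesis
    proof (cases "ennreal S * Y")
      case (real w)
      have "ennreal (real N * j) \<le> ennreal (real N / 2 * j + w)"
        using main real j by (simp add: ennreal_mult' ennreal_plus[symmetric] del: ennreal_plus) (simp add: ennreal_mult'[symmetric] ennreal_plus[symmetric] del: ennreal_plus)
      then have "real N * j \<le> real N / 2 * j + w" using j real by (subst (asm) ennreal_le_iff) auto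
      then have "j \<le> 2 / real N * w" using N by (simp add: field_simps)
      then show ?thesis using real j N by (simp add: ennreal_mult'[symmetric] ennreal_leI)
    next
      case top
      then show ?thesis using N by (simp add: ennreal_mult_top)
    qed
  qed
  have "(\<integral>\<^sup>+x. min (X x) (ennreal \<Lambda>) epowr P \<partial>v) \<le> (\<integral>\<^sup>+x. ennreal (2 powr P) * dyadic_layers P \<Lambda> (X x) \<partial>v)"
    using P \<Lambda> by (intro nn_integral_mono dyadic_layers_lower) auto
  also have "\<dots> = ennreal (2 powr P) * J" unfolding J_eq by (simp add: nn_integral_cmult)
  also have "\<dots> \<le> ennreal (2 powr P) * (ennreal (2 / real N) * (ennreal S * (ennreal (1 / (1 - 2 powr - P) / \<gamma> powr P) * (\<integral>\<^sup>+x. G x epowr P \<partial>v))))"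
    by (intro mult_left_mono order_trans[OF J_le] Y_le) auto
  also have "\<dots> = ennreal (2 powr P * (2 / real N * (S * (1 / (1 - 2 powr - P) / \<gamma> powr P)))) * (\<integral>\<^sup>+x. G x epowr P \<partial>v)"
    using S by (simp only: ennreal_mult' powr_ge_zero mult.assoc of_nat_0_le_iff divide_nonneg_nonneg zero_le_numeral)
  finally show "(\<integral>\<^sup>+x. min (X x) (ennreal \<Lambda>) epowr P \<partial>v)
    \<le> ennreal (2 powr P * (2 / real N * ((\<Sum>k\<in>?I. (2 ^ k) powr P) * (1 / (1 - 2 powr - P) / \<gamma> powr P)))) * (\<integral>\<^sup>+x. G x epowr P \<partial>v)"
    unfolding S_def .
qed (use P in auto)

text \<open>The density truncated at m + 1 is dominated by (m + 1) dx, so integrability of F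
  provides the weak bound that permits absorption. The constants for the truncated weights do not
  depend on m, and monotone convergence removes the truncation. The numbers \<epsilon> and B precede
  F, G and V.\<close>

theorem weighted_maximal_inequality:
  fixes q P a C K :: real
  assumes q: "1 < q" and P: "1 < P" "P < q" and a: "1 \<le> a" and C: "1 \<le> C" and K: "1 \<le> K"
  obtains \<epsilon> B where "0 < \<epsilon>" "\<epsilon> \<le> P / q / 2"
    "\<forall>(F :: 'a::euclidean_space \<Rightarrow> ennreal) G V.
      good_decomposition a q F G \<longrightarrow> V \<in> borel_measurable lebesgue \<longrightarrow> doubling_measure (density lebesgue V) K \<longrightarrow>
      Ainf_measure C (P / q - \<epsilon>) (density lebesgue V) \<longrightarrow>
      (\<integral>\<^sup>+x. V x * maximal_fun lebesgue F x epowr P \<partial>lebesgue) \<le> ennreal B * (\<integral>\<^sup>+x. V x * G x epowr P \<partial>lebesgue)"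
proof -
  define \<theta>\<^sub>0 where "\<theta>\<^sub>0 = P / q / 2"
  have \<theta>\<^sub>0: "0 < \<theta>\<^sub>0" using P q by (simp add: \<theta>\<^sub>0_def)
  define e where "e = (1 / (2 * C)) powr (1 / \<theta>\<^sub>0) / 2"
  have e: "0 < e" "e \<le> 1"
  proof -
    have "(1 / (2 * C)) powr (1 / \<theta>\<^sub>0) \<le> 1" using C \<theta>\<^sub>0 by (intro powr_le1) auto
    then show "0 < e" "e \<le> 1" using C by (auto simp: e_def)
  qed
  \<comment> \<open>The good-\<lambda> inequality is set up for the constants of the truncated
    weights, so that \<epsilon>, N and \<gamma> serve all of them.\<close>
  have C': "1 \<le> C / e" and K': "1 \<le> max K (5 ^ DIM('a)) / e" using C K e by (auto simp: le_divide_eq)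
  obtain \<epsilon> N \<gamma> where \<epsilon>: "0 < \<epsilon>" "\<epsilon> \<le> P / q / 2" and N: "0 < (N::nat)" and \<gamma>: "0 < \<gamma>" and
    gl: "\<forall>(F :: 'a \<Rightarrow> ennreal) G v l.
      good_decomposition a q F G \<longrightarrow> doubling_measure v (max K (5 ^ DIM('a)) / e) \<longrightarrow> Ainf_measure (C / e) (P / q - \<epsilon>) v \<longrightarrow> 0 < l \<longrightarrow>
      (\<Sum>k\<in>{3 * DIM('a)..<3 * DIM('a) + N}. ennreal ((2 ^ k) powr P) *
          emeasure v {x. ennreal (2 ^ k * l) < maximal_fun lebesgue F x \<and> G x \<le> ennreal (\<gamma> * l)})
      \<le> ennreal (real N / 2) * emeasure v {x. ennreal l < maximal_fun lebesgue F x}"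
    using good_lambda[where ?'a = 'a, OF q order.strict_trans[OF zero_less_one P(1)] P(2) a C' K'] by blast
  define B where "B = 2 powr P * (2 / real N * ((\<Sum>k\<in>{3 * DIM('a)..<3 * DIM('a) + N}. (2 ^ k) powr P) * (1 / (1 - 2 powr - P) / \<gamma> powr P)))"
  show thesis
  proof (rule that[of \<epsilon> B]; (intro allI impI)?)
    show "0 < \<epsilon>" "\<epsilon> \<le> P / q / 2" by fact+
    fix F G V :: "'a \<Rightarrow> ennreal"
    assume gd: "good_decomposition a q F G" and [measurable]: "V \<in> borel_measurable lebesgue"
      and dbl: "doubling_measure (density lebesgue V) K" and ainf: "Ainf_measure C (P / q - \<epsilon>) (density lebesgue V)"
    have [measurable]: "F \<in> borel_measurable lebesgue" "G \<in> borel_measurable lebesgue" and F: "(\<integral>\<^sup>+x. F x \<partial>lebesgue) < top"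
      using gd by (auto simp: good_decomposition_def)
    let ?MF = "maximal_fun lebesgue F"
    have MF [measurable]: "?MF \<in> borel_measurable lebesgue" by (rule measurable_maximal_fun) simp
    obtain f where f: "0 \<le> f" "(\<integral>\<^sup>+x. F x \<partial>lebesgue) = ennreal f" using F by (cases "\<integral>\<^sup>+x. F x \<partial>lebesgue") auto
    let ?V = "\<lambda>m x. min (V x) (ennreal (real (Suc m)))"
    have trunc: "(\<integral>\<^sup>+x. ?V m x * ?MF x epowr P \<partial>lebesgue) \<le> ennreal B * (\<integral>\<^sup>+x. V x * G x epowr P \<partial>lebesgue)" for m
    proof -
      let ?v = "density lebesgue (?V m)"
      have \<theta>: "\<theta>\<^sub>0 \<le> P / q - \<epsilon>" "P / q - \<epsilon> \<le> 1"
        using \<epsilon> P q by (auto simp: \<theta>\<^sub>0_def) (smt (verit) divide_le_eq_1_pos)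
      have v: "doubling_measure ?v (max K (5 ^ DIM('a)) / e)" "Ainf_measure (C / e) (P / q - \<epsilon>) ?v"
        unfolding e_def using truncated_weight[OF _ dbl ainf \<theta>\<^sub>0 \<theta> C, of "real (Suc m)"] by (auto simp del: of_nat_Suc)
      have "(\<integral>\<^sup>+x. ?MF x epowr P \<partial>?v) \<le> ennreal B * (\<integral>\<^sup>+x. G x epowr P \<partial>?v)"
        unfolding B_def
      proof (rule integral_of_good_lambda)
        show "(\<Sum>k\<in>{3 * DIM('a)..<3 * DIM('a) + N}. ennreal ((2 ^ k) powr P) *
            emeasure ?v {x. ennreal (2 ^ k * l) < ?MF x \<and> G x \<le> ennreal (\<gamma> * l)})
          \<le> ennreal (real N / 2) * emeasure ?v {x. ennreal l < ?MF x}" if "0 < l" for l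
          using gl gd v that by blast
        show "ennreal l * emeasure ?v {x. ennreal l < ?MF x} \<le> ennreal (real (Suc m) * (5 ^ DIM('a) * f))" if l: "0 < l" for l
        proof -
          have [measurable]: "{x. ennreal l < ?MF x} \<in> sets lebesgue" by (intro lebesgue.open_sets open_superlevel_maximal_fun)
          have "emeasure ?v {x. ennreal l < ?MF x} \<le> (\<integral>\<^sup>+x. ennreal (real (Suc m)) * indicator {x. ennreal l < ?MF x} x \<partial>lebesgue)"
            by (subst emeasure_density) (auto intro!: nn_integral_mono mult_right_mono)
          also have "\<dots> = ennreal (real (Suc m)) * emeasure lebesgue {x. ennreal l < ?MF x}"
            by (rule nn_integral_cmult_indicator) measurable
          finally have "ennreal l * emeasure ?v {x. ennreal l < ?MF x} \<le> ennreal (real (Suc m)) * (ennreal l * emeasure lebesgue {x. ennreal l < ?MF x})"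
            by (subst mult.left_commute) (rule mult_left_mono, auto)
          also have "\<dots> \<le> ennreal (real (Suc m)) * (ennreal (5 ^ DIM('a)) * ennreal f)"
            unfolding f(2)[symmetric] using l by (intro mult_left_mono lebesgue.weak_type) auto
          also have "\<dots> = ennreal (real (Suc m) * (5 ^ DIM('a) * f))"
            using f by (simp only: ennreal_mult' of_nat_0_le_iff zero_le_power zero_le_numeral mult_nonneg_nonneg)
          finally show ?thesis .
        qed
      qed (use P N \<gamma> in auto)
      then have "(\<integral>\<^sup>+x. ?V m x * ?MF x epowr P \<partial>lebesgue) \<le> ennreal B * (\<integral>\<^sup>+x. ?V m x * G x epowr P \<partial>lebesgue)"
        by (simp add: nn_integral_density del: of_nat_Suc)
      also have "\<dots> \<le> ennreal B * (\<integral>\<^sup>+x. V x * G x epowr P \<partial>lebesgue)"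
        by (intro mult_left_mono nn_integral_mono mult_right_mono) auto
      finally show ?thesis .
    qed
    have "(\<integral>\<^sup>+x. V x * ?MF x epowr P \<partial>lebesgue) = (\<integral>\<^sup>+x. (SUP m. ?V m x * ?MF x epowr P) \<partial>lebesgue)"
      by (simp add: SUP_mult_right_ennreal[symmetric] min_of_nat_SUP del: of_nat_Suc)
    also have "\<dots> = (SUP m. \<integral>\<^sup>+x. ?V m x * ?MF x epowr P \<partial>lebesgue)"
      by (rule nn_integral_monotone_convergence_SUP)
        (auto simp: incseq_def le_fun_def intro!: mult_right_mono min.mono ennreal_leI simp del: of_nat_Suc)
    also have "\<dots> \<le> ennreal B * (\<integral>\<^sup>+x. V x * G x epowr P \<partial>lebesgue)"
      by (intro SUP_least trunc)
    finally show "(\<integral>\<^sup>+x. V x * ?MF x epowr P \<partial>lebesgue) \<le> ennreal B * (\<integral>\<^sup>+x. V x * G x epowr P \<partial>lebesgue)" .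
  qed
qed

subsection \<open>Extrapolation\<close>

text \<open>
  If \<open>maximal_fun \<le> a < b \<le> g\<close> on a set \<open>E\<close> of positive measure, then Vitali balls inside an
  open neighbourhood of \<open>E\<close> of almost the same measure give \<open>b |E| \<le> a |E|\<close>.
\<close>

lemma (in doubling_measure) le_maximal_fun_AE:
  assumes ainf: "Ainf_measure C \<theta> M" and \<theta>: "0 < \<theta>" and [measurable]: "g \<in> borel_measurable M"
  shows "AE x in M. g x \<le> maximal_fun M g x"
proof -
  have null: "emeasure M ({x. maximal_fun M g x \<le> ennreal a \<and> ennreal b \<le> g x} \<inter> ball 0 (real n)) = 0"
    (is "emeasure M ?E = 0") if ab: "0 \<le> a" "a < b" for a b :: real and n
  proof (rule ccontr)
    assume "emeasure M ?E \<noteq> 0"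
    have "{x \<in> space M. maximal_fun M g x \<le> ennreal a \<and> ennreal b \<le> g x} \<in> sets M" by measurable
    then have E [measurable]: "?E \<in> sets M" by (simp add: space_M)
    have n: "0 < real n" using \<open>emeasure M ?E \<noteq> 0\<close> by (cases "n = 0") auto
    let ?B = "ball (0::'a) (real n)"
    obtain \<beta> where \<beta>: "0 < \<beta>" "emeasure lebesgue ?B = ennreal \<beta>"
      using lebesgue_ball_pos[OF n, of "0::'a"] lebesgue_ball_finite[of "0::'a" "real n"]
      by (cases "emeasure lebesgue ?B" rule: ennreal_cases_pos) auto
    obtain \<nu> where \<nu>: "0 < \<nu>" "emeasure M ?B = ennreal \<nu>"
      using ball_pos[OF n, of 0] ball_finite[of 0 "real n"]
      by (cases "emeasure M ?B" rule: ennreal_cases_pos) auto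
    have "emeasure M ?E \<le> emeasure M (ball (0::'a) (real n))"
      by (intro emeasure_mono) auto
    then have fin: "emeasure M ?E < top"
      using ball_finite[of "0::'a" "real n"] by (rule le_less_trans)
    then obtain e where e: "0 < e" "emeasure M ?E = ennreal e"
      using \<open>emeasure M ?E \<noteq> 0\<close> by (cases "emeasure M ?E" rule: ennreal_cases_pos) auto
    \<comment> \<open>An excess of measure small enough that a d < (b - a) e, which contradicts b e
      \<le> a (e + d).\<close>
    define d where "d = e * (b - a) / 2 / (a + 1)"
    have d: "0 < d" using e ab by (auto simp: d_def)
    have a1: "a + 1 \<noteq> 0" using ab by simp
    define C' where "C' = max C 1"
    \<comment> \<open>Outer approximation is available for Lebesgue measure; the A_\<infinity>
      condition turns an excess \<delta> there into an excess d for M.\<close>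
    define \<delta> where "\<delta> = \<beta> * (d / (C' * \<nu>)) powr (1 / \<theta>)"
    have \<delta>: "0 < \<delta>" using \<beta> \<nu> d by (simp add: \<delta>_def C'_def)
    obtain T\<^sub>0 where T\<^sub>0: "open T\<^sub>0" "?E \<subseteq> T\<^sub>0" "T\<^sub>0 - ?E \<in> lmeasurable" "emeasure lebesgue (T\<^sub>0 - ?E) < ennreal \<delta>"
      using sets_lebesgue_outer_open[of ?E \<delta>] \<delta> E by (auto simp: sets_M)
    define T where "T = T\<^sub>0 \<inter> ?B"
    have T: "open T" "?E \<subseteq> T" using T\<^sub>0 by (auto simp: T_def)
    have mT: "T \<in> sets M" using T by (intro open_sets)
    then have TE_sets: "T - ?E \<in> sets lebesgue" "T - ?E \<in> sets M" using E by (auto simp: sets_M)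
    have small: "emeasure M (T - ?E) \<le> ennreal d"
    proof -
      have "emeasure M (T - ?E) \<le> ennreal C * (emeasure lebesgue (T - ?E) / emeasure lebesgue ?B) epowr \<theta> * emeasure M ?B"
        by (rule Ainf_measureD[OF ainf n TE_sets(1)]) (auto simp: T_def)
      also have "\<dots> \<le> ennreal C' * ennreal (\<delta> / \<beta>) epowr \<theta> * emeasure M ?B"
      proof (intro mult_mono epowr_mono)
        have "emeasure lebesgue (T - ?E) \<le> emeasure lebesgue (T\<^sub>0 - ?E)"
          using T\<^sub>0 by (intro emeasure_mono) (auto simp: T_def)
        then have "emeasure lebesgue (T - ?E) / emeasure lebesgue ?B \<le> ennreal \<delta> / ennreal \<beta>"
          using T\<^sub>0 \<beta> by (auto intro!: divide_right_mono_ennreal)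
        then show "emeasure lebesgue (T - ?E) / emeasure lebesgue ?B \<le> ennreal (\<delta> / \<beta>)"
          using \<beta> \<delta> by (simp add: divide_ennreal)
      qed (use \<theta> in \<open>auto simp: C'_def intro: ennreal_leI\<close>)
      also have "\<dots> = ennreal (C' * (\<delta> / \<beta>) powr \<theta> * \<nu>)"
        using \<beta> \<nu> \<delta> by (simp add: ennreal_epowr ennreal_mult' C'_def)
      also have "(\<delta> / \<beta>) powr \<theta> = d / (C' * \<nu>)"
        using \<beta> \<theta> d \<nu> by (simp add: \<delta>_def powr_powr C'_def)
      also have "C' * (d / (C' * \<nu>)) * \<nu> = d" using \<nu> by (simp add: C'_def)
      finally show ?thesis .
    qed
    have TE: "emeasure M T \<le> ennreal (e + d)"
    proof -
      have "emeasure M T \<le> emeasure M (?E \<union> (T - ?E))"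
        by (intro emeasure_mono sets.Un E TE_sets) auto
      also have "\<dots> \<le> emeasure M ?E + emeasure M (T - ?E)"
        using TE_sets by (intro emeasure_subadditive) auto
      also have "\<dots> \<le> ennreal e + ennreal d" using small e by (intro add_mono) auto
      finally show ?thesis using e d by simp
    qed
    \<comment> \<open>The centres lie in E, where the maximal function is at most a; hence so is the
      average of g over each of these balls.\<close>
    define I where "I = {(c, \<rho>). 0 < \<rho> \<and> ball c \<rho> \<subseteq> T \<and> c \<in> ?E}"
    obtain J where J: "countable J" "J \<subseteq> I"
      "pairwise (\<lambda>i j. disjnt (ball (fst i) (snd i)) (ball (fst j) (snd j))) J"
      "negligible (?E - (\<Union>i \<in> J. ball (fst i) (snd i)))"
    proof (rule Vitali_covering_theorem_balls[of ?E I fst snd])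
      fix x :: 'a and d' :: real assume x: "x \<in> ?E" "0 < d'"
      then obtain \<rho> where "0 < \<rho>" "ball x \<rho> \<subseteq> T"
        using openE[OF T(1), of x] T(2) by blast
      then show "\<exists>i. i \<in> I \<and> x \<in> ball (fst i) (snd i) \<and> snd i < d'"
        using x by (intro exI[of _ "(x, min \<rho> (d' / 2))"]) (auto simp: I_def)
    qed (rule that)
    let ?U = "\<Union>i \<in> J. ball (fst i) (snd i)"
    have disj: "disjoint_family_on (\<lambda>i. ball (fst i) (snd i)) J"
      using J(3) by (auto simp: disjoint_family_on_def pairwise_def disjnt_def)
    have [measurable]: "?U \<in> sets M" by (intro open_sets) auto
    have "ennreal b * ennreal e \<le> (\<integral>\<^sup>+x. ennreal b * indicator ?E x \<partial>M)"
      using e by (simp add: nn_integral_cmult_indicator)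
    also have "\<dots> \<le> (\<integral>\<^sup>+x\<in>?U. g x \<partial>M)"
    proof (rule nn_integral_mono_AE)
      have "AE x in M. x \<notin> ?E - ?U"
      proof (intro AE_not_in null_setsI)
        have "?E - ?U \<in> null_sets lebesgue" using J(4) by (simp add: negligible_iff_null_sets)
        then have "?E - ?U \<in> sets lebesgue" "emeasure lebesgue (?E - ?U) = 0" by auto
        \<comment> \<open>The covering is complete up to a Lebesgue null set. The A_\<infinity>
          condition with \<theta> > 0 makes M absolutely continuous.\<close>
        then have "emeasure M (?E - ?U) \<le> 0"
          using Ainf_measureD[OF ainf n, of "?E - ?U" 0] \<theta> by auto
        then show "emeasure M (?E - ?U) = 0" by simp
        show "?E - ?U \<in> sets M" by measurable
      qed
      then show "AE x in M. ennreal b * indicator ?E x \<le> g x * indicator ?U x"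
        by eventually_elim (auto split: split_indicator)
    qed
    also have "\<dots> = emeasure (density M g) ?U"
      by (subst emeasure_density) auto
    also have "\<dots> = (\<integral>\<^sup>+i. emeasure (density M g) (ball (fst i) (snd i)) \<partial>count_space J)"
      by (intro emeasure_UN_countable disj J) auto
    also have "\<dots> \<le> (\<integral>\<^sup>+i. ennreal a * emeasure M (ball (fst i) (snd i)) \<partial>count_space J)"
    proof (rule nn_integral_mono)
      fix i assume "i \<in> space (count_space J)"
      then obtain c \<rho> where i: "i = (c, \<rho>)" "0 < \<rho>" "c \<in> ?E" using J by (cases i) (auto simp: I_def)
      have "(\<integral>\<^sup>+y\<in>ball c \<rho>. g y \<partial>M) / emeasure M (ball c \<rho>) \<le> ennreal a"
        using i maximal_fun_upper[of \<rho> c c M g] by auto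
      then have "(\<integral>\<^sup>+y\<in>ball c \<rho>. g y \<partial>M) \<le> emeasure M (ball c \<rho>) * ennreal a"
        using i by (subst (asm) ennreal_divide_le_iff) (auto simp: ball_pos ball_finite)
      then show "emeasure (density M g) (ball (fst i) (snd i)) \<le> ennreal a * emeasure M (ball (fst i) (snd i))"
        using i by (simp add: emeasure_density mult.commute)
    qed
    also have "\<dots> = ennreal a * (\<integral>\<^sup>+i. emeasure M (ball (fst i) (snd i)) \<partial>count_space J)"
      by (intro nn_integral_cmult) auto
    also have "(\<integral>\<^sup>+i. emeasure M (ball (fst i) (snd i)) \<partial>count_space J) = emeasure M ?U"
      by (intro emeasure_UN_countable[symmetric] disj J) auto
    also have "ennreal a * emeasure M ?U \<le> ennreal a * ennreal (e + d)"
    proof -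
      have "?U \<subseteq> T" using J by (auto simp: I_def subset_iff)
      then have "emeasure M ?U \<le> emeasure M T" using mT by (intro emeasure_mono) auto
      then show ?thesis using TE by (intro mult_left_mono) auto
    qed
    finally have "b * e \<le> a * (e + d)"
      using ab e d by (simp add: ennreal_mult'[symmetric] ennreal_plus[symmetric] del: ennreal_plus)
    moreover have "a * d < (b - a) * e"
    proof -
      have "a * d \<le> (a + 1) * d" using d by simp
      also have "\<dots> = e * (b - a) / 2"
        using a1 by (metis d_def nonzero_mult_div_cancel_left times_divide_eq_right)
      also have "\<dots> < (b - a) * e" using ab e by simp
      finally show ?thesis .
    qed
    ultimately show False by (simp add: algebra_simps)
  qed
  \<comment> \<open>Countably many triples of a, b and n exhaust the set where the maximal function
    is smaller than g.\<close>
  have "AE x in M. \<forall>a\<in>\<rat>. \<forall>b\<in>\<rat>. \<forall>n::nat. 0 \<le> a \<longrightarrow> a < b \<longrightarrow>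
      x \<notin> {x. maximal_fun M g x \<le> ennreal a \<and> ennreal b \<le> g x} \<inter> ball 0 (real n)"
    unfolding AE_ball_countable[OF countable_rat] AE_all_countable
  proof (intro ballI allI)
    fix a b :: real and n :: nat
    let ?S = "{x. maximal_fun M g x \<le> ennreal a \<and> ennreal b \<le> g x} \<inter> ball 0 (real n)"
    have "{x \<in> space M. maximal_fun M g x \<le> ennreal a \<and> ennreal b \<le> g x} \<in> sets M" by measurable
    then have [measurable]: "?S \<in> sets M" by (simp add: space_M)
    show "AE x in M. 0 \<le> a \<longrightarrow> a < b \<longrightarrow> x \<notin> ?S"
    proof (cases "0 \<le> a \<and> a < b")
      case True
      then have "?S \<in> null_sets M" using null by (intro null_setsI) auto
      then show ?thesis by (auto dest: AE_not_in)
    qed auto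
  qed
  then show ?thesis
  proof eventually_elim
    case (elim x)
    show ?case
    proof (rule ccontr)
      assume "\<not> ?thesis"
      then have lt: "maximal_fun M g x < g x" by simp
      obtain z where z: "maximal_fun M g x < z" "z < g x" using dense[OF lt] by auto
      obtain m where m: "0 \<le> m" "maximal_fun M g x = ennreal m" using lt by (cases "maximal_fun M g x") auto
      obtain z' where z': "0 \<le> z'" "z = ennreal z'" using z by (cases z) auto
      have mz: "m < z'" using m z z' by (simp add: ennreal_less_iff)
      obtain a where a: "a \<in> \<rat>" "m < a" "a < z'" using Rats_dense_in_real[OF mz] by auto
      obtain b where b: "b \<in> \<rat>" "a < b" "b < z'" using Rats_dense_in_real[OF a(3)] by auto
      obtain n :: nat where n: "norm x < real n" using reals_Archimedean2 by auto
      have "maximal_fun M g x \<le> ennreal a" using m a by (auto intro: ennreal_leI)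
      moreover have "ennreal b \<le> g x"
        using b z z' by (metis ennreal_leI less_imp_le order_trans)
      moreover have "x \<in> ball 0 (real n)" using n by simp
      ultimately show False using elim a b m by auto
    qed
  qed
qed


lemma Ainf_measure_lebesgue: "Ainf_measure 1 1 (lebesgue :: 'a::euclidean_space measure)"
  unfolding Ainf_measure_def
proof (intro allI impI)
  fix c :: 'a and \<rho> :: real and A assume "0 < \<rho>"
  then show "emeasure lebesgue A \<le> ennreal 1 * (emeasure lebesgue A / emeasure lebesgue (ball c \<rho>)) epowr 1 * emeasure lebesgue (ball c \<rho>)"
    using ennreal_mult_div_cancel[of "emeasure lebesgue (ball c \<rho>)" "emeasure lebesgue A"]
    by (simp add: lebesgue_ball_pos lebesgue_ball_finite mult.commute)
qed

section \<open>Majorants of Coifman and Rochberg\<close>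

lemma epowr_add_le: "0 < a \<Longrightarrow> a < 1 \<Longrightarrow> (x + y) epowr a \<le> 2 * (x epowr a + y epowr a)"
proof -
  assume a: "0 < a" "a < 1"
  have "(x + y) epowr a \<le> 2 epowr a * (x epowr a + y epowr a)" by (rule epowr_sum_le[OF a(1)])
  also have "2 epowr a \<le> 2 epowr 1" using a by (intro epowr_increasing) auto
  finally show ?thesis by (auto simp: mult_right_mono)
qed

context doubling_measure
begin

text \<open>The factor 2 comes from splitting the power of a sum, the first summand from the near
  part and the second from the far part. It is evaluated at the upper bound \<eta>', because \<eta>
  itself is chosen later, depending on a number that depends on this constant.\<close>

definition majorant_const :: "real \<Rightarrow> real" where
  "majorant_const \<eta> = 2 * (K\<^sup>2 * (1 + 2 / (1 - 2 powr (\<eta> - 1))) + K)"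

text \<open>
  The far part of \<open>g\<close> contributes an almost constant function on the ball; the near part is estimated by
  Kolmogorov's inequality. The constant stays bounded for \<open>\<eta> \<le> \<eta>'\<close>.
\<close>

lemma integral_maximal_power:
  assumes [measurable]: "g \<in> borel_measurable M" "A \<in> sets M" and \<eta>: "0 < \<eta>" "\<eta> \<le> \<eta>'" "\<eta>' < 1"
    and \<rho>: "0 < \<rho>" and A: "A \<subseteq> ball c \<rho>" and y: "y \<in> ball c \<rho>"
  shows "(\<integral>\<^sup>+x\<in>A. maximal_fun M g x epowr \<eta> \<partial>M)
    \<le> ennreal (majorant_const \<eta>') * (emeasure M A / emeasure M (ball c \<rho>)) epowr (1 - \<eta>) * emeasure M (ball c \<rho>)
      * maximal_fun M g y epowr \<eta>"
proof -
  let ?B = "ball c \<rho>" and ?B5 = "ball c (5 * \<rho>)"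
  let ?m = "maximal_fun M g" and ?b = "emeasure M ?B"
  let ?x = "emeasure M A / ?b"
  define c\<^sub>\<eta> where "c\<^sub>\<eta> \<eta> = 1 + 2 / (1 - 2 powr (\<eta> - 1))" for \<eta> :: real
  have b: "0 < ?b" "?b < top" using \<rho> by (auto intro: ball_pos ball_finite)
  have A_le: "emeasure M A \<le> ?b" using A by (intro emeasure_mono) auto
  have Af: "emeasure M A < top" using A_le b(2) by (rule le_less_trans)
  define m\<^sub>1 where "m\<^sub>1 = maximal_fun M (\<lambda>x. g x * indicator ?B5 x)"
  define m\<^sub>2 where "m\<^sub>2 = maximal_fun M (\<lambda>x. g x * indicator (- ?B5) x)"
  have [measurable]: "- ?B5 \<in> sets M" using sets.compl_sets[of ?B5 M] by (simp add: space_M Compl_eq_Diff_UNIV)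
  have [measurable]: "m\<^sub>1 \<in> borel_measurable M" "m\<^sub>2 \<in> borel_measurable M"
    unfolding m\<^sub>1_def m\<^sub>2_def by measurable
  have m_le: "?m x \<le> m\<^sub>1 x + m\<^sub>2 x" for x
  proof -
    have "?m x = maximal_fun M (\<lambda>x. g x * indicator ?B5 x + g x * indicator (- ?B5) x) x"
      by (rule arg_cong[of _ _ "\<lambda>f. maximal_fun M f x"]) (auto simp: indicator_def)
    also have "\<dots> \<le> m\<^sub>1 x + m\<^sub>2 x" unfolding m\<^sub>1_def m\<^sub>2_def by (rule maximal_fun_add[OF sets_M]) measurable
    finally show ?thesis .
  qed
  \<comment> \<open>A ball through x that leaves the fivefold ball has radius above 2\<rho>, so its
    fivefold enlargement contains y; doubling costs the factor K.\<close>
  have far: "m\<^sub>2 x \<le> ennreal K * ?m y" if x: "x \<in> ?B" for x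
    unfolding m\<^sub>2_def
  proof (rule maximal_fun_least)
    fix c' r assume r: "0 < (r::real)" "x \<in> ball c' r"
    let ?B' = "ball c' r"
    have b': "0 < emeasure M ?B'" "emeasure M ?B' < top" using r by (auto intro: ball_pos ball_finite)
    show "(\<integral>\<^sup>+y\<in>?B'. g y * indicator (- ?B5) y \<partial>M) / emeasure M ?B' \<le> ennreal K * ?m y"
    proof (cases "?B' \<subseteq> ?B5")
      case True
      then have "(\<integral>\<^sup>+y\<in>?B'. g y * indicator (- ?B5) y \<partial>M) = (\<integral>\<^sup>+y. 0 \<partial>M)"
        by (intro nn_integral_cong) (auto split: split_indicator)
      then show ?thesis by simp
    next
      case False
      then obtain z where z: "z \<in> ?B'" "z \<notin> ?B5" by blast
      have "5 * \<rho> \<le> dist c z" using z by simp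
      also have "dist c z \<le> dist c x + dist x c' + dist c' z"
        using dist_triangle[of c z x] dist_triangle[of x z c'] by linarith
      also have "\<dots> < \<rho> + r + r" using x r z by (intro add_strict_mono) (auto simp: dist_commute)
      finally have r2: "2 * \<rho> < r" by simp
      have "dist c' y \<le> dist c' x + dist x c + dist c y"
        using dist_triangle[of c' y x] dist_triangle[of x y c] by linarith
      also have "\<dots> < r + \<rho> + \<rho>" using x r y by (intro add_strict_mono) (auto simp: dist_commute)
      finally have y5: "y \<in> ball c' (5 * r)" using r2 \<rho> by simp
      have "(\<integral>\<^sup>+y\<in>?B'. g y * indicator (- ?B5) y \<partial>M) \<le> (\<integral>\<^sup>+y\<in>ball c' (5 * r). g y \<partial>M)"
        using r by (intro nn_integral_mono) (auto split: split_indicator)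
      also have "\<dots> \<le> emeasure M (ball c' (5 * r)) * ?m y"
        using maximal_fun_upper[of "5 * r" y c' M g] r y5
        by (subst (asm) ennreal_divide_le_iff) (auto intro!: ball_pos ball_finite)
      also have "\<dots> \<le> ennreal K * emeasure M ?B' * ?m y"
        using r by (intro mult_right_mono doubling) auto
      finally show ?thesis
        by (subst ennreal_divide_le_iff[OF b']) (simp only: ac_simps)
    qed
  qed
  have K1: "1 \<le> ennreal K" using K_ge_1 by (simp add: ennreal_ge_1)
  \<comment> \<open>The near part is integrable on the fivefold ball whenever the maximal function
    of g is finite at y, and Kolmogorov's inequality on A produces the power 1 - \<eta> of
    M(A).\<close>
  have near: "(\<integral>\<^sup>+x\<in>A. m\<^sub>1 x epowr \<eta> \<partial>M)
    \<le> ennreal (c\<^sub>\<eta> \<eta>) * (emeasure M A epowr (1 - \<eta>) * (ennreal K * (\<integral>\<^sup>+x\<in>?B5. g x \<partial>M)) epowr \<eta>)"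
    unfolding c\<^sub>\<eta>_def
  proof (rule kolmogorov)
    show "t * emeasure M {x. t < m\<^sub>1 x} \<le> ennreal K * (\<integral>\<^sup>+x\<in>?B5. g x \<partial>M)" if "0 < t" "t < top" for t
      unfolding m\<^sub>1_def using that by (intro weak_type) auto
  qed (use \<eta> Af in auto)
  have "ennreal K * (\<integral>\<^sup>+x\<in>?B5. g x \<partial>M) \<le> ennreal (K\<^sup>2) * ?b * ?m y"
  proof -
    have \<rho>5: "0 < 5 * \<rho>" and y5: "y \<in> ?B5" using \<rho> y by auto
    have "(\<integral>\<^sup>+x\<in>?B5. g x \<partial>M) \<le> emeasure M ?B5 * ?m y"
      using maximal_fun_upper[OF \<rho>5 y5, of M g]
      by (subst (asm) ennreal_divide_le_iff) (use \<rho>5 in \<open>auto intro!: ball_pos ball_finite\<close>)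
    also have "\<dots> \<le> ennreal K * ?b * ?m y" using \<rho> by (intro mult_right_mono doubling) auto
    finally have "ennreal K * (\<integral>\<^sup>+x\<in>?B5. g x \<partial>M) \<le> ennreal K * (ennreal K * ?b * ?m y)" by (rule mult_left_mono) simp
    also have "\<dots> = ennreal (K\<^sup>2) * ?b * ?m y" using K_ge_1 by (simp add: power2_eq_square ennreal_mult' mult.assoc)
    finally show ?thesis .
  qed
  then have "(ennreal K * (\<integral>\<^sup>+x\<in>?B5. g x \<partial>M)) epowr \<eta> \<le> (ennreal (K\<^sup>2) * ?b * ?m y) epowr \<eta>"
    using \<eta> by (intro epowr_mono) auto
  also have "\<dots> \<le> ennreal (K\<^sup>2) * (?b epowr \<eta> * ?m y epowr \<eta>)"
  proof -
    have "1 \<le> ennreal (K\<^sup>2)" using K_ge_1 by (simp add: ennreal_ge_1)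
    then have "ennreal (K\<^sup>2) epowr \<eta> \<le> ennreal (K\<^sup>2) epowr 1" using \<eta> by (intro epowr_increasing) auto
    then have "ennreal (K\<^sup>2) epowr \<eta> * (?b epowr \<eta> * ?m y epowr \<eta>) \<le> ennreal (K\<^sup>2) * (?b epowr \<eta> * ?m y epowr \<eta>)"
      by (intro mult_right_mono) auto
    then show ?thesis using \<eta> by (simp only: epowr_mult mult.assoc)
  qed
  finally have "(\<integral>\<^sup>+x\<in>A. m\<^sub>1 x epowr \<eta> \<partial>M)
    \<le> ennreal (c\<^sub>\<eta> \<eta>) * (emeasure M A epowr (1 - \<eta>) * (ennreal (K\<^sup>2) * (?b epowr \<eta> * ?m y epowr \<eta>)))"
    by (intro order_trans[OF near] mult_left_mono) auto
  also have "\<dots> = ennreal (c\<^sub>\<eta> \<eta>) * ennreal (K\<^sup>2) * ((emeasure M A epowr (1 - \<eta>) * ?b epowr \<eta>) * ?m y epowr \<eta>)"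
    by (simp only: ac_simps)
  also have "emeasure M A epowr (1 - \<eta>) * ?b epowr \<eta> = ?x epowr (1 - \<eta>) * ?b"
  proof -
    have "emeasure M A = ?x * ?b" using ennreal_mult_div_cancel[OF b, of "emeasure M A"] by (simp add: mult.commute)
    then have "emeasure M A epowr (1 - \<eta>) = ?x epowr (1 - \<eta>) * ?b epowr (1 - \<eta>)"
      using \<eta> by (metis epowr_mult diff_gt_0_iff_gt order_le_less_trans)
    moreover have "?b epowr (1 - \<eta>) * ?b epowr \<eta> = ?b" using \<eta> by (subst epowr_add[symmetric]) auto
    ultimately show ?thesis by (simp add: mult.assoc)
  qed
  also have "ennreal (c\<^sub>\<eta> \<eta>) * ennreal (K\<^sup>2) \<le> ennreal (K\<^sup>2 * c\<^sub>\<eta> \<eta>')"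
  proof -
    have "2 powr (\<eta> - 1) \<le> 2 powr (\<eta>' - 1)" "2 powr (\<eta>' - 1) < 1" using \<eta> by (auto intro: powr_less_one)
    note p = this
    have "c\<^sub>\<eta> \<eta> \<le> c\<^sub>\<eta> \<eta>'" unfolding c\<^sub>\<eta>_def using p
      by (intro add_mono divide_left_mono mult_pos_pos) linarith+
    moreover have "0 \<le> c\<^sub>\<eta> \<eta>" unfolding c\<^sub>\<eta>_def using p by (intro add_nonneg_nonneg divide_nonneg_nonneg) linarith+
    ultimately show ?thesis by (subst ennreal_mult'[symmetric]) (auto simp: mult.commute intro!: ennreal_leI mult_right_mono)
  qed
  finally have int1: "(\<integral>\<^sup>+x\<in>A. m\<^sub>1 x epowr \<eta> \<partial>M) \<le> ennreal (K\<^sup>2 * c\<^sub>\<eta> \<eta>') * (?x epowr (1 - \<eta>) * ?b * ?m y epowr \<eta>)"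
    by (auto simp: mult_right_mono)
  have int2: "(\<integral>\<^sup>+x\<in>A. m\<^sub>2 x epowr \<eta> \<partial>M) \<le> ennreal K * (?x epowr (1 - \<eta>) * ?b * ?m y epowr \<eta>)"
  proof -
    have "(\<integral>\<^sup>+x\<in>A. m\<^sub>2 x epowr \<eta> \<partial>M) \<le> (\<integral>\<^sup>+x. (ennreal K * ?m y) epowr \<eta> * indicator A x \<partial>M)"
      using A far \<eta> by (intro nn_integral_mono) (auto intro!: epowr_mono split: split_indicator)
    also have "\<dots> = (ennreal K * ?m y) epowr \<eta> * emeasure M A" by (rule nn_integral_cmult_indicator) measurable
    also have "\<dots> \<le> (ennreal K * ?m y epowr \<eta>) * (?x epowr (1 - \<eta>) * ?b)"
    proof (intro mult_mono)
      have "(ennreal K * ?m y) epowr \<eta> = ennreal K epowr \<eta> * ?m y epowr \<eta>" using \<eta> by (simp add: epowr_mult)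
      also have "\<dots> \<le> ennreal K epowr 1 * ?m y epowr \<eta>" using \<eta> K1 by (intro mult_right_mono epowr_increasing) auto
      finally show "(ennreal K * ?m y) epowr \<eta> \<le> ennreal K * ?m y epowr \<eta>" by simp
      have "?x \<le> 1" using A_le by (subst ennreal_divide_le_iff[OF b]) auto
      then have "?x epowr 1 \<le> ?x epowr (1 - \<eta>)" using \<eta> by (intro epowr_decreasing) auto
      then have "?x * ?b \<le> ?x epowr (1 - \<eta>) * ?b" by (intro mult_right_mono) auto
      then show "emeasure M A \<le> ?x epowr (1 - \<eta>) * ?b"
        using ennreal_mult_div_cancel[OF b, of "emeasure M A"] by (simp add: mult.commute)
    qed auto
    finally show ?thesis by (simp only: ac_simps)
  qed
  have "(\<integral>\<^sup>+x\<in>A. ?m x epowr \<eta> \<partial>M) \<le> (\<integral>\<^sup>+x. 2 * (m\<^sub>1 x epowr \<eta> * indicator A x + m\<^sub>2 x epowr \<eta> * indicator A x) \<partial>M)"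
  proof (rule nn_integral_mono)
    fix x
    have "?m x epowr \<eta> \<le> (m\<^sub>1 x + m\<^sub>2 x) epowr \<eta>" using m_le \<eta> by (intro epowr_mono) auto
    also have "\<dots> \<le> 2 * (m\<^sub>1 x epowr \<eta> + m\<^sub>2 x epowr \<eta>)" using \<eta> by (intro epowr_add_le) auto
    finally show "?m x epowr \<eta> * indicator A x \<le> 2 * (m\<^sub>1 x epowr \<eta> * indicator A x + m\<^sub>2 x epowr \<eta> * indicator A x)"
      by (auto split: split_indicator)
  qed
  also have "\<dots> = 2 * ((\<integral>\<^sup>+x\<in>A. m\<^sub>1 x epowr \<eta> \<partial>M) + (\<integral>\<^sup>+x\<in>A. m\<^sub>2 x epowr \<eta> \<partial>M))"
    by (simp add: nn_integral_cmult nn_integral_add)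
  also have "\<dots> \<le> 2 * (ennreal (K\<^sup>2 * c\<^sub>\<eta> \<eta>') * (?x epowr (1 - \<eta>) * ?b * ?m y epowr \<eta>) + ennreal K * (?x epowr (1 - \<eta>) * ?b * ?m y epowr \<eta>))"
    by (intro mult_left_mono add_mono int1 int2) auto
  also have "\<dots> = (2 * (ennreal (K\<^sup>2 * c\<^sub>\<eta> \<eta>') + ennreal K)) * (?x epowr (1 - \<eta>) * ?b * ?m y epowr \<eta>)"
    by (simp only: distrib_right mult.assoc)
  also have "2 * (ennreal (K\<^sup>2 * c\<^sub>\<eta> \<eta>') + ennreal K) = ennreal (majorant_const \<eta>')"
  proof -
    have "2 powr (\<eta>' - 1) < 1" using \<eta> by (auto intro: powr_less_one)
    then have "0 \<le> K\<^sup>2 * c\<^sub>\<eta> \<eta>'" by (auto simp: c\<^sub>\<eta>_def intro!: mult_nonneg_nonneg add_nonneg_nonneg)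
    then show ?thesis
      using K_ge_1 by (simp add: majorant_const_def c\<^sub>\<eta>_def ennreal_mult' ennreal_plus)
  qed
  finally show ?thesis by (simp only: mult.assoc)
qed

text \<open>The theorem of Coifman and Rochberg relative to M: \<phi> behaves like an A_1 weight.
  \<open>integral_maximal_power\<close> holds for all y in the ball, so the value \<phi> y can be
  averaged over the ball. Taking the fivefold ball itself as the set gives doubling; a general set
  gives the power 1 - \<eta> of its relative M-measure, which multiplies the exponent \<theta> of
  M.\<close>

lemma majorant_weight:
  assumes [measurable]: "g \<in> borel_measurable M" and \<eta>: "0 < \<eta>" "\<eta> \<le> \<eta>'" "\<eta>' < 1"
    and g: "\<not> (AE x in M. g x = 0)" and fin: "AE x in M. maximal_fun M g x < top"
    and ainf: "Ainf_measure C \<theta> M" and C: "1 \<le> C"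
  defines "\<phi> \<equiv> \<lambda>x. maximal_fun M g x epowr \<eta>"
  shows "doubling_measure (density M \<phi>) (majorant_const \<eta>' * K)"
    and "Ainf_measure (majorant_const \<eta>' * C) (\<theta> * (1 - \<eta>)) (density M \<phi>)"
proof -
  let ?v = "density M \<phi>"
  define D where "D = majorant_const \<eta>'"
  have D: "0 \<le> D"
  proof -
    have "2 powr (\<eta>' - 1) < 1" using \<eta> by (auto intro: powr_less_one)
    then show ?thesis using K_ge_1 unfolding D_def majorant_const_def
      by (intro mult_nonneg_nonneg add_nonneg_nonneg divide_nonneg_nonneg) auto
  qed
  have [measurable]: "\<phi> \<in> borel_measurable M" unfolding \<phi>_def by measurable
  have v: "emeasure ?v A = (\<integral>\<^sup>+x\<in>A. \<phi> x \<partial>M)" if "A \<in> sets M" for A using that by (intro emeasure_density) auto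
  have pointwise: "emeasure ?v A \<le> ennreal D * (emeasure M A / emeasure M (ball c \<rho>)) epowr (1 - \<eta>) * emeasure M (ball c \<rho>) * \<phi> y"
    if "0 < \<rho>" "A \<in> sets M" "A \<subseteq> ball c \<rho>" "y \<in> ball c \<rho>" for c \<rho> A y
    unfolding v[OF that(2)] unfolding \<phi>_def D_def using that \<eta> by (intro integral_maximal_power) auto
  \<comment> \<open>Integrating a bound that holds at every y replaces \<phi> y by its integral over
    the ball.\<close>
  have average: "z * emeasure M B \<le> k * emeasure ?v B" if [measurable]: "B \<in> sets M" and "\<And>y. y \<in> B \<Longrightarrow> z \<le> k * \<phi> y" for z k B
  proof -
    have "z * emeasure M B = (\<integral>\<^sup>+y. z * indicator B y \<partial>M)" by (simp add: nn_integral_cmult_indicator)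
    also have "\<dots> \<le> (\<integral>\<^sup>+y. k * (\<phi> y * indicator B y) \<partial>M)"
      using that by (intro nn_integral_mono) (auto split: split_indicator)
    also have "\<dots> = k * emeasure ?v B" by (simp add: v nn_integral_cmult)
    finally show ?thesis .
  qed
  have \<phi>_pos: "0 < \<phi> x" for x
    using maximal_fun_pos[OF _ g, of x] \<eta> by (auto simp: \<phi>_def zero_less_iff_neq_zero)
  show "doubling_measure ?v (D * K)"
  proof
    show "sets ?v = sets lebesgue" by (simp add: sets_M)
    fix c :: 'a and \<rho> :: real
    show "emeasure ?v (ball c \<rho>) < top"
    proof (cases "0 < \<rho>")
      case \<rho>: True
      have "\<exists>y\<in>ball c \<rho>. maximal_fun M g y < top"
      proof (rule ccontr)
        assume "\<not> ?thesis"
        then have "AE x in M. x \<notin> ball c \<rho>" by (intro eventually_mono[OF fin]) blast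
        then have "ball c \<rho> \<in> null_sets M" by (subst AE_iff_null_sets) auto
        then have "emeasure M (ball c \<rho>) = 0" by (rule null_setsD1)
        with ball_pos[OF \<rho>, of c] show False by simp
      qed
      then obtain y where y: "y \<in> ball c \<rho>" "maximal_fun M g y < top" by blast
      have "emeasure ?v (ball c \<rho>) \<le> ennreal D * (emeasure M (ball c \<rho>) / emeasure M (ball c \<rho>)) epowr (1 - \<eta>) * emeasure M (ball c \<rho>) * \<phi> y"
        using \<rho> y by (intro pointwise) auto
      also have "\<dots> < top"
        using ball_pos[OF \<rho>, of c] ball_finite[of c \<rho>] y \<eta>
        by (auto simp: ennreal_div_self ennreal_mult_less_top \<phi>_def intro: epowr_less_top)
      finally show ?thesis .
    qed (simp add: ball_empty)
    assume \<rho>: "0 < \<rho>"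
    show "0 < emeasure ?v (ball c \<rho>)"
      unfolding v[OF ball_sets] by (rule set_nn_integral_pos) (use \<phi>_pos ball_pos[OF \<rho>] in auto)
    let ?B = "ball c \<rho>" and ?B5 = "ball c (5 * \<rho>)"
    have b: "0 < emeasure M ?B" "emeasure M ?B < top" "0 < emeasure M ?B5" "emeasure M ?B5 < top"
      using \<rho> by (auto intro: ball_pos ball_finite)
    have "emeasure ?v ?B5 * emeasure M ?B \<le> (ennreal D * emeasure M ?B5) * emeasure ?v ?B"
    proof (rule average)
      fix y assume "y \<in> ?B"
      then have "emeasure ?v ?B5 \<le> ennreal D * (emeasure M ?B5 / emeasure M ?B5) epowr (1 - \<eta>) * emeasure M ?B5 * \<phi> y"
        using \<rho> by (intro pointwise) auto
      then show "emeasure ?v ?B5 \<le> ennreal D * emeasure M ?B5 * \<phi> y" using b by (simp add: ennreal_div_self)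
    qed measurable
    also have "\<dots> \<le> (ennreal D * (ennreal K * emeasure M ?B)) * emeasure ?v ?B"
      by (intro mult_right_mono mult_left_mono doubling \<rho>) auto
    also have "\<dots> = ennreal (D * K) * emeasure ?v ?B * emeasure M ?B"
      using D by (simp only: ennreal_mult' ac_simps)
    finally show "emeasure ?v ?B5 \<le> ennreal (D * K) * emeasure ?v ?B"
      by (rule ennreal_mult_right_cancel_le[OF b(1,2)])
  qed
  show "Ainf_measure (D * C) (\<theta> * (1 - \<eta>)) ?v"
    unfolding Ainf_measure_def
  proof (intro allI impI)
    fix c :: 'a and \<rho> :: real and A assume \<rho>: "0 < \<rho>" and A: "A \<in> sets lebesgue" "A \<subseteq> ball c \<rho>"
    let ?B = "ball c \<rho>"
    let ?x = "emeasure lebesgue A / emeasure lebesgue ?B" and ?y = "emeasure M A / emeasure M ?B"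
    have b: "0 < emeasure M ?B" "emeasure M ?B < top" using \<rho> by (auto intro: ball_pos ball_finite)
    have "emeasure ?v A * emeasure M ?B \<le> (ennreal D * ?y epowr (1 - \<eta>) * emeasure M ?B) * emeasure ?v ?B"
      using \<rho> A by (intro average pointwise) (auto simp: sets_M)
    then have "emeasure ?v A * emeasure M ?B \<le> (ennreal D * ?y epowr (1 - \<eta>)) * emeasure ?v ?B * emeasure M ?B"
      by (simp only: ac_simps)
    then have 1: "emeasure ?v A \<le> (ennreal D * ?y epowr (1 - \<eta>)) * emeasure ?v ?B"
      by (rule ennreal_mult_right_cancel_le[OF b])
    have "?y \<le> ennreal C * ?x epowr \<theta>"
      using Ainf_measureD[OF ainf \<rho> A] by (subst ennreal_divide_le_iff[OF b]) (simp only: ac_simps)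
    then have "?y epowr (1 - \<eta>) \<le> (ennreal C * ?x epowr \<theta>) epowr (1 - \<eta>)" using \<eta> by (intro epowr_mono) auto
    also have "\<dots> = ennreal C epowr (1 - \<eta>) * ?x epowr (\<theta> * (1 - \<eta>))" using \<eta> by (simp add: epowr_mult epowr_epowr)
    also have "\<dots> \<le> ennreal C epowr 1 * ?x epowr (\<theta> * (1 - \<eta>))"
      using C \<eta> by (intro mult_right_mono epowr_increasing) (auto simp: ennreal_ge_1)
    finally have "(ennreal D * ?y epowr (1 - \<eta>)) * emeasure ?v ?B \<le> (ennreal D * (ennreal C * ?x epowr (\<theta> * (1 - \<eta>)))) * emeasure ?v ?B"
      by (intro mult_right_mono mult_left_mono) auto
    with 1 have "emeasure ?v A \<le> (ennreal D * (ennreal C * ?x epowr (\<theta> * (1 - \<eta>)))) * emeasure ?v ?B" by (rule order_trans)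
    then show "emeasure ?v A \<le> ennreal (D * C) * ?x epowr (\<theta> * (1 - \<eta>)) * emeasure ?v ?B"
      using D by (simp only: ennreal_mult' mult.assoc)
  qed
qed

end

text \<open>Duality: X, the sum of the x j, is tested against h in the dual exponent s/(s - 1). Once
  h is replaced by a majorant v for which the inequality is known for each j, the inequalities can
  be added, since v does not depend on j. Hoelder's inequality recovers the norm of the sum of the y
  j.\<close>

lemma extrapolation_up:
  fixes x y :: "nat \<Rightarrow> 'a \<Rightarrow> ennreal"
  assumes [measurable]: "\<And>j. x j \<in> borel_measurable \<mu>" "\<And>j. y j \<in> borel_measurable \<mu>"
    and s: "1 < s" and C: "0 < C\<^sub>0" "0 < C\<^sub>1"
    and exh: "incseq A" "\<And>n::nat. A n \<in> sets \<mu>" "(\<Union>n. A n) = space \<mu>" "\<And>n. emeasure \<mu> (A n) < top"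
    and major: "\<And>h. h \<in> borel_measurable \<mu> \<Longrightarrow> 0 < (\<integral>\<^sup>+z. h z epowr (s / (s - 1)) \<partial>\<mu>) \<Longrightarrow> (\<integral>\<^sup>+z. h z epowr (s / (s - 1)) \<partial>\<mu>) < top \<Longrightarrow>
      \<exists>v\<in>borel_measurable \<mu>. (AE z in \<mu>. h z \<le> v z) \<and>
        (\<integral>\<^sup>+z. v z epowr (s / (s - 1)) \<partial>\<mu>) \<le> ennreal C\<^sub>0 * (\<integral>\<^sup>+z. h z epowr (s / (s - 1)) \<partial>\<mu>) \<and>
        (\<forall>j. (\<integral>\<^sup>+z. x j z * v z \<partial>\<mu>) \<le> ennreal C\<^sub>1 * (\<integral>\<^sup>+z. y j z * v z \<partial>\<mu>))"
  shows "(\<integral>\<^sup>+z. (\<Sum>j. x j z) epowr s \<partial>\<mu>)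
    \<le> ennreal ((C\<^sub>1 * C\<^sub>0 powr (1 - 1 / s)) powr s) * (\<integral>\<^sup>+z. (\<Sum>j. y j z) epowr s \<partial>\<mu>)"
proof -
  define s' where "s' = s / (s - 1)"
  have s': "0 < s'" "1 / s' = 1 - 1 / s" "(s - 1) * s' = s" using s by (auto simp: s'_def field_simps)
  define X where "X z = (\<Sum>j. x j z)" for z
  define Y where "Y z = (\<Sum>j. y j z)" for z
  have [measurable]: "X \<in> borel_measurable \<mu>" "Y \<in> borel_measurable \<mu>" unfolding X_def Y_def by measurable
  let ?Y = "\<integral>\<^sup>+z. Y z epowr s \<partial>\<mu>"
  define C where "C = C\<^sub>1 * C\<^sub>0 powr (1 - 1 / s)"
  have C_pos: "0 < C" using C by (simp add: C_def)
  have test: "(\<integral>\<^sup>+z. X z * h z \<partial>\<mu>) \<le> ennreal C * ?Y epowr (1 / s) * (\<integral>\<^sup>+z. h z epowr s' \<partial>\<mu>) epowr (1 / s')"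
    if h: "h \<in> borel_measurable \<mu>" "0 < (\<integral>\<^sup>+z. h z epowr s' \<partial>\<mu>)" "(\<integral>\<^sup>+z. h z epowr s' \<partial>\<mu>) < top" for h
  proof -
    obtain v where [measurable]: "v \<in> borel_measurable \<mu>" and v: "AE z in \<mu>. h z \<le> v z"
      "(\<integral>\<^sup>+z. v z epowr s' \<partial>\<mu>) \<le> ennreal C\<^sub>0 * (\<integral>\<^sup>+z. h z epowr s' \<partial>\<mu>)"
      "\<And>j. (\<integral>\<^sup>+z. x j z * v z \<partial>\<mu>) \<le> ennreal C\<^sub>1 * (\<integral>\<^sup>+z. y j z * v z \<partial>\<mu>)"
      using major[OF h[unfolded s'_def]] unfolding s'_def by blast
    have "(\<integral>\<^sup>+z. X z * h z \<partial>\<mu>) \<le> (\<integral>\<^sup>+z. X z * v z \<partial>\<mu>)"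
      by (rule nn_integral_mono_AE, use v(1) in eventually_elim) (rule mult_left_mono, auto)
    also have "\<dots> = (\<Sum>j. \<integral>\<^sup>+z. x j z * v z \<partial>\<mu>)"
      unfolding X_def by (simp add: nn_integral_suminf flip: ennreal_suminf_multc)
    also have "\<dots> \<le> (\<Sum>j. ennreal C\<^sub>1 * (\<integral>\<^sup>+z. y j z * v z \<partial>\<mu>))" by (intro suminf_le v) auto
    also have "\<dots> = ennreal C\<^sub>1 * (\<integral>\<^sup>+z. Y z * v z \<partial>\<mu>)"
      unfolding Y_def by (simp add: nn_integral_suminf flip: ennreal_suminf_multc)
    also have "(\<integral>\<^sup>+z. Y z * v z \<partial>\<mu>) = (\<integral>\<^sup>+z. (Y z epowr s) epowr (1 / s) * (v z epowr s') epowr (1 - 1 / s) \<partial>\<mu>)"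
      unfolding s'(2)[symmetric] using s s'(1) by (simp add: epowr_epowr)
    also have "\<dots> \<le> ?Y epowr (1 / s) * (\<integral>\<^sup>+z. v z epowr s' \<partial>\<mu>) epowr (1 - 1 / s)"
      by (rule nn_integral_Hoelder) (use s in auto)
    also have "(\<integral>\<^sup>+z. v z epowr s' \<partial>\<mu>) epowr (1 - 1 / s) \<le> (ennreal C\<^sub>0 * (\<integral>\<^sup>+z. h z epowr s' \<partial>\<mu>)) epowr (1 - 1 / s)"
      using s by (intro epowr_mono v) auto
    also have "\<dots> = ennreal (C\<^sub>0 powr (1 - 1 / s)) * (\<integral>\<^sup>+z. h z epowr s' \<partial>\<mu>) epowr (1 - 1 / s)"
      using s C by (simp add: epowr_mult ennreal_epowr)
    finally have "(\<integral>\<^sup>+z. X z * h z \<partial>\<mu>) \<le> ennreal C\<^sub>1 * (?Y epowr (1 / s) * (ennreal (C\<^sub>0 powr (1 - 1 / s)) * (\<integral>\<^sup>+z. h z epowr s' \<partial>\<mu>) epowr (1 - 1 / s)))"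
      by (auto simp: mult_left_mono)
    also have "\<dots> = (ennreal C\<^sub>1 * ennreal (C\<^sub>0 powr (1 - 1 / s))) * ?Y epowr (1 / s) * (\<integral>\<^sup>+z. h z epowr s' \<partial>\<mu>) epowr (1 - 1 / s)"
      by (simp only: ac_simps)
    also have "ennreal C\<^sub>1 * ennreal (C\<^sub>0 powr (1 - 1 / s)) = ennreal C"
      using C by (simp add: C_def ennreal_mult')
    finally show ?thesis unfolding s'(2) .
  qed
  have step: "(\<integral>\<^sup>+z. min (X z) (ennreal (real (Suc n))) epowr s * indicator (A n) z \<partial>\<mu>) \<le> ennreal (C powr s) * ?Y" for n
  proof -
    let ?m = "\<lambda>z. min (X z) (ennreal (real (Suc n)))"
    let ?I = "\<integral>\<^sup>+z. ?m z epowr s * indicator (A n) z \<partial>\<mu>"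
    note [measurable] = exh(2)
    \<comment> \<open>The extremal test function for the s-norm, truncated and localised so that its
      own norm is finite and can be divided out.\<close>
    define h where "h z = ?m z epowr (s - 1) * indicator (A n) z" for z
    have [measurable]: "h \<in> borel_measurable \<mu>" unfolding h_def by measurable
    have hI: "(\<integral>\<^sup>+z. h z epowr s' \<partial>\<mu>) = ?I"
      using s s' by (intro nn_integral_cong) (auto simp: h_def epowr_epowr split: split_indicator)
    have "?I \<le> (\<integral>\<^sup>+z. ennreal (real (Suc n)) epowr s * indicator (A n) z \<partial>\<mu>)"
      using s by (intro nn_integral_mono mult_right_mono epowr_mono) auto
    also have "\<dots> = ennreal (real (Suc n)) epowr s * emeasure \<mu> (A n)" by (rule nn_integral_cmult_indicator) measurable
    also have "\<dots> < top" using exh(4)[of n] s by (auto simp: ennreal_mult_less_top intro!: epowr_less_top simp del: of_nat_Suc)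
    finally have fin: "?I < top" .
    show ?thesis
    proof (cases "?I = 0")
      case False
      then have pos: "0 < ?I" by (simp add: zero_less_iff_neq_zero)
      have "?I \<le> (\<integral>\<^sup>+z. X z * h z \<partial>\<mu>)"
      proof (rule nn_integral_mono)
        fix z
        have "?m z epowr s = ?m z * ?m z epowr (s - 1)" using s epowr_add[of 1 "s - 1" "?m z"] by simp
        also have "\<dots> \<le> X z * ?m z epowr (s - 1)" by (intro mult_right_mono) auto
        finally show "?m z epowr s * indicator (A n) z \<le> X z * h z" by (auto simp: h_def split: split_indicator)
      qed
      also have "\<dots> \<le> ennreal C * ?Y epowr (1 / s) * ?I epowr (1 / s')"
        using test[of h] pos fin unfolding hI by simp
      also have "?I = ?I epowr (1 / s) * ?I epowr (1 / s')" using epowr_add[of "1 / s" "1 / s'" ?I] s s' by simp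
      finally have "?I epowr (1 / s) * ?I epowr (1 / s') \<le> (ennreal C * ?Y epowr (1 / s)) * ?I epowr (1 / s')"
        using epowr_add[of "1 / s" "1 / s'" ?I] s s' by simp
      then have "?I epowr (1 / s) * ?I epowr (1 / s') \<le> ennreal C * ?Y epowr (1 / s) * ?I epowr (1 / s')" by simp
      then have "?I epowr (1 / s) \<le> ennreal C * ?Y epowr (1 / s)"
        by (rule ennreal_mult_right_cancel_le[rotated 2]) (use pos fin in \<open>auto intro: epowr_pos epowr_finite\<close>)
      then have "(?I epowr (1 / s)) epowr s \<le> (ennreal C * ?Y epowr (1 / s)) epowr s" using s by (intro epowr_mono) auto
      then show ?thesis using s C_pos by (simp add: epowr_epowr epowr_mult ennreal_epowr)
    qed simp
  qed
  have "(\<integral>\<^sup>+z. X z epowr s \<partial>\<mu>) = (\<integral>\<^sup>+z. (SUP n. min (X z) (ennreal (real (Suc n))) epowr s * indicator (A n) z) \<partial>\<mu>)"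
  proof (rule nn_integral_cong)
    fix z assume "z \<in> space \<mu>"
    then obtain N where N: "z \<in> A N" using exh(3) by blast
    show "X z epowr s = (SUP n. min (X z) (ennreal (real (Suc n))) epowr s * indicator (A n) z)"
    proof (rule antisym)
      have "X z epowr s = (SUP n. min (X z) (ennreal (real (Suc n))) epowr s)"
        using s by (simp add: epowr_SUP[symmetric] min_of_nat_SUP del: of_nat_Suc)
      also have "\<dots> \<le> (SUP n. min (X z) (ennreal (real (Suc n))) epowr s * indicator (A n) z)"
      proof (rule SUP_mono)
        fix n
        have "z \<in> A (max n N)" using N exh(1) by (meson incseqD max.cobounded2 subsetD)
        moreover have "min (X z) (ennreal (real (Suc n))) epowr s \<le> min (X z) (ennreal (real (Suc (max n N)))) epowr s"
          using s by (intro epowr_mono min.mono ennreal_leI) auto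
        ultimately show "\<exists>m\<in>UNIV. min (X z) (ennreal (real (Suc n))) epowr s \<le> min (X z) (ennreal (real (Suc m))) epowr s * indicator (A m) z"
          by (intro bexI[of _ "max n N"]) (auto simp del: of_nat_Suc)
      qed
      finally show "X z epowr s \<le> (SUP n. min (X z) (ennreal (real (Suc n))) epowr s * indicator (A n) z)" .
      show "(SUP n. min (X z) (ennreal (real (Suc n))) epowr s * indicator (A n) z) \<le> X z epowr s"
        using s by (intro SUP_least) (auto split: split_indicator intro!: epowr_mono)
    qed
  qed
  also have "\<dots> = (SUP n. \<integral>\<^sup>+z. min (X z) (ennreal (real (Suc n))) epowr s * indicator (A n) z \<partial>\<mu>)"
  proof (rule nn_integral_monotone_convergence_SUP)
    show "incseq (\<lambda>n z. min (X z) (ennreal (real (Suc n))) epowr s * indicator (A n) z)"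
      using exh(1) s
      by (auto simp: incseq_def le_fun_def intro!: mult_mono epowr_mono min.mono ennreal_leI split: split_indicator simp del: of_nat_Suc)
  qed (use exh(2) in measurable)
  also have "\<dots> \<le> ennreal (C powr s) * ?Y" by (intro SUP_least step)
  finally show ?thesis unfolding X_def Y_def C_def .
qed

subsection \<open>Vector-valued inequalities\<close>

lemma good_decomposition_measurable:
  "good_decomposition a q F G \<Longrightarrow> F \<in> borel_measurable lebesgue"
  by (simp add: good_decomposition_def)

text \<open>The maximal function dominates F almost everywhere by Lebesgue's differentiation
  theorem. The choice of \<epsilon> and B before F, G and V matters because V will be built from
  test functions.\<close>

lemma weighted_inequality:
  fixes Q R a C K :: real
  assumes "1 < Q" "1 < R" "R < Q" "1 \<le> a" "1 \<le> C" "1 \<le> K"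
  obtains \<epsilon> B where "0 < \<epsilon>" "\<epsilon> \<le> R / Q / 2" "0 < B"
    "\<forall>(F :: 'a::euclidean_space \<Rightarrow> ennreal) G V.
      good_decomposition a Q F G \<longrightarrow> V \<in> borel_measurable lebesgue \<longrightarrow> doubling_measure (density lebesgue V) K \<longrightarrow>
      Ainf_measure C (R / Q - \<epsilon>) (density lebesgue V) \<longrightarrow>
      (\<integral>\<^sup>+x. V x * F x epowr R \<partial>lebesgue) \<le> ennreal B * (\<integral>\<^sup>+x. V x * G x epowr R \<partial>lebesgue)"
proof -
  obtain \<epsilon> B where \<epsilon>: "0 < \<epsilon>" "\<epsilon> \<le> R / Q / 2" and E: "\<forall>(F :: 'a \<Rightarrow> ennreal) G V.
      good_decomposition a Q F G \<longrightarrow> V \<in> borel_measurable lebesgue \<longrightarrow> doubling_measure (density lebesgue V) K \<longrightarrow>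
      Ainf_measure C (R / Q - \<epsilon>) (density lebesgue V) \<longrightarrow>
      (\<integral>\<^sup>+x. V x * maximal_fun lebesgue F x epowr R \<partial>lebesgue) \<le> ennreal B * (\<integral>\<^sup>+x. V x * G x epowr R \<partial>lebesgue)"
    using weighted_maximal_inequality[where ?'a = 'a, OF assms] by blast
  show thesis
  proof (rule that[of \<epsilon> "max B 1"]; (intro allI impI)?)
    fix F G V :: "'a \<Rightarrow> ennreal"
    assume gd: "good_decomposition a Q F G" and V: "V \<in> borel_measurable lebesgue" "doubling_measure (density lebesgue V) K"
      "Ainf_measure C (R / Q - \<epsilon>) (density lebesgue V)"
    have "AE x in lebesgue. F x \<le> maximal_fun lebesgue F x"
      by (rule lebesgue.le_maximal_fun_AE[OF Ainf_measure_lebesgue]) (use gd in \<open>auto intro: good_decomposition_measurable\<close>)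
    then have "(\<integral>\<^sup>+x. V x * F x epowr R \<partial>lebesgue) \<le> (\<integral>\<^sup>+x. V x * maximal_fun lebesgue F x epowr R \<partial>lebesgue)"
      using assms by (intro nn_integral_mono_AE) (auto elim!: eventually_mono intro!: mult_left_mono epowr_mono)
    also have "\<dots> \<le> ennreal B * (\<integral>\<^sup>+x. V x * G x epowr R \<partial>lebesgue)" using E gd V by blast
    also have "\<dots> \<le> ennreal (max B 1) * (\<integral>\<^sup>+x. V x * G x epowr R \<partial>lebesgue)"
      by (intro mult_right_mono ennreal_leI) auto
    finally show "(\<integral>\<^sup>+x. V x * F x epowr R \<partial>lebesgue) \<le> ennreal (max B 1) * (\<integral>\<^sup>+x. V x * G x epowr R \<partial>lebesgue)" .
  qed (use \<epsilon> in auto)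
qed

lemma Ap_doubling_ge_1: "1 \<le> C \<Longrightarrow> 0 \<le> t \<Longrightarrow> 1 \<le> Ap_doubling TYPE('a::euclidean_space) t C"
proof -
  assume *: "1 \<le> C" "0 \<le> t"
  then have "1 \<le> (5 ^ DIM('a)) powr t" by (intro ge_one_powr_ge_zero) auto
  then have "1 * 1 \<le> C * (5 ^ DIM('a)) powr t" using * by (intro mult_mono) auto
  then show ?thesis by (simp add: Ap_doubling_def)
qed

lemma scalar_inequality:
  fixes w :: "'a::euclidean_space \<Rightarrow> ennreal" and P Q a C C' :: real
  assumes P: "1 < P" "P < Q" and a: "1 \<le> a" and w: "Ap_weight P C w"
    and ainf: "Ainf_measure C' (P / Q) (density lebesgue w)" and C': "1 \<le> C'"
  obtains B where "0 < B"
    "\<forall>F g. g \<in> borel_measurable lebesgue \<longrightarrow> good_decomposition a Q F (maximal_fun lebesgue g) \<longrightarrow>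
      (\<integral>\<^sup>+x. w x * F x epowr P \<partial>lebesgue) \<le> ennreal B * (\<integral>\<^sup>+x. w x * g x epowr P \<partial>lebesgue)"
proof -
  note [measurable] = Ap_weight_measurable[OF w]
  have C: "1 \<le> C" by (rule Ap_weight_const_ge_1[OF w P(1)])
  define K where "K = Ap_doubling TYPE('a) P C"
  have K: "1 \<le> K" unfolding K_def using C P by (intro Ap_doubling_ge_1) auto
  have "1 < Q" using P by simp
  obtain \<epsilon> B where \<epsilon>: "0 < \<epsilon>" and B: "0 < B" and E: "\<forall>(F :: 'a \<Rightarrow> ennreal) G V.
      good_decomposition a Q F G \<longrightarrow> V \<in> borel_measurable lebesgue \<longrightarrow> doubling_measure (density lebesgue V) K \<longrightarrow>
      Ainf_measure C' (P / Q - \<epsilon>) (density lebesgue V) \<longrightarrow>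
      (\<integral>\<^sup>+x. V x * F x epowr P \<partial>lebesgue) \<le> ennreal B * (\<integral>\<^sup>+x. V x * G x epowr P \<partial>lebesgue)"
    by (rule weighted_inequality[where ?'a = 'a, OF \<open>1 < Q\<close> P a C' K]) (rule that; assumption)
  define N where "N = max 1 (muckenhoupt_const TYPE('a) P C)"
  show thesis
  proof (rule that[of "B * N"]; (intro allI impI)?)
    show "0 < B * N" using B by (auto simp: N_def intro!: mult_pos_pos)
    fix F g :: "'a \<Rightarrow> ennreal" assume g: "g \<in> borel_measurable lebesgue" and gd: "good_decomposition a Q F (maximal_fun lebesgue g)"
    have "(\<integral>\<^sup>+x. w x * F x epowr P \<partial>lebesgue) \<le> ennreal B * (\<integral>\<^sup>+x. w x * maximal_fun lebesgue g x epowr P \<partial>lebesgue)"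
    proof -
      have "Ainf_measure C' (P / Q - \<epsilon>) (density lebesgue w)" by (rule Ainf_measure_mono[OF ainf]) (use \<epsilon> in auto)
      moreover have "doubling_measure (density lebesgue w) K" unfolding K_def by (rule Ap_weight_doubling[OF w P(1)])
      ultimately show ?thesis using E gd Ap_weight_measurable[OF w] by blast
    qed
    also have "\<dots> \<le> ennreal B * (ennreal N * (\<integral>\<^sup>+x. w x * g x epowr P \<partial>lebesgue))"
    proof (rule mult_left_mono)
      have "(\<integral>\<^sup>+x. w x * maximal_fun lebesgue g x epowr P \<partial>lebesgue) \<le> ennreal (muckenhoupt_const TYPE('a) P C) * (\<integral>\<^sup>+x. w x * g x epowr P \<partial>lebesgue)"
        by (rule muckenhoupt_maximal_theorem[OF w P(1) g])
      also have "\<dots> \<le> ennreal N * (\<integral>\<^sup>+x. w x * g x epowr P \<partial>lebesgue)"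
        unfolding N_def by (intro mult_right_mono ennreal_leI) auto
      finally show "(\<integral>\<^sup>+x. w x * maximal_fun lebesgue g x epowr P \<partial>lebesgue) \<le> ennreal N * (\<integral>\<^sup>+x. w x * g x epowr P \<partial>lebesgue)" .
    qed simp
    also have "\<dots> = ennreal (B * N) * (\<integral>\<^sup>+x. w x * g x epowr P \<partial>lebesgue)"
      using B by (simp only: ennreal_mult' less_imp_le mult.assoc)
    finally show "(\<integral>\<^sup>+x. w x * F x epowr P \<partial>lebesgue) \<le> ennreal (B * N) * (\<integral>\<^sup>+x. w x * g x epowr P \<partial>lebesgue)" .
  qed
qed

lemma balls_exhaust:
  "incseq (\<lambda>n. ball (0::'a::real_normed_vector) (real n))" "(\<Union>n. ball (0::'a) (real n)) = UNIV"
proof -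
  show "incseq (\<lambda>n. ball (0::'a) (real n))" by (auto simp: incseq_def)
  have "\<exists>n. norm x < real n" for x :: 'a by (rule reals_Archimedean2)
  then show "(\<Union>n. ball (0::'a) (real n)) = UNIV" by auto
qed

text \<open>The dual test function h is majorised by the \<eta>-th power v of the maximal function
  of h^(1/\<eta>) for w dx. Norm control in the dual exponent s' needs \<eta> s' > 1, that is \<eta>
  > 1 - R/P, whereas w v has only the A_\<infinity> exponent (P/Q)(1 - \<eta>), which is then less
  than R/Q. The deficit is what the \<epsilon> of \<open>weighted_inequality\<close> permits. As w v
  is controlled only in the A_\<infinity> sense, Muckenhoupt's theorem is not applied to it and G
  stays on the right.\<close>

lemma vector_inequality_up_maximal:
  fixes w :: "'a::euclidean_space \<Rightarrow> ennreal" and P Q R a C C' :: real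
  assumes R: "1 < R" "R < P" "R < Q" and a: "1 \<le> a" and w: "Ap_weight P C w"
    and ainf: "Ainf_measure C' (P / Q) (density lebesgue w)" and C': "1 \<le> C'"
  obtains B where "0 < B"
    "\<forall>F G. (\<forall>j::nat. good_decomposition a Q (F j) (G j)) \<longrightarrow>
      (\<integral>\<^sup>+x. w x * (\<Sum>j. F j x epowr R) epowr (P / R) \<partial>lebesgue) \<le> ennreal B * (\<integral>\<^sup>+x. w x * (\<Sum>j. G j x epowr R) epowr (P / R) \<partial>lebesgue)"
proof -
  note [measurable] = Ap_weight_measurable[OF w]
  let ?\<mu> = "density lebesgue w"
  have P: "1 < P" and Q: "1 < Q" using R by auto
  have C: "1 \<le> C" by (rule Ap_weight_const_ge_1[OF w P])
  define K where "K = Ap_doubling TYPE('a) P C"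
  interpret \<mu>: doubling_measure ?\<mu> K unfolding K_def by (rule Ap_weight_doubling[OF w P])
  define s where "s = P / R"
  define s' where "s' = s / (s - 1)"
  have s: "1 < s" "1 < s'" "1 / s' = 1 - R / P" using R P by (auto simp: s_def s'_def field_simps)
  \<comment> \<open>The midpoint between 1/s' = 1 - R/P and 1. It fixes the constant of the majorant
    before \<epsilon> is known.\<close>
  define \<eta>' where "\<eta>' = 1 - R / P / 2"
  have RP: "0 < R / P" "R / P < 1" using R by auto
  define x where "x = R / P"
  have \<eta>': "\<eta>' < 1" using RP unfolding \<eta>'_def x_def[symmetric] by linarith
  have s\<eta>': "1 / s' < \<eta>'" using RP unfolding s(3) \<eta>'_def x_def[symmetric] by linarith
  define D where "D = \<mu>.majorant_const \<eta>'"
  have D: "1 \<le> D"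
  proof -
    have "2 powr (\<eta>' - 1) < 1" using \<eta>' by (auto intro: powr_less_one)
    define z where "z = K\<^sup>2 * (1 + 2 / (1 - 2 powr (\<eta>' - 1)))"
    have "0 \<le> z" using \<open>2 powr (\<eta>' - 1) < 1\<close> unfolding z_def
      by (intro mult_nonneg_nonneg add_nonneg_nonneg divide_nonneg_nonneg) auto
    have "1 * 1 \<le> 2 * (z + K)" using \<open>0 \<le> z\<close> \<mu>.K_ge_1 by (intro mult_mono) auto
    then show ?thesis unfolding D_def \<mu>.majorant_const_def z_def by simp
  qed
  have DC: "1 \<le> D * C'" and DK: "1 \<le> D * K"
    using mult_mono[of 1 D 1 C'] mult_mono[of 1 D 1 K] D C' \<mu>.K_ge_1 by auto
  obtain \<epsilon> B where \<epsilon>: "0 < \<epsilon>" and B: "0 < B" and E: "\<forall>(F :: 'a \<Rightarrow> ennreal) G V.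
      good_decomposition a Q F G \<longrightarrow> V \<in> borel_measurable lebesgue \<longrightarrow> doubling_measure (density lebesgue V) (D * K) \<longrightarrow>
      Ainf_measure (D * C') (R / Q - \<epsilon>) (density lebesgue V) \<longrightarrow>
      (\<integral>\<^sup>+x. V x * F x epowr R \<partial>lebesgue) \<le> ennreal B * (\<integral>\<^sup>+x. V x * G x epowr R \<partial>lebesgue)"
    by (rule weighted_inequality[where ?'a = 'a, OF Q R(1,3) a DC DK]) (rule that; assumption)
  \<comment> \<open>The second term is the largest \<eta> with (P/Q)(1 - \<eta>) \<ge> R/Q -
    \<epsilon>; it still exceeds 1 - R/P.\<close>
  define \<eta> where "\<eta> = min \<eta>' (1 - R / P + \<epsilon> * Q / P)"
  have "0 < \<epsilon> * Q / P" using \<epsilon> Q P by simp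
  then have \<eta>: "1 / s' < \<eta>" "\<eta> \<le> \<eta>'" using s\<eta>' s(3) RP by (auto simp: \<eta>_def)
  have "0 < 1 / s'" using s(2) by simp
  then have \<eta>0: "0 < \<eta>" using \<eta> by linarith
  have \<eta>s: "1 < \<eta> * s'" using \<eta>(1) s(2) by (simp add: divide_less_eq)
  have index: "R / Q - \<epsilon> \<le> P / Q * (1 - \<eta>)"
  proof -
    have "\<eta> \<le> 1 - R / P + \<epsilon> * Q / P" by (simp add: \<eta>_def)
    then have "R / P - \<epsilon> * Q / P \<le> 1 - \<eta>" by linarith
    then have "P / Q * (R / P - \<epsilon> * Q / P) \<le> P / Q * (1 - \<eta>)" using P Q by (intro mult_left_mono) auto
    moreover have "P / Q * (R / P - \<epsilon> * Q / P) = R / Q - \<epsilon>" using P Q by (simp add: field_simps)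
    ultimately show ?thesis by simp
  qed
  define C\<^sub>0 where "C\<^sub>0 = max 1 (\<mu>.strong_const (\<eta> * s'))"
  have C\<^sub>0: "0 < C\<^sub>0" by (simp add: C\<^sub>0_def)
  define B' where "B' = (B * C\<^sub>0 powr (1 - 1 / s)) powr s"
  show thesis
  proof (rule that[of B']; (intro allI impI)?)
    show "0 < B'" using B C\<^sub>0 by (simp add: B'_def)
    fix F G :: "nat \<Rightarrow> 'a \<Rightarrow> ennreal" assume gd: "\<forall>j. good_decomposition a Q (F j) (G j)"
    have [measurable]: "F j \<in> borel_measurable lebesgue" "G j \<in> borel_measurable lebesgue" for j
      using gd by (auto simp: good_decomposition_def)
    have "(\<integral>\<^sup>+z. (\<Sum>j. F j z epowr R) epowr s \<partial>?\<mu>) \<le> ennreal B' * (\<integral>\<^sup>+z. (\<Sum>j. G j z epowr R) epowr s \<partial>?\<mu>)"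
      unfolding B'_def
    proof (rule extrapolation_up[of _ _ _ _ _ _ "\<lambda>n. ball 0 (real n)"])
      fix h assume h [measurable]: "h \<in> borel_measurable ?\<mu>" and h0: "0 < (\<integral>\<^sup>+z. h z epowr (s / (s - 1)) \<partial>?\<mu>)"
        and h1: "(\<integral>\<^sup>+z. h z epowr (s / (s - 1)) \<partial>?\<mu>) < top"
      have [measurable]: "h \<in> borel_measurable lebesgue" using h by simp
      define g where "g z = h z epowr (1 / \<eta>)" for z
      have [measurable]: "g \<in> borel_measurable lebesgue" unfolding g_def by measurable
      let ?m = "maximal_fun ?\<mu> g"
      define v where "v z = ?m z epowr \<eta>" for z
      have [measurable]: "?m \<in> borel_measurable lebesgue" by (rule measurable_maximal_fun) simp
      have [measurable]: "v \<in> borel_measurable lebesgue" unfolding v_def by measurable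
      have int_m: "(\<integral>\<^sup>+z. ?m z epowr (\<eta> * s') \<partial>?\<mu>) \<le> ennreal C\<^sub>0 * (\<integral>\<^sup>+z. h z epowr s' \<partial>?\<mu>)"
      proof -
        have "(\<integral>\<^sup>+z. ?m z epowr (\<eta> * s') \<partial>?\<mu>) \<le> ennreal (\<mu>.strong_const (\<eta> * s')) * (\<integral>\<^sup>+z. g z epowr (\<eta> * s') \<partial>?\<mu>)"
          by (rule \<mu>.strong_type[OF _ \<eta>s]) simp
        also have "(\<integral>\<^sup>+z. g z epowr (\<eta> * s') \<partial>?\<mu>) = (\<integral>\<^sup>+z. h z epowr s' \<partial>?\<mu>)"
          using \<eta>0 by (simp add: g_def epowr_epowr)
        also have "ennreal (\<mu>.strong_const (\<eta> * s')) * \<dots> \<le> ennreal C\<^sub>0 * (\<integral>\<^sup>+z. h z epowr s' \<partial>?\<mu>)"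
          unfolding C\<^sub>0_def by (intro mult_right_mono ennreal_leI) auto
        finally show ?thesis .
      qed
      have "(\<integral>\<^sup>+z. ?m z epowr (\<eta> * s') \<partial>?\<mu>) < top"
        using h1 by (intro le_less_trans[OF int_m]) (simp add: s'_def ennreal_mult_less_top)
      then have "AE z in ?\<mu>. ?m z epowr (\<eta> * s') \<noteq> \<infinity>"
        by (intro nn_integral_PInf_AE) auto
      then have m_fin: "AE z in ?\<mu>. ?m z < top"
        by eventually_elim (use \<eta>s in \<open>auto simp: less_top[symmetric]\<close>)
      have g0: "\<not> (AE z in ?\<mu>. g z = 0)"
      proof
        assume "AE z in ?\<mu>. g z = 0"
        then have "AE z in ?\<mu>. h z epowr (s / (s - 1)) = 0"
          by eventually_elim (use \<eta>0 s in \<open>auto simp: g_def s'_def[symmetric]\<close>)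
        then have "(\<integral>\<^sup>+z. h z epowr (s / (s - 1)) \<partial>?\<mu>) = 0" by (subst nn_integral_0_iff_AE) auto
        with h0 show False by simp
      qed
      have dd: "density ?\<mu> v = density lebesgue (\<lambda>z. w z * v z)" by (rule density_density_eq) auto
      have V: "doubling_measure (density lebesgue (\<lambda>z. w z * v z)) (D * K)"
        "Ainf_measure (D * C') (P / Q * (1 - \<eta>)) (density lebesgue (\<lambda>z. w z * v z))"
        using \<mu>.majorant_weight[OF _ \<eta>0 \<eta>(2) \<eta>' g0 m_fin ainf C'] unfolding dd[symmetric] unfolding v_def D_def by simp_all
      have V': "Ainf_measure (D * C') (R / Q - \<epsilon>) (density lebesgue (\<lambda>z. w z * v z))"
        by (rule Ainf_measure_mono[OF V(2) index])
      have "AE z in ?\<mu>. g z \<le> ?m z"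
        by (rule \<mu>.le_maximal_fun_AE[OF ainf]) (use P Q in auto)
      then have hv: "AE z in ?\<mu>. h z \<le> v z"
      proof eventually_elim
        case (elim z)
        then have "g z epowr \<eta> \<le> v z" unfolding v_def using \<eta>0 by (intro epowr_mono) auto
        then show ?case using \<eta>0 by (simp add: g_def epowr_epowr)
      qed
      show "\<exists>v\<in>borel_measurable ?\<mu>. (AE z in ?\<mu>. h z \<le> v z) \<and>
        (\<integral>\<^sup>+z. v z epowr (s / (s - 1)) \<partial>?\<mu>) \<le> ennreal C\<^sub>0 * (\<integral>\<^sup>+z. h z epowr (s / (s - 1)) \<partial>?\<mu>) \<and>
        (\<forall>j. (\<integral>\<^sup>+z. F j z epowr R * v z \<partial>?\<mu>) \<le> ennreal B * (\<integral>\<^sup>+z. G j z epowr R * v z \<partial>?\<mu>))"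
      proof (intro bexI[of _ v] conjI allI)
        show "AE z in ?\<mu>. h z \<le> v z" by (rule hv)
        show "(\<integral>\<^sup>+z. v z epowr (s / (s - 1)) \<partial>?\<mu>) \<le> ennreal C\<^sub>0 * (\<integral>\<^sup>+z. h z epowr (s / (s - 1)) \<partial>?\<mu>)"
          using int_m by (simp add: v_def epowr_epowr s'_def)
        fix j
        have "(\<integral>\<^sup>+z. (w z * v z) * F j z epowr R \<partial>lebesgue) \<le> ennreal B * (\<integral>\<^sup>+z. (w z * v z) * G j z epowr R \<partial>lebesgue)"
          using E gd V(1) V' by (simp add: borel_measurable_times)
        then show "(\<integral>\<^sup>+z. F j z epowr R * v z \<partial>?\<mu>) \<le> ennreal B * (\<integral>\<^sup>+z. G j z epowr R * v z \<partial>?\<mu>)"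
          by (simp add: nn_integral_density ac_simps)
      qed auto
    qed (use s(1) B C\<^sub>0 balls_exhaust \<mu>.ball_finite in auto)
    then show "(\<integral>\<^sup>+x. w x * (\<Sum>j. F j x epowr R) epowr (P / R) \<partial>lebesgue) \<le> ennreal B' * (\<integral>\<^sup>+x. w x * (\<Sum>j. G j x epowr R) epowr (P / R) \<partial>lebesgue)"
      by (simp add: nn_integral_density s_def)
  qed
qed

text \<open>The same duality, now with a weight in A_R so that Muckenhoupt's theorem applies for
  each j. Rubio de Francia's algorithm in the dual space L^P'(\<sigma>) produces an A_1 weight U,
  and the geometric mean U^a w^(1-a) is in A_R.\<close>

lemma fefferman_stein_up:
  fixes w :: "'a::euclidean_space \<Rightarrow> ennreal" and P R C :: real
  assumes R: "1 < R" "R < P" and w: "Ap_weight P C w"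
  obtains B where "0 < B"
    "\<forall>g. (\<forall>j::nat. g j \<in> borel_measurable lebesgue) \<longrightarrow>
      (\<integral>\<^sup>+x. w x * (\<Sum>j. maximal_fun lebesgue (g j) x epowr R) epowr (P / R) \<partial>lebesgue)
        \<le> ennreal B * (\<integral>\<^sup>+x. w x * (\<Sum>j. g j x epowr R) epowr (P / R) \<partial>lebesgue)"
proof -
  note [measurable] = Ap_weight_measurable[OF w]
  let ?\<mu> = "density lebesgue w"
  have P: "1 < P" using R by simp
  have C: "1 \<le> C" by (rule Ap_weight_const_ge_1[OF w P])
  interpret \<mu>: doubling_measure ?\<mu> "Ap_doubling TYPE('a) P C" by (rule Ap_weight_doubling[OF w P])
  define s where "s = P / R"
  define P' where "P' = P / (P - 1)"
  define \<sigma> where "\<sigma> = (\<lambda>x. w x epowr (- 1 / (P - 1)))"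
  have [measurable]: "\<sigma> \<in> borel_measurable lebesgue" unfolding \<sigma>_def by measurable
  have s: "1 < s" using R by (simp add: s_def)
  have P': "1 < P'" using P by (simp add: P'_def less_divide_eq)
  \<comment> \<open>Chosen so that R = a + (1 - a) P. Then s/(s - 1) = P'/a, which matches the norm
    of h with that of u below.\<close>
  define a where "a = (P - R) / (P - 1)"
  have a: "0 < a" "a < 1" using R by (auto simp: a_def)
  have "s / (s - 1) = P / (P - R)" using R by (simp add: s_def field_simps)
  moreover have "P' / a = P / (P - R)" using R by (simp add: P'_def a_def)
  ultimately have s': "s / (s - 1) = P' / a" by simp
  have \<sigma>: "Ap_weight P' (C powr (1 / (P - 1))) \<sigma>"
    unfolding P'_def \<sigma>_def by (rule Ap_weight_dual[OF w P])
  define N where "N = max 1 (muckenhoupt_const TYPE('a) P' (C powr (1 / (P - 1))))"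
  define k where "k = 2 * N powr (1 / P')"
  have k: "0 < k" by (simp add: k_def N_def)
  define N' where "N' = max 1 (muckenhoupt_const TYPE('a) R (k powr a * C powr (1 - a)))"
  define C\<^sub>0 where "C\<^sub>0 = 2 powr P'"
  define B where "B = (N' * C\<^sub>0 powr (1 - 1 / s)) powr s"
  show thesis
  proof (rule that[of B]; (intro allI impI)?)
    show "0 < B" by (simp add: B_def N'_def C\<^sub>0_def)
    fix g :: "nat \<Rightarrow> 'a \<Rightarrow> ennreal" assume "\<forall>j. g j \<in> borel_measurable lebesgue"
    then have g [measurable]: "g j \<in> borel_measurable lebesgue" for j by blast
    have [measurable]: "maximal_fun lebesgue (g j) \<in> borel_measurable lebesgue" for j by (rule measurable_maximal_fun) simp
    have "(\<integral>\<^sup>+z. (\<Sum>j. maximal_fun lebesgue (g j) z epowr R) epowr s \<partial>?\<mu>) \<le> ennreal B * (\<integral>\<^sup>+z. (\<Sum>j. g j z epowr R) epowr s \<partial>?\<mu>)"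
      unfolding B_def
    proof (rule extrapolation_up[of _ _ _ _ _ _ "\<lambda>n. ball 0 (real n)"])
      fix h assume h [measurable]: "h \<in> borel_measurable ?\<mu>" and h0: "0 < (\<integral>\<^sup>+z. h z epowr (s / (s - 1)) \<partial>?\<mu>)"
        and h1: "(\<integral>\<^sup>+z. h z epowr (s / (s - 1)) \<partial>?\<mu>) < top"
      have [measurable]: "h \<in> borel_measurable lebesgue" using h by simp
      \<comment> \<open>The norm of u in L^P'(\<sigma>) is the dual norm of h, because \<sigma> w^P'
        = w.\<close>
      define u where "u z = h z epowr (1 / a) * w z" for z
      have [measurable]: "u \<in> borel_measurable lebesgue" unfolding u_def by measurable
      have \<sigma>w: "\<sigma> z * (x * w z) epowr P' = w z * x epowr P'" if "0 < w z" "w z < top" for x z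
      proof -
        have "- 1 / (P - 1) + P' = 1" using P by (simp add: P'_def diff_divide_distrib[symmetric])
        then have "\<sigma> z * w z epowr P' = w z" unfolding \<sigma>_def using epowr_add_finite[OF that, of "- 1 / (P - 1)" P'] by simp
        moreover have "\<sigma> z * (x * w z) epowr P' = (\<sigma> z * w z epowr P') * x epowr P'"
          using P' by (simp add: epowr_mult ac_simps)
        ultimately show ?thesis by simp
      qed
      have int_u: "(\<integral>\<^sup>+z. \<sigma> z * u z epowr P' \<partial>lebesgue) = (\<integral>\<^sup>+z. h z epowr (s / (s - 1)) \<partial>?\<mu>)"
      proof -
        have "(\<integral>\<^sup>+z. \<sigma> z * u z epowr P' \<partial>lebesgue) = (\<integral>\<^sup>+z. w z * h z epowr (s / (s - 1)) \<partial>lebesgue)"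
        proof (rule nn_integral_cong_AE, use Ap_weight_AE[OF w] in eventually_elim)
          fix z assume "0 < w z \<and> w z < top"
          then show "\<sigma> z * u z epowr P' = w z * h z epowr (s / (s - 1))"
            unfolding u_def s' using \<sigma>w[of z "h z epowr (1 / a)"] by (simp add: epowr_epowr)
        qed
        then show ?thesis by (simp add: nn_integral_density)
      qed
      obtain U where U [measurable]: "U \<in> borel_measurable lebesgue" and uU: "\<And>x. u x \<le> 2 * U x"
        and int_U: "(\<integral>\<^sup>+x. \<sigma> x * U x epowr P' \<partial>lebesgue) \<le> (\<integral>\<^sup>+x. \<sigma> x * u x epowr P' \<partial>lebesgue)"
        and A1: "\<And>x. maximal_fun lebesgue U x \<le> ennreal (2 * N powr (1 / P')) * U x"
        and U0: "\<not> (AE x in lebesgue. u x = 0) \<Longrightarrow> (\<forall>x. 0 < U x)"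
      proof (rule rubio_de_francia[of \<sigma> P' N u])
        show "(\<integral>\<^sup>+x. \<sigma> x * maximal_fun lebesgue f x epowr P' \<partial>lebesgue) \<le> ennreal N * (\<integral>\<^sup>+x. \<sigma> x * f x epowr P' \<partial>lebesgue)"
          if "f \<in> borel_measurable lebesgue" for f
          by (rule order_trans[OF muckenhoupt_maximal_theorem[OF \<sigma> P' that]])
            (auto simp: N_def intro!: mult_right_mono ennreal_leI)
      qed (use P' in \<open>auto simp: N_def\<close>)
      have u0: "\<not> (AE x in lebesgue. u x = 0)"
      proof
        assume "AE x in lebesgue. u x = 0"
        then have "AE x in lebesgue. \<sigma> x * u x epowr P' = 0" by eventually_elim (use P' in auto)
        then have "(\<integral>\<^sup>+x. \<sigma> x * u x epowr P' \<partial>lebesgue) = 0" by (subst nn_integral_0_iff_AE) auto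
        with h0 int_u show False by simp
      qed
      have "(\<integral>\<^sup>+x. \<sigma> x * U x epowr P' \<partial>lebesgue) < top" using h1 int_U unfolding int_u by (rule le_less_trans[rotated])
      then have "AE x in lebesgue. \<sigma> x * U x epowr P' \<noteq> \<infinity>" by (intro nn_integral_PInf_AE) auto
      then have U_fin: "AE x in lebesgue. 0 < U x \<and> U x < top"
        using Ap_weight_AE[OF \<sigma>]
      proof eventually_elim
        case (elim x)
        then have "U x \<noteq> top" using P' by (auto simp: ennreal_mult_top split: if_splits)
        then show ?case using U0[OF u0] by (auto simp: less_top)
      qed
      define V where "V x = U x epowr a * w x epowr (1 - a)" for x
      have V: "Ap_weight R (k powr a * C powr (1 - a)) V"
        unfolding V_def a_def using Ap_weight_A1_geometric_mean[OF w R U U_fin A1] k unfolding k_def by simp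
      \<comment> \<open>With this v, w v is the constant 2^a times V, and u \<le> 2 U becomes h
        \<le> v.\<close>
      define v where "v x = ennreal (2 powr a) * (U x * inverse (w x)) epowr a" for x
      have [measurable]: "v \<in> borel_measurable lebesgue" unfolding v_def by measurable
      have wv: "w x * v x = ennreal (2 powr a) * V x" if "0 < w x" "w x < top" for x
      proof -
        have "w x * w x epowr (- a) = w x epowr (1 - a)" using epowr_add_finite[OF that, of 1 "- a"] by simp
        then show ?thesis unfolding v_def V_def using a
          by (simp add: epowr_mult inverse_epowr epowr_minus[symmetric]) (simp flip: \<open>w x * w x epowr (- a) = w x epowr (1 - a)\<close> add: ac_simps)
      qed
      have int_V: "(\<integral>\<^sup>+z. f z * v z \<partial>?\<mu>) = ennreal (2 powr a) * (\<integral>\<^sup>+z. V z * f z \<partial>lebesgue)"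
        if [measurable]: "f \<in> borel_measurable lebesgue" for f
      proof -
        have [measurable]: "V \<in> borel_measurable lebesgue" by (rule Ap_weight_measurable[OF V])
        have "(\<integral>\<^sup>+z. f z * v z \<partial>?\<mu>) = (\<integral>\<^sup>+z. w z * (f z * v z) \<partial>lebesgue)" by (rule nn_integral_density) auto
        also have "\<dots> = (\<integral>\<^sup>+z. ennreal (2 powr a) * (V z * f z) \<partial>lebesgue)"
        proof (rule nn_integral_cong_AE, use Ap_weight_AE[OF w] in eventually_elim)
          fix z assume "0 < w z \<and> w z < top"
          then have "w z * v z = ennreal (2 powr a) * V z" by (intro wv) auto
          then show "w z * (f z * v z) = ennreal (2 powr a) * (V z * f z)" by (metis mult.assoc mult.commute)
        qed
        finally show ?thesis by (simp add: nn_integral_cmult)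
      qed
      have "AE z in lebesgue. h z \<le> v z"
        using Ap_weight_AE[OF w]
      proof eventually_elim
        case (elim z)
        then have "inverse (w z) * w z = 1" using ennreal_div_self[of "w z"] by (simp add: divide_ennreal_def mult.commute)
        then have "h z epowr (1 / a) = u z * inverse (w z)" unfolding u_def
          by (simp add: mult.assoc mult.left_commute[of "inverse (w z)"] mult.commute[of _ "inverse (w z)"])
        also have "\<dots> \<le> 2 * U z * inverse (w z)" by (intro mult_right_mono uU) auto
        finally have "(h z epowr (1 / a)) epowr a \<le> (2 * (U z * inverse (w z))) epowr a"
          using a by (intro epowr_mono) (auto simp: mult.assoc)
        then show ?case using a by (simp add: epowr_epowr v_def epowr_mult ennreal_epowr_numeral)
      qed
      then have hv: "AE z in ?\<mu>. h z \<le> v z" by (subst AE_density) (auto elim!: eventually_mono)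
      have int_v: "(\<integral>\<^sup>+z. v z epowr (s / (s - 1)) \<partial>?\<mu>) \<le> ennreal C\<^sub>0 * (\<integral>\<^sup>+z. h z epowr (s / (s - 1)) \<partial>?\<mu>)"
      proof -
        have "(\<integral>\<^sup>+z. v z epowr (s / (s - 1)) \<partial>?\<mu>) = (\<integral>\<^sup>+z. w z * v z epowr (s / (s - 1)) \<partial>lebesgue)"
          by (rule nn_integral_density) auto
        also have "\<dots> = (\<integral>\<^sup>+z. ennreal C\<^sub>0 * (\<sigma> z * U z epowr P') \<partial>lebesgue)"
        proof (rule nn_integral_cong_AE, use Ap_weight_AE[OF w] in eventually_elim)
          fix z assume z: "0 < w z \<and> w z < top"
          have "v z epowr (s / (s - 1)) = ennreal C\<^sub>0 * (U z * inverse (w z)) epowr P'"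
            unfolding s' v_def C\<^sub>0_def using a P' by (simp add: epowr_mult[of "P' / a"] epowr_epowr ennreal_epowr powr_powr)
          moreover have "w z * (U z * inverse (w z)) epowr P' = \<sigma> z * U z epowr P'"
          proof -
            have "inverse (w z) * w z = 1" using z ennreal_div_self[of "w z"] by (simp add: divide_ennreal_def mult.commute)
            then have "U z = U z * inverse (w z) * w z" by (simp add: mult.assoc)
            then show ?thesis using \<sigma>w[of z "U z * inverse (w z)"] z by simp
          qed
          ultimately show "w z * v z epowr (s / (s - 1)) = ennreal C\<^sub>0 * (\<sigma> z * U z epowr P')"
            by (simp add: mult.left_commute)
        qed
        also have "\<dots> = ennreal C\<^sub>0 * (\<integral>\<^sup>+z. \<sigma> z * U z epowr P' \<partial>lebesgue)" by (rule nn_integral_cmult) measurable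
        also have "\<dots> \<le> ennreal C\<^sub>0 * (\<integral>\<^sup>+z. h z epowr (s / (s - 1)) \<partial>?\<mu>)"
          unfolding int_u[symmetric] by (intro mult_left_mono int_U) auto
        finally show ?thesis .
      qed
      show "\<exists>v\<in>borel_measurable ?\<mu>. (AE z in ?\<mu>. h z \<le> v z) \<and>
        (\<integral>\<^sup>+z. v z epowr (s / (s - 1)) \<partial>?\<mu>) \<le> ennreal C\<^sub>0 * (\<integral>\<^sup>+z. h z epowr (s / (s - 1)) \<partial>?\<mu>) \<and>
        (\<forall>j. (\<integral>\<^sup>+z. maximal_fun lebesgue (g j) z epowr R * v z \<partial>?\<mu>) \<le> ennreal N' * (\<integral>\<^sup>+z. g j z epowr R * v z \<partial>?\<mu>))"
      proof (intro bexI[of _ v] conjI allI hv int_v)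
        fix j
        have "(\<integral>\<^sup>+z. V z * maximal_fun lebesgue (g j) z epowr R \<partial>lebesgue) \<le> ennreal N' * (\<integral>\<^sup>+z. V z * g j z epowr R \<partial>lebesgue)"
          by (rule order_trans[OF muckenhoupt_maximal_theorem[OF V R(1) g]])
            (auto simp: N'_def intro!: mult_right_mono ennreal_leI)
        then have "ennreal (2 powr a) * (\<integral>\<^sup>+z. V z * maximal_fun lebesgue (g j) z epowr R \<partial>lebesgue)
          \<le> ennreal (2 powr a) * (ennreal N' * (\<integral>\<^sup>+z. V z * g j z epowr R \<partial>lebesgue))" by (rule mult_left_mono) simp
        then show "(\<integral>\<^sup>+z. maximal_fun lebesgue (g j) z epowr R * v z \<partial>?\<mu>) \<le> ennreal N' * (\<integral>\<^sup>+z. g j z epowr R * v z \<partial>?\<mu>)"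
          by (subst (1 2) int_V) (auto simp: mult.left_commute)
      qed auto
    qed (use s balls_exhaust \<mu>.ball_finite in \<open>auto simp: N'_def C\<^sub>0_def\<close>)
    then show "(\<integral>\<^sup>+x. w x * (\<Sum>j. maximal_fun lebesgue (g j) x epowr R) epowr (P / R) \<partial>lebesgue) \<le> ennreal B * (\<integral>\<^sup>+x. w x * (\<Sum>j. g j x epowr R) epowr (P / R) \<partial>lebesgue)"
      by (simp add: nn_integral_density s_def)
  qed
qed


text \<open>Hoelder's inequality with s = P/R splits w X^s into (v X)^s and (W U^\<theta>)^(1-s),
  where W = w^\<tau> for the conjugate exponent \<tau> of Q/P. U is a Rubio de Francia majorant in
  L^\<theta>(W), so the second factor costs only the right side. The first is the case of exponent R
  for the weight v, which is defined by v^\<kappa> = W U^(\<theta> - \<theta>'), with \<kappa> the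
  conjugate exponent of Q/R: this is in A_\<theta>', hence v satisfies the A_R condition together
  with the A_\<infinity> exponent R/Q.\<close>

lemma vector_inequality_down:
  fixes w :: "'a::euclidean_space \<Rightarrow> ennreal" and P Q R a C C' C'' :: real
  assumes P: "1 < P" "P < R" "R < Q" and a: "1 \<le> a" and w: "Ap_weight P C w"
    and ainf: "Ainf_measure C'' (P / Q) (density lebesgue w)" and C'': "1 \<le> C''"
    and W: "Ap_weight (Q / (Q - P) * (P - 1) + 1) C' (\<lambda>x. w x epowr (Q / (Q - P)))"
  obtains B where "0 < B"
    "\<forall>F g. (\<forall>j::nat. g j \<in> borel_measurable lebesgue) \<longrightarrow> (\<forall>j. good_decomposition a Q (F j) (maximal_fun lebesgue (g j))) \<longrightarrow>
      (\<integral>\<^sup>+x. w x * (\<Sum>j. F j x epowr R) epowr (P / R) \<partial>lebesgue) \<le> ennreal B * (\<integral>\<^sup>+x. w x * (\<Sum>j. g j x epowr R) epowr (P / R) \<partial>lebesgue)"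
proof -
  note w_meas [measurable] = Ap_weight_measurable[OF w]
  define \<tau> where "\<tau> = Q / (Q - P)"
  define \<theta> where "\<theta> = \<tau> * (P - 1) + 1"
  define \<kappa> where "\<kappa> = Q / (Q - R)"
  define \<theta>' where "\<theta>' = \<kappa> * (R - 1) + 1"
  define s where "s = P / R"
  have pos: "0 < Q - P" "0 < Q - R" "0 < R" "0 < P" using P by auto
  have s: "0 < s" "s < 1" using P by (auto simp: s_def)
  have \<tau>: "1 < \<tau>" and \<kappa>: "1 < \<kappa>" using P by (auto simp: \<tau>_def \<kappa>_def less_divide_eq)
  have \<theta>_eq: "\<theta> = P * (Q - 1) / (Q - P)" and \<theta>'_eq: "\<theta>' = R * (Q - 1) / (Q - R)"
    using pos by (simp_all add: \<theta>_def \<theta>'_def \<tau>_def \<kappa>_def field_simps)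
  have \<theta>: "1 < \<theta>" using \<tau> P by (auto simp: \<theta>_def intro!: mult_pos_pos)
  have \<theta>\<theta>': "\<theta> < \<theta>'"
  proof -
    have "P / (Q - P) < R / (Q - R)" using P pos by (intro frac_less) auto
    then have "P / (Q - P) * (Q - 1) < R / (Q - R) * (Q - 1)" using P by (intro mult_strict_right_mono) auto
    then show ?thesis by (simp add: \<theta>_eq \<theta>'_eq)
  qed
  define b where "b = (\<theta> - \<theta>') / \<kappa>"
  \<comment> \<open>The powers of w in the two Hoelder factors add up to one.\<close>
  have e1: "s * \<tau> / \<kappa> + \<tau> * (1 - s) = 1"
  proof -
    have "s * \<tau> / \<kappa> = P * (Q - R) / (R * (Q - P))" using pos P by (simp add: s_def \<tau>_def \<kappa>_def)
    moreover have "\<tau> * (1 - s) = Q * (R - P) / (R * (Q - P))" using pos by (simp add: s_def \<tau>_def field_simps)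
    moreover have "P * (Q - R) + Q * (R - P) = R * (Q - P)" by (simp add: algebra_simps)
    ultimately show ?thesis using pos by (simp add: add_divide_distrib[symmetric])
  qed
  \<comment> \<open>The powers of U in the two Hoelder factors cancel.\<close>
  have e2: "s * b + \<theta> * (1 - s) = 0"
  proof -
    have "\<theta>' / \<kappa> = R * (Q - 1) / Q" using pos P by (simp add: \<theta>'_eq \<kappa>_def)
    moreover have "\<theta> / \<kappa> = P * (Q - 1) * (Q - R) / (Q * (Q - P))" using pos P by (simp add: \<theta>_eq \<kappa>_def)
    moreover have "R * (Q - 1) / Q = R * (Q - 1) * (Q - P) / (Q * (Q - P))" using pos by simp
    ultimately have "b = (P * (Q - 1) * (Q - R) - R * (Q - 1) * (Q - P)) / (Q * (Q - P))"
      by (simp add: b_def diff_divide_distrib)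
    also have "P * (Q - 1) * (Q - R) - R * (Q - 1) * (Q - P) = Q * ((Q - 1) * (P - R))" by (simp add: algebra_simps)
    finally have "b = (Q - 1) * (P - R) / (Q - P)" using P by simp
    moreover have "\<theta> * (1 - s) = P * ((Q - 1) * (R - P)) / (R * (Q - P))"
      using pos by (simp add: \<theta>_eq s_def field_simps)
    ultimately have "s * b + \<theta> * (1 - s) = (P * ((Q - 1) * (P - R)) + P * ((Q - 1) * (R - P))) / (R * (Q - P))"
      by (simp add: s_def add_divide_distrib)
    also have "P * ((Q - 1) * (P - R)) + P * ((Q - 1) * (R - P)) = 0" by (simp add: algebra_simps)
    finally show ?thesis by simp
  qed
  define W where "W x = w x epowr \<tau>" for x
  have W_Ap: "Ap_weight \<theta> C' W" using W unfolding W_def \<theta>_def \<tau>_def .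
  have [measurable]: "W \<in> borel_measurable lebesgue" by (rule Ap_weight_measurable[OF W_Ap])
  have C': "1 \<le> C'" by (rule Ap_weight_const_ge_1[OF W_Ap \<theta>])
  define N where "N = max 1 (muckenhoupt_const TYPE('a) \<theta> C')"
  have N0: "0 < N" by (simp add: N_def)
  define k where "k = 2 * N powr (1 / \<theta>)"
  have k: "1 \<le> k"
  proof -
    have "1 \<le> N powr (1 / \<theta>)" using \<theta> by (intro ge_one_powr_ge_zero) (auto simp: N_def)
    then show ?thesis by (simp add: k_def)
  qed
  define A\<^sub>0 where "A\<^sub>0 = C' * k powr (\<theta>' - \<theta>)"
  define A where "A = A\<^sub>0 powr (1 / \<kappa>)"
  have A: "1 \<le> A"
  proof -
    have "1 \<le> k powr (\<theta>' - \<theta>)" using k \<theta>\<theta>' by (intro ge_one_powr_ge_zero) auto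
    then have "1 * 1 \<le> A\<^sub>0" unfolding A\<^sub>0_def using C' by (intro mult_mono) auto
    then show ?thesis unfolding A_def using \<kappa> by (intro ge_one_powr_ge_zero) auto
  qed
  have R1: "1 < R" and Q1: "1 < Q" using P by auto
  define K where "K = Ap_doubling TYPE('a) R A"
  have K: "1 \<le> K" unfolding K_def using A P by (intro Ap_doubling_ge_1) auto
  obtain \<epsilon> B where \<epsilon>: "0 < \<epsilon>" and B: "0 < B" and E: "\<forall>(F :: 'a \<Rightarrow> ennreal) G V.
      good_decomposition a Q F G \<longrightarrow> V \<in> borel_measurable lebesgue \<longrightarrow> doubling_measure (density lebesgue V) K \<longrightarrow>
      Ainf_measure A (R / Q - \<epsilon>) (density lebesgue V) \<longrightarrow>
      (\<integral>\<^sup>+x. V x * F x epowr R \<partial>lebesgue) \<le> ennreal B * (\<integral>\<^sup>+x. V x * G x epowr R \<partial>lebesgue)"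
    by (rule weighted_inequality[where ?'a = 'a, OF Q1 R1 P(3) a A K]) (rule that; assumption)
  have PQ: "P < Q" using P by simp
  obtain B\<^sub>s where B\<^sub>s: "0 < B\<^sub>s"
    "\<forall>F g. g \<in> borel_measurable lebesgue \<longrightarrow> good_decomposition a Q F (maximal_fun lebesgue g) \<longrightarrow>
      (\<integral>\<^sup>+x. w x * F x epowr P \<partial>lebesgue) \<le> ennreal B\<^sub>s * (\<integral>\<^sup>+x. w x * g x epowr P \<partial>lebesgue)"
    by (rule scalar_inequality[OF P(1) PQ a w ainf C'']) (rule that; assumption)
  define N\<^sub>v where "N\<^sub>v = max 1 (muckenhoupt_const TYPE('a) R A)"
  define c where "c = 2 powr (\<theta> * (1 - s) / s)"
  define B' where "B' = (B * N\<^sub>v * c) powr s"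
  have B': "0 < B'" using B by (simp add: B'_def N\<^sub>v_def c_def)
  show thesis
  proof (rule that[of B']; (intro allI impI)?)
    show "0 < B'" by (rule B')
    fix F g :: "nat \<Rightarrow> 'a \<Rightarrow> ennreal"
    assume "\<forall>j. g j \<in> borel_measurable lebesgue" and gd: "\<forall>j. good_decomposition a Q (F j) (maximal_fun lebesgue (g j))"
    then have g [measurable]: "g j \<in> borel_measurable lebesgue" for j by blast
    have [measurable]: "F j \<in> borel_measurable lebesgue" for j using gd by (auto simp: good_decomposition_def)
    have [measurable]: "maximal_fun lebesgue (g j) \<in> borel_measurable lebesgue" for j by (rule measurable_maximal_fun) simp
    define X where "X x = (\<Sum>j. F j x epowr R)" for x
    define Y where "Y x = (\<Sum>j. g j x epowr R)" for x
    have [measurable]: "X \<in> borel_measurable lebesgue" "Y \<in> borel_measurable lebesgue" unfolding X_def Y_def by measurable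
    let ?Y = "\<integral>\<^sup>+x. w x * Y x epowr s \<partial>lebesgue"
    have "(\<integral>\<^sup>+x. w x * X x epowr s \<partial>lebesgue) \<le> ennreal B' * ?Y"
    proof -
      consider "?Y = 0" | "?Y = top" | "0 < ?Y" "?Y < top" using zero_less_iff_neq_zero less_top by metis
      then show ?thesis
      proof cases
        \<comment> \<open>Here u vanishes almost everywhere and Rubio de Francia's algorithm yields
          no positive U. The scalar inequality shows instead that every F j vanishes almost
          everywhere.\<close>
        case 1
        then have "AE x in lebesgue. w x * Y x epowr s = 0" by (subst (asm) nn_integral_0_iff_AE) auto
        then have Y0: "AE x in lebesgue. Y x = 0"
          using Ap_weight_AE[OF w] by eventually_elim (use s in auto)
        have "AE x in lebesgue. F j x = 0" for j
        proof -
          have "(\<integral>\<^sup>+x. w x * g j x epowr P \<partial>lebesgue) = 0"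
          proof (subst nn_integral_0_iff_AE)
            show "AE x in lebesgue. w x * g j x epowr P = 0"
              using Y0
            proof eventually_elim
              case (elim x)
              have "g j x epowr R \<le> Y x" unfolding Y_def using sum_le_suminf[of "\<lambda>j. g j x epowr R" "{j}"] by simp
              then show ?case using elim pos P by simp
            qed
          qed measurable
          then have "(\<integral>\<^sup>+x. w x * F j x epowr P \<partial>lebesgue) = 0"
            using B\<^sub>s(2)[rule_format, OF g, of "F j" j] gd by simp
          then have "AE x in lebesgue. w x * F j x epowr P = 0" by (subst (asm) nn_integral_0_iff_AE) auto
          then show ?thesis using Ap_weight_AE[OF w] by eventually_elim (use pos in auto)
        qed
        then have "AE x in lebesgue. \<forall>j. F j x = 0" by (subst AE_all_countable) blast
        then have "AE x in lebesgue. w x * X x epowr s = 0"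
          by eventually_elim (use s pos in \<open>simp add: X_def\<close>)
        then have "(\<integral>\<^sup>+x. w x * X x epowr s \<partial>lebesgue) = 0" by (subst nn_integral_0_iff_AE) auto
        then show ?thesis by simp
      next
        case 2
        then show ?thesis using B' by (simp add: ennreal_mult_top)
      next
        case 3
        \<comment> \<open>Chosen so that W u^\<theta> = w Y^s: the norm of u in L^\<theta>(W) is the
          right side of the claim.\<close>
        define u where "u x = Y x epowr (s / \<theta>) * w x epowr ((1 - \<tau>) / \<theta>)" for x
        have [measurable]: "u \<in> borel_measurable lebesgue" unfolding u_def by measurable
        have Wu: "W x * u x epowr \<theta> = w x * Y x epowr s" if "0 < w x" "w x < top" for x
        proof -
          have "u x epowr \<theta> = Y x epowr s * w x epowr (1 - \<tau>)" using \<theta> by (simp add: u_def epowr_mult epowr_epowr)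
          moreover have "W x * w x epowr (1 - \<tau>) = w x"
            unfolding W_def using epowr_add_finite[OF that, of \<tau> "1 - \<tau>"] by simp
          ultimately show ?thesis by (metis mult.assoc mult.commute)
        qed
        have int_u: "(\<integral>\<^sup>+x. W x * u x epowr \<theta> \<partial>lebesgue) = ?Y"
          by (rule nn_integral_cong_AE, use Ap_weight_AE[OF w] in eventually_elim) (use Wu in auto)
        obtain U where U [measurable]: "U \<in> borel_measurable lebesgue" and uU: "\<And>x. u x \<le> 2 * U x"
          and int_U: "(\<integral>\<^sup>+x. W x * U x epowr \<theta> \<partial>lebesgue) \<le> (\<integral>\<^sup>+x. W x * u x epowr \<theta> \<partial>lebesgue)"
          and A1: "\<And>x. maximal_fun lebesgue U x \<le> ennreal (2 * N powr (1 / \<theta>)) * U x"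
          and U0: "\<not> (AE x in lebesgue. u x = 0) \<Longrightarrow> (\<forall>x. 0 < U x)"
        proof (rule rubio_de_francia[of W \<theta> N u])
          show "(\<integral>\<^sup>+x. W x * maximal_fun lebesgue f x epowr \<theta> \<partial>lebesgue) \<le> ennreal N * (\<integral>\<^sup>+x. W x * f x epowr \<theta> \<partial>lebesgue)"
            if "f \<in> borel_measurable lebesgue" for f
            by (rule order_trans[OF muckenhoupt_maximal_theorem[OF W_Ap \<theta> that]])
              (auto simp: N_def intro!: mult_right_mono ennreal_leI)
        qed (use \<theta> in \<open>auto simp: N_def\<close>)
        have u0: "\<not> (AE x in lebesgue. u x = 0)"
        proof
          assume "AE x in lebesgue. u x = 0"
          then have "AE x in lebesgue. W x * u x epowr \<theta> = 0" by eventually_elim (use \<theta> in auto)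
          then have "(\<integral>\<^sup>+x. W x * u x epowr \<theta> \<partial>lebesgue) = 0" by (subst nn_integral_0_iff_AE) auto
          with 3 int_u show False by simp
        qed
        have "(\<integral>\<^sup>+x. W x * U x epowr \<theta> \<partial>lebesgue) < top" using 3(2) int_U unfolding int_u by (rule le_less_trans[rotated])
        then have "AE x in lebesgue. W x * U x epowr \<theta> \<noteq> \<infinity>" by (intro nn_integral_PInf_AE) auto
        then have U_fin: "AE x in lebesgue. 0 < U x \<and> U x < top"
          using Ap_weight_AE[OF W_Ap]
        proof eventually_elim
          case (elim x)
          then have "U x \<noteq> top" using \<theta> by (auto simp: ennreal_mult_top split: if_splits)
          then show ?case using U0[OF u0] by (auto simp: less_top)
        qed
        \<comment> \<open>The difference \<theta> - \<theta>' is negative, so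
          \<open>Ap_weight_mult_A1_negative_power\<close> raises the class of W from \<theta> to
          \<theta>', the index attached to \<kappa> and R.\<close>
        define v where "v x = (W x * U x epowr (\<theta> - \<theta>')) epowr (1 / \<kappa>)" for x
        have v [measurable]: "v \<in> borel_measurable lebesgue" unfolding v_def by measurable
        have v\<kappa>: "Ap_weight (\<kappa> * (R - 1) + 1) A\<^sub>0 (\<lambda>x. v x epowr \<kappa>)"
          using Ap_weight_mult_A1_negative_power[OF W_Ap \<theta> \<theta>\<theta>' U U_fin A1] k \<kappa> N0
          unfolding v_def epowr_epowr A\<^sub>0_def k_def \<theta>'_def[symmetric] by simp
        have v_Ap: "Ap_weight R A v" unfolding A_def by (rule Ap_weight_epowr_imp[OF v\<kappa> v R1 \<kappa>])
        have v_Ainf: "Ainf_measure A (R / Q - \<epsilon>) (density lebesgue v)"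
        proof (rule Ainf_measure_mono)
          show "Ainf_measure A (1 - 1 / \<kappa>) (density lebesgue v)"
            unfolding A_def by (rule Ap_weight_epowr_Ainf[OF v\<kappa> v R1 \<kappa>])
          have "1 - 1 / \<kappa> = R / Q" using pos P by (simp add: \<kappa>_def field_simps)
          then show "R / Q - \<epsilon> \<le> 1 - 1 / \<kappa>" using \<epsilon> by simp
        qed
        have v_dbl: "doubling_measure (density lebesgue v) K"
          unfolding K_def by (rule Ap_weight_doubling[OF v_Ap R1])
        have v_eq: "v x = w x epowr (\<tau> / \<kappa>) * U x epowr b" if "0 < w x" "w x < top" "0 < U x" "U x < top" for x
          unfolding v_def W_def b_def using that \<kappa> by (simp add: epowr_mult epowr_epowr)
        have single: "(\<integral>\<^sup>+x. v x * F j x epowr R \<partial>lebesgue) \<le> ennreal (B * N\<^sub>v) * (\<integral>\<^sup>+x. v x * g j x epowr R \<partial>lebesgue)" for j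
        proof -
          have "(\<integral>\<^sup>+x. v x * F j x epowr R \<partial>lebesgue) \<le> ennreal B * (\<integral>\<^sup>+x. v x * maximal_fun lebesgue (g j) x epowr R \<partial>lebesgue)"
            using E gd v v_dbl v_Ainf by blast
          also have "\<dots> \<le> ennreal B * (ennreal N\<^sub>v * (\<integral>\<^sup>+x. v x * g j x epowr R \<partial>lebesgue))"
            by (intro mult_left_mono order_trans[OF muckenhoupt_maximal_theorem[OF v_Ap R1 g]])
              (auto simp: N\<^sub>v_def intro!: mult_right_mono ennreal_leI)
          also have "\<dots> = ennreal (B * N\<^sub>v) * (\<integral>\<^sup>+x. v x * g j x epowr R \<partial>lebesgue)"
            using B by (simp only: ennreal_mult' less_imp_le mult.assoc)
          finally show ?thesis .
        qed
        have int_X: "(\<integral>\<^sup>+x. v x * X x \<partial>lebesgue) \<le> ennreal (B * N\<^sub>v) * (\<integral>\<^sup>+x. v x * Y x \<partial>lebesgue)"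
        proof -
          have "(\<integral>\<^sup>+x. v x * X x \<partial>lebesgue) = (\<Sum>j. \<integral>\<^sup>+x. v x * F j x epowr R \<partial>lebesgue)"
            unfolding X_def ennreal_suminf_cmult[symmetric] by (rule nn_integral_suminf) measurable
          also have "\<dots> \<le> (\<Sum>j. ennreal (B * N\<^sub>v) * (\<integral>\<^sup>+x. v x * g j x epowr R \<partial>lebesgue))" by (intro suminf_le single) auto
          also have "\<dots> = ennreal (B * N\<^sub>v) * (\<Sum>j. \<integral>\<^sup>+x. v x * g j x epowr R \<partial>lebesgue)" by (rule ennreal_suminf_cmult)
          also have "(\<Sum>j. \<integral>\<^sup>+x. v x * g j x epowr R \<partial>lebesgue) = (\<integral>\<^sup>+x. v x * Y x \<partial>lebesgue)"
            unfolding Y_def ennreal_suminf_cmult[symmetric] by (rule nn_integral_suminf[symmetric]) measurable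
          finally show ?thesis .
        qed
        have "(\<integral>\<^sup>+x. v x * Y x \<partial>lebesgue) \<le> (\<integral>\<^sup>+x. ennreal c * (w x * Y x epowr s) \<partial>lebesgue)"
        proof (rule nn_integral_mono_AE, use Ap_weight_AE[OF w] U_fin in eventually_elim)
          fix x assume x: "0 < w x \<and> w x < top" "0 < U x \<and> U x < top"
          show "v x * Y x \<le> ennreal c * (w x * Y x epowr s)"
          proof (cases "Y x" rule: ennreal_cases_pos)
            case (pos y)
            then have yf: "0 < Y x" "Y x < top" by auto
            \<comment> \<open>The exponent with m = - b. Raising u \<le> 2 U to this power turns the
              negative power of U in v into the factor that reduces Y to Y^s.\<close>
            define m where "m = \<theta> * (1 - s) / s"
            have m: "0 < m" using \<theta> s by (simp add: m_def)
            have "Y x epowr (1 - s) * w x epowr ((1 - \<tau>) * (1 - s) / s) = u x epowr m"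
              using m \<theta> s by (simp add: u_def epowr_mult epowr_epowr m_def)
            also have "\<dots> \<le> (2 * U x) epowr m" using uU m by (intro epowr_mono) auto
            also have "\<dots> = ennreal c * U x epowr m" using m by (simp add: epowr_mult ennreal_epowr_numeral c_def m_def)
            finally have le: "Y x epowr (1 - s) * w x epowr ((1 - \<tau>) * (1 - s) / s) \<le> ennreal c * U x epowr m" .
            have mb: "m + b = 0"
            proof -
              have "s * (m + b) = 0" using e2 s by (simp add: m_def distrib_left mult.commute)
              then show ?thesis using s by simp
            qed
            have ww: "(1 - \<tau>) * (1 - s) / s + (1 - \<tau> / \<kappa>) = 0"
            proof -
              have "s * ((1 - \<tau>) * (1 - s) / s + (1 - \<tau> / \<kappa>)) = (1 - \<tau>) * (1 - s) + (s - s * \<tau> / \<kappa>)"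
                using s by (simp add: distrib_left right_diff_distrib[of s])
              also have "\<dots> = 1 - (s * \<tau> / \<kappa> + \<tau> * (1 - s))" by (simp add: algebra_simps)
              also have "\<dots> = 0" using e1 by simp
              finally show ?thesis using s by simp
            qed
            have w_split: "w x epowr (\<tau> / \<kappa>) = w x * w x epowr ((1 - \<tau>) * (1 - s) / s)"
            proof -
              have "1 + (1 - \<tau>) * (1 - s) / s = \<tau> / \<kappa>" using ww by linarith
              then show ?thesis using epowr_add_finite[of "w x" 1 "(1 - \<tau>) * (1 - s) / s"] x by simp
            qed
            have "Y x = Y x epowr s * Y x epowr (1 - s)"
              using epowr_add_finite[OF yf, of s "1 - s"] by simp
            then have "v x * Y x = v x * (Y x epowr s * Y x epowr (1 - s))" by (rule arg_cong)
            also have "\<dots> = (w x * Y x epowr s) * U x epowr b * (Y x epowr (1 - s) * w x epowr ((1 - \<tau>) * (1 - s) / s))"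
              using x by (simp only: v_eq w_split ac_simps)
            also have "\<dots> \<le> (w x * Y x epowr s) * U x epowr b * (ennreal c * U x epowr m)"
              by (intro mult_left_mono le) auto
            also have "\<dots> = ennreal c * (w x * Y x epowr s) * (U x epowr m * U x epowr b)" by (simp only: ac_simps)
            also have "U x epowr m * U x epowr b = 1"
              using epowr_add_finite[of "U x" m b] x mb by simp
            finally show ?thesis by simp
          next
            case infinity
            then show ?thesis using x s by (auto simp: ennreal_mult_top c_def)
          qed simp
        qed
        also have "\<dots> = ennreal c * ?Y" by (rule nn_integral_cmult) measurable
        finally have int_vY: "(\<integral>\<^sup>+x. v x * Y x \<partial>lebesgue) \<le> ennreal c * ?Y" .
        have "(\<integral>\<^sup>+x. w x * X x epowr s \<partial>lebesgue) = (\<integral>\<^sup>+x. (v x * X x) epowr s * (W x * U x epowr \<theta>) epowr (1 - s) \<partial>lebesgue)"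
        proof (rule nn_integral_cong_AE, use Ap_weight_AE[OF w] U_fin in eventually_elim)
          fix x assume x: "0 < w x \<and> w x < top" "0 < U x \<and> U x < top"
          have "(v x * X x) epowr s * (W x * U x epowr \<theta>) epowr (1 - s)
            = (w x epowr (s * \<tau> / \<kappa>) * w x epowr (\<tau> * (1 - s))) * (U x epowr (s * b) * U x epowr (\<theta> * (1 - s))) * X x epowr s"
            using x s by (simp add: v_eq W_def epowr_mult epowr_epowr ac_simps)
          also have "w x epowr (s * \<tau> / \<kappa>) * w x epowr (\<tau> * (1 - s)) = w x"
            using epowr_add_finite[of "w x" "s * \<tau> / \<kappa>" "\<tau> * (1 - s)"] x e1 by simp
          also have "U x epowr (s * b) * U x epowr (\<theta> * (1 - s)) = 1"
            using epowr_add_finite[of "U x" "s * b" "\<theta> * (1 - s)"] x e2 by simp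
          finally show "w x * X x epowr s = (v x * X x) epowr s * (W x * U x epowr \<theta>) epowr (1 - s)" by simp
        qed
        also have "\<dots> \<le> (\<integral>\<^sup>+x. v x * X x \<partial>lebesgue) epowr s * (\<integral>\<^sup>+x. W x * U x epowr \<theta> \<partial>lebesgue) epowr (1 - s)"
          by (rule nn_integral_Hoelder) (use s in auto)
        also have "\<dots> \<le> (ennreal (B * N\<^sub>v) * (ennreal c * ?Y)) epowr s * ?Y epowr (1 - s)"
        proof (intro mult_mono epowr_mono)
          show "(\<integral>\<^sup>+x. v x * X x \<partial>lebesgue) \<le> ennreal (B * N\<^sub>v) * (ennreal c * ?Y)"
            by (rule order_trans[OF int_X mult_left_mono[OF int_vY]]) simp
          show "(\<integral>\<^sup>+x. W x * U x epowr \<theta> \<partial>lebesgue) \<le> ?Y" using int_U unfolding int_u .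
        qed (use s in auto)
        also have "\<dots> = ennreal B' * (?Y epowr s * ?Y epowr (1 - s))"
        proof -
          have BN: "0 < B * N\<^sub>v" "0 < c" using B by (auto simp: N\<^sub>v_def c_def)
          have "(ennreal (B * N\<^sub>v) * (ennreal c * ?Y)) epowr s = (ennreal (B * N\<^sub>v * c) * ?Y) epowr s"
            using BN by (simp only: ennreal_mult'[of "B * N\<^sub>v", OF less_imp_le] mult.assoc[symmetric])
          also have "\<dots> = ennreal B' * ?Y epowr s"
            unfolding epowr_mult[OF s(1)] B'_def using BN by (subst ennreal_epowr) auto
          finally show ?thesis by (simp only: mult.assoc)
        qed
        also have "?Y epowr s * ?Y epowr (1 - s) = ?Y"
          using s by (subst epowr_add[symmetric]) auto
        finally show ?thesis .
      qed
    qed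
    then show "(\<integral>\<^sup>+x. w x * (\<Sum>j. F j x epowr R) epowr (P / R) \<partial>lebesgue) \<le> ennreal B' * (\<integral>\<^sup>+x. w x * (\<Sum>j. g j x epowr R) epowr (P / R) \<partial>lebesgue)"
      unfolding X_def Y_def s_def .
  qed
qed

text \<open>Since R < Q, the endpoint P = Q occurs only in the case R < P, where the good-\<lambda>
  inequality is used with the exponent R. Both remaining cases have P < Q.\<close>

theorem vector_inequality:
  fixes w :: "'a::euclidean_space \<Rightarrow> ennreal" and P Q R a C C' C'' :: real
  assumes P: "1 < P" "P \<le> Q" and R: "1 < R" "R < Q" and a: "1 \<le> a" and w: "Ap_weight P C w"
    and ainf: "Ainf_measure C'' (P / Q) (density lebesgue w)" and C'': "1 \<le> C''"
    and W: "P < Q \<Longrightarrow> Ap_weight (Q / (Q - P) * (P - 1) + 1) C' (\<lambda>x. w x epowr (Q / (Q - P)))"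
  obtains B where "0 < B"
    "\<forall>F g. (\<forall>j::nat. g j \<in> borel_measurable lebesgue) \<longrightarrow> (\<forall>j. good_decomposition a Q (F j) (maximal_fun lebesgue (g j))) \<longrightarrow>
      (\<integral>\<^sup>+x. w x * (\<Sum>j. F j x epowr R) epowr (P / R) \<partial>lebesgue) \<le> ennreal B * (\<integral>\<^sup>+x. w x * (\<Sum>j. g j x epowr R) epowr (P / R) \<partial>lebesgue)"
proof -
  note [measurable] = Ap_weight_measurable[OF w]
  consider "P < R" | "P = R" | "R < P" by linarith
  then show thesis
  proof cases
    case 1
    then have PQ: "P < Q" using R by simp
    show thesis
      by (rule vector_inequality_down[OF P(1) 1 R(2) a w ainf C'' W[OF PQ]]) (rule that; assumption)
  next
    case 2
    then have PQ: "P < Q" using R by simp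
    obtain B where B: "0 < B"
      "\<forall>F g. g \<in> borel_measurable lebesgue \<longrightarrow> good_decomposition a Q F (maximal_fun lebesgue g) \<longrightarrow>
        (\<integral>\<^sup>+x. w x * F x epowr P \<partial>lebesgue) \<le> ennreal B * (\<integral>\<^sup>+x. w x * g x epowr P \<partial>lebesgue)"
      by (rule scalar_inequality[OF P(1) PQ a w ainf C'']) (rule that; assumption)
    show thesis
    proof (rule that[OF B(1)]; (intro allI impI)?)
      fix F g :: "nat \<Rightarrow> 'a \<Rightarrow> ennreal"
      assume "\<forall>j. g j \<in> borel_measurable lebesgue" and gd: "\<forall>j. good_decomposition a Q (F j) (maximal_fun lebesgue (g j))"
      then have g [measurable]: "g j \<in> borel_measurable lebesgue" for j by blast
      have [measurable]: "F j \<in> borel_measurable lebesgue" for j using gd by (auto simp: good_decomposition_def)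
      have "(\<integral>\<^sup>+x. w x * (\<Sum>j. F j x epowr R) epowr (P / R) \<partial>lebesgue) = (\<integral>\<^sup>+x. w x * (\<Sum>j. F j x epowr P) \<partial>lebesgue)"
        using 2 R by simp
      also have "\<dots> = (\<Sum>j. \<integral>\<^sup>+x. w x * F j x epowr P \<partial>lebesgue)"
        unfolding ennreal_suminf_cmult[symmetric] by (rule nn_integral_suminf) measurable
      also have "\<dots> \<le> (\<Sum>j. ennreal B * (\<integral>\<^sup>+x. w x * g j x epowr P \<partial>lebesgue))"
        using B(2) g gd by (intro suminf_le) auto
      also have "\<dots> = ennreal B * (\<Sum>j. \<integral>\<^sup>+x. w x * g j x epowr P \<partial>lebesgue)" by (rule ennreal_suminf_cmult)
      also have "(\<Sum>j. \<integral>\<^sup>+x. w x * g j x epowr P \<partial>lebesgue) = (\<integral>\<^sup>+x. w x * (\<Sum>j. g j x epowr P) \<partial>lebesgue)"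
        unfolding ennreal_suminf_cmult[symmetric] by (rule nn_integral_suminf[symmetric]) measurable
      finally show "(\<integral>\<^sup>+x. w x * (\<Sum>j. F j x epowr R) epowr (P / R) \<partial>lebesgue) \<le> ennreal B * (\<integral>\<^sup>+x. w x * (\<Sum>j. g j x epowr R) epowr (P / R) \<partial>lebesgue)"
        using 2 R by simp
    qed
  next
    case 3
    obtain B where B: "0 < B" "\<forall>F G. (\<forall>j::nat. good_decomposition a Q (F j) (G j)) \<longrightarrow>
      (\<integral>\<^sup>+x. w x * (\<Sum>j. F j x epowr R) epowr (P / R) \<partial>lebesgue) \<le> ennreal B * (\<integral>\<^sup>+x. w x * (\<Sum>j. G j x epowr R) epowr (P / R) \<partial>lebesgue)"
      by (rule vector_inequality_up_maximal[OF R(1) 3 R(2) a w ainf C'']) (rule that; assumption)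
    obtain B' where B': "0 < B'" "\<forall>g. (\<forall>j::nat. g j \<in> borel_measurable lebesgue) \<longrightarrow>
      (\<integral>\<^sup>+x. w x * (\<Sum>j. maximal_fun lebesgue (g j) x epowr R) epowr (P / R) \<partial>lebesgue)
        \<le> ennreal B' * (\<integral>\<^sup>+x. w x * (\<Sum>j. g j x epowr R) epowr (P / R) \<partial>lebesgue)"
      by (rule fefferman_stein_up[OF R(1) 3 w]) (rule that; assumption)
    show thesis
    proof (rule that[of "B * B'"]; (intro allI impI)?)
      show "0 < B * B'" using B B' by simp
      fix F g :: "nat \<Rightarrow> 'a \<Rightarrow> ennreal"
      assume g: "\<forall>j. g j \<in> borel_measurable lebesgue" and gd: "\<forall>j. good_decomposition a Q (F j) (maximal_fun lebesgue (g j))"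
      have "(\<integral>\<^sup>+x. w x * (\<Sum>j. F j x epowr R) epowr (P / R) \<partial>lebesgue)
        \<le> ennreal B * (\<integral>\<^sup>+x. w x * (\<Sum>j. maximal_fun lebesgue (g j) x epowr R) epowr (P / R) \<partial>lebesgue)"
        using B(2)[rule_format, of F "\<lambda>j. maximal_fun lebesgue (g j)"] gd by blast
      also have "\<dots> \<le> ennreal B * (ennreal B' * (\<integral>\<^sup>+x. w x * (\<Sum>j. g j x epowr R) epowr (P / R) \<partial>lebesgue))"
        using B'(2) g by (intro mult_left_mono) auto
      finally show "(\<integral>\<^sup>+x. w x * (\<Sum>j. F j x epowr R) epowr (P / R) \<partial>lebesgue) \<le> ennreal (B * B') * (\<integral>\<^sup>+x. w x * (\<Sum>j. g j x epowr R) epowr (P / R) \<partial>lebesgue)"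
        using B(1) by (simp only: ennreal_mult' less_imp_le mult.assoc)
    qed
  qed
qed

subsection \<open>From the operators to the decompositions\<close>

lemma maximal_eq_maximal_fun: "maximal g = maximal_fun lebesgue g"
  by (rule ext) (simp only: maximal_def maximal_fun_def average_def)

lemma average_mult_ball:
  "0 < \<rho> \<Longrightarrow> (\<integral>\<^sup>+x\<in>ball c \<rho>. g x \<partial>lebesgue) = emeasure lebesgue (ball c \<rho>) * average (ball c \<rho>) g"
  unfolding average_def using lebesgue_ball_pos[of \<rho> c] lebesgue_ball_finite[of c \<rho>]
  by (simp add: ennreal_mult_div_cancel)

lemma weight_measurable: "weight w \<Longrightarrow> w \<in> borel_measurable lebesgue"
  by (simp add: weight_def)

lemma weight_integral_ball_finite:
  assumes w: "weight w"
  shows "(\<integral>\<^sup>+x\<in>ball c \<rho>. ennreal (w x) \<partial>lebesgue) < top"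
proof -
  have w0: "0 \<le> w x" for x using w by (simp add: weight_def)
  have "set_integrable lebesgue (cball c \<rho>) w" using w by (simp add: weight_def)
  then have "(\<integral>\<^sup>+x. ennreal (norm (indicat_real (cball c \<rho>) x *\<^sub>R w x)) \<partial>lebesgue) < \<infinity>"
    unfolding set_integrable_def by (simp only: integrable_iff_bounded)
  moreover have "(\<integral>\<^sup>+x\<in>ball c \<rho>. ennreal (w x) \<partial>lebesgue) \<le> (\<integral>\<^sup>+x. ennreal (norm (indicat_real (cball c \<rho>) x *\<^sub>R w x)) \<partial>lebesgue)"
    by (rule nn_integral_mono) (auto simp: w0 split: split_indicator)
  ultimately show ?thesis by simp
qed

text \<open>A weight in A_t that is not zero almost everywhere is positive almost everywhere. Some
  ball around the origin has positive mass, hence all larger ones do; the A_t bound then makes the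
  integral of w^(-1/(t - 1)) finite on them, which excludes zeros since a negative power of 0 is
  \<infinity>.\<close>

lemma muckenhoupt_Ap_weight:
  fixes w :: "real^'n \<Rightarrow> real"
  assumes w: "w \<in> muckenhoupt t" and t: "1 < t" and nz: "\<not> (AE x in lebesgue. w x = 0)"
  obtains C where "Ap_weight t C (\<lambda>x. ennreal (w x))"
proof -
  have wt: "weight w" using w by (simp add: muckenhoupt_def)
  then have w0: "0 \<le> w x" for x by (simp add: weight_def)
  have [measurable]: "w \<in> borel_measurable lebesgue" by (rule weight_measurable[OF wt])
  define I where "I c \<rho> = (\<integral>\<^sup>+x\<in>ball c \<rho>. ennreal (w x) \<partial>lebesgue)" for c \<rho>
  define J where "J c \<rho> = (\<integral>\<^sup>+x\<in>ball c \<rho>. ennreal (w x) epowr (- 1 / (t - 1)) \<partial>lebesgue)" for c \<rho>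
  have "1 - t / (t - 1) = - 1 / (t - 1)" using t by (simp add: field_simps)
  then obtain C where C: "average (ball c \<rho>) (\<lambda>y. ennreal (w y)) *
      average (ball c \<rho>) (\<lambda>y. ennreal (w y) epowr (- 1 / (t - 1))) epowr (t - 1) \<le> ennreal C" if "0 < \<rho>" for c \<rho>
    using w t unfolding muckenhoupt_def by auto
  have IJ: "I c \<rho> * J c \<rho> epowr (t - 1) \<le> ennreal C * emeasure lebesgue (ball c \<rho>) epowr t" if \<rho>: "0 < \<rho>" for c \<rho>
  proof -
    let ?b = "emeasure lebesgue (ball c \<rho>)"
    have "I c \<rho> * J c \<rho> epowr (t - 1) = (?b * ?b epowr (t - 1)) * (average (ball c \<rho>) (\<lambda>y. ennreal (w y)) *
      average (ball c \<rho>) (\<lambda>y. ennreal (w y) epowr (- 1 / (t - 1))) epowr (t - 1))"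
      unfolding I_def J_def average_mult_ball[OF \<rho>] using t by (simp only: epowr_mult diff_gt_0_iff_gt ac_simps)
    also have "?b * ?b epowr (t - 1) = ?b epowr t"
      using epowr_add_finite[OF lebesgue_ball_pos[OF \<rho>] lebesgue_ball_finite, of c 1 "t - 1"] by simp
    also have "?b epowr t * (average (ball c \<rho>) (\<lambda>y. ennreal (w y)) *
      average (ball c \<rho>) (\<lambda>y. ennreal (w y) epowr (- 1 / (t - 1))) epowr (t - 1)) \<le> ?b epowr t * ennreal C"
      by (rule mult_left_mono[OF C[OF \<rho>]]) simp
    finally show ?thesis by (simp only: mult.commute)
  qed
  have pos: "AE x in lebesgue. 0 < w x"
  proof -
    have "\<exists>n. I 0 (real n) \<noteq> 0"
    proof (rule ccontr)
      assume "\<not> ?thesis"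
      then have "AE x in lebesgue. ennreal (w x) * indicator (ball 0 (real n)) x = 0" for n
        by (subst nn_integral_0_iff_AE[symmetric]) (auto simp: I_def)
      then have "AE x in lebesgue. \<forall>n. ennreal (w x) * indicator (ball 0 (real n)) x = 0" by (subst AE_all_countable) auto
      then have "AE x in lebesgue. w x = 0"
      proof eventually_elim
        case (elim x)
        obtain n where "norm x < real n" using reals_Archimedean2 by blast
        then show ?case using elim[rule_format, of n] w0[of x] by (simp add: ennreal_eq_0_iff)
      qed
      with nz show False by simp
    qed
    then obtain n\<^sub>0 where n\<^sub>0: "I 0 (real n\<^sub>0) \<noteq> 0" by blast
    have "AE x in lebesgue. n\<^sub>0 < n \<longrightarrow> x \<in> ball 0 (real n) \<longrightarrow> 0 < w x" for n
    proof (cases "n\<^sub>0 < n")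
      case True
      have "I 0 (real n\<^sub>0) \<le> I 0 (real n)"
        unfolding I_def using True by (intro nn_integral_mono) (auto split: split_indicator)
      then have I: "I 0 (real n) \<noteq> 0" using n\<^sub>0 by auto
      have "I 0 (real n) * J 0 (real n) epowr (t - 1) < top"
      proof (rule le_less_trans[OF IJ])
        have "emeasure lebesgue (ball (0 :: real^'n) (real n)) epowr t < top"
          using t by (intro epowr_less_top lebesgue_ball_finite) auto
        then show "ennreal C * emeasure lebesgue (ball (0 :: real^'n) (real n)) epowr t < top"
          by (simp add: ennreal_mult_less_top)
      qed (use True in auto)
      then have "J 0 (real n) \<noteq> \<infinity>" using I t by (auto simp: ennreal_mult_top)
      then have "AE x in lebesgue. ennreal (w x) epowr (- 1 / (t - 1)) * indicator (ball 0 (real n)) x \<noteq> \<infinity>"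
        unfolding J_def by (intro nn_integral_PInf_AE) auto
      then show ?thesis
      proof eventually_elim
        case (elim x)
        have "ennreal 0 epowr (- 1 / (t - 1)) = \<infinity>" using t by (simp add: epowr_def)
        then have "x \<in> ball 0 (real n) \<longrightarrow> w x \<noteq> 0" using elim by auto
        then show ?case using w0[of x] by auto
      qed
    qed auto
    then have "AE x in lebesgue. \<forall>n. n\<^sub>0 < n \<longrightarrow> x \<in> ball 0 (real n) \<longrightarrow> 0 < w x" by (subst AE_all_countable) auto
    then show ?thesis
    proof eventually_elim
      case (elim x)
      obtain n where "norm x < real n" using reals_Archimedean2 by blast
      then have "norm x < real (n + n\<^sub>0 + 1)" by simp
      then show ?case using elim[rule_format, of "n + n\<^sub>0 + 1"] by simp
    qed
  qed
  have "Ap_weight t C (\<lambda>x. ennreal (w x))"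
    unfolding Ap_weight_def I_def[symmetric] J_def[symmetric]
  proof (intro conjI allI impI)
    show "AE x in lebesgue. 0 < ennreal (w x) \<and> ennreal (w x) < top" using pos by eventually_elim auto
  qed (use IJ weight_integral_ball_finite[OF wt] in \<open>auto simp: I_def\<close>)
  then show thesis by (rule that)
qed

text \<open>The constants of the hypotheses are arbitrary reals, and \<open>ennreal\<close> sends
  negative ones to 0.\<close>

lemma ennreal_epowr_max: "0 < a \<Longrightarrow> ennreal C epowr a = ennreal (max C 0 powr a)"
  by (cases "0 \<le> C") (auto simp: ennreal_epowr_nonneg ennreal_neg max_def)

lemma reverse_hoelder_integral:
  fixes w :: "real^'n \<Rightarrow> real"
  assumes w: "w \<in> reverse_hoelder (ereal \<tau>)" and \<tau>: "1 < \<tau>"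
  shows "\<exists>C'. \<forall>c \<rho>. 0 < \<rho> \<longrightarrow> (\<integral>\<^sup>+x\<in>ball c \<rho>. ennreal (w x) epowr \<tau> \<partial>lebesgue)
    \<le> ennreal C' * emeasure lebesgue (ball c \<rho>) epowr (1 - \<tau>) * (\<integral>\<^sup>+x\<in>ball c \<rho>. ennreal (w x) \<partial>lebesgue) epowr \<tau>"
proof -
  have "ereal \<tau> \<noteq> 1" using \<tau> by simp
  then obtain C where C: "Lp_average (ereal \<tau>) (ball c \<rho>) (\<lambda>y. ennreal (w y))
      \<le> ennreal C * average (ball c \<rho>) (\<lambda>y. ennreal (w y))" if "0 < \<rho>" for c \<rho>
    using w unfolding reverse_hoelder_def by auto
  have "(\<integral>\<^sup>+x\<in>ball c \<rho>. ennreal (w x) epowr \<tau> \<partial>lebesgue)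
    \<le> ennreal (max C 0 powr \<tau>) * emeasure lebesgue (ball c \<rho>) epowr (1 - \<tau>) * (\<integral>\<^sup>+x\<in>ball c \<rho>. ennreal (w x) \<partial>lebesgue) epowr \<tau>"
    if \<rho>: "0 < \<rho>" for c \<rho>
  proof -
    let ?b = "emeasure lebesgue (ball c \<rho>)" and ?A = "average (ball c \<rho>) (\<lambda>y. ennreal (w y))"
    have "average (ball c \<rho>) (\<lambda>y. ennreal (w y) epowr \<tau>) \<le> (ennreal C * ?A) epowr \<tau>"
      using C[OF \<rho>, of c] \<tau> by (simp add: Lp_average_def epowr_le_swap)
    also have "\<dots> = ennreal (max C 0 powr \<tau>) * ?A epowr \<tau>" using \<tau> by (simp add: epowr_mult ennreal_epowr_max)
    finally have "?b * average (ball c \<rho>) (\<lambda>y. ennreal (w y) epowr \<tau>) \<le> ?b * (ennreal (max C 0 powr \<tau>) * ?A epowr \<tau>)"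
      by (intro mult_left_mono) auto
    also have "\<dots> = ennreal (max C 0 powr \<tau>) * (?b epowr (1 - \<tau>) * ?b epowr \<tau>) * ?A epowr \<tau>"
      using epowr_add_finite[OF lebesgue_ball_pos[OF \<rho>] lebesgue_ball_finite, of c "1 - \<tau>" \<tau>] by (simp add: ac_simps)
    finally show ?thesis unfolding average_mult_ball[OF \<rho>] using \<tau> by (simp only: epowr_mult less_trans[OF zero_less_one] mult.assoc)
  qed
  then show ?thesis by blast
qed

lemma reverse_hoelder_infinity_Ainf_measure:
  fixes w :: "real^'n \<Rightarrow> real"
  assumes w: "w \<in> reverse_hoelder \<infinity>"
  obtains C where "Ainf_measure C 1 (density lebesgue (\<lambda>x. ennreal (w x)))"
proof -
  have [measurable]: "w \<in> borel_measurable lebesgue"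
    using w by (auto simp: reverse_hoelder_def intro: weight_measurable)
  obtain C where C: "AE x in lebesgue. x \<in> ball c \<rho> \<longrightarrow> ennreal (w x) \<le> ennreal C * average (ball c \<rho>) (\<lambda>y. ennreal (w y))"
    if "0 < \<rho>" for c \<rho>
    using w unfolding reverse_hoelder_def by auto
  have "Ainf_measure C 1 (density lebesgue (\<lambda>x. ennreal (w x)))"
    unfolding Ainf_measure_def
  proof (intro allI impI)
    fix c :: "real^'n" and \<rho> :: real and A assume \<rho>: "0 < \<rho>" and [measurable]: "A \<in> sets lebesgue" and A: "A \<subseteq> ball c \<rho>"
    let ?A = "average (ball c \<rho>) (\<lambda>y. ennreal (w y))" and ?b = "emeasure lebesgue (ball c \<rho>)"
    have "emeasure (density lebesgue (\<lambda>x. ennreal (w x))) A = (\<integral>\<^sup>+x\<in>A. ennreal (w x) \<partial>lebesgue)"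
      by (rule emeasure_density) auto
    also have "\<dots> \<le> (\<integral>\<^sup>+x. ennreal C * ?A * indicator A x \<partial>lebesgue)"
      by (rule nn_integral_mono_AE, use C[OF \<rho>, of c] in eventually_elim) (use A in \<open>auto split: split_indicator\<close>)
    also have "\<dots> = ennreal C * ?A * emeasure lebesgue A" by (simp add: nn_integral_cmult_indicator)
    also have "\<dots> = ennreal C * (emeasure lebesgue A / ?b) * (\<integral>\<^sup>+x\<in>ball c \<rho>. ennreal (w x) \<partial>lebesgue)"
      unfolding average_def by (simp add: divide_ennreal_def ac_simps)
    also have "(\<integral>\<^sup>+x\<in>ball c \<rho>. ennreal (w x) \<partial>lebesgue) = emeasure (density lebesgue (\<lambda>x. ennreal (w x))) (ball c \<rho>)"
      by (rule emeasure_density[symmetric]) auto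
    finally show "emeasure (density lebesgue (\<lambda>x. ennreal (w x))) A
      \<le> ennreal C * (emeasure lebesgue A / ?b) epowr 1 * emeasure (density lebesgue (\<lambda>x. ennreal (w x))) (ball c \<rho>)" by simp
  qed
  then show thesis by (rule that)
qed

lemma Ainf_measure_const_mono:
  assumes "Ainf_measure C \<theta> M" "C \<le> C'" shows "Ainf_measure C' \<theta> M"
  unfolding Ainf_measure_def
proof (intro allI impI)
  fix c :: 'a and \<rho> :: real and A assume *: "0 < \<rho>" "A \<in> sets lebesgue" "A \<subseteq> ball c \<rho>"
  show "emeasure M A \<le> ennreal C' * (emeasure lebesgue A / emeasure lebesgue (ball c \<rho>)) epowr \<theta> * emeasure M (ball c \<rho>)"
    by (rule order_trans[OF Ainf_measureD[OF assms(1) *]]) (intro mult_right_mono ennreal_leI assms(2); simp)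
qed

text \<open>
  If \<open>q\<^sub>0 = \<infinity>\<close>, there is no reverse Hoelder assumption; the self-improvement of \<open>A\<^sub>t\<close> supplies one for
  some finite \<open>q\<close>.
\<close>

lemma finite_exponent:
  fixes w :: "real^'n \<Rightarrow> real" and q\<^sub>0 :: ereal
  assumes P: "1 < P" and w: "Ap_weight P C (\<lambda>x. ennreal (w x))" and p: "0 < p" "ereal p \<le> q\<^sub>0" and r: "ereal r < q\<^sub>0"
    and RH: "w \<in> reverse_hoelder (conjugate_exponent (q\<^sub>0 / ereal p))"
  obtains q C'' C' where "ereal q = q\<^sub>0 \<or> q\<^sub>0 = \<infinity>" "p \<le> q" "r < q" "1 \<le> C''"
    "Ainf_measure C'' (p / q) (density lebesgue (\<lambda>x. ennreal (w x)))"
    "p < q \<Longrightarrow> Ap_weight (q / (q - p) * (P - 1) + 1) C' (\<lambda>x. ennreal (w x) epowr (q / (q - p)))"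
proof -
  let ?W = "\<lambda>x. ennreal (w x)"
  have W: "?W \<in> borel_measurable lebesgue" by (rule Ap_weight_measurable[OF w])
  note result = that
  have improve: thesis if q: "ereal q = q\<^sub>0 \<or> q\<^sub>0 = \<infinity>" "p < q" "r < q"
    and int: "\<exists>C'. \<forall>c \<rho>. 0 < \<rho> \<longrightarrow> (\<integral>\<^sup>+x\<in>ball c \<rho>. ?W x epowr (q / (q - p)) \<partial>lebesgue)
      \<le> ennreal C' * emeasure lebesgue (ball c \<rho>) epowr (1 - q / (q - p)) * (\<integral>\<^sup>+x\<in>ball c \<rho>. ?W x \<partial>lebesgue) epowr (q / (q - p))"
    for q
  proof -
    \<comment> \<open>The conjugate exponent of q/p; the reverse Hoelder inequality of this order
      corresponds to the A_\<infinity> exponent p/q.\<close>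
    define \<tau> where "\<tau> = q / (q - p)"
    have \<tau>: "1 < \<tau>" "1 - 1 / \<tau> = p / q" using q(2) p(1) by (auto simp: \<tau>_def field_simps)
    obtain C' where "(\<integral>\<^sup>+x\<in>ball c \<rho>. ?W x epowr \<tau> \<partial>lebesgue)
      \<le> ennreal C' * emeasure lebesgue (ball c \<rho>) epowr (1 - \<tau>) * (\<integral>\<^sup>+x\<in>ball c \<rho>. ?W x \<partial>lebesgue) epowr \<tau>"
      if "0 < \<rho>" for c \<rho> using int unfolding \<tau>_def by blast
    then have Ap: "Ap_weight (\<tau> * (P - 1) + 1) (C' * C powr \<tau>) (\<lambda>x. ?W x epowr \<tau>)"
      by (intro Ap_weight_epowr_intro[OF w P \<tau>(1)])
    have "Ainf_measure (max 1 ((C' * C powr \<tau>) powr (1 / \<tau>))) (p / q) (density lebesgue ?W)"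
      using Ainf_measure_const_mono[OF Ap_weight_epowr_Ainf[OF Ap W P \<tau>(1)]] by (simp add: \<tau>(2))
    then show thesis using q Ap unfolding \<tau>_def by (intro result[of q "max 1 ((C' * C powr (q / (q - p))) powr (1 / (q / (q - p))))"]) auto
  qed
  consider "q\<^sub>0 = ereal p" | q where "q\<^sub>0 = ereal q" "p < q" | "q\<^sub>0 = \<infinity>"
    using p by (cases q\<^sub>0) (auto simp: le_less)
  then show thesis
  proof cases
    \<comment> \<open>For p = q0 the assumption is RH_\<infinity>, which gives the A_\<infinity>
      exponent 1 = p/p.\<close>
    case 1
    then have "conjugate_exponent (q\<^sub>0 / ereal p) = \<infinity>" using p(1) by (simp add: conjugate_exponent_def one_ereal_def)
    then obtain C'' where "Ainf_measure C'' 1 (density lebesgue ?W)"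
      using RH reverse_hoelder_infinity_Ainf_measure by metis
    then have "Ainf_measure (max 1 C'') (p / p) (density lebesgue ?W)"
      using Ainf_measure_const_mono[of C'' 1 _ "max 1 C''"] p by simp
    then show thesis using 1 r p by (intro result[of p "max 1 C''"]) auto
  next
    case (2 q)
    have "conjugate_exponent (q\<^sub>0 / ereal p) = ereal (q / (q - p))"
      using 2 p(1) by (simp add: conjugate_exponent_def one_ereal_def field_simps)
    then have "w \<in> reverse_hoelder (ereal (q / (q - p)))" using RH by simp
    moreover have "1 < q / (q - p)" using 2 p(1) by (simp add: field_simps)
    ultimately show thesis using 2 r by (intro improve[of q] reverse_hoelder_integral) auto
  next
    case 3
    obtain s\<^sub>0 where s\<^sub>0: "1 < s\<^sub>0" "\<And>s. 1 < s \<Longrightarrow> s < s\<^sub>0 \<Longrightarrow>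
      \<exists>C'. \<forall>c \<rho>. 0 < \<rho> \<longrightarrow> (\<integral>\<^sup>+x\<in>ball c \<rho>. ?W x epowr s \<partial>lebesgue)
      \<le> ennreal C' * emeasure lebesgue (ball c \<rho>) epowr (1 - s) * (\<integral>\<^sup>+x\<in>ball c \<rho>. ?W x \<partial>lebesgue) epowr s"
      by (rule Ap_weight_reverse_Hoelder[OF w P]) (rule that; blast)
    \<comment> \<open>The last term of the maximum enforces q/(q - p) < s0, the range of the
      self-improved reverse Hoelder inequality.\<close>
    define q where "q = 1 + max (max p r) (p * s\<^sub>0 / (s\<^sub>0 - 1))"
    have q: "p < q" "r < q" "p * s\<^sub>0 / (s\<^sub>0 - 1) < q" by (auto simp: q_def)
    then have "1 < q / (q - p)" "q / (q - p) < s\<^sub>0" using s\<^sub>0(1) p(1) by (simp_all add: field_simps)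
    then show thesis using 3 q by (intro improve[of q] s\<^sub>0(2)) auto
  qed
qed

text \<open>A bound for the essential supremum over the ball bounds the average of every finite
  order q by the same X; in this way a finite exponent replaces q0 = \<infinity>.\<close>

lemma Lp_average_integral_le:
  fixes u :: "real^'n \<Rightarrow> ennreal"
  assumes [measurable]: "u \<in> borel_measurable lebesgue" and q: "0 < q" "ereal q = q\<^sub>0 \<or> q\<^sub>0 = \<infinity>" and \<rho>: "0 < \<rho>"
    and le: "Lp_average q\<^sub>0 (ball c \<rho>) u \<le> X"
  shows "(\<integral>\<^sup>+y\<in>ball c \<rho>. u y epowr q \<partial>lebesgue) \<le> emeasure lebesgue (ball c \<rho>) * X epowr q"
proof (cases "q\<^sub>0 = \<infinity>")
  case True
  have "AE x in restrict_space lebesgue (ball c \<rho>). u x \<le> X"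
    using esssup_AE[of u "restrict_space lebesgue (ball c \<rho>)"] le True
    by (auto simp: Lp_average_def elim!: eventually_mono)
  then have "AE x in lebesgue. x \<in> ball c \<rho> \<longrightarrow> u x \<le> X" by (subst (asm) AE_restrict_space_iff) auto
  then have "(\<integral>\<^sup>+y\<in>ball c \<rho>. u y epowr q \<partial>lebesgue) \<le> (\<integral>\<^sup>+y. X epowr q * indicator (ball c \<rho>) y \<partial>lebesgue)"
    by (intro nn_integral_mono_AE, elim eventually_mono) (use q in \<open>auto intro: epowr_mono split: split_indicator\<close>)
  then show ?thesis by (simp add: nn_integral_cmult_indicator mult.commute)
next
  case False
  then have "average (ball c \<rho>) (\<lambda>y. u y epowr q) \<le> X epowr q"
    using le q by (auto simp: Lp_average_def epowr_le_swap[symmetric] epowr_le_swap)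
  then show ?thesis unfolding average_mult_ball[OF \<rho>] by (intro mult_left_mono) auto
qed

lemma infsum_eq_suminf:
  fixes f :: "nat \<Rightarrow> ennreal"
  shows "infsum f J = (\<Sum>j. if j \<in> J then f j else 0)"
proof -
  have "infsum f J = infsum (\<lambda>j. if j \<in> J then f j else 0) UNIV" by (rule infsum_cong_neutral) auto
  also have "\<dots> = (\<Sum>j. if j \<in> J then f j else 0)"
    by (intro sums_unique has_sum_imp_sums has_sum_infsum nonneg_summable_on_complete) auto
  finally show ?thesis .
qed

text \<open>Families over J are extended to sequences by zero; the added terms need a decomposition
  too.\<close>

lemma good_decomposition_zero: "0 < q \<Longrightarrow> good_decomposition a q (\<lambda>x :: 'a::euclidean_space. 0) (maximal_fun lebesgue (\<lambda>x. 0))"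
proof -
  have "maximal_fun lebesgue (\<lambda>x :: 'a. 0) = (\<lambda>x. 0)" by (auto simp: maximal_fun_def fun_eq_iff intro!: antisym SUP_least)
  then show "0 < q \<Longrightarrow> ?thesis" unfolding good_decomposition_def
    by (auto intro!: bexI[of _ "\<lambda>x. 0"])
qed

lemma enorm_measurable: "f \<in> borel_measurable M \<Longrightarrow> (\<lambda>x. enorm (f x :: 'b::euclidean_space)) \<in> borel_measurable M"
  unfolding enorm_def by measurable

text \<open>On a ball of radius \<rho>, f is split into f - A \<rho> f and A \<rho> f; this is why g
  and h depend on the ball. Sublinearity and the elementary bound for the power p0 of a sum give F
  \<le> g + h, and the two hypotheses, raised to the powers p0 and q, are the two integral
  bounds.\<close>

lemma operator_good_decomposition:
  fixes E D :: "(real^'n \<Rightarrow> 'k::{real_normed_field, euclidean_space}) set"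
    and T S :: "(real^'n \<Rightarrow> 'k) \<Rightarrow> real^'n \<Rightarrow> 'k"
  assumes p\<^sub>0: "1 \<le> p\<^sub>0" and q: "p\<^sub>0 < q" "ereal q = q\<^sub>0 \<or> q\<^sub>0 = \<infinity>"
    and E: "function_space E" and DE: "D \<subseteq> E"
    and T: "\<And>f. f \<in> E \<Longrightarrow> T f \<in> Lp_space p\<^sub>0" and sub: "sublinear_on E T"
    and A: "\<And>\<rho> f. \<rho> > 0 \<Longrightarrow> f \<in> D \<Longrightarrow> A \<rho> f \<in> E"
    and I: "\<And>f c \<rho> x. f \<in> D \<Longrightarrow> \<rho> > 0 \<Longrightarrow> x \<in> ball c \<rho> \<Longrightarrow>
          Lp_average (ereal p\<^sub>0) (ball c \<rho>) (\<lambda>y. enorm (T (\<lambda>z. f z - A \<rho> f z) y))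
          \<le> ennreal C * maximal (\<lambda>y. enorm (S f y) epowr p\<^sub>0) x epowr (1 / p\<^sub>0)"
    and II: "\<And>f c \<rho> x. f \<in> D \<Longrightarrow> \<rho> > 0 \<Longrightarrow> x \<in> ball c \<rho> \<Longrightarrow>
          Lp_average q\<^sub>0 (ball c \<rho>) (\<lambda>y. enorm (T (A \<rho> f) y))
          \<le> ennreal C * maximal (\<lambda>y. enorm (T f y) epowr p\<^sub>0) x epowr (1 / p\<^sub>0)"
  obtains a where "1 \<le> a" "\<forall>f\<in>D. good_decomposition a (q / p\<^sub>0) (\<lambda>x. enorm (T f x) epowr p\<^sub>0)
    (maximal_fun lebesgue (\<lambda>x. enorm (S f x) epowr p\<^sub>0))"
proof -
  have pos: "0 < p\<^sub>0" "0 < q" "0 < q / p\<^sub>0" using p\<^sub>0 q by auto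
  have T_meas: "(\<lambda>x. enorm (T f x)) \<in> borel_measurable lebesgue" if "f \<in> E" for f
    using T[OF that] by (auto simp: Lp_space_def intro: enorm_measurable)
  \<comment> \<open>The factor k splits the p0-th power of a sum; the constants that follow collect
    its powers and those of C from the two estimates.\<close>
  define k where "k = 2 powr p\<^sub>0"
  define a\<^sub>1 where "a\<^sub>1 = k * max C 0 powr p\<^sub>0"
  define a\<^sub>2 where "a\<^sub>2 = k powr (q / p\<^sub>0) * max C 0 powr q"
  define a where "a = max 1 (max a\<^sub>1 a\<^sub>2)"
  have "good_decomposition a (q / p\<^sub>0) (\<lambda>x. enorm (T f x) epowr p\<^sub>0)
    (maximal_fun lebesgue (\<lambda>x. enorm (S f x) epowr p\<^sub>0))" if f: "f \<in> D" for f
    unfolding good_decomposition_def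
  proof (intro conjI allI impI)
    have fE: "f \<in> E" using f DE by auto
    note [measurable] = T_meas[OF fE]
    show "(\<lambda>x. enorm (T f x) epowr p\<^sub>0) \<in> borel_measurable lebesgue" by measurable
    show "maximal_fun lebesgue (\<lambda>x. enorm (S f x) epowr p\<^sub>0) \<in> borel_measurable lebesgue"
      by (rule measurable_maximal_fun) simp
    show "(\<integral>\<^sup>+x. enorm (T f x) epowr p\<^sub>0 \<partial>lebesgue) < top" using T[OF fE] by (simp add: Lp_space_def)
    fix c :: "real^'n" and \<rho> :: real assume \<rho>: "0 < \<rho>"
    let ?b = "emeasure lebesgue (ball c \<rho>)"
    let ?u = "\<lambda>z. f z - A \<rho> f z" and ?v = "A \<rho> f"
    have v: "?v \<in> E" by (rule A[OF \<rho> f])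
    have add: "\<forall>f\<in>E. \<forall>g\<in>E. (\<lambda>x. f x + g x) \<in> E" and smult: "\<forall>a. \<forall>f\<in>E. (\<lambda>x. a * f x) \<in> E"
      using E unfolding function_space_def by auto
    have "(\<lambda>z. f z + (- 1) * A \<rho> f z) \<in> E" by (rule add[rule_format, OF fE smult[rule_format, OF v]])
    then have u: "?u \<in> E" by simp
    note [measurable] = T_meas[OF v] T_meas[OF u]
    let ?g = "\<lambda>y. ennreal k * enorm (T ?u y) epowr p\<^sub>0" and ?h = "\<lambda>y. ennreal k * enorm (T ?v y) epowr p\<^sub>0"
    show "\<exists>g\<in>borel_measurable lebesgue. \<exists>h\<in>borel_measurable lebesgue.
        (AE x in lebesgue. x \<in> ball c \<rho> \<longrightarrow> enorm (T f x) epowr p\<^sub>0 \<le> g x + h x) \<and>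
        (\<forall>x\<in>ball c \<rho>. (\<integral>\<^sup>+y\<in>ball c \<rho>. g y \<partial>lebesgue)
          \<le> ennreal a * ?b * maximal_fun lebesgue (\<lambda>x. enorm (S f x) epowr p\<^sub>0) x) \<and>
        (\<forall>x\<in>ball c \<rho>. (\<integral>\<^sup>+y\<in>ball c \<rho>. h y epowr (q / p\<^sub>0) \<partial>lebesgue)
          \<le> ennreal a * ?b * maximal_fun lebesgue (\<lambda>x. enorm (T f x) epowr p\<^sub>0) x epowr (q / p\<^sub>0))"
    proof (rule bexI[of _ ?g], rule bexI[of _ ?h], intro conjI ballI)
      have "AE x in lebesgue. norm (T (\<lambda>y. ?u y + ?v y) x) \<le> norm (T ?u x) + norm (T ?v x)"
        by (rule conjunct1[OF sub[unfolded sublinear_on_def], rule_format, OF u v])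
      then show "AE x in lebesgue. x \<in> ball c \<rho> \<longrightarrow> enorm (T f x) epowr p\<^sub>0 \<le> ?g x + ?h x"
      proof eventually_elim
        case (elim x)
        then have "enorm (T f x) \<le> enorm (T ?u x) + enorm (T ?v x)"
          by (simp add: enorm_def ennreal_leI flip: ennreal_plus)
        then have "enorm (T f x) epowr p\<^sub>0 \<le> (enorm (T ?u x) + enorm (T ?v x)) epowr p\<^sub>0"
          using pos by (intro epowr_mono) auto
        also have "\<dots> \<le> 2 epowr p\<^sub>0 * (enorm (T ?u x) epowr p\<^sub>0 + enorm (T ?v x) epowr p\<^sub>0)"
          by (rule epowr_sum_le[OF pos(1)])
        finally show ?case by (simp add: ennreal_epowr_numeral k_def distrib_left)
      qed
    next
      fix x assume x: "x \<in> ball c \<rho>"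
      let ?G = "maximal_fun lebesgue (\<lambda>x. enorm (S f x) epowr p\<^sub>0) x"
      have "(\<integral>\<^sup>+y\<in>ball c \<rho>. ?g y \<partial>lebesgue) = ennreal k * (\<integral>\<^sup>+y\<in>ball c \<rho>. enorm (T ?u y) epowr p\<^sub>0 \<partial>lebesgue)"
        by (simp add: mult.assoc nn_integral_cmult)
      also have "\<dots> \<le> ennreal k * (?b * (ennreal C * ?G epowr (1 / p\<^sub>0)) epowr p\<^sub>0)"
        using I[OF f \<rho> x] pos \<rho> unfolding maximal_eq_maximal_fun
        by (intro mult_left_mono Lp_average_integral_le[where q\<^sub>0 = "ereal p\<^sub>0"]) auto
      also have "\<dots> = ennreal a\<^sub>1 * ?b * ?G"
        using pos by (simp add: epowr_mult epowr_epowr ennreal_epowr_max a\<^sub>1_def k_def ennreal_mult' ac_simps)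
      also have "\<dots> \<le> ennreal a * ?b * ?G" by (intro mult_right_mono ennreal_leI) (auto simp: a_def)
      finally show "(\<integral>\<^sup>+y\<in>ball c \<rho>. ?g y \<partial>lebesgue) \<le> ennreal a * ?b * ?G" .
    next
      fix x assume x: "x \<in> ball c \<rho>"
      let ?F = "maximal_fun lebesgue (\<lambda>x. enorm (T f x) epowr p\<^sub>0) x"
      have "(\<integral>\<^sup>+y\<in>ball c \<rho>. ?h y epowr (q / p\<^sub>0) \<partial>lebesgue)
        = (\<integral>\<^sup>+y. ennreal (k powr (q / p\<^sub>0)) * (enorm (T ?v y) epowr q * indicator (ball c \<rho>) y) \<partial>lebesgue)"
        using pos by (simp add: epowr_mult epowr_epowr ennreal_epowr k_def mult.assoc)
      also have "\<dots> = ennreal (k powr (q / p\<^sub>0)) * (\<integral>\<^sup>+y\<in>ball c \<rho>. enorm (T ?v y) epowr q \<partial>lebesgue)"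
        by (rule nn_integral_cmult) measurable
      also have "\<dots> \<le> ennreal (k powr (q / p\<^sub>0)) * (?b * (ennreal C * ?F epowr (1 / p\<^sub>0)) epowr q)"
        using II[OF f \<rho> x] pos \<rho> q(2) unfolding maximal_eq_maximal_fun
        by (intro mult_left_mono Lp_average_integral_le[where q\<^sub>0 = q\<^sub>0]) auto
      also have "\<dots> = ennreal a\<^sub>2 * ?b * ?F epowr (q / p\<^sub>0)"
        using pos by (simp add: epowr_mult epowr_epowr ennreal_epowr_max a\<^sub>2_def ennreal_mult' ac_simps)
      also have "\<dots> \<le> ennreal a * ?b * ?F epowr (q / p\<^sub>0)" by (intro mult_right_mono ennreal_leI) (auto simp: a_def)
      finally show "(\<integral>\<^sup>+y\<in>ball c \<rho>. ?h y epowr (q / p\<^sub>0) \<partial>lebesgue) \<le> ennreal a * ?b * ?F epowr (q / p\<^sub>0)" .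
    qed measurable
  qed
  then show thesis by (intro that[of a]) (auto simp: a_def)
qed

text \<open>Passes to the functions raised to the power p0, with p and r divided by p0, which is the
  form of \<open>vector_inequality\<close>.\<close>

lemma weighted_Lp_norm_sum:
  fixes w :: "real^'n \<Rightarrow> real" and u :: "nat \<Rightarrow> real^'n \<Rightarrow> ennreal"
  assumes [measurable]: "w \<in> borel_measurable lebesgue" "\<And>j. j \<in> J \<Longrightarrow> u j \<in> borel_measurable lebesgue"
    and pos: "0 < p\<^sub>0" "0 < p" "0 < r"
  shows "weighted_Lp_norm p w (\<lambda>x. (\<Sum>\<^sub>\<infinity>j\<in>J. u j x epowr r) epowr (1 / r))
    = (\<integral>\<^sup>+x. ennreal (w x) * (\<Sum>j. (if j \<in> J then u j x epowr p\<^sub>0 else 0) epowr (r / p\<^sub>0)) epowr ((p / p\<^sub>0) / (r / p\<^sub>0)) \<partial>lebesgue)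
      epowr (1 / p)"
proof -
  have [measurable]: "(\<lambda>x. if j \<in> J then u j x epowr r else 0) \<in> borel_measurable lebesgue" for j
    by (cases "j \<in> J") auto
  have eq: "(if j \<in> J then u j x epowr p\<^sub>0 else 0) epowr (r / p\<^sub>0) = (if j \<in> J then u j x epowr r else 0)" for j x
    using pos by (auto simp: epowr_epowr)
  have "(p / p\<^sub>0) / (r / p\<^sub>0) = p / r" using pos by simp
  then show ?thesis
    unfolding weighted_Lp_norm_def infsum_eq_suminf eq epowr_epowr
    by (subst nn_integral_density) auto
qed

theorem theorem3p7:
  fixes p0 p :: real and q0 :: ereal
    and E D :: "(real^'n \<Rightarrow> 'k::{real_normed_field, euclidean_space}) set"
    and T S :: "(real^'n \<Rightarrow> 'k) \<Rightarrow> real^'n \<Rightarrow> 'k"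
    and A :: "real \<Rightarrow> (real^'n \<Rightarrow> 'k) \<Rightarrow> real^'n \<Rightarrow> 'k"
    and C :: real
    and w :: "real^'n \<Rightarrow> real"
  assumes "1 \<le> p0" and "ereal p0 < q0"
    and "function_space E" and "function_space D" and "D \<subseteq> E"
    and "\<And>f. f \<in> D \<Longrightarrow> S f \<in> borel_measurable lebesgue"
    and "\<And>f. f \<in> E \<Longrightarrow> T f \<in> Lp_space p0"
    and "sublinear_on E T"
    and "\<And>\<rho> f. \<rho> > 0 \<Longrightarrow> f \<in> D \<Longrightarrow> A \<rho> f \<in> E"
    and "\<And>f c \<rho> x. f \<in> D \<Longrightarrow> \<rho> > 0 \<Longrightarrow> x \<in> ball c \<rho> \<Longrightarrow>
          Lp_average (ereal p0) (ball c \<rho>) (\<lambda>y. enorm (T (\<lambda>z. f z - A \<rho> f z) y))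
          \<le> ennreal C * maximal (\<lambda>y. enorm (S f y) epowr p0) x epowr (1 / p0)"
    and "\<And>f c \<rho> x. f \<in> D \<Longrightarrow> \<rho> > 0 \<Longrightarrow> x \<in> ball c \<rho> \<Longrightarrow>
          Lp_average q0 (ball c \<rho>) (\<lambda>y. enorm (T (A \<rho> f) y))
          \<le> ennreal C * maximal (\<lambda>y. enorm (T f y) epowr p0) x epowr (1 / p0)"
    and "p0 < p" and "ereal p \<le> q0"
    and "w \<in> muckenhoupt (p / p0)"
    and "w \<in> reverse_hoelder (conjugate_exponent (q0 / ereal p))"
  shows "(\<exists>C'::real. \<forall>f\<in>D.
            weighted_Lp_norm p w (\<lambda>x. enorm (T f x))
            \<le> ennreal C' * weighted_Lp_norm p w (\<lambda>x. enorm (S f x)))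
       \<and> (\<forall>r::real. p0 < r \<and> ereal r < q0 \<longrightarrow>
            (\<exists>C'::real. \<forall>(J::nat set) f. (\<forall>j\<in>J. f j \<in> D) \<longrightarrow>
              weighted_Lp_norm p w
                (\<lambda>x. (\<Sum>\<^sub>\<infinity>j\<in>J. enorm (T (f j) x) epowr r) epowr (1 / r))
              \<le> ennreal C' * weighted_Lp_norm p w
                (\<lambda>x. (\<Sum>\<^sub>\<infinity>j\<in>J. enorm (S (f j) x) epowr r) epowr (1 / r))))"
proof -
  note p0 = assms(1) and S = assms(6)
  have pos: "0 < p0" "0 < p" using p0 assms(12) by auto
  have wt: "weight w" using assms(14) by (simp add: muckenhoupt_def)
  note [measurable] = weight_measurable[OF wt]
  have vector: "\<exists>C'::real. \<forall>(J::nat set) f. (\<forall>j\<in>J. f j \<in> D) \<longrightarrow>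
      weighted_Lp_norm p w (\<lambda>x. (\<Sum>\<^sub>\<infinity>j\<in>J. enorm (T (f j) x) epowr r) epowr (1 / r))
      \<le> ennreal C' * weighted_Lp_norm p w (\<lambda>x. (\<Sum>\<^sub>\<infinity>j\<in>J. enorm (S (f j) x) epowr r) epowr (1 / r))"
    if r: "p0 < r" "ereal r < q0" for r
  proof (cases "AE x in lebesgue. w x = 0")
    \<comment> \<open>A weight vanishing almost everywhere is a member of the A_t class but not an
      \<open>Ap_weight\<close>; all its norms are zero.\<close>
    case True
    have "density lebesgue (\<lambda>x. ennreal (w x)) = density lebesgue (\<lambda>x. 0)"
      by (rule density_cong, use True in \<open>auto elim: eventually_mono\<close>)
    then have "weighted_Lp_norm p w X = 0" for X
      using pos by (simp add: weighted_Lp_norm_def null_measure_eq_density[symmetric])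
    then show ?thesis by simp
  next
    case False
    have P: "1 < p / p0" using assms(12) pos by simp
    obtain C\<^sub>w where w: "Ap_weight (p / p0) C\<^sub>w (\<lambda>x. ennreal (w x))"
      by (rule muckenhoupt_Ap_weight[OF assms(14) P False])
    obtain q C'' C' where q: "ereal q = q0 \<or> q0 = \<infinity>" "p \<le> q" "r < q" and C'': "1 \<le> C''"
      "Ainf_measure C'' (p / q) (density lebesgue (\<lambda>x. ennreal (w x)))"
      and C': "p < q \<Longrightarrow> Ap_weight (q / (q - p) * (p / p0 - 1) + 1) C' (\<lambda>x. ennreal (w x) epowr (q / (q - p)))"
      by (rule finite_exponent[OF P w pos(2) assms(13) r(2) assms(15)]) (rule that; assumption)
    have pq: "p0 < q" using q r by simp
    obtain a where a: "1 \<le> a" "\<forall>f\<in>D. good_decomposition a (q / p0) (\<lambda>x. enorm (T f x) epowr p0)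
        (maximal_fun lebesgue (\<lambda>x. enorm (S f x) epowr p0))"
      using operator_good_decomposition[OF p0 pq q(1) assms(3,5,7,8,9,10,11)] by blast
    have exps: "p / p0 / (q / p0) = p / q" "q / p0 / (q / p0 - p / p0) = q / (q - p)"
      using pos pq by (simp_all add: diff_divide_distrib[symmetric])
    obtain B where B: "0 < B" "\<forall>F g :: nat \<Rightarrow> real^'n \<Rightarrow> ennreal. (\<forall>j. g j \<in> borel_measurable lebesgue) \<longrightarrow>
        (\<forall>j. good_decomposition a (q / p0) (F j) (maximal_fun lebesgue (g j))) \<longrightarrow>
        (\<integral>\<^sup>+x. ennreal (w x) * (\<Sum>j. F j x epowr (r / p0)) epowr (p / p0 / (r / p0)) \<partial>lebesgue)
        \<le> ennreal B * (\<integral>\<^sup>+x. ennreal (w x) * (\<Sum>j. g j x epowr (r / p0)) epowr (p / p0 / (r / p0)) \<partial>lebesgue)"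
    proof (rule vector_inequality[of "p / p0" "q / p0" "r / p0" a C\<^sub>w "\<lambda>x. ennreal (w x)" C'' C'])
      show "Ap_weight (q / p0 / (q / p0 - p / p0) * (p / p0 - 1) + 1) C'
          (\<lambda>x. ennreal (w x) epowr (q / p0 / (q / p0 - p / p0)))" if "p / p0 < q / p0"
        unfolding exps using that pos by (intro C') (simp add: divide_less_cancel)
    qed (use P q r a(1) w C'' pos exps in \<open>auto simp: divide_right_mono divide_strict_right_mono\<close>)
    show ?thesis
    proof (intro exI[of _ "B powr (1 / p)"] allI impI)
      fix J :: "nat set" and f assume f: "\<forall>j\<in>J. f j \<in> D"
      define F where "F j x = (if j \<in> J then enorm (T (f j) x) epowr p0 else 0)" for j x
      define g where "g j x = (if j \<in> J then enorm (S (f j) x) epowr p0 else 0)" for j x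
      have Tm: "(\<lambda>x. enorm (T (f j) x)) \<in> borel_measurable lebesgue"
        and Sm: "(\<lambda>x. enorm (S (f j) x)) \<in> borel_measurable lebesgue" if "j \<in> J" for j
        using assms(5,7) S f that by (auto simp: Lp_space_def intro!: enorm_measurable)
      have "g j \<in> borel_measurable lebesgue" for j
        unfolding g_def using Sm[of j] by (cases "j \<in> J") auto
      moreover have "good_decomposition a (q / p0) (F j) (maximal_fun lebesgue (g j))" for j
        unfolding F_def g_def using a(2) f pos pq by (cases "j \<in> J") (auto intro: good_decomposition_zero)
      ultimately have "(\<integral>\<^sup>+x. ennreal (w x) * (\<Sum>j. F j x epowr (r / p0)) epowr (p / p0 / (r / p0)) \<partial>lebesgue)
        \<le> ennreal B * (\<integral>\<^sup>+x. ennreal (w x) * (\<Sum>j. g j x epowr (r / p0)) epowr (p / p0 / (r / p0)) \<partial>lebesgue)"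
        (is "?F \<le> _ * ?g") using B(2) by blast
      then have "?F epowr (1 / p) \<le> (ennreal B * ?g) epowr (1 / p)" using pos by (intro epowr_mono) auto
      also have "\<dots> = ennreal (B powr (1 / p)) * ?g epowr (1 / p)"
        using pos B(1) by (simp add: epowr_mult ennreal_epowr)
      finally have "?F epowr (1 / p) \<le> ennreal (B powr (1 / p)) * ?g epowr (1 / p)" .
      then show "weighted_Lp_norm p w (\<lambda>x. (\<Sum>\<^sub>\<infinity>j\<in>J. enorm (T (f j) x) epowr r) epowr (1 / r))
        \<le> ennreal (B powr (1 / p)) * weighted_Lp_norm p w (\<lambda>x. (\<Sum>\<^sub>\<infinity>j\<in>J. enorm (S (f j) x) epowr r) epowr (1 / r))"
        using r pos Tm Sm by (simp add: weighted_Lp_norm_sum[where p\<^sub>0 = p0] F_def g_def)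
    qed
  qed
  show ?thesis
  proof (intro conjI allI impI)
    \<comment> \<open>Any intermediate r will do: for a family with one member the r-sum is the
      function itself. For p = q0 the choice r < q0 is essential to the argument.\<close>
    obtain r where r: "p0 < r" "ereal r < q0" using ereal_dense2[OF assms(2)] by auto
    obtain C' where C': "\<forall>(J::nat set) f. (\<forall>j\<in>J. f j \<in> D) \<longrightarrow>
      weighted_Lp_norm p w (\<lambda>x. (\<Sum>\<^sub>\<infinity>j\<in>J. enorm (T (f j) x) epowr r) epowr (1 / r))
      \<le> ennreal C' * weighted_Lp_norm p w (\<lambda>x. (\<Sum>\<^sub>\<infinity>j\<in>J. enorm (S (f j) x) epowr r) epowr (1 / r))"
      using vector[OF r] by blast
    have "weighted_Lp_norm p w (\<lambda>x. enorm (T f x)) \<le> ennreal C' * weighted_Lp_norm p w (\<lambda>x. enorm (S f x))"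
      if "f \<in> D" for f
      using C'[rule_format, of "{0}" "\<lambda>_. f"] that r pos by (simp add: epowr_epowr)
    then show "\<exists>C'::real. \<forall>f\<in>D. weighted_Lp_norm p w (\<lambda>x. enorm (T f x))
        \<le> ennreal C' * weighted_Lp_norm p w (\<lambda>x. enorm (S f x))" by blast
  qed (use vector in blast)
qed

end
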